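(* Let $r\in\mathbb{N}$ with $r\ge2$, let $E$ and $X$ be paracompact Banach manifolds and let $p\colon E\to X$ be a smooth fibration and a surjective submersion whose fibers are path-connected. Let $g$ be a complete Riemannian metric on $E$ and let $\bar g$ be the Riemannian metric on $E^r_X$ obtained by restricting the product metric $g^r$ on $E^r$. Let $F\in C^1(E^r_X)$ be a real-valued function which is bounded from below. Assume that $(F,\bar{g})$ satisfies the Palais-Smale condition and that $\nabla^{\bar{g}}F$ is vertically proportional with respect to $q_r\colon E^r_X\to X$ and $\bar{g}$. Then for each $\lambda \in \mathbb{R}$ it holds that $$\mathsf{TC}_{r,p}(F^\lambda) \leq \sum_{\mu \in (-\infty,\lambda]} \max \left\{\mathsf{TC}_{r,p}(C)\mid C \in \mathcal{C}_\mu(F) \right\}.$$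
   Context: For a function $F\colon Y\to\mathbb{R}$ put $F^\lambda=\{y\mid F(y)\le\lambda\}$ and $F_\mu=\{y\mid F(y)=\mu\}$; for differentiable $F$, $\mathrm{Crit}\,F=\{y\mid DF_y=0\}$ and $\mathcal{C}_\mu(F)$ is the set of connected components of $F_\mu\cap\mathrm{Crit}\,F$. Fiber products: $E^r_X=\{(u_1,\dots,u_r)\in E^r\mid p(u_1)=\dots=p(u_r)\}$ (a smooth Banach submanifold of $E^r$, since $p$ is a submersion), and $q_r\colon E^r_X\to X$, $q_r(u_1,\dots,u_r)=p(u_1)$. Sequential parametrized subspace complexity: put $E^I_X=\{\gamma\in C^0([0,1],E)\mid p(\gamma(t))=p(\gamma(0))\ \forall t\}$ (compact-open topology) and $\Pi_r\colon E^I_X\to E^r_X$, $\Pi_r(\gamma)=(\gamma(0),\gamma(\tfrac1{r-1}),\dots,\gamma(\tfrac{r-2}{r-1}),\gamma(1))$. For $A\subset E^r_X$, $\mathsf{TC}_{r,p}(A)$ is the minimal $n$ for which there exist open subsets $U_1,\dots,U_n\subset E^r_X$ with $A\subset\bigcup_{i=1}^nU_i$ such that each $U_i$ admits a continuous local section $U_i\to E^I_X$ of $\Pi_r$; if no such $n$ exists, $\mathsf{TC}_{r,p}(A)=\infty$. Convention: the maximum over an empty set is $0$. Palais-Smale condition: $(F,g)$ on a complete Riemannian Banach manifold $(M,g)$ satisfies it if every sequence $(x_n)$ in $M$ with $(|F(x_n)|)$ bounded and $\nabla^gF(x_n)\to0$ has a convergent subsequence; $\nabla^gF$ is the gradient of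 $F$ with respect to $g$. Vertical proportionality: let $M,N$ be Banach manifolds, $q\colon M\to N$ smooth and $g$ a Riemannian metric on $M$. For a vector field $Y$ on $M$ let $Y^{\mathrm{ver}}(m)$ be the orthogonal projection (with respect to $g$) of $Y(m)$ onto $\mathrm{Ver}_m(q)=\ker Dq_m$. $Y$ is vertically proportional with respect to $q$ and $g$ if there is $C>0$ with $\|Y(m)\|_g\le C\,\|Y^{\mathrm{ver}}(m)\|_g$ for all $m\in M$. *)

theory Defs
  imports "HOL-Analysis.Analysis"
begin

section \<open>Differential calculus on open subsets of closed subspaces of Banach spaces\<close>

text \<open>
  Charts take values in closed linear subspaces \<open>V\<close> of a Banach space, so that the charts of one
  manifold may have different model spaces and submanifolds are again manifolds. Derivatives are
  therefore maps on \<open>V\<close> only. (The library's derivative within \<open>V\<close> is a bounded linear map on the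
  whole type; a bounded linear map on \<open>V\<close> need not extend that far.)
\<close>

definition has_fderiv ::
  "'a::real_normed_vector set \<Rightarrow> ('a \<Rightarrow> 'b::real_normed_vector) \<Rightarrow> ('a \<Rightarrow> 'b) \<Rightarrow> 'a \<Rightarrow> bool" where
  "has_fderiv V f f' x \<longleftrightarrow>
     (\<forall>u\<in>V. \<forall>v\<in>V. f' (u + v) = f' u + f' v) \<and>
     (\<forall>a. \<forall>v\<in>V. f' (a *\<^sub>R v) = a *\<^sub>R f' v) \<and>
     (\<exists>K. \<forall>v\<in>V. norm (f' v) \<le> K * norm v) \<and>
     ((\<lambda>y. (f y - f x - f' (y - x)) /\<^sub>R norm (y - x)) \<longlongrightarrow> 0) (at x within V)"

text \<open>Where \<open>f\<close> is differentiable at \<open>x\<close>, the values of this map on \<open>V\<close> are uniquely determined.\<close>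

definition fderiv ::
  "'a::real_normed_vector set \<Rightarrow> ('a \<Rightarrow> 'b::real_normed_vector) \<Rightarrow> 'a \<Rightarrow> 'a \<Rightarrow> 'b" where
  "fderiv V f x = (SOME f'. has_fderiv V f f' x)"

text \<open>An \<open>n\<close>-linear map on \<open>V\<close> is a function on lists of length \<open>n\<close> with entries in \<open>V\<close>;
  the predicate \<open>form_norm_le V n T b\<close> says that its operator norm is at most \<open>b\<close>.\<close>

definition tuples :: "'a set \<Rightarrow> nat \<Rightarrow> 'a list set" where
  "tuples V n = {vs. set vs \<subseteq> V \<and> length vs = n}"

definition form_norm_le ::
  "'a::real_normed_vector set \<Rightarrow> nat \<Rightarrow> ('a list \<Rightarrow> 'b::real_normed_vector) \<Rightarrow> real \<Rightarrow> bool" where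
  "form_norm_le V n T b \<longleftrightarrow> (\<forall>vs\<in>tuples V n. norm (T vs) \<le> b * prod_list (map norm vs))"

definition bounded_multilinear_on ::
  "'a::real_normed_vector set \<Rightarrow> nat \<Rightarrow> ('a list \<Rightarrow> 'b::real_normed_vector) \<Rightarrow> bool" where
  "bounded_multilinear_on V n T \<longleftrightarrow>
     (\<forall>vs\<in>tuples V n. \<forall>i<n. \<forall>u\<in>V. \<forall>v\<in>V. \<forall>a.
        T (vs[i := a *\<^sub>R u + v]) = a *\<^sub>R T (vs[i := u]) + T (vs[i := v])) \<and>
     (\<exists>b. form_norm_le V n T b)"

text \<open>
  \<open>T\<close> is a map of class \<open>C\<^sup>k\<close> from the open subset \<open>S\<close> of \<open>V\<close> to the space of bounded \<open>l\<close>-linear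
  maps on \<open>V\<close> with the operator norm. Here \<open>D j x\<close> is the \<open>j\<close>-th Frechet derivative at \<open>x\<close>, as a
  \<open>(j + l)\<close>-linear map whose last \<open>l\<close> arguments are those of \<open>T\<close>.
\<close>

definition Ck_forms ::
  "enat \<Rightarrow> nat \<Rightarrow> 'a::real_normed_vector set \<Rightarrow> 'a set \<Rightarrow>
     ('a \<Rightarrow> 'a list \<Rightarrow> 'b::real_normed_vector) \<Rightarrow> bool" where
  "Ck_forms k l V S T \<longleftrightarrow> (\<exists>D :: nat \<Rightarrow> 'a \<Rightarrow> 'a list \<Rightarrow> 'b.
     (\<forall>x\<in>S. \<forall>vs\<in>tuples V l. D 0 x vs = T x vs) \<and>
     (\<forall>j. enat j \<le> k \<longrightarrow> (\<forall>x\<in>S. bounded_multilinear_on V (j + l) (D j x))) \<and>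
     (\<forall>j. enat j \<le> k \<longrightarrow> (\<forall>x\<in>S. \<forall>e>0. \<forall>\<^sub>F y in at x within S.
        form_norm_le V (j + l) (\<lambda>vs. D j y vs - D j x vs) e)) \<and>
     (\<forall>j. enat j < k \<longrightarrow> (\<forall>x\<in>S. \<forall>e>0. \<forall>\<^sub>F y in at x within S.
        form_norm_le V (j + l) (\<lambda>vs. D j y vs - D j x vs - D (Suc j) x ((y - x) # vs))
          (e * norm (y - x)))))"

definition Ck_on ::
  "enat \<Rightarrow> 'a::real_normed_vector set \<Rightarrow> 'a set \<Rightarrow> ('a \<Rightarrow> 'b::real_normed_vector) \<Rightarrow> bool" where
  "Ck_on k V S f \<longleftrightarrow> Ck_forms k 0 V S (\<lambda>x _. f x)"

definition splits :: "'a::real_normed_vector set \<Rightarrow> 'a set \<Rightarrow> bool" where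
  "splits V W \<longleftrightarrow> subspace W \<and> closed W \<and> W \<subseteq> V \<and>
     (\<exists>Z. subspace Z \<and> closed Z \<and> Z \<subseteq> V \<and> W \<inter> Z = {0} \<and> V = {w + z | w z. w \<in> W \<and> z \<in> Z})"


section \<open>Banach manifolds\<close>

record ('p, 'm) chart =
  cdom :: "'p set"
  cmap :: "'p \<Rightarrow> 'm"
  cmodel :: "'m set"

record ('p, 'm) manifold =
  mtop :: "'p topology"
  atlas :: "('p, 'm) chart set"

abbreviation mpoints :: "('p, 'm) manifold \<Rightarrow> 'p set" where
  "mpoints M \<equiv> topspace (mtop M)"

definition cinv :: "('p, 'm) chart \<Rightarrow> 'm \<Rightarrow> 'p" where
  "cinv c = inv_into (cdom c) (cmap c)"

definition is_chart :: "'p topology \<Rightarrow> ('p, 'm::banach) chart \<Rightarrow> bool" where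
  "is_chart T c \<longleftrightarrow>
     openin T (cdom c) \<and> subspace (cmodel c) \<and> closed (cmodel c) \<and>
     openin (top_of_set (cmodel c)) (cmap c ` cdom c) \<and>
     homeomorphic_map (subtopology T (cdom c)) (top_of_set (cmap c ` cdom c)) (cmap c)"

definition smooth_transition :: "('p, 'm::banach) chart \<Rightarrow> ('p, 'm) chart \<Rightarrow> bool" where
  "smooth_transition c d \<longleftrightarrow>
     Ck_on \<infinity> (cmodel c) (cmap c ` (cdom c \<inter> cdom d)) (cmap d \<circ> cinv c)"

definition banach_manifold :: "('p, 'm::banach) manifold \<Rightarrow> bool" where
  "banach_manifold M \<longleftrightarrow>
     Hausdorff_space (mtop M) \<and>
     (\<forall>c\<in>atlas M. is_chart (mtop M) c) \<and>
     (\<Union>c\<in>atlas M. cdom c) = mpoints M \<and>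
     (\<forall>c\<in>atlas M. \<forall>d\<in>atlas M. smooth_transition c d)"

definition paracompact_space :: "'p topology \<Rightarrow> bool" where
  "paracompact_space T \<longleftrightarrow>
     Hausdorff_space T \<and>
     (\<forall>\<U>. (\<forall>U\<in>\<U>. openin T U) \<and> \<Union>\<U> = topspace T \<longrightarrow>
        (\<exists>\<V>. (\<forall>V\<in>\<V>. openin T V) \<and> \<Union>\<V> = topspace T \<and> (\<forall>V\<in>\<V>. \<exists>U\<in>\<U>. V \<subseteq> U) \<and>
             locally_finite_in T \<V>))"

definition max_atlas :: "('p, 'm::banach) manifold \<Rightarrow> ('p, 'm) chart set" where
  "max_atlas M = {c. is_chart (mtop M) c \<and>
     (\<forall>d\<in>atlas M. smooth_transition c d \<and> smooth_transition d c)}"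

definition smooth_map ::
  "('p, 'm::banach) manifold \<Rightarrow> ('q, 'n::banach) manifold \<Rightarrow> ('p \<Rightarrow> 'q) \<Rightarrow> bool" where
  "smooth_map M N f \<longleftrightarrow> continuous_map (mtop M) (mtop N) f \<and>
     (\<forall>c\<in>atlas M. \<forall>d\<in>atlas N.
        Ck_on \<infinity> (cmodel c) (cmap c ` (cdom c \<inter> f -` cdom d)) (cmap d \<circ> f \<circ> cinv c))"

definition Ck_function :: "enat \<Rightarrow> ('p, 'm::banach) manifold \<Rightarrow> ('p \<Rightarrow> real) \<Rightarrow> bool" where
  "Ck_function k M F \<longleftrightarrow> (\<forall>c\<in>atlas M. Ck_on k (cmodel c) (cmap c ` cdom c) (F \<circ> cinv c))"


subsection \<open>Tangent vectors and differentials\<close>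

text \<open>
  A tangent vector at \<open>m\<close> is an equivalence class of pairs \<open>(c, v)\<close>, where \<open>c\<close> is a chart around
  \<open>m\<close> and \<open>v\<close> a vector of its model space, modulo the derivatives at \<open>m\<close> of the chart changes;
  \<open>tvec M m c v\<close> is the class of \<open>(c, v)\<close>.
\<close>

type_synonym ('p, 'm) tangent = "(('p, 'm) chart \<times> 'm) set"

definition tvec ::
  "('p, 'm::banach) manifold \<Rightarrow> 'p \<Rightarrow> ('p, 'm) chart \<Rightarrow> 'm \<Rightarrow> ('p, 'm) tangent" where
  "tvec M m c v = {(d, w). d \<in> atlas M \<and> m \<in> cdom d \<and>
     w = fderiv (cmodel c) (cmap d \<circ> cinv c) (cmap c m) v}"

definition tangent_space :: "('p, 'm::banach) manifold \<Rightarrow> 'p \<Rightarrow> ('p, 'm) tangent set" where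
  "tangent_space M m = {tvec M m c v | c v. c \<in> atlas M \<and> m \<in> cdom c \<and> v \<in> cmodel c}"

definition tzero :: "('p, 'm::banach) manifold \<Rightarrow> 'p \<Rightarrow> ('p, 'm) tangent" where
  "tzero M m = {(c, 0) | c. c \<in> atlas M \<and> m \<in> cdom c}"

definition tminus ::
  "('p, 'm::banach) tangent \<Rightarrow> ('p, 'm) tangent \<Rightarrow> ('p, 'm) tangent" where
  "tminus \<xi> \<eta> = {(c, v - w) | c v w. (c, v) \<in> \<xi> \<and> (c, w) \<in> \<eta>}"

definition mdiff ::
  "('p, 'm::banach) manifold \<Rightarrow> ('q, 'n::banach) manifold \<Rightarrow> ('p \<Rightarrow> 'q) \<Rightarrow> 'p \<Rightarrow>
     ('p, 'm) tangent \<Rightarrow> ('q, 'n) tangent" where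
  "mdiff M N f m \<xi> = {(d, w). d \<in> atlas N \<and> f m \<in> cdom d \<and>
     (\<exists>(c, v)\<in>\<xi>. w = fderiv (cmodel c) (cmap d \<circ> f \<circ> cinv c) (cmap c m) v)}"

definition rdiff :: "('p \<Rightarrow> real) \<Rightarrow> 'p \<Rightarrow> ('p, 'm::banach) tangent \<Rightarrow> real" where
  "rdiff F m \<xi> = (THE s. \<exists>(c, v)\<in>\<xi>. s = fderiv (cmodel c) (F \<circ> cinv c) (cmap c m) v)"

definition Crit :: "('p, 'm::banach) manifold \<Rightarrow> ('p \<Rightarrow> real) \<Rightarrow> 'p set" where
  "Crit M F = {m \<in> mpoints M. \<forall>\<xi>\<in>tangent_space M m. rdiff F m \<xi> = 0}"

definition Ver ::
  "('p, 'm::banach) manifold \<Rightarrow> ('q, 'n::banach) manifold \<Rightarrow> ('p \<Rightarrow> 'q) \<Rightarrow> 'p \<Rightarrow>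
     ('p, 'm) tangent set" where
  "Ver M N q m = {\<xi> \<in> tangent_space M m. mdiff M N q m \<xi> = tzero N (q m)}"

text \<open>A submersion: the differentials are surjective and their kernels are complemented.\<close>

definition submersion ::
  "('p, 'm::banach) manifold \<Rightarrow> ('q, 'n::banach) manifold \<Rightarrow> ('p \<Rightarrow> 'q) \<Rightarrow> bool" where
  "submersion M N q \<longleftrightarrow> smooth_map M N q \<and>
     (\<forall>m\<in>mpoints M. mdiff M N q m ` tangent_space M m = tangent_space N (q m) \<and>
        (\<forall>c\<in>atlas M. m \<in> cdom c \<longrightarrow>
           splits (cmodel c) {v \<in> cmodel c. tvec M m c v \<in> Ver M N q m}))"


subsection \<open>Products and submanifolds\<close>

text \<open>
  Points of the \<open>r\<close>-fold product are extensional functions on \<open>{..<r}\<close>. Its charts take values in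
  the subspaces of the Banach space of bounded sequences in the model space of \<open>M\<close> that vanish
  from index \<open>r\<close> on.
\<close>

text \<open>The library has completeness only for metric spaces as domain, and \<^typ>\<open>nat\<close> is not in that class.\<close>

instance bcontfun :: (topological_space, complete_space) complete_space
proof
  fix f :: "nat \<Rightarrow> 'a \<Rightarrow>\<^sub>C 'b"
  assume "Cauchy f"
  then obtain g where "uniform_limit UNIV (\<lambda>n. apply_bcontfun (f n)) g sequentially"
    using uniformly_convergent_eq_cauchy[of "\<lambda>_. True" "\<lambda>n. apply_bcontfun (f n)"]
    unfolding Cauchy_def uniform_limit_sequentially_iff
    by (metis dist_fun_lt_imp_dist_val_lt)
  from uniform_limit_bcontfunE[OF this sequentially_bot]
  obtain l where "f \<longlonglongrightarrow> l" by metis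
  then show "convergent f" by (intro convergentI)
qed

instance bcontfun :: (topological_space, banach) banach ..

definition prod_chart ::
  "nat \<Rightarrow> (nat \<Rightarrow> ('p, 'm::banach) chart) \<Rightarrow> (nat \<Rightarrow> 'p, nat \<Rightarrow>\<^sub>C 'm) chart" where
  "prod_chart r c =
     \<lparr>cdom = (\<Pi>\<^sub>E i\<in>{..<r}. cdom (c i)),
      cmap = (\<lambda>u. Bcontfun (\<lambda>i. if i < r then cmap (c i) (u i) else 0)),
      cmodel = {v. \<forall>i. if i < r then apply_bcontfun v i \<in> cmodel (c i) else apply_bcontfun v i = 0}\<rparr>"

definition prod_manifold ::
  "nat \<Rightarrow> ('p, 'm::banach) manifold \<Rightarrow> (nat \<Rightarrow> 'p, nat \<Rightarrow>\<^sub>C 'm) manifold" where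
  "prod_manifold r M =
     \<lparr>mtop = product_topology (\<lambda>_. mtop M) {..<r},
      atlas = {prod_chart r c | c. \<forall>i<r. c i \<in> atlas M}\<rparr>"

text \<open>The charts of a submanifold \<open>S\<close> of \<open>M\<close> are the restrictions of the charts of the maximal
  atlas of \<open>M\<close> which map \<open>S\<close> onto an open part of a complemented subspace \<open>W\<close>.\<close>

definition submanifold_of ::
  "('p, 'm::banach) manifold \<Rightarrow> 'p set \<Rightarrow> ('p, 'm) manifold" where
  "submanifold_of M S =
     \<lparr>mtop = subtopology (mtop M) S,
      atlas = {\<lparr>cdom = cdom c \<inter> S, cmap = cmap c, cmodel = W\<rparr> | c W.
        c \<in> max_atlas M \<and> splits (cmodel c) W \<and> cmap c ` (cdom c \<inter> S) = cmap c ` cdom c \<inter> W}\<rparr>"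


section \<open>Riemannian metrics\<close>

type_synonym ('p, 'm) metric = "'p \<Rightarrow> ('p, 'm) tangent \<Rightarrow> ('p, 'm) tangent \<Rightarrow> real"

text \<open>
  A smooth (strong) Riemannian metric: in every chart it is a smooth map into the bounded bilinear
  forms, and each inner product induces the topology of the tangent space.
\<close>

definition riemannian_metric :: "('p, 'm::banach) manifold \<Rightarrow> ('p, 'm) metric \<Rightarrow> bool" where
  "riemannian_metric M g \<longleftrightarrow>
     (\<forall>m\<in>mpoints M. \<forall>\<xi>\<in>tangent_space M m. \<forall>\<eta>\<in>tangent_space M m. g m \<xi> \<eta> = g m \<eta> \<xi>) \<and>
     (\<forall>c\<in>atlas M. Ck_forms \<infinity> 2 (cmodel c) (cmap c ` cdom c)
        (\<lambda>x vs. g (cinv c x) (tvec M (cinv c x) c (vs ! 0)) (tvec M (cinv c x) c (vs ! 1)))) \<and>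
     (\<forall>c\<in>atlas M. \<forall>m\<in>cdom c. \<exists>k>0. \<forall>v\<in>cmodel c. k * (norm v)\<^sup>2 \<le> g m (tvec M m c v) (tvec M m c v))"

definition tnorm :: "('p, 'm) metric \<Rightarrow> 'p \<Rightarrow> ('p, 'm) tangent \<Rightarrow> real" where
  "tnorm g m \<xi> = sqrt (g m \<xi> \<xi>)"

definition prod_metric ::
  "nat \<Rightarrow> ('p, 'm::banach) manifold \<Rightarrow> ('p, 'm) metric \<Rightarrow> (nat \<Rightarrow> 'p, nat \<Rightarrow>\<^sub>C 'm) metric" where
  "prod_metric r M g = (\<lambda>u \<xi> \<eta>. \<Sum>i<r.
     g (u i) (mdiff (prod_manifold r M) M (\<lambda>w. w i) u \<xi>) (mdiff (prod_manifold r M) M (\<lambda>w. w i) u \<eta>))"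

definition restrict_metric ::
  "('p, 'm::banach) manifold \<Rightarrow> 'p set \<Rightarrow> ('p, 'm) metric \<Rightarrow> ('p, 'm) metric" where
  "restrict_metric M S g = (\<lambda>m \<xi> \<eta>.
     g m (mdiff (submanifold_of M S) M (\<lambda>x. x) m \<xi>) (mdiff (submanifold_of M S) M (\<lambda>x. x) m \<eta>))"

text \<open>Derivatives of curves are two-sided; the finite set \<open>P\<close> of exceptional parameters may contain
  the end points \<open>0\<close> and \<open>1\<close>. It does not contribute to the length.\<close>

definition piecewise_C1_curve :: "('p, 'm::banach) manifold \<Rightarrow> (real \<Rightarrow> 'p) \<Rightarrow> bool" where
  "piecewise_C1_curve M \<gamma> \<longleftrightarrow> pathin (mtop M) \<gamma> \<and>
     (\<exists>P. finite P \<and> (\<forall>c\<in>atlas M.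
        (cmap c \<circ> \<gamma>) C1_differentiable_on (({0..1} - P) \<inter> \<gamma> -` cdom c)))"

definition velocity :: "('p, 'm::banach) manifold \<Rightarrow> (real \<Rightarrow> 'p) \<Rightarrow> real \<Rightarrow> ('p, 'm) tangent" where
  "velocity M \<gamma> t = {(c, v). c \<in> atlas M \<and> \<gamma> t \<in> cdom c \<and>
     ((cmap c \<circ> \<gamma>) has_vector_derivative v) (at t)}"

definition curve_length ::
  "('p, 'm::banach) manifold \<Rightarrow> ('p, 'm) metric \<Rightarrow> (real \<Rightarrow> 'p) \<Rightarrow> ennreal" where
  "curve_length M g \<gamma> =
     (\<integral>\<^sup>+t\<in>{0..1}. ennreal (tnorm g (\<gamma> t) (velocity M \<gamma> t)) \<partial>lborel)"

definition rdist ::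
  "('p, 'm::banach) manifold \<Rightarrow> ('p, 'm) metric \<Rightarrow> 'p \<Rightarrow> 'p \<Rightarrow> ennreal" where
  "rdist M g x y =
     (INF \<gamma>\<in>{\<gamma>. piecewise_C1_curve M \<gamma> \<and> \<gamma> 0 = x \<and> \<gamma> 1 = y}. curve_length M g \<gamma>)"

definition complete_metric :: "('p, 'm::banach) manifold \<Rightarrow> ('p, 'm) metric \<Rightarrow> bool" where
  "complete_metric M g \<longleftrightarrow>
     (\<forall>s :: nat \<Rightarrow> 'p. range s \<subseteq> mpoints M \<and>
        (\<forall>e>0. \<exists>n0. \<forall>i\<ge>n0. \<forall>j\<ge>n0. rdist M g (s i) (s j) < e) \<longrightarrow>
        (\<exists>l\<in>mpoints M. (\<lambda>i. rdist M g (s i) l) \<longlonglongrightarrow> 0))"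

definition gradient ::
  "('p, 'm::banach) manifold \<Rightarrow> ('p, 'm) metric \<Rightarrow> ('p \<Rightarrow> real) \<Rightarrow> 'p \<Rightarrow> ('p, 'm) tangent" where
  "gradient M g F m =
     (THE \<xi>. \<xi> \<in> tangent_space M m \<and> (\<forall>\<eta>\<in>tangent_space M m. g m \<xi> \<eta> = rdiff F m \<eta>))"

definition palais_smale ::
  "('p, 'm::banach) manifold \<Rightarrow> ('p, 'm) metric \<Rightarrow> ('p \<Rightarrow> real) \<Rightarrow> bool" where
  "palais_smale M g F \<longleftrightarrow>
     (\<forall>s :: nat \<Rightarrow> 'p. range s \<subseteq> mpoints M \<and>
        (\<exists>b. \<forall>n. \<bar>F (s n)\<bar> \<le> b) \<and>
        (\<lambda>n. tnorm g (s n) (gradient M g F (s n))) \<longlonglongrightarrow> 0 \<longrightarrow>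
        (\<exists>l k. strict_mono k \<and> limitin (mtop M) (s \<circ> k) l sequentially))"

definition vertical_part ::
  "('p, 'm::banach) manifold \<Rightarrow> ('q, 'n::banach) manifold \<Rightarrow> ('p \<Rightarrow> 'q) \<Rightarrow> ('p, 'm) metric \<Rightarrow>
     ('p \<Rightarrow> ('p, 'm) tangent) \<Rightarrow> 'p \<Rightarrow> ('p, 'm) tangent" where
  "vertical_part M N q g Y m =
     (THE \<zeta>. \<zeta> \<in> Ver M N q m \<and> (\<forall>\<eta>\<in>Ver M N q m. g m (tminus (Y m) \<zeta>) \<eta> = 0))"

definition vertically_proportional ::
  "('p, 'm::banach) manifold \<Rightarrow> ('q, 'n::banach) manifold \<Rightarrow> ('p \<Rightarrow> 'q) \<Rightarrow> ('p, 'm) metric \<Rightarrow>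
     ('p \<Rightarrow> ('p, 'm) tangent) \<Rightarrow> bool" where
  "vertically_proportional M N q g Y \<longleftrightarrow>
     (\<exists>C>0. \<forall>m\<in>mpoints M. tnorm g m (Y m) \<le> C * tnorm g m (vertical_part M N q g Y m))"


section \<open>Fibrations and path spaces\<close>

definition cmaps :: "'a topology \<Rightarrow> 'b topology \<Rightarrow> ('a \<Rightarrow> 'b) set" where
  "cmaps A B = {f \<in> extensional (topspace A). continuous_map A B f}"

definition compact_open_topology :: "'a topology \<Rightarrow> 'b topology \<Rightarrow> ('a \<Rightarrow> 'b) topology" where
  "compact_open_topology A B =
     topology_generated_by {{f \<in> cmaps A B. f ` K \<subseteq> U} | K U. compactin A K \<and> openin B U}"

abbreviation unit_interval :: "real topology" where
  "unit_interval \<equiv> top_of_set {0..1}"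

definition homotopy_lifting ::
  "'z topology \<Rightarrow> 'e topology \<Rightarrow> 'x topology \<Rightarrow> ('e \<Rightarrow> 'x) \<Rightarrow> bool" where
  "homotopy_lifting Z TE TX p \<longleftrightarrow>
     (\<forall>f h. continuous_map Z TE f \<and> continuous_map (prod_topology Z unit_interval) TX h \<and>
        (\<forall>z\<in>topspace Z. h (z, 0) = p (f z)) \<longrightarrow>
        (\<exists>H. continuous_map (prod_topology Z unit_interval) TE H \<and>
           (\<forall>z\<in>topspace Z. H (z, 0) = f z) \<and>
           (\<forall>z\<in>topspace Z. \<forall>t\<in>{0..1}. p (H (z, t)) = h (z, t))))"

text \<open>
  Hurewicz fibrations have the homotopy lifting property for all topological spaces \<open>Z\<close>. A
  definition can only quantify over spaces carried by one type. The type chosen here contains the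
  mapping path space of \<open>p\<close>, so that lifting for all other spaces follows; see
  \<open>hurewicz_fibration_lifting\<close> below.
\<close>

definition hurewicz_fibration :: "'e topology \<Rightarrow> 'x topology \<Rightarrow> ('e \<Rightarrow> 'x) \<Rightarrow> bool" where
  "hurewicz_fibration TE TX p \<longleftrightarrow> continuous_map TE TX p \<and>
     (\<forall>Z :: ('e \<times> (real \<Rightarrow> 'x)) topology. homotopy_lifting Z TE TX p)"

lemma topspace_compact_open: "topspace (compact_open_topology A B) = cmaps A B"
proof -
  have "cmaps A B \<in> {{f \<in> cmaps A B. f ` K \<subseteq> U} | K U. compactin A K \<and> openin B U}"
    by (intro CollectI exI[of _ "{}"]) auto
  then show ?thesis
    unfolding compact_open_topology_def topology_generated_by_topspace by blast
qed

lemma openin_compact_open: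
  assumes "compactin A K" "openin B U"
  shows "openin (compact_open_topology A B) {f \<in> cmaps A B. f ` K \<subseteq> U}"
  unfolding compact_open_topology_def
  by (rule topology_generated_by_Basis) (use assms in blast)

lemma continuous_map_path_eval:
  "continuous_map (prod_topology (compact_open_topology unit_interval B) unit_interval) B
     (\<lambda>(\<gamma>, t). \<gamma> t)"
  unfolding continuous_map_def
proof (intro conjI allI impI)
  show "(\<lambda>(\<gamma>, t). \<gamma> t) \<in> topspace (prod_topology (compact_open_topology unit_interval B) unit_interval)
          \<rightarrow> topspace B"
    by (auto simp: topspace_compact_open cmaps_def continuous_map_def)
next
  fix U assume U: "openin B U"
  let ?P = "prod_topology (compact_open_topology unit_interval B) unit_interval"
  show "openin ?P {z \<in> topspace ?P. (case z of (\<gamma>, t) \<Rightarrow> \<gamma> t) \<in> U}"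
  proof (subst openin_subopen, intro ballI)
    fix z assume z: "z \<in> {z \<in> topspace ?P. (case z of (\<gamma>, t) \<Rightarrow> \<gamma> t) \<in> U}"
    obtain \<gamma> t where zt: "z = (\<gamma>, t)" by (cases z)
    have \<gamma>: "continuous_map unit_interval B \<gamma>" and t: "t \<in> {0..1}" and \<gamma>t: "\<gamma> t \<in> U"
      and g: "\<gamma> \<in> cmaps unit_interval B"
      using z zt by (auto simp: topspace_compact_open cmaps_def)
    have "openin unit_interval {s \<in> {0..1}. \<gamma> s \<in> U}"
      using openin_continuous_map_preimage[OF \<gamma> U] by simp
    then obtain e where e: "e > 0" "\<And>s. s \<in> {0..1} \<Longrightarrow> dist s t < e \<Longrightarrow> \<gamma> s \<in> U"
      using t \<gamma>t unfolding openin_euclidean_subtopology_iff by blast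
    define K where "K = {0..1} \<inter> cball t (e/2)"
    define V where "V = {0..1} \<inter> ball t (e/2)"
    have "compact K" unfolding K_def by (intro compact_Int) auto
    then have K: "compactin unit_interval K"
      by (simp add: compactin_subtopology K_def)
    have gK: "\<gamma> ` K \<subseteq> U"
      using e by (auto simp: K_def dist_commute)
    have V: "openin unit_interval V"
      unfolding V_def by (simp add: openin_open_Int)
    let ?W = "{f \<in> cmaps unit_interval B. f ` K \<subseteq> U} \<times> V"
    have "openin ?P ?W"
      using openin_compact_open[OF K U] V by (simp add: openin_prod_Times_iff)
    moreover have "z \<in> ?W"
      using zt g gK t e(1) by (auto simp: V_def)
    moreover have "?W \<subseteq> {z \<in> topspace ?P. (case z of (\<gamma>, t) \<Rightarrow> \<gamma> t) \<in> U}"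
      by (auto simp: topspace_compact_open V_def K_def subset_iff)
    ultimately show "\<exists>T. openin ?P T \<and> z \<in> T \<and>
        T \<subseteq> {z \<in> topspace ?P. (case z of (\<gamma>, t) \<Rightarrow> \<gamma> t) \<in> U}" by blast
  qed
qed

lemma continuous_map_path_curry:
  assumes h: "continuous_map (prod_topology Z unit_interval) B h"
  shows "continuous_map Z (compact_open_topology unit_interval B) (\<lambda>z. \<lambda>t\<in>{0..1}. h (z, t))"
proof -
  have mem: "(\<lambda>t\<in>{0..1}. h (z, t)) \<in> cmaps unit_interval B" if z: "z \<in> topspace Z" for z
  proof -
    have "continuous_map unit_interval (prod_topology Z unit_interval) (\<lambda>t. (z, t))"
      using z by (intro continuous_map_pairedI) auto
    then have "continuous_map unit_interval B (h \<circ> (\<lambda>t. (z, t)))"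
      using h by (rule continuous_map_compose)
    then have "continuous_map unit_interval B (\<lambda>t\<in>{0..1}. h (z, t))"
      by (rule continuous_map_eq) auto
    then show ?thesis by (auto simp: cmaps_def)
  qed
  show ?thesis
    unfolding compact_open_topology_def
  proof (rule continuous_on_generated_topo)
    fix Q assume "Q \<in> {{f \<in> cmaps unit_interval B. f ` K \<subseteq> U} | K U. compactin unit_interval K \<and> openin B U}"
    then obtain K U where Q: "Q = {f \<in> cmaps unit_interval B. f ` K \<subseteq> U}"
      and K: "compactin unit_interval K" and U: "openin B U" by blast
    have K01: "K \<subseteq> {0..1}" and cK: "compact K"
      using K by (auto simp: compactin_subtopology)
    have cl: "closed_map (prod_topology Z (top_of_set K)) Z fst"
      using cK by (intro closed_map_fst) (simp add: compact_space_subtopology)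
    have hK: "continuous_map (prod_topology Z (top_of_set K)) B h"
    proof -
      have "continuous_map (prod_topology Z (top_of_set K)) unit_interval snd"
        using continuous_map_snd[of Z "top_of_set K"] K01
        by (auto simp: continuous_map_in_subtopology)
      then have "continuous_map (prod_topology Z (top_of_set K)) (prod_topology Z unit_interval)
          (\<lambda>x. (fst x, snd x))"
        by (intro continuous_map_pairedI continuous_map_fst)
      from continuous_map_compose[OF this h] show ?thesis by (simp add: comp_def)
    qed
    let ?C = "{x \<in> topspace (prod_topology Z (top_of_set K)). h x \<in> topspace B - U}"
    have "closedin (prod_topology Z (top_of_set K)) ?C"
      by (rule closedin_continuous_map_preimage[OF hK]) (use U in auto)
    then have "closedin Z (fst ` ?C)"
      using cl by (auto simp: closed_map_def)
    then have "openin Z (topspace Z - fst ` ?C)" by auto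
    moreover have "(\<lambda>z. \<lambda>t\<in>{0..1}. h (z, t)) -` Q \<inter> topspace Z = topspace Z - fst ` ?C"
    proof -
      have hB: "h (z, t) \<in> topspace B" if "z \<in> topspace Z" "t \<in> K" for z t
        using hK that by (auto simp: continuous_map_def)
      show ?thesis
        using K01 hB by (auto simp: Q mem image_iff subset_iff split: if_splits) blast+
    qed
    ultimately show "openin Z ((\<lambda>z. \<lambda>t\<in>{0..1}. h (z, t)) -` Q \<inter> topspace Z)" by simp
  next
    show "(\<lambda>z. \<lambda>t\<in>{0..1}. h (z, t)) ` topspace Z
        \<subseteq> \<Union>{{f \<in> cmaps unit_interval B. f ` K \<subseteq> U} | K U. compactin unit_interval K \<and> openin B U}"
      using mem topspace_compact_open[of unit_interval B]
      unfolding compact_open_topology_def topology_generated_by_topspace by auto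
  qed
qed

lemma hurewicz_fibration_lifting:
  fixes Z :: "'z topology" and TE :: "'e topology" and TX :: "'x topology"
  assumes p: "hurewicz_fibration TE TX p"
  shows "homotopy_lifting Z TE TX p"
  unfolding homotopy_lifting_def
proof (intro allI impI, elim conjE)
  fix f h
  assume f: "continuous_map Z TE f" and h: "continuous_map (prod_topology Z unit_interval) TX h"
    and fh: "\<forall>z\<in>topspace Z. h (z, 0) = p (f z)"
  let ?C = "compact_open_topology unit_interval TX"
  define N where "N = subtopology (prod_topology TE ?C) {(e, \<gamma>). p e = \<gamma> 0}"
  have a1: "continuous_map N TE fst"
    unfolding N_def by (intro continuous_map_from_subtopology continuous_map_fst)
  have a2: "continuous_map (prod_topology N unit_interval) TX (\<lambda>((e, \<gamma>), t). \<gamma> t)"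
  proof -
    have "continuous_map N ?C snd"
      unfolding N_def by (intro continuous_map_from_subtopology continuous_map_snd)
    from continuous_map_compose[OF continuous_map_fst this, of unit_interval]
    have "continuous_map (prod_topology N unit_interval) (prod_topology ?C unit_interval)
        (\<lambda>y. (snd (fst y), snd y))"
      by (intro continuous_map_pairedI continuous_map_snd) (simp add: comp_def)
    from continuous_map_compose[OF this continuous_map_path_eval] show ?thesis
      by (simp add: comp_def case_prod_unfold)
  qed
  have a3: "\<forall>z\<in>topspace N. (\<lambda>((e, \<gamma>), t). \<gamma> t) (z, 0) = p (fst z)"
    by (auto simp: N_def)
  have "homotopy_lifting N TE TX p"
    using p by (simp add: hurewicz_fibration_def)
  then have "\<exists>H. continuous_map (prod_topology N unit_interval) TE H \<and>
      (\<forall>z\<in>topspace N. H (z, 0) = fst z) \<and>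
      (\<forall>z\<in>topspace N. \<forall>t\<in>{0..1}. p (H (z, t)) = (\<lambda>((e, \<gamma>), t). \<gamma> t) (z, t))"
    unfolding homotopy_lifting_def
    by (elim allE[of _ fst] allE[of _ "\<lambda>((e, \<gamma>), t). \<gamma> t"] impE) (rule conjI[OF a1 conjI[OF a2 a3]])
  then obtain H where H: "continuous_map (prod_topology N unit_interval) TE H"
      and H0: "\<And>z. z \<in> topspace N \<Longrightarrow> H (z, 0) = fst z"
      and pH: "\<And>z t. z \<in> topspace N \<Longrightarrow> t \<in> {0..1} \<Longrightarrow> p (H (z, t)) = (\<lambda>((e, \<gamma>), t). \<gamma> t) (z, t)"
    by auto
  define k where "k = (\<lambda>z. (f z, \<lambda>t\<in>{0..1}. h (z, t)))"
  have "continuous_map Z (prod_topology TE ?C) k"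
    unfolding k_def by (intro continuous_map_pairedI f continuous_map_path_curry h)
  then have k: "continuous_map Z N k"
    unfolding N_def by (rule continuous_map_into_subtopology) (use fh in \<open>auto simp: k_def\<close>)
  then have kN: "k z \<in> topspace N" if "z \<in> topspace Z" for z
    using that by (auto simp: continuous_map_def)
  from continuous_map_compose[OF continuous_map_fst k, of unit_interval]
  have "continuous_map (prod_topology Z unit_interval) (prod_topology N unit_interval)
      (\<lambda>y. (k (fst y), snd y))"
    by (intro continuous_map_pairedI continuous_map_snd) (simp add: comp_def)
  from continuous_map_compose[OF this H]
  have "continuous_map (prod_topology Z unit_interval) TE (\<lambda>y. H (k (fst y), snd y))"
    by (simp add: comp_def)
  moreover have "\<forall>z\<in>topspace Z. H (k (fst (z, 0::real)), snd (z, 0)) = f z"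
    using kN H0 by (simp add: k_def)
  moreover have "\<forall>z\<in>topspace Z. \<forall>t\<in>{0..1}. p (H (k (fst (z, t)), snd (z, t))) = h (z, t)"
    using kN pH by (simp add: k_def)
  ultimately show "\<exists>H. continuous_map (prod_topology Z unit_interval) TE H \<and>
      (\<forall>z\<in>topspace Z. H (z, 0) = f z) \<and>
      (\<forall>z\<in>topspace Z. \<forall>t\<in>{0..1}. p (H (z, t)) = h (z, t))" by blast
qed


section \<open>Fiber products and sequential parametrized subspace complexity\<close>

definition fiber_product :: "nat \<Rightarrow> 'e topology \<Rightarrow> ('e \<Rightarrow> 'x) \<Rightarrow> (nat \<Rightarrow> 'e) set" where
  "fiber_product r TE p =
     {u \<in> (\<Pi>\<^sub>E i\<in>{..<r}. topspace TE). \<forall>i<r. \<forall>j<r. p (u i) = p (u j)}"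

definition fiber_product_topology :: "nat \<Rightarrow> 'e topology \<Rightarrow> ('e \<Rightarrow> 'x) \<Rightarrow> (nat \<Rightarrow> 'e) topology" where
  "fiber_product_topology r TE p =
     subtopology (product_topology (\<lambda>_. TE) {..<r}) (fiber_product r TE p)"

definition fiber_product_manifold ::
  "nat \<Rightarrow> ('e, 'm::banach) manifold \<Rightarrow> ('e \<Rightarrow> 'x) \<Rightarrow> (nat \<Rightarrow> 'e, nat \<Rightarrow>\<^sub>C 'm) manifold" where
  "fiber_product_manifold r E p = submanifold_of (prod_manifold r E) (fiber_product r (mtop E) p)"

lemma mtop_fiber_product_manifold:
  "mtop (fiber_product_manifold r E p) = fiber_product_topology r (mtop E) p"
  by (simp add: fiber_product_manifold_def submanifold_of_def prod_manifold_def
      fiber_product_topology_def)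

definition fiber_product_metric ::
  "nat \<Rightarrow> ('e, 'm::banach) manifold \<Rightarrow> ('e \<Rightarrow> 'x) \<Rightarrow> ('e, 'm) metric \<Rightarrow>
     (nat \<Rightarrow> 'e, nat \<Rightarrow>\<^sub>C 'm) metric" where
  "fiber_product_metric r E p g =
     restrict_metric (prod_manifold r E) (fiber_product r (mtop E) p) (prod_metric r E g)"

text \<open>The map \<open>q\<^sub>r\<close>; tuples are indexed from \<open>0\<close>.\<close>

definition fiber_proj :: "('e \<Rightarrow> 'x) \<Rightarrow> (nat \<Rightarrow> 'e) \<Rightarrow> 'x" where
  "fiber_proj p u = p (u 0)"

definition fiber_paths :: "'e topology \<Rightarrow> ('e \<Rightarrow> 'x) \<Rightarrow> (real \<Rightarrow> 'e) topology" where
  "fiber_paths TE p =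
     subtopology (compact_open_topology unit_interval TE) {\<gamma>. \<forall>t\<in>{0..1}. p (\<gamma> t) = p (\<gamma> 0)}"

definition path_eval :: "nat \<Rightarrow> (real \<Rightarrow> 'e) \<Rightarrow> (nat \<Rightarrow> 'e)" where
  "path_eval r \<gamma> = (\<lambda>i\<in>{..<r}. \<gamma> (real i / real (r - 1)))"

text \<open>The infimum of the empty set is \<open>\<infinity>\<close>; for \<open>A = {}\<close> the empty cover gives \<open>0\<close>.\<close>

definition TC :: "nat \<Rightarrow> 'e topology \<Rightarrow> ('e \<Rightarrow> 'x) \<Rightarrow> (nat \<Rightarrow> 'e) set \<Rightarrow> enat" where
  "TC r TE p A = (INF n\<in>{n. \<exists>U :: nat \<Rightarrow> (nat \<Rightarrow> 'e) set.
     A \<subseteq> (\<Union>i<n. U i) \<and>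
     (\<forall>i<n. openin (fiber_product_topology r TE p) (U i) \<and>
        (\<exists>s. continuous_map (subtopology (fiber_product_topology r TE p) (U i)) (fiber_paths TE p) s \<and>
             (\<forall>u\<in>U i. path_eval r (s u) = u)))}. enat n)"

definition sublevel :: "'y set \<Rightarrow> ('y \<Rightarrow> real) \<Rightarrow> real \<Rightarrow> 'y set" where
  "sublevel Y F l = {y \<in> Y. F y \<le> l}"

definition level :: "'y set \<Rightarrow> ('y \<Rightarrow> real) \<Rightarrow> real \<Rightarrow> 'y set" where
  "level Y F \<mu> = {y \<in> Y. F y = \<mu>}"

definition crit_components ::
  "('p, 'm::banach) manifold \<Rightarrow> ('p \<Rightarrow> real) \<Rightarrow> real \<Rightarrow> 'p set set" where
  "crit_components M F \<mu> =
     connected_components_of (subtopology (mtop M) (level (mpoints M) F \<mu> \<inter> Crit M F))"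

end

(*
The complexity TC is invariant under arbitrary homotopies of subsets of the fibre product: along a homotopy b
with b(u,0) = u, a section near b(u,1) yields a section near u, because the loop that runs through the tracks of
the homotopy and the given fibre path projects to a null-homotopic loop in X, and the homotopy lifting property
of p moves the whole picture into one fibre. Together with subadditivity and the inequality
TC(K) <= sup of TC(C) over the components C of K, valid for compact K, this reduces the theorem to crossing one
level c: by the Palais-Smale condition the critical set K_c is compact and, off a neighbourhood of K_c, points
near level c admit local descents of a uniform rate. Instead of integrating a pseudo-gradient field, the local
descents are composed in the complete metric space given by the Riemannian distance, which gives a deformation of
the sublevel set c + e, off the neighbourhood, into the sublevel set c - e. A supremum argument over the levels
finishes the proof. Coordinates on the fibre product come from charts of E in which p is linear.
*)

theory Submission
  imports Defs
begin

section \<open>Calculus on closed subspaces\<close>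

text \<open>\<open>F\<close> is only of class C^1, so its gradient is merely continuous and need not
  have a flow. A descent is therefore a straight move in one chart: all estimates are made at one
  point, and strict differentiability carries them to a neighbourhood. Distances are sums over the
  coordinates of Riemannian distances in \<open>E\<close>, truncated at 1, and not distances for the
  restricted metric. Completeness is given on \<open>E\<close> and passes to a closed subset of a
  power of \<open>E\<close>; the restricted metric is compared with this distance only
  infinitesimally, at the price of a constant depending on \<open>r\<close>. The fibre product takes
  its charts from the maximal atlas of the power of \<open>E\<close>. To see that there are enough
  of them, \<open>p\<close> has to be straightened by charts of \<open>E\<close> whose changes to
  the given charts are smooth in both directions. This calls for a smooth inverse function theorem
  on closed subspaces, hence for smoothness of composites and inverses; the calculus of multilinear
  forms serves only this purpose.\<close>

definition blinear_on ::
 "'a::real_normed_vector set=>('a=>'b::real_normed_vector)=>bool" where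
 "blinear_on V f \<longleftrightarrow>
   (ALL u:V. ALL v:V. f (u + v)=f u + f v)&(ALL a. ALL v:V. f (a *\<^sub>R v)=a *\<^sub>R f v) &
   (EX K. ALL v:V. norm (f v)<=K * norm v)"

lemma blinear_on_add: "blinear_on V f==>u:V==>v:V==>f (u + v)=f u + f v"
 and blinear_on_scale: "blinear_on V f==>v:V==>f (a *\<^sub>R v)=a *\<^sub>R f v"
 by (auto simp: blinear_on_def)

lemma blinear_on_bound:
 assumes "blinear_on V f"
 obtains K where "K>0" "!!v. v:V==>norm (f v)<=K * norm v"
proof -
 obtain K where K: "ALL v:V. norm (f v)<=K * norm v"
  using assms by (auto simp: blinear_on_def)
 have "norm (f v)<=(max K 1) * norm v" if "v:V" for v
  by (rule order_trans[OF K[rule_format, OF that]]) (auto intro: mult_right_mono)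
 then show ?thesis by (intro that[of "max K 1"]) auto
qed

lemma blinear_on_zero: "blinear_on V f==>subspace V==>f 0=0"
 using blinear_on_scale[of V f 0 0] by (simp add: subspace_0)

lemma blinear_on_minus: "blinear_on V f==>subspace V==>v:V==>f (- v) = - f v"
 using blinear_on_scale[of V f v "-1"] by simp

lemma blinear_on_diff:
 "blinear_on V f==>subspace V==>u:V==>v:V==>f (u - v)=f u - f v"
 using blinear_on_add[of V f u "-v"] blinear_on_minus[of V f v]
 by (simp add: subspace_neg)

lemma blinear_on_subset: "blinear_on V f==>W<=V==>blinear_on W f"
 unfolding blinear_on_def by (meson subset_iff)

lemma blinear_on_compose:
 assumes f: "blinear_on V f" and g: "blinear_on W g" and "!!v. v:V==>f v:W"
 shows "blinear_on V (%v. g (f v))"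
proof -
 obtain K where K: "K>0" "!!v. v:V==>norm (f v)<=K * norm v"
  using blinear_on_bound[OF f] by metis
 obtain L where L: "L>0" "!!v. v:W==>norm (g v)<=L * norm v"
  using blinear_on_bound[OF g] by metis
 have "norm (g (f v))<=(L * K) * norm v" if "v:V" for v
 proof -
  have "norm (g (f v))<=L * norm (f v)" using L assms(3) that by blast
  also have "...<=L * (K * norm v)" using K that L by (intro mult_left_mono) auto
  finally show ?thesis by simp
 qed
 then show ?thesis
  using f g assms(3) unfolding blinear_on_def by metis
qed

lemma bounded_linear_imp_on: "bounded_linear f==>blinear_on V f"
 unfolding blinear_on_def
 using bounded_linear.bounded[of f] by (auto simp: linear_simps mult.commute)

text \<open>At \<open>y = x\<close> both sides of the estimate vanish, so the punctured limit
  becomes a bound on a full ball. Later estimates use this form and avoid the case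
  distinction.\<close>

lemma has_fderiv_iff:
 "has_fderiv V f f' x\<longleftrightarrow>blinear_on V f' &
   (ALL e>0. EX d>0. ALL y:V. dist y x<d-->norm (f y - f x - f' (y - x))<=e * norm (y - x))"
 (is "?L\<longleftrightarrow>?B&?R")
proof -
 have "?R\<longleftrightarrow>((%y. (f y - f x - f' (y - x)) /\<^sub>R norm (y - x)) \<longlongrightarrow> 0) (at x within V)" (is "_\<longleftrightarrow>?T")
  if B: ?B
 proof
  assume R: ?R
  show ?T
  proof (rule tendstoI)
   fix e :: real assume "e>0"
   then obtain d where d: "d>0"
    "!!y. y:V==>dist y x<d==>norm (f y - f x - f' (y - x))<=(e/2) * norm (y - x)"
    using R[rule_format, of "e/2"] by auto
   show "\<forall>\<^sub>F y in at x within V. dist ((f y - f x - f' (y - x)) /\<^sub>R norm (y - x)) 0<e"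
    unfolding eventually_at
   proof (intro exI[of _ d] conjI ballI impI, fact)
    fix y assume y: "y:V" "y~=x&dist y x<d"
    then have "norm (f y - f x - f' (y - x)) / norm (y - x)<=e/2"
     using d(2)[of y] by (simp add: divide_simps)
    moreover have "norm ((f y - f x - f' (y - x)) /\<^sub>R norm (y - x))=norm (f y - f x - f' (y - x)) / norm (y - x)"
     by (simp add: divide_inverse mult.commute)
    ultimately show "dist ((f y - f x - f' (y - x)) /\<^sub>R norm (y - x)) 0<e"
     using \<open>e>0\<close> unfolding dist_norm diff_zero by linarith
   qed
  qed
 next
  assume T: ?T
  show ?R
  proof (intro allI impI)
   fix e :: real assume e: "e>0"
   obtain d where d: "d>0"
    "!!y. y:V==>y~=x==>dist y x<d==>norm ((f y - f x - f' (y - x)) /\<^sub>R norm (y - x))<e"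
    using tendstoD[OF T e] unfolding eventually_at by auto
   have "norm (f y - f x - f' (y - x))<=e * norm (y - x)" if y: "y:V" "dist y x<d" for y
   proof (cases "y=x")
    case True
    have "f' 0=0" using blinear_on_scale[OF B y(1), of 0] by simp
    then show ?thesis using True by simp
   next
    case False
    then have "norm (f y - f x - f' (y - x)) / norm (y - x)<e"
     using d(2)[OF y(1) False y(2)] by (simp add: divide_inverse mult.commute)
    then show ?thesis using False by (simp add: divide_simps split: if_splits)
   qed
   with d(1) show "EX d>0. ALL y:V. dist y x<d-->norm (f y - f x - f' (y - x))<=e * norm (y - x)"
    by blast
  qed
 qed
 then show ?thesis
  unfolding has_fderiv_def blinear_on_def by blast
qed

lemma has_fderiv_linear: "has_fderiv V f f' x==>blinear_on V f'"
 by (simp add: has_fderiv_iff)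

lemma has_fderivD:
 assumes "has_fderiv V f f' x" "e>0"
 obtains d where "d>0" "!!y. y:V==>dist y x<d==>norm (f y - f x - f' (y - x))<=e * norm (y - x)"
 using assms unfolding has_fderiv_iff by metis

text \<open>Derivatives are determined by difference quotients along lines, which stay in \<open>V\<close>.\<close>

lemma has_fderiv_quotient:
 assumes f: "has_fderiv V f f' x" and V: "subspace V" "x:V" "v:V"
 shows "((%t. (f (x + t *\<^sub>R v) - f x) /\<^sub>R t) \<longlongrightarrow> f' v) (at (0::real))"
proof (rule tendstoI)
 fix e :: real assume e: "e>0"
 \<comment> \<open>Adding 1 keeps the quotient meaningful for \<open>v = 0\<close>; the same guard
   recurs in many constants below. The factor 2 turns the non-strict bound into a strict
   one.\<close>
 define k where "k=e / (2 * (norm v + 1))"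
 have nv: "norm v + 1>0" by (simp add: add_nonneg_pos)
 have k: "k>0" using e nv unfolding k_def by (intro divide_pos_pos) auto
 obtain d where d: "d>0" "!!y. y:V==>dist y x<d==>norm (f y - f x - f' (y - x))<=k * norm (y - x)"
  using has_fderivD[OF f k] by metis
 show "\<forall>\<^sub>F t in at 0. dist ((f (x + t *\<^sub>R v) - f x) /\<^sub>R t) (f' v)<e"
  unfolding eventually_at
 proof (intro exI[of _ "d / (norm v + 1)"] conjI ballI impI)
  show "d / (norm v + 1)>0" using d nv by (intro divide_pos_pos) auto
  fix t :: real assume "t~=0&dist t 0<d / (norm v + 1)"
  then have t: "t~=0" "\<bar>t\<bar> * (norm v + 1)<d" using nv by (auto simp: pos_less_divide_eq)
  have "x + t *\<^sub>R v:V" using V by (simp add: subspace_add subspace_scale)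
  moreover have "dist (x + t *\<^sub>R v) x<d"
   using t by (simp add: dist_norm distrib_left)
  ultimately have "norm (f (x + t *\<^sub>R v) - f x - f' (t *\<^sub>R v))<=k * (\<bar>t\<bar> * norm v)"
   using d(2)[of "x + t *\<^sub>R v"] by simp
  moreover have "f' (t *\<^sub>R v)=t *\<^sub>R f' v"
   using f V by (auto dest: has_fderiv_linear intro: blinear_on_scale)
  moreover have "(f (x + t *\<^sub>R v) - f x) /\<^sub>R t - f' v=(f (x + t *\<^sub>R v) - f x - t *\<^sub>R f' v) /\<^sub>R t"
   using t by (simp add: algebra_simps)
  ultimately have "norm ((f (x + t *\<^sub>R v) - f x) /\<^sub>R t - f' v)<=(k * (\<bar>t\<bar> * norm v)) / \<bar>t\<bar>"
   by (simp add: divide_inverse mult.commute mult_left_mono)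
  also have "...=k * norm v" using t by simp
  also have "...<=k * (norm v + 1)" using k by simp
  also have "...=e / 2" unfolding k_def using nv by (simp add: field_simps)
  also have "...<e" using e by simp
  finally show "dist ((f (x + t *\<^sub>R v) - f x) /\<^sub>R t) (f' v)<e" by (simp add: dist_norm)
 qed
qed

lemma has_fderiv_unique:
 assumes "has_fderiv V f f' x" "has_fderiv V f f'' x" "subspace V" "x:V" "v:V"
 shows "f' v=f'' v"
 using has_fderiv_quotient[OF assms(1) assms(3-5)] has_fderiv_quotient[OF assms(2) assms(3-5)]
 by (rule tendsto_unique[OF at_neq_bot])

lemma has_fderiv_fderiv: "has_fderiv V f f' x==>has_fderiv V f (fderiv V f x) x"
 unfolding fderiv_def by (rule someI[of "%f'. has_fderiv V f f' x"])

lemma fderiv_eq: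
 assumes "has_fderiv V f f' x" "subspace V" "x:V" "v:V"
 shows "fderiv V f x v=f' v"
 using has_fderiv_unique[OF has_fderiv_fderiv[OF assms(1)] assms] .

lemma has_fderiv_cong:
 assumes "has_fderiv V f f' x" "!!v. v:V==>f' v=f'' v" "subspace V" "x:V"
  and "d>0" "!!y. y:V==>dist y x<d==>f y=g y"
 shows "has_fderiv V g f'' x"
 unfolding has_fderiv_iff
proof (intro conjI allI impI)
 show "blinear_on V f''"
  using assms(1-3) unfolding has_fderiv_iff blinear_on_def
  by (metis subspace_add subspace_scale)
 fix e :: real assume "e>0"
 then obtain d' where d': "d'>0" "!!y. y:V==>dist y x<d'==>norm (f y - f x - f' (y - x))<=e * norm (y - x)"
  using has_fderivD[OF assms(1)] by metis
 have "f x=g x" using assms by simp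
 have "norm (g y - g x - f'' (y - x))<=e * norm (y - x)" if y: "y:V" "dist y x<min d d'" for y
 proof -
  have "f y=g y" "f' (y - x)=f'' (y - x)" using assms(2-6) y by (auto simp: subspace_diff)
  then show ?thesis using d'(2)[OF y(1)] y \<open>f x=g x\<close> by simp
 qed
 then show "EX d>0. ALL y:V. dist y x<d-->norm (g y - g x - f'' (y - x))<=e * norm (y - x)"
  using d'(1) assms(5) by (intro exI[of _ "min d d'"]) auto
qed

lemma has_fderiv_subset:
 assumes "has_fderiv V f f' x" "W<=V" shows "has_fderiv W f f' x"
 using assms unfolding has_fderiv_iff by (meson blinear_on_subset subsetD)

lemma has_fderiv_continuous:
 assumes f: "has_fderiv V f f' x" and V: "subspace V" "x:V"
 shows "continuous (at x within V) f"
proof -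
 obtain K where K: "K>0" "!!v. v:V==>norm (f' v)<=K * norm v"
  using blinear_on_bound[OF has_fderiv_linear[OF f]] by metis
 obtain d where d: "d>0" "!!y. y:V==>dist y x<d==>norm (f y - f x - f' (y - x))<=1 * norm (y - x)"
  using has_fderivD[OF f zero_less_one] by metis
 have le: "norm (f y - f x)<=(K + 1) * norm (y - x)" if "y:V" "dist y x<d" for y
 proof -
  have "norm (f y - f x)<=norm (f y - f x - f' (y - x)) + norm (f' (y - x))"
   by (metis diff_add_cancel norm_triangle_ineq)
  then show ?thesis using d(2)[OF that] K(2)[of "y - x"] that V
   by (simp add: subspace_diff algebra_simps)
 qed
 show ?thesis
  unfolding continuous_within_eps_delta
 proof (intro allI impI)
  fix e :: real assume e: "e>0"
  show "EX d>0. ALL x':V. dist x' x<d-->dist (f x') (f x)<e"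
  proof (intro exI[of _ "min d (e / (K + 1))"] conjI ballI impI)
   show "0<min d (e / (K + 1))" using d K e by auto
   fix y assume y: "y:V" "dist y x<min d (e / (K + 1))"
   then have "(K + 1) * norm (y - x)<e" using K by (simp add: dist_norm pos_less_divide_eq mult.commute)
   then show "dist (f y) (f x)<e" using le[of y] y by (simp add: dist_norm)
  qed
 qed
qed

text \<open>The derivative is a limit of difference quotients, which lie in the closed subspace
  \<open>W\<close>. The chain rule needs this, since a derivative on \<open>W\<close> may only be
  applied to vectors of \<open>W\<close>.\<close>

lemma has_fderiv_range:
 assumes f: "has_fderiv V f f' x" and V: "subspace V" "x:V" "v:V" and W: "subspace W" "closed W"
  and d: "d>0" "!!y. y:V==>dist y x<d==>f y:W"
 shows "f' v:W"
proof (rule Lim_in_closed_set[OF W(2) _ at_neq_bot has_fderiv_quotient[OF f V]])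
 have nv: "norm v + 1>0" by (simp add: add_nonneg_pos)
 show "\<forall>\<^sub>F t in at 0. (f (x + t *\<^sub>R v) - f x) /\<^sub>R t:W"
  unfolding eventually_at
 proof (intro exI[of _ "d / (norm v + 1)"] conjI ballI impI)
  show "d / (norm v + 1)>0" using d nv by (intro divide_pos_pos) auto
  fix t :: real assume "t~=0&dist t 0<d / (norm v + 1)"
  then have t: "\<bar>t\<bar> * (norm v + 1)<d" using nv by (auto simp: pos_less_divide_eq)
  then have "dist (x + t *\<^sub>R v) x<d"
   by (simp add: dist_norm distrib_left)
  then show "(f (x + t *\<^sub>R v) - f x) /\<^sub>R t:W"
   using d V W by (intro subspace_scale subspace_diff) (auto simp: subspace_add subspace_scale)
 qed
qed

lemma has_fderiv_compose:
 assumes f: "has_fderiv V f f' x" and V: "subspace V" "x:V"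
  and g: "has_fderiv W g g' (f x)" and W: "subspace W" "closed W"
  and d: "d>0" "!!y. y:V==>dist y x<d==>f y:W"
 shows "has_fderiv V (%y. g (f y)) (%v. g' (f' v)) x"
 unfolding has_fderiv_iff
proof (intro conjI allI impI)
 have r: "f' v:W" if "v:V" for v using has_fderiv_range[OF f V that W d] by blast
 show "blinear_on V (%v. g' (f' v))"
  using has_fderiv_linear[OF f] has_fderiv_linear[OF g] r by (rule blinear_on_compose)
 obtain K where K: "K>0" "!!v. v:V==>norm (f' v)<=K * norm v"
  using blinear_on_bound[OF has_fderiv_linear[OF f]] by metis
 obtain L where L: "L>0" "!!v. v:W==>norm (g' v)<=L * norm v"
  using blinear_on_bound[OF has_fderiv_linear[OF g]] by metis
 fix e :: real assume e: "e>0"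
 \<comment> \<open>The cap 1 in \<open>e1\<close> gives \<open>f\<close> the Lipschitz constant
   \<open>K + 1\<close> at \<open>x\<close>. Beyond that \<open>e1\<close> controls the error of
   \<open>f\<close> after application of \<open>g'\<close>, and \<open>e2\<close> the error of
   \<open>g\<close>; each contributes half of \<open>e\<close>.\<close>
 define e1 where "e1=min 1 (e / (2 * L))"
 define e2 where "e2=e / (2 * (K + 1))"
 have e1: "e1>0" and e2: "e2>0" using e L K by (auto simp: e1_def e2_def)
 obtain d1 where d1: "d1>0" "!!y. y:V==>dist y x<d1==>norm (f y - f x - f' (y - x))<=e1 * norm (y - x)"
  using has_fderivD[OF f e1] by metis
 obtain d2 where d2: "d2>0" "!!z. z:W==>dist z (f x)<d2==>norm (g z - g (f x) - g' (z - f x))<=e2 * norm (z - f x)"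
  using has_fderivD[OF g e2] by metis
 show "EX d>0. ALL y:V. dist y x<d-->norm (g (f y) - g (f x) - g' (f' (y - x)))<=e * norm (y - x)"
 proof (intro exI[of _ "min d (min d1 (d2 / (K + 1)))"] conjI ballI impI)
  show "0<min d (min d1 (d2 / (K + 1)))" using d d1 d2 K by auto
  fix y assume y: "y:V" "dist y x<min d (min d1 (d2 / (K + 1)))"
  have yx: "y - x:V" using y V by (simp add: subspace_diff)
  have fW: "f y:W" "f x:W" using d y V by auto
  have fd: "norm (f y - f x - f' (y - x))<=e1 * norm (y - x)" using d1(2) y by auto
  have "norm (f y - f x)<=norm (f y - f x - f' (y - x)) + norm (f' (y - x))"
   by (metis diff_add_cancel norm_triangle_ineq)
  also have "...<=1 * norm (y - x) + K * norm (y - x)"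
   using fd K(2)[OF yx] mult_right_mono[of e1 1 "norm (y - x)"] by (auto simp: e1_def)
  finally have fl: "norm (f y - f x)<=(K + 1) * norm (y - x)" by (simp add: algebra_simps)
  have "(K + 1) * norm (y - x)<d2" using y K by (simp add: dist_norm pos_less_divide_eq mult.commute)
  then have "norm (g (f y) - g (f x) - g' (f y - f x))<=e2 * norm (f y - f x)"
   using d2(2)[OF fW(1)] fl by (simp add: dist_norm)
  also have "...<=e2 * ((K + 1) * norm (y - x))" using fl e2 by (intro mult_left_mono) auto
  also have "...=e / 2 * norm (y - x)" using K by (simp add: e2_def field_simps)
  finally have A: "norm (g (f y) - g (f x) - g' (f y - f x))<=e / 2 * norm (y - x)" .
  have "g' (f y - f x) - g' (f' (y - x))=g' (f y - f x - f' (y - x))"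
   using blinear_on_diff[OF has_fderiv_linear[OF g] W(1)] fW r[OF yx] W by (simp add: subspace_diff)
  moreover have "f y - f x - f' (y - x):W" using fW r[OF yx] W by (simp add: subspace_diff)
  ultimately have "norm (g' (f y - f x) - g' (f' (y - x)))<=L * (e1 * norm (y - x))"
   using L(2)[of "f y - f x - f' (y - x)"] fd L(1) by (smt (verit) mult_left_mono)
  also have "...<=L * (e / (2 * L) * norm (y - x))"
   using L e by (intro mult_left_mono mult_right_mono) (auto simp: e1_def)
  also have "...=e / 2 * norm (y - x)" using L by simp
  finally have B: "norm (g' (f y - f x) - g' (f' (y - x)))<=e / 2 * norm (y - x)" .
  have "g (f y) - g (f x) - g' (f' (y - x)) =
    (g (f y) - g (f x) - g' (f y - f x)) + (g' (f y - f x) - g' (f' (y - x)))" by simp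
  then have "norm (g (f y) - g (f x) - g' (f' (y - x)))<=e / 2 * norm (y - x) + e / 2 * norm (y - x)"
   using A B by (metis add_mono norm_triangle_mono)
  then show "norm (g (f y) - g (f x) - g' (f' (y - x)))<=e * norm (y - x)" by (simp add: algebra_simps)
 qed
qed

lemma has_fderiv_bounded_linear:
 assumes f: "has_fderiv V f f' x" and L: "bounded_linear L"
 shows "has_fderiv V (%y. L (f y)) (%v. L (f' v)) x"
 unfolding has_fderiv_iff
proof (intro conjI allI impI)
 show "blinear_on V (%v. L (f' v))"
  using has_fderiv_linear[OF f] bounded_linear_imp_on[OF L, of UNIV] by (rule blinear_on_compose) auto
 obtain K where K: "K>0" "!!v. norm (L v)<=norm v * K" using bounded_linear.pos_bounded[OF L] by auto
 fix e :: real assume "e>0"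
 then have "e / K>0" using K by simp
 then obtain d where d: "d>0" "!!y. y:V==>dist y x<d==>norm (f y - f x - f' (y - x))<=e / K * norm (y - x)"
  using has_fderivD[OF f] by metis
 have "norm (L (f y) - L (f x) - L (f' (y - x)))<=e * norm (y - x)" if "y:V" "dist y x<d" for y
 proof -
  have "norm (L (f y - f x - f' (y - x)))<=(e / K * norm (y - x)) * K"
   using d(2)[OF that] K by (smt (verit) mult_right_mono)
  then show ?thesis using K by (simp add: linear_simps[OF L])
 qed
 then show "EX d>0. ALL y:V. dist y x<d-->norm (L (f y) - L (f x) - L (f' (y - x)))<=e * norm (y - x)"
  using d(1) by blast
qed

text \<open>Along a line the derivative becomes that of an ordinary curve, the form in which the
  mean value inequality is available.\<close>

lemma has_fderiv_line:
 assumes f: "has_fderiv V f f' (x + t *\<^sub>R v)" and V: "subspace V" "x:V" "v:V"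
 shows "((%s. f (x + s *\<^sub>R v)) has_vector_derivative f' v) (at t)"
 unfolding has_vector_derivative_def has_derivative_at_alt
proof (intro conjI allI impI)
 show "bounded_linear (%h. h *\<^sub>R f' v)" by (rule bounded_linear_scaleR_left)
 fix e :: real assume e: "e>0"
 have nv: "norm v + 1>0" by (simp add: add_nonneg_pos)
 have "e / (norm v + 1)>0" using e nv by simp
 then obtain d where d: "d>0" "!!y. y:V==>dist y (x + t *\<^sub>R v)<d ==>
   norm (f y - f (x + t *\<^sub>R v) - f' (y - (x + t *\<^sub>R v)))<=e / (norm v + 1) * norm (y - (x + t *\<^sub>R v))"
  using has_fderivD[OF f] by metis
 show "EX d>0. ALL y. norm (y - t)<d -->
   norm (f (x + y *\<^sub>R v) - f (x + t *\<^sub>R v) - (y - t) *\<^sub>R f' v)<=e * norm (y - t)"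
 proof (intro exI[of _ "d / (norm v + 1)"] conjI allI impI)
  show "d / (norm v + 1)>0" using d nv by simp
  fix s assume s: "norm (s - t)<d / (norm v + 1)"
  have sv: "x + s *\<^sub>R v - (x + t *\<^sub>R v)=(s - t) *\<^sub>R v" by (simp add: algebra_simps)
  have "norm ((s - t) *\<^sub>R v)<=\<bar>s - t\<bar> * (norm v + 1)" by (simp add: distrib_left)
  moreover have "\<bar>s - t\<bar> * (norm v + 1)<d" using s nv by (simp add: pos_less_divide_eq)
  ultimately have "dist (x + s *\<^sub>R v) (x + t *\<^sub>R v)<d" unfolding dist_norm sv by linarith
  moreover have "x + s *\<^sub>R v:V" using V by (simp add: subspace_add subspace_scale)
  ultimately have "norm (f (x + s *\<^sub>R v) - f (x + t *\<^sub>R v) - f' ((s - t) *\<^sub>R v))<=e / (norm v + 1) * norm ((s - t) *\<^sub>R v)"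
   using d(2)[of "x + s *\<^sub>R v"] by (simp only: sv)
  also have "...<=e / (norm v + 1) * (\<bar>s - t\<bar> * (norm v + 1))"
   using e nv by (intro mult_left_mono) (simp_all add: distrib_left)
  also have "...=e * norm (s - t)" using nv by simp
  also have "f' ((s - t) *\<^sub>R v)=(s - t) *\<^sub>R f' v"
   using blinear_on_scale[OF has_fderiv_linear[OF f] V(3)] .
  finally show "norm (f (x + s *\<^sub>R v) - f (x + t *\<^sub>R v) - (s - t) *\<^sub>R f' v)<=e * norm (s - t)" .
 qed
qed

subsection \<open>Continuously differentiable maps\<close>

definition C1_on :: "'a::real_normed_vector set=>'a set=>('a=>'b::real_normed_vector)=>('a=>'a=>'b)=>bool" where
 "C1_on V S f f'\<longleftrightarrow>(ALL x:S. has_fderiv V f (f' x) x) &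
   (ALL x:S. ALL e>0. EX d>0. ALL y:S. dist y x<d-->(ALL v:V. norm (f' y v - f' x v)<=e * norm v))"


lemma openin_top_of_set_ball:
 "openin (top_of_set V) S\<longleftrightarrow>S<=V&(ALL x:S. EX d>0. ALL y:V. dist y x<d-->y:S)"
 by (meson openin_euclidean_subtopology_iff)

lemma C1_on_subset:
 assumes "C1_on V S f f'" "W<=V" "T<=S" shows "C1_on W T f f'"
 using assms unfolding C1_on_def by (meson has_fderiv_subset subsetD)

lemma C1_on_cong:
 assumes "C1_on V S f f'" "subspace V" "openin (top_of_set V) S" "!!x. x:S==>f x=g x"
 shows "C1_on V S g f'"
 unfolding C1_on_def
proof (intro conjI ballI)
 fix x assume x: "x:S"
 then obtain d where d: "d>0" "!!y. y:V==>dist y x<d==>y:S" "x:V"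
  using assms(3) unfolding openin_top_of_set_ball by (meson subsetD)
 have f: "has_fderiv V f (f' x) x" using assms(1) x by (simp add: C1_on_def)
 show "has_fderiv V g (f' x) x"
  by (rule has_fderiv_cong[OF f refl assms(2) d(3,1)]) (use d(2) assms(4) in blast)
qed (use assms(1) in \<open>auto simp: C1_on_def\<close>)

lemma C1_on_bounded_linear:
 assumes f: "C1_on V S f f'" and L: "bounded_linear L"
 shows "C1_on V S (%x. L (f x)) (%x v. L (f' x v))"
 unfolding C1_on_def
proof (intro conjI ballI allI impI)
 fix x assume x: "x:S"
 then have "has_fderiv V f (f' x) x" using f by (simp add: C1_on_def)
 then show "has_fderiv V (%x. L (f x)) (%v. L (f' x v)) x" using L by (rule has_fderiv_bounded_linear)
 obtain K where K: "K>0" "!!v. norm (L v)<=norm v * K" using bounded_linear.pos_bounded[OF L] by auto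
 fix e :: real assume "e>0"
 then have "e / K>0" using K by simp
 then obtain d where d: "d>0" "ALL y:S. dist y x<d-->(ALL v:V. norm (f' y v - f' x v)<=e / K * norm v)"
  using f x unfolding C1_on_def by blast
 have "norm (L (f' y v) - L (f' x v))<=e * norm v" if "y:S" "dist y x<d" "v:V" for y v
 proof -
  have "norm (L (f' y v - f' x v))<=(e / K * norm v) * K"
   using d(2) that K by (smt (verit) mult_right_mono)
  then show ?thesis using K by (simp add: linear_simps[OF L])
 qed
 then show "EX d>0. ALL y:S. dist y x<d-->(ALL v:V. norm (L (f' y v) - L (f' x v))<=e * norm v)"
  using d(1) by blast
qed

lemma C1_on_continuous_on:
 assumes "C1_on V S f f'" "subspace V" "S<=V" shows "continuous_on S f"
 using assms has_fderiv_continuous[of V f _ _] unfolding C1_on_def continuous_on_eq_continuous_within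
 by (meson continuous_within_subset subsetD)

text \<open>The mean value inequality on segments upgrades differentiability to strict differentiability.\<close>

lemma C1_on_strict:
 assumes f: "C1_on V S f f'" and V: "subspace V" and S: "openin (top_of_set V) S" and x: "x:S" and e: "e>0"
 obtains d where "d>0" "!!y. y:V==>dist y x<d==>y:S"
  "!!y z. y:V==>dist y x<d==>z:V==>dist z x<d==>norm (f y - f z - f' x (y - z))<=e * norm (y - z)"
proof -
 have xV: "x:V" using S x by (auto simp: openin_top_of_set_ball)
 obtain d1 where d1: "d1>0" "!!y. y:V==>dist y x<d1==>y:S"
  using S x unfolding openin_top_of_set_ball by meson
 obtain d2 where d2: "d2>0" "!!y v. y:S==>dist y x<d2==>v:V==>norm (f' y v - f' x v)<=e * norm v"
  using f x e unfolding C1_on_def by meson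
 define d where "d=min d1 d2"
 have "norm (f y - f z - f' x (y - z))<=e * norm (y - z)"
  if y: "y:V" "dist y x<d" and z: "z:V" "dist z x<d" for y z
 proof -
  define v where "v=y - z"
  have v: "v:V" using y z V by (simp add: v_def subspace_diff)
  \<comment> \<open>Subtracting the path with constant slope \<open>f' x v\<close> leaves a curve
    whose derivative has norm at most \<open>e * norm v\<close>; its total increment is exactly the
    remainder to be estimated.\<close>
  define h where "h=(%t::real. f (z + t *\<^sub>R v) - t *\<^sub>R f' x v)"
  have inb: "z + t *\<^sub>R v:S&dist (z + t *\<^sub>R v) x<d2" if t: "t:{0..1}" for t
  proof -
   have "z + t *\<^sub>R v=(1 - t) *\<^sub>R z + t *\<^sub>R y" by (simp add: v_def algebra_simps)
   moreover have "(1 - t) *\<^sub>R z + t *\<^sub>R y:ball x d"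
    using t y z by (intro convexD) (auto simp: dist_commute)
   ultimately have "dist (z + t *\<^sub>R v) x<d" by (simp add: dist_commute)
   moreover have "z + t *\<^sub>R v:V" using z v V by (simp add: subspace_add subspace_scale)
   ultimately show ?thesis using d1 by (auto simp: d_def)
  qed
  have der: "(h has_derivative (%s. s *\<^sub>R (f' (z + t *\<^sub>R v) v - f' x v))) (at t within {0..1})" if t: "t:{0..1}" for t
  proof -
   have "has_fderiv V f (f' (z + t *\<^sub>R v)) (z + t *\<^sub>R v)" using f inb[OF t] by (auto simp: C1_on_def)
   from has_fderiv_line[OF this V z(1) v]
   have "(h has_vector_derivative (f' (z + t *\<^sub>R v) v - f' x v)) (at t)"
    unfolding h_def by (auto intro!: derivative_eq_intros)
   then show ?thesis by (simp add: has_vector_derivative_def has_derivative_at_withinI)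
  qed
  have bnd: "onorm (%s. s *\<^sub>R (f' (z + t *\<^sub>R v) v - f' x v))<=e * norm v" if t: "t:{0..1}" for t
   using d2(2)[of "z + t *\<^sub>R v" v] inb[OF t] v
   by (intro onorm_le) (simp add: mult.commute mult_left_mono)
  have "norm (h 1 - h 0)<=e * norm v * norm (1 - 0 :: real)"
   by (rule differentiable_bound[OF _ der bnd]) auto
  then show ?thesis by (simp add: h_def v_def algebra_simps)
 qed
 then show ?thesis using d1 d2 by (intro that[of d]) (auto simp: d_def)
qed

lemma Ck_on_imp_C1:
 assumes f: "Ck_on k V S f" and k: "1<=k" and V: "subspace V" and S: "openin (top_of_set V) S"
 obtains f' where "C1_on V S f f'"
proof -
 obtain D where D: "ALL x:S. ALL vs:tuples V 0. D 0 x vs=f x"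
  "ALL j. enat j<=k-->(ALL x:S. bounded_multilinear_on V (j + 0) (D j x))"
  "ALL j. enat j<=k-->(ALL x:S. ALL e>0. \<forall>\<^sub>F y in at x within S.
    form_norm_le V (j + 0) (%vs. D j y vs - D j x vs) e)"
  "ALL j. enat j<k-->(ALL x:S. ALL e>0. \<forall>\<^sub>F y in at x within S.
    form_norm_le V (j + 0) (%vs. D j y vs - D j x vs - D (Suc j) x ((y - x) # vs)) (e * norm (y - x)))"
  using f unfolding Ck_on_def Ck_forms_def by (elim exE conjE) (rule that, assumption+)
 note D0=D(1)[rule_format] and Db=D(2)[rule_format] and Dc=D(3)[rule_format] and Dd=D(4)[rule_format]
 have k1: "enat 1<=k" using k by (simp add: one_enat_def)
 have k0: "enat 0<k" using k by (cases k) (auto simp: one_enat_def)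
 define f' where "f'=(%x v. D 1 x [v])"
 have t1: "[v]:tuples V 1" if "v:V" for v using that by (auto simp: tuples_def)
 have t0: "[]:tuples V 0" by (auto simp: tuples_def)
 have "C1_on V S f f'"
  unfolding C1_on_def
 proof (intro conjI ballI allI impI)
  fix x assume x: "x:S"
  have B: "bounded_multilinear_on V 1 (D 1 x)" using Db[OF k1 x] by simp
  show "has_fderiv V f (f' x) x"
   unfolding has_fderiv_iff
  proof (intro conjI allI impI)
   have lin: "D 1 x [a *\<^sub>R u + v]=a *\<^sub>R D 1 x [u] + D 1 x [v]" if "u:V" "v:V" for a u v
    using B[unfolded bounded_multilinear_on_def, THEN conjunct1, rule_format, OF t1[OF that(1)], of 0 u v a] that by simp
   have z: "D 1 x [0]=0" using lin[of 0 0 1] V by (simp add: subspace_0)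
   obtain b where b: "!!v. v:V==>norm (D 1 x [v])<=b * norm v"
    using B t1 unfolding bounded_multilinear_on_def form_norm_le_def by fastforce
   show "blinear_on V (f' x)"
    unfolding blinear_on_def f'_def
    using lin[of _ _ 1] lin[of _ 0] z V b by (auto simp: subspace_0 intro: exI[of _ b])
   fix e :: real assume e: "e>0"
   obtain d where d0: "d>0" "!!y. y:S==>y~=x==>dist y x<d ==>
     form_norm_le V 0 (%vs. D 0 y vs - D 0 x vs - D 1 x ((y - x) # vs)) (e * norm (y - x))"
    using Dd[OF k0 x e] unfolding eventually_at by auto
   have d: "d>0" "!!y. y:S==>y~=x==>dist y x<d==>norm (f y - f x - f' x (y - x))<=e * norm (y - x)"
    using d0(1) d0(2)[unfolded form_norm_le_def, rule_format, OF _ _ _ t0] D0[OF _ t0] x by (auto simp: f'_def)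
   obtain d1 where d1: "d1>0" "!!y. y:V==>dist y x<d1==>y:S"
    using S x unfolding openin_top_of_set_ball by meson
   show "EX d>0. ALL y:V. dist y x<d-->norm (f y - f x - f' x (y - x))<=e * norm (y - x)"
   proof (intro exI[of _ "min d d1"] conjI ballI impI)
    fix y assume "y:V" "dist y x<min d d1"
    then show "norm (f y - f x - f' x (y - x))<=e * norm (y - x)"
     using d d1 z by (cases "y=x") (auto simp: f'_def)
   qed (use d d1 in auto)
  qed
 next
  fix x and e :: real assume x: "x:S" and e: "e>0"
  obtain d where d: "d>0" "!!y. y:S==>y~=x==>dist y x<d==>form_norm_le V 1 (%vs. D 1 y vs - D 1 x vs) e"
   using Dc[OF k1 x e] unfolding eventually_at by auto
  show "EX d>0. ALL y:S. dist y x<d-->(ALL v:V. norm (f' y v - f' x v)<=e * norm v)"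
  proof (intro exI[of _ d] conjI ballI impI)
   fix y v assume "y:S" "dist y x<d" "v:V"
   then show "norm (f' y v - f' x v)<=e * norm v"
    using d(2)[of y] t1[of v] e by (cases "y=x") (auto simp: f'_def form_norm_le_def)
  qed (use d in auto)
 qed
 then show ?thesis by (rule that)
qed

section \<open>Smooth maps: composition and inversion\<close>

text \<open>
  Multilinear maps whose slots range over different subspaces. Writing \<open>V\<close> for the space in which
  the base point varies, a family of such forms that is closed under derivatives consists of
  smooth maps; the families below are generated from given forms by inserting one form into the
  first slot of another, by permuting arguments and by sums.
\<close>

definition tup :: "'a set list=>'a list set" where
 "tup Vs={vs. list_all2 (%v V. v:V) vs Vs}"

definition form_le :: "'a::real_normed_vector set list=>('a list=>'b::real_normed_vector)=>real=>bool" where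
 "form_le Vs T b\<longleftrightarrow>(ALL vs:tup Vs. norm (T vs)<=b * prod_list (map norm vs))"

definition mlin :: "'a::real_normed_vector set list=>'b::real_normed_vector set=>('a list=>'b)=>bool" where
 "mlin Vs U T\<longleftrightarrow>(ALL vs:tup Vs. T vs:U) &
   (ALL vs:tup Vs. ALL i<length Vs. ALL u:Vs ! i. ALL v:Vs ! i. ALL a.
    T (vs[i := a *\<^sub>R u + v])=a *\<^sub>R T (vs[i := u]) + T (vs[i := v])) &
   (EX b>=0. form_le Vs T b)"

text \<open>The direction is the first argument of \<open>T'\<close>. Continuity of
  \<open>T'\<close> is not demanded: in a tower of derivatives it follows from differentiability of
  the next level, see \<open>fdiff_Lipschitz\<close>.\<close>

definition fdiff ::
 "'a::real_normed_vector set=>'a set=>'a set list=>'b::real_normed_vector set =>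
   ('a=>'a list=>'b)=>('a=>'a list=>'b)=>bool" where
 "fdiff V S Vs U T T'\<longleftrightarrow>(ALL x:S. mlin Vs U (T x)&mlin (V # Vs) U (T' x) &
   (ALL e>0. EX d>0. ALL y:S. dist y x<d -->
    form_le Vs (%vs. T y vs - T x vs - T' x ((y - x) # vs)) (e * norm (y - x))))"

section \<open>Argument tuples, operator bounds and the operations on forms\<close>

lemma tup_Nil [simp]: "tup []={[]}"
 by (auto simp: tup_def)

lemma tup_Cons [simp]: "v # vs:tup (V # Vs)\<longleftrightarrow>v:V&vs:tup Vs"
 by (auto simp: tup_def)

lemma tup_Cons_E:
 assumes "ws:tup (V # Vs)" obtains v vs where "ws=v # vs" "v:V" "vs:tup Vs"
 using assms by (auto simp: tup_def list_all2_Cons2)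

lemma tup_append_E:
 assumes "ws:tup (Us @ Vs)" obtains us vs where "ws=us @ vs" "us:tup Us" "vs:tup Vs"
 using assms by (auto simp: tup_def list_all2_append2)

lemma tup_length: "vs:tup Vs==>length vs=length Vs"
 by (auto simp: tup_def list_all2_lengthD)

lemma tup_update: "vs:tup Vs==>u:Vs ! i==>vs[i := u]:tup Vs"
 by (cases "i<length vs") (auto simp: tup_def list_all2_conv_all_nth nth_list_update)

lemma tup_replicate: "tup (replicate n V)=tuples V n"
 by (auto simp: tup_def tuples_def list_all2_conv_all_nth in_set_conv_nth subset_iff)

lemma prod_list_norm_nonneg: "0<=prod_list (map norm vs)"
 by (induction vs) auto

lemma form_leD: "form_le Vs T b==>vs:tup Vs==>norm (T vs)<=b * prod_list (map norm vs)"
 by (auto simp: form_le_def)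

lemma form_le_mono: "form_le Vs T b==>b<=c==>form_le Vs T c"
 unfolding form_le_def by (meson mult_right_mono order_trans prod_list_norm_nonneg)

lemma mlin_range: "mlin Vs U T==>vs:tup Vs==>T vs:U"
 and mlin_update: "mlin Vs U T==>vs:tup Vs==>i<length Vs==>u:Vs ! i==>v:Vs ! i ==>
  T (vs[i := a *\<^sub>R u + v])=a *\<^sub>R T (vs[i := u]) + T (vs[i := v])"
 and mlin_bound: "mlin Vs U T==>EX b>=0. form_le Vs T b"
 by (auto simp: mlin_def)

lemma mlin_Cons:
 assumes "mlin (V # Vs) U T" "u:V" "v:V" "vs:tup Vs"
 shows "T ((a *\<^sub>R u + v) # vs)=a *\<^sub>R T (u # vs) + T (v # vs)"
 using mlin_update[OF assms(1), of "u # vs" 0 u v a] assms by simp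

lemma mlin_Cons_diff:
 assumes "mlin (V # Vs) U T" "u:V" "v:V" "vs:tup Vs"
 shows "T ((u - v) # vs)=T (u # vs) - T (v # vs)"
 using mlin_Cons[OF assms(1,3,2,4), of "-1"] by simp

inductive gen :: "('a::real_normed_vector set list \<times> 'a set \<times> ('a=>'a list=>'a)) set =>
  'a set list=>'a set=>('a=>'a list=>'a)=>bool" for B where
 base: "(Vs, U, T):B==>gen B Vs U T"
| add: "gen B Vs U T1==>gen B Vs U T2==>gen B Vs U (%x vs. T1 x vs + T2 x vs)"
| neg: "gen B Vs U T==>gen B Vs U (%x vs. - T x vs)"
| perm: "gen B Vs U T==>distinct js==>set js={..<length Ws}==>Vs=map ((!) Ws) js ==>
  gen B Ws U (%x ws. T x (map ((!) ws) js))"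
| plug: "gen B (W # Vs) U T==>gen B Us W A==>n=length Us ==>
  gen B (Us @ Vs) U (%x ws. T x (A x (take n ws) # drop n ws))"

lemma perm_tup:
 assumes js: "distinct js" "set js={..<length Ws}" and ws: "ws:tup Ws"
 shows "map ((!) ws) js:tup (map ((!) Ws) js)"
  and "prod_list (map norm (map ((!) ws) js))=prod_list (map norm ws)"
proof -
 show "map ((!) ws) js:tup (map ((!) Ws) js)"
  using js ws unfolding tup_def by (auto simp: list_all2_conv_all_nth) (metis lessThan_iff nth_mem)
 have "prod_list (map norm (map ((!) ws) js))=(\<Prod>j\<in>set js. norm (ws ! j))"
  using js(1) by (simp add: prod.distinct_set_conv_list comp_def)
 also have "...=(\<Prod>j<length ws. norm (ws ! j))" using js(2) tup_length[OF ws] by simp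
 also have "...=prod_list (map norm ws)"
  by (simp add: prod.list_conv_set_nth atLeast0LessThan)
 finally show "prod_list (map norm (map ((!) ws) js))=prod_list (map norm ws)" .
qed

lemma form_le_perm:
 assumes "distinct js" "set js={..<length Ws}" "form_le (map ((!) Ws) js) T b"
 shows "form_le Ws (%ws. T (map ((!) ws) js)) b"
 unfolding form_le_def
proof
 fix ws assume ws: "ws:tup Ws"
 show "norm (T (map ((!) ws) js))<=b * prod_list (map norm ws)"
  using form_leD[OF assms(3) perm_tup(1)[OF assms(1,2) ws]] perm_tup(2)[OF assms(1,2) ws] by simp
qed

lemma mlin_perm:
 assumes js: "distinct js" "set js={..<length Ws}" and T: "mlin (map ((!) Ws) js) U T"
 shows "mlin Ws U (%ws. T (map ((!) ws) js))"
 unfolding mlin_def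
proof (intro conjI ballI allI impI)
 fix ws assume ws: "ws:tup Ws"
 note wsj=perm_tup(1)[OF js ws]
 show "T (map ((!) ws) js):U" using mlin_range[OF T wsj] .
 fix i u v a assume i: "i<length Ws" and u: "u:Ws ! i" and v: "v:Ws ! i"
 obtain k where k: "k<length js" "js ! k=i" using js(2) i by (metis in_set_conv_nth lessThan_iff)
 have upd: "map ((!) (ws[i := z])) js=(map ((!) ws) js)[k := z]" for z
 proof (rule nth_equalityI)
  fix m assume m: "m<length (map ((!) (ws[i := z])) js)"
  have "js ! m=i\<longleftrightarrow>m=k" using js(1) k m by (auto simp: nth_eq_iff_index_eq)
  moreover have "js ! m<length ws" using js(2) m tup_length[OF ws] by (metis length_map lessThan_iff nth_mem)
  ultimately show "map ((!) (ws[i := z])) js ! m=(map ((!) ws) js)[k := z] ! m"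
   using m k by (auto simp: nth_list_update)
 qed simp
 show "T (map ((!) (ws[i := a *\<^sub>R u + v])) js)=a *\<^sub>R T (map ((!) (ws[i := u])) js) + T (map ((!) (ws[i := v])) js)"
  unfolding upd using k u v by (intro mlin_update[OF T wsj]) auto
next
 show "EX b>=0. form_le Ws (%ws. T (map ((!) ws) js)) b"
  using mlin_bound[OF T] form_le_perm[OF js] by blast
qed

lemma form_le_plug:
 assumes T: "form_le (W # Vs) T b" "b>=0" and A: "form_le Us A c"
  and AW: "!!us. us:tup Us==>A us:W"
 shows "form_le (Us @ Vs) (%ws. T (A (take (length Us) ws) # drop (length Us) ws)) (b * c)"
 unfolding form_le_def
proof
 fix ws assume "ws:tup (Us @ Vs)"
 then obtain us vs where ws: "ws=us @ vs" "us:tup Us" "vs:tup Vs" by (rule tup_append_E)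
 have "norm (T (A us # vs))<=b * (norm (A us) * prod_list (map norm vs))"
  using form_leD[OF T(1), of "A us # vs"] AW ws by simp
 also have "...<=b * ((c * prod_list (map norm us)) * prod_list (map norm vs))"
  using form_leD[OF A ws(2)] T(2) prod_list_norm_nonneg by (intro mult_left_mono mult_right_mono)
 finally show "norm (T (A (take (length Us) ws) # drop (length Us) ws))<=b * c * prod_list (map norm ws)"
  using ws tup_length[OF ws(2)] by (simp add: mult.assoc)
qed

lemma mlin_plug:
 assumes T: "mlin (W # Vs) U T" and A: "mlin Us W A"
 shows "mlin (Us @ Vs) U (%ws. T (A (take (length Us) ws) # drop (length Us) ws))"
 unfolding mlin_def
proof (intro conjI ballI allI impI)
 fix ws assume "ws:tup (Us @ Vs)"
 then obtain us vs where ws: "ws=us @ vs" "us:tup Us" "vs:tup Vs" by (rule tup_append_E)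
 note len=tup_length[OF ws(2)]
 have Aus: "A us:W" using mlin_range[OF A ws(2)] .
 show "T (A (take (length Us) ws) # drop (length Us) ws):U"
  using mlin_range[OF T, of "A us # vs"] Aus ws len by simp
 fix i u v a assume i: "i<length (Us @ Vs)" and uv: "u:(Us @ Vs) ! i" "v:(Us @ Vs) ! i"
 show "T (A (take (length Us) (ws[i := a *\<^sub>R u + v])) # drop (length Us) (ws[i := a *\<^sub>R u + v])) =
   a *\<^sub>R T (A (take (length Us) (ws[i := u])) # drop (length Us) (ws[i := u])) +
   T (A (take (length Us) (ws[i := v])) # drop (length Us) (ws[i := v]))"
 proof (cases "i<length Us")
  case True
  then have uv: "u:Us ! i" "v:Us ! i" using uv by (auto simp: nth_append)
  have upd: "take (length Us) (ws[i := z])=us[i := z]" "drop (length Us) (ws[i := z])=vs" for z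
   using ws len True by (auto simp: list_update_append)
  show ?thesis
   unfolding upd mlin_update[OF A ws(2) True uv]
   using ws(2,3) uv by (intro mlin_Cons[OF T] mlin_range[OF A] tup_update)
 next
  case False
  \<comment> \<open>Slot 0 of \<open>T\<close> holds the value of \<open>A\<close>, so slot
    \<open>i\<close> of the combined form is slot \<open>i - length Us + 1\<close> of
    \<open>T\<close>.\<close>
  then have uv: "u:(W # Vs) ! Suc (i - length Us)" "v:(W # Vs) ! Suc (i - length Us)"
   and i': "Suc (i - length Us)<length (W # Vs)" using uv i by (auto simp: nth_append)
  have upd: "take (length Us) (ws[i := z])=us"
   "drop (length Us) (ws[i := z])=vs[i - length Us := z]" for z
   using ws len False by (auto simp: list_update_append)
  show ?thesis
   unfolding upd using mlin_update[OF T _ i' uv, of "A us # vs" a] Aus ws(3) by simp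
 qed
next
 obtain b where b: "b>=0" "form_le (W # Vs) T b" using mlin_bound[OF T] by blast
 obtain c where c: "c>=0" "form_le Us A c" using mlin_bound[OF A] by blast
 show "EX b>=0. form_le (Us @ Vs) (%ws. T (A (take (length Us) ws) # drop (length Us) ws)) b"
  using form_le_plug[OF b(2,1) c(2) mlin_range[OF A]] b c by (intro exI[of _ "b * c"]) auto
qed

section \<open>Derivatives of sums, permutations and insertions of forms\<close>

lemma form_le_add: "form_le Vs T b==>form_le Vs A c==>form_le Vs (%vs. T vs + A vs) (b + c)"
 unfolding form_le_def by (metis (no_types, lifting) add_mono distrib_right norm_triangle_mono)

lemma form_le_uminus: "form_le Vs T b==>form_le Vs (%vs. - T vs) b"
 by (simp add: form_le_def)

lemma form_le_cong: "form_le Vs T b==>(!!vs. vs:tup Vs==>T vs=A vs)==>form_le Vs A b"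
 by (simp add: form_le_def)

lemma mlin_add:
 assumes "mlin Vs U T" "mlin Vs U A" "subspace U" shows "mlin Vs U (%vs. T vs + A vs)"
proof -
 obtain b c where "b>=0" "form_le Vs T b" "c>=0" "form_le Vs A c"
  using assms mlin_bound by metis
 then have "EX b>=0. form_le Vs (%vs. T vs + A vs) b"
  by (intro exI[of _ "b + c"]) (auto intro: form_le_add)
 then show ?thesis
  unfolding mlin_def using assms
  by (auto simp: mlin_update mlin_range subspace_add scaleR_add_right)
qed

lemma mlin_uminus:
 assumes "mlin Vs U T" "subspace U" shows "mlin Vs U (%vs. - T vs)"
 using mlin_bound[OF assms(1)] form_le_uminus[of Vs T] assms unfolding mlin_def
 by (auto simp: subspace_neg)

lemma fdiffE:
 assumes "fdiff V S Vs U T T'" "x:S" "e>0"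
 obtains d where "d>0" "!!y. y:S==>dist y x<d ==>
   form_le Vs (%vs. T y vs - T x vs - T' x ((y - x) # vs)) (e * norm (y - x))"
 using assms unfolding fdiff_def by blast

lemma fdiff_add:
 assumes T: "fdiff V S Vs U T T'" and A: "fdiff V S Vs U A A'" and U: "subspace U"
 shows "fdiff V S Vs U (%x vs. T x vs + A x vs) (%x vs. T' x vs + A' x vs)"
 unfolding fdiff_def
proof (intro ballI conjI allI impI)
 fix x assume x: "x:S"
 show "mlin Vs U (%vs. T x vs + A x vs)" "mlin (V # Vs) U (%vs. T' x vs + A' x vs)"
  using T A x U by (auto simp: fdiff_def intro: mlin_add)
 fix e :: real assume "e>0"
 then have e2: "e / 2>0" by simp
 obtain d1 where d1: "d1>0" "!!y. y:S==>dist y x<d1 ==>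
   form_le Vs (%vs. T y vs - T x vs - T' x ((y - x) # vs)) (e / 2 * norm (y - x))"
  using T x e2 unfolding fdiff_def by metis
 obtain d2 where d2: "d2>0" "!!y. y:S==>dist y x<d2 ==>
   form_le Vs (%vs. A y vs - A x vs - A' x ((y - x) # vs)) (e / 2 * norm (y - x))"
  using A x e2 unfolding fdiff_def by metis
 have "form_le Vs (%vs. T y vs + A y vs - (T x vs + A x vs) - (T' x ((y - x) # vs) + A' x ((y - x) # vs))) (e * norm (y - x))"
  if "y:S" "dist y x<min d1 d2" for y
  using form_le_add[OF d1(2) d2(2), of y y] that
  by (auto simp: algebra_simps elim!: form_le_cong)
 then show "EX d>0. ALL y:S. dist y x<d-->form_le Vs (%vs. T y vs + A y vs - (T x vs + A x vs) -
   (T' x ((y - x) # vs) + A' x ((y - x) # vs))) (e * norm (y - x))"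
  using d1(1) d2(1) by (intro exI[of _ "min d1 d2"]) auto
qed

lemma fdiff_uminus:
 assumes T: "fdiff V S Vs U T T'" and U: "subspace U"
 shows "fdiff V S Vs U (%x vs. - T x vs) (%x vs. - T' x vs)"
 unfolding fdiff_def
proof (intro ballI conjI allI impI)
 fix x assume x: "x:S"
 show "mlin Vs U (%vs. - T x vs)" "mlin (V # Vs) U (%vs. - T' x vs)"
  using T x U by (auto simp: fdiff_def intro: mlin_uminus)
 fix e :: real assume "e>0"
 then obtain d1 where d1: "d1>0" "!!y. y:S==>dist y x<d1 ==>
   form_le Vs (%vs. T y vs - T x vs - T' x ((y - x) # vs)) (e * norm (y - x))"
  using T x unfolding fdiff_def by metis
 have "form_le Vs (%vs. - T y vs - - T x vs - - T' x ((y - x) # vs)) (e * norm (y - x))"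
  if "y:S" "dist y x<d1" for y
  using form_le_uminus[OF d1(2)[OF that]] by (rule form_le_cong) simp
 then show "EX d>0. ALL y:S. dist y x<d-->form_le Vs (%vs. - T y vs - - T x vs - - T' x ((y - x) # vs)) (e * norm (y - x))"
  using d1(1) by blast
qed

lemma fdiff_perm:
 assumes T: "fdiff V S (map ((!) Ws) js) U T T'" and js: "distinct js" "set js={..<length Ws}"
 shows "fdiff V S Ws U (%x ws. T x (map ((!) ws) js)) (%x ws. T' x (map ((!) ws) (0 # map Suc js)))"
 unfolding fdiff_def
proof (intro ballI conjI allI impI)
 fix x assume x: "x:S"
 show "mlin Ws U (%ws. T x (map ((!) ws) js))"
  using T x by (intro mlin_perm[OF js]) (auto simp: fdiff_def)
 have 0: "V # map ((!) Ws) js=map ((!) (V # Ws)) (0 # map Suc js)" by simp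
 have js': "distinct (0 # map Suc js)" "set (0 # map Suc js)={..<length (V # Ws)}"
  using js by (auto simp: distinct_map lessThan_Suc_eq_insert_0)
 show "mlin (V # Ws) U (%ws. T' x (map ((!) ws) (0 # map Suc js)))"
 proof (rule mlin_perm[OF js'])
  have "mlin (V # map ((!) Ws) js) U (T' x)" using T x by (simp add: fdiff_def)
  then show "mlin (map ((!) (V # Ws)) (0 # map Suc js)) U (T' x)" unfolding 0 .
 qed
 fix e :: real assume e: "e>0"
 obtain d1 where d1: "d1>0" "!!y. y:S==>dist y x<d1 ==>
   form_le (map ((!) Ws) js) (%vs. T y vs - T x vs - T' x ((y - x) # vs)) (e * norm (y - x))"
  by (fact fdiffE[OF T x e])
 have "form_le Ws (%ws. T y (map ((!) ws) js) - T x (map ((!) ws) js) -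
   T' x (map ((!) ((y - x) # ws)) (0 # map Suc js))) (e * norm (y - x))"
  if "y:S" "dist y x<d1" for y
  using form_le_perm[OF js d1(2)[OF that]] by (simp add: comp_def)
 then show "EX d>0. ALL y:S. dist y x<d-->form_le Ws (%ws. T y (map ((!) ws) js) - T x (map ((!) ws) js) -
   T' x (map ((!) ((y - x) # ws)) (0 # map Suc js))) (e * norm (y - x))"
  using d1(1) by blast
qed

text \<open>The remainder with tolerance 1 plus the operator norm \<open>b\<close> of
  \<open>T' x\<close> gives the constant \<open>1 + b\<close>. This yields continuity of each level
  of a tower from the existence of the next one.\<close>

lemma fdiff_Lipschitz:
 assumes T: "fdiff V S Vs U T T'" and x: "x:S" and SV: "S<=V" "subspace V"
 obtains K d where "K>0" "d>0" "!!y. y:S==>dist y x<d==>form_le Vs (%vs. T y vs - T x vs) (K * norm (y - x))"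
proof -
 obtain b where b: "b>=0" "form_le (V # Vs) (T' x) b" using T x mlin_bound unfolding fdiff_def by metis
 obtain d where d: "d>0" "!!y. y:S==>dist y x<d ==>
   form_le Vs (%vs. T y vs - T x vs - T' x ((y - x) # vs)) (1 * norm (y - x))"
  using T x zero_less_one unfolding fdiff_def by metis
 have "form_le Vs (%vs. T y vs - T x vs) ((1 + b) * norm (y - x))" if y: "y:S" "dist y x<d" for y
 proof -
  have "form_le Vs (%vs. T' x ((y - x) # vs)) (b * norm (y - x))"
   unfolding form_le_def
  proof
   fix vs assume "vs:tup Vs"
   moreover have "y - x:V" using y x SV by (blast intro: subspace_diff)
   ultimately show "norm (T' x ((y - x) # vs))<=b * norm (y - x) * prod_list (map norm vs)"
    using form_leD[OF b(2), of "(y - x) # vs"] by (simp add: mult.assoc)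
  qed
  from form_le_add[OF d(2)[OF y] this] show ?thesis by (simp add: distrib_right)
 qed
 then show ?thesis using b d by (intro that[of "1 + b" d]) auto
qed


lemma map_nth_middle: "map ((!) (us @ vs @ ws)) [length us..<length us + length vs]=vs"
 by (rule nth_equalityI) (auto simp: nth_append)

lemma swap_first_two: "map ((!) (w # h # vs)) (1 # 0 # [2..<2 + length vs])=h # w # vs"
 using map_nth_middle[of "[w, h]" vs "[]"] by (simp add: numeral_2_eq_2 del: upt_Suc)

lemma move_first: "map ((!) (h # us @ vs)) ([1..<Suc (length us)] @ [0] @ [Suc (length us)..<Suc (length us) + length vs])=us @ h # vs"
 using map_nth_middle[of "[h]" us vs] map_nth_middle[of "h # us" vs "[]"] by (simp del: upt_Suc)

text \<open>The Leibniz rule, spelled only with the operations of \<open>gen\<close>. The direction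
  is the first argument of the whole form; for the summand with \<open>T'\<close> the outer index
  list moves it behind the arguments of \<open>A\<close>, and the inner one exchanges it with the
  value of \<open>A\<close>, because \<open>T'\<close> expects the direction first. The readable
  form is \<open>plug_deriv_eq\<close>.\<close>

definition plug_deriv ::
 "nat=>nat=>('a=>'a list=>'b::real_normed_vector)=>('a=>'a list=>'b) =>
   ('a=>'a list=>'a)=>('a=>'a list=>'a)=>'a=>'a list=>'b" where
 "plug_deriv n m T T' A A'=(%x ws.
   (%us. (%vs. T' x (map ((!) vs) (1 # 0 # [2..<2 + m]))) (A x (take n us) # drop n us))
    (map ((!) ws) ([1..<Suc n] @ [0] @ [Suc n..<Suc n + m]))
   + T x (A' x (take (Suc n) ws) # drop (Suc n) ws))"

lemma plug_deriv_eq: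
 "plug_deriv (length us) (length vs) T T' A A' x (h # us @ vs)=T' x (h # A x us # vs) + T x (A' x (h # us) # vs)"
 unfolding plug_deriv_def move_first using swap_first_two[of "A x us" h vs] by simp

lemma swap_first_two_index:
 "distinct (1 # 0 # [2..<2 + length Vs])" "set (1 # 0 # [2..<2 + length Vs])={..<length (W # V # Vs)}"
 "V # W # Vs=map ((!) (W # V # Vs)) (1 # 0 # [2..<2 + length Vs])"
 by (simp_all only: swap_first_two) auto

lemma move_first_index:
 "distinct ([1..<Suc (length Us)] @ [0] @ [Suc (length Us)..<Suc (length Us) + length Vs])"
 "set ([1..<Suc (length Us)] @ [0] @ [Suc (length Us)..<Suc (length Us) + length Vs])={..<length (V # Us @ Vs)}"
 "Us @ V # Vs=map ((!) (V # Us @ Vs)) ([1..<Suc (length Us)] @ [0] @ [Suc (length Us)..<Suc (length Us) + length Vs])"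
 by (simp_all only: move_first) auto

lemma mlin_plug_deriv:
 assumes T: "mlin (W # Vs) U (T x)" "mlin (V # W # Vs) U (T' x)"
  and A: "mlin Us W (A x)" "mlin (V # Us) W (A' x)" and U: "subspace U"
 shows "mlin (V # Us @ Vs) U (plug_deriv (length Us) (length Vs) T T' A A' x)"
 unfolding plug_deriv_def
proof (rule mlin_add[OF _ _ U])
 show "mlin (V # Us @ Vs) U (%ws. T x (A' x (take (Suc (length Us)) ws) # drop (Suc (length Us)) ws))"
  using mlin_plug[OF T(1) A(2)] by simp
 show "mlin (V # Us @ Vs) U (%ws. (%us. (%vs. T' x (map ((!) vs) (1 # 0 # [2..<2 + length Vs])))
   (A x (take (length Us) us) # drop (length Us) us))
    (map ((!) ws) ([1..<Suc (length Us)] @ [0] @ [Suc (length Us)..<Suc (length Us) + length Vs])))"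
  by (rule mlin_perm[OF move_first_index(1,2)], unfold move_first_index(3)[symmetric],
    rule mlin_plug[OF _ A(1)], rule mlin_perm[OF swap_first_two_index(1,2)],
    unfold swap_first_two_index(3)[symmetric], rule T(2))
qed

lemma gen_plug_deriv:
 assumes T: "gen B (W # Vs) U T" "gen B (V # W # Vs) U T'" and A: "gen B Us W A" "gen B (V # Us) W A'"
 shows "gen B (V # Us @ Vs) U (plug_deriv (length Us) (length Vs) T T' A A')"
 unfolding plug_deriv_def
proof (rule gen.add)
 show "gen B (V # Us @ Vs) U (%x ws. T x (A' x (take (Suc (length Us)) ws) # drop (Suc (length Us)) ws))"
  using gen.plug[OF T(1) A(2)] by simp
 have "gen B (W # V # Vs) U (%x vs. T' x (map ((!) vs) (1 # 0 # [2..<2 + length Vs])))"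
  by (rule gen.perm[OF T(2) swap_first_two_index])
 from gen.plug[OF this A(1) refl]
 show "gen B (V # Us @ Vs) U (%x ws. (%us. (%vs. T' x (map ((!) vs) (1 # 0 # [2..<2 + length Vs])))
   (A x (take (length Us) us) # drop (length Us) us))
    (map ((!) ws) ([1..<Suc (length Us)] @ [0] @ [Suc (length Us)..<Suc (length Us) + length Vs])))"
  by (rule gen.perm[OF _ move_first_index])
qed

lemma fdiff_plug:
 assumes T: "fdiff V S (W # Vs) U T T'" and A: "fdiff V S Us W A A'"
  and UW: "subspace U" "subspace W" and SV: "S<=V" "subspace V"
 shows "fdiff V S (Us @ Vs) U (%x ws. T x (A x (take (length Us) ws) # drop (length Us) ws))
  (plug_deriv (length Us) (length Vs) T T' A A')"
 unfolding fdiff_def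
proof (intro ballI conjI allI impI)
 fix x assume x: "x:S"
 have m: "mlin (W # Vs) U (T x)" "mlin (V # W # Vs) U (T' x)" "mlin Us W (A x)" "mlin (V # Us) W (A' x)"
  using T A x by (auto simp: fdiff_def)
 show "mlin (Us @ Vs) U (%ws. T x (A x (take (length Us) ws) # drop (length Us) ws))"
  by (rule mlin_plug[OF m(1,3)])
 show "mlin (V # Us @ Vs) U (plug_deriv (length Us) (length Vs) T T' A A' x)"
  by (rule mlin_plug_deriv[where T=T and T'=T' and A=A and A'=A', OF m UW(1)])
 obtain bT where bT: "bT>=0" "form_le (W # Vs) (T x) bT" using mlin_bound[OF m(1)] by blast
 obtain bT' where bT': "bT'>=0" "form_le (V # W # Vs) (T' x) bT'" using mlin_bound[OF m(2)] by blast
 obtain bA where bA: "bA>=0" "form_le Us (A x) bA" using mlin_bound[OF m(3)] by blast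
 obtain K dA where K: "K>0" "dA>0" "!!y. y:S==>dist y x<dA==>form_le Us (%vs. A y vs - A x vs) (K * norm (y - x))"
  by (fact fdiff_Lipschitz[OF A x SV])
 fix e :: real assume e: "e>0"
 \<comment> \<open>The remainder splits into the remainder of \<open>T\<close> evaluated at
   \<open>A y\<close>, a term quadratic in \<open>h\<close> formed from \<open>T' x\<close> and
   \<open>A y - A x\<close>, and \<open>T x\<close> applied to the remainder of \<open>A\<close>;
   each gets a third of \<open>e\<close>. The bound 1 in \<open>d\<close> makes
   \<open>bA + K\<close> a bound for \<open>A y\<close>, and \<open>d <= e2\<close> controls the
   quadratic term.\<close>
 define e1 where "e1=e / (3 * (bA + K))"
 define e2 where "e2=e / (3 * (bT' * K + 1))"
 define e3 where "e3=e / (3 * (bT + 1))"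
 have es: "e1>0" "e2>0" "e3>0"
  unfolding e1_def e2_def e3_def using e K bT bT' bA by (auto intro!: divide_pos_pos add_nonneg_pos)
 obtain d1 where d1: "d1>0" "!!y. y:S==>dist y x<d1 ==>
   form_le (W # Vs) (%vs. T y vs - T x vs - T' x ((y - x) # vs)) (e1 * norm (y - x))"
  by (fact fdiffE[OF T x es(1)])
 obtain d3 where d3: "d3>0" "!!y. y:S==>dist y x<d3 ==>
   form_le Us (%vs. A y vs - A x vs - A' x ((y - x) # vs)) (e3 * norm (y - x))"
  by (fact fdiffE[OF A x es(3)])
 define d where "d=Min {1, d1, d3, dA, e2}"
 have d0: "d>0" using d1 d3 K es by (auto simp: d_def)
 have dle: "d<=1" "d<=d1" "d<=d3" "d<=dA" "d<=e2" by (auto simp: d_def)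
 let ?P="%x ws. T x (A x (take (length Us) ws) # drop (length Us) ws)"
 let ?D="plug_deriv (length Us) (length Vs) T T' A A'"
 have "form_le (Us @ Vs) (%ws. ?P y ws - ?P x ws - ?D x ((y - x) # ws)) (e * norm (y - x))"
  if y: "y:S" "dist y x<d" for y
 proof -
  define h where "h=y - x"
  have h: "norm h<=1" "norm h<=e2" using y dle by (auto simp: h_def dist_norm)
  have hV: "h:V" unfolding h_def using y x SV by (blast intro: subspace_diff)
  note h=h hV
  have yd: "dist y x<d1" "dist y x<d3" "dist y x<dA" using y dle by auto
  have my: "mlin (W # Vs) U (T y)" "mlin Us W (A y)" using T A y by (auto simp: fdiff_def)
  have rA: "A x us:W" "A y us:W" "A' x (h # us):W" if "us:tup Us" for us
   using mlin_range[OF m(3) that] mlin_range[OF my(2) that] mlin_range[OF m(4), of "h # us"] that h by auto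
  have Ay: "form_le Us (A y) (bA + K)"
  proof (rule form_le_mono)
   show "form_le Us (A y) (K * norm (y - x) + bA)"
    by (rule form_le_cong[OF form_le_add[OF K(3)[OF y(1) yd(3)] bA(2)]]) simp
   show "K * norm (y - x) + bA<=bA + K"
    using h(1) K(1) mult_left_mono[of "norm h" 1 K] by (simp add: h_def)
  qed
  have 1: "form_le (Us @ Vs) (%ws. (%vs. T y vs - T x vs - T' x (h # vs)) (A y (take (length Us) ws) # drop (length Us) ws))
    ((e1 * norm h) * (bA + K))"
   using d1(2)[OF y(1) yd(1)] es rA by (intro form_le_plug[OF _ _ Ay]) (auto simp: h_def)
  have Th: "form_le (W # Vs) (%vs. T' x (h # vs)) (bT' * norm h)"
   unfolding form_le_def
  proof
   fix vs assume "vs:tup (W # Vs)"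
   then show "norm (T' x (h # vs))<=bT' * norm h * prod_list (map norm vs)"
    using form_leD[OF bT'(2), of "h # vs"] h by (simp add: mult.assoc)
  qed
  have 2: "form_le (Us @ Vs) (%ws. (%vs. T' x (h # vs)) ((%us. A y us - A x us) (take (length Us) ws) # drop (length Us) ws))
    ((bT' * norm h) * (K * norm h))"
   using K(3)[OF y(1) yd(3)] bT' rA UW unfolding h_def[symmetric]
   by (intro form_le_plug[OF Th]) (auto simp: subspace_diff)
  have 3: "form_le (Us @ Vs) (%ws. T x ((%us. A y us - A x us - A' x (h # us)) (take (length Us) ws) # drop (length Us) ws))
    (bT * (e3 * norm h))"
   using d3(2)[OF y(1) yd(2)] rA UW unfolding h_def[symmetric]
   by (intro form_le_plug[OF bT(2,1)]) (auto simp: subspace_diff)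
  have "bA + K>0" "bT' * K + 1>0" "bT + 1>0" using bA bT bT' K by (auto intro: add_nonneg_pos)
  then have b1: "(e1 * norm h) * (bA + K)=e / 3 * norm h" and b3: "bT * (e3 * norm h)<=e / 3 * norm h"
   and b2: "(bT' * norm h) * (K * norm h)<=e / 3 * norm h"
  proof -
   assume p: "bA + K>0" "bT' * K + 1>0" "bT + 1>0"
   show "(e1 * norm h) * (bA + K)=e / 3 * norm h" using p by (simp add: e1_def field_simps)
   have "bT * e3<=(bT + 1) * e3" using es by simp
   also have "...=e / 3" using p by (simp add: e3_def field_simps)
   finally show "bT * (e3 * norm h)<=e / 3 * norm h"
    using mult_right_mono[of "bT * e3" "e / 3" "norm h"] by (simp add: mult.assoc)
   have "bT' * K * norm h<=(bT' * K + 1) * e2" using h(2) bT' K es by (intro mult_mono) auto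
   also have "...=e / 3" using p by (simp add: e2_def field_simps)
   finally show "(bT' * norm h) * (K * norm h)<=e / 3 * norm h"
    using mult_right_mono[of "bT' * K * norm h" "e / 3" "norm h"] by (simp add: ac_simps)
  qed
  show ?thesis
  proof (rule form_le_mono[OF form_le_cong[OF form_le_add[OF form_le_add[OF 1 2] 3]]])
   show "e1 * norm h * (bA + K) + bT' * norm h * (K * norm h) + bT * (e3 * norm h)<=e * norm (y - x)"
    using b1 b2 b3 unfolding h_def[symmetric] by linarith
   fix ws assume "ws:tup (Us @ Vs)"
   then obtain us vs where ws: "ws=us @ vs" "us:tup Us" "vs:tup Vs" by (rule tup_append_E)
   note len=tup_length[OF ws(2)] tup_length[OF ws(3)]
   note r=rA[OF ws(2)]
   have D: "?D x (h # ws)=T' x (h # A x us # vs) + T x (A' x (h # us) # vs)"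
    using plug_deriv_eq[of us vs T T' A A' x h] len ws by simp
   have l1: "T x ((A y us - A x us - A' x (h # us)) # vs)=T x (A y us # vs) - T x (A x us # vs) - T x (A' x (h # us) # vs)"
    using mlin_Cons_diff[OF m(1) _ _ ws(3)] r UW by (simp add: subspace_diff)
   have swap: "mlin (W # V # Vs) U (%vs. T' x (map ((!) vs) (1 # 0 # [2..<2 + length Vs])))"
    by (rule mlin_perm[OF swap_first_two_index(1,2)], unfold swap_first_two_index(3)[symmetric], rule m(2))
   have l2: "T' x (h # (A y us - A x us) # vs)=T' x (h # A y us # vs) - T' x (h # A x us # vs)"
    using mlin_Cons_diff[OF swap r(2,1), of "h # vs"] ws(3) h(3)
    unfolding len(2)[symmetric] swap_first_two by simp
   show "(%vs. T y vs - T x vs - T' x (h # vs)) (A y (take (length Us) ws) # drop (length Us) ws) +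
    (%vs. T' x (h # vs)) ((%us. A y us - A x us) (take (length Us) ws) # drop (length Us) ws) +
    T x ((%us. A y us - A x us - A' x (h # us)) (take (length Us) ws) # drop (length Us) ws) =
    ?P y ws - ?P x ws - ?D x ((y - x) # ws)"
    unfolding h_def[symmetric] D using ws len by (simp add: l1 l2)
  qed
 qed
 then show "EX d>0. ALL y:S. dist y x<d-->form_le (Us @ Vs) (%ws. ?P y ws - ?P x ws - ?D x ((y - x) # ws)) (e * norm (y - x))"
  using d0 by blast
qed

text \<open>Generators only need a derivative in \<open>gen B\<close>, not in \<open>B\<close>
  itself. This is the freedom that makes composites and inverses work: their derivatives are
  insertions of generators.\<close>

theorem gen_derivative:
 assumes B: "!!Vs U T. (Vs, U, T):B==>subspace U&(EX T'. gen B (V # Vs) U T'&fdiff V S Vs U T T')"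
  and SV: "S<=V" "subspace V"
  and T: "gen B Vs U T"
 shows "subspace U&(EX T'. gen B (V # Vs) U T'&fdiff V S Vs U T T')"
 using T
proof induction
 case (base Vs U T)
 then show ?case by (rule B)
next
 case (add Vs U T1 T2)
 then obtain T1' T2' where "gen B (V # Vs) U T1'" "fdiff V S Vs U T1 T1'" "gen B (V # Vs) U T2'" "fdiff V S Vs U T2 T2'"
  and U: "subspace U" by blast
 then show ?case using gen.add[of B "V # Vs" U T1' T2'] fdiff_add[of V S Vs U T1 T1' T2 T2'] by blast
next
 case (neg Vs U T)
 then obtain T' where "gen B (V # Vs) U T'" "fdiff V S Vs U T T'" and U: "subspace U" by blast
 then show ?case using gen.neg[of B "V # Vs" U T'] fdiff_uminus[of V S Vs U T T'] by blast
next
 case (perm Vs U T js Ws)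
 then obtain T' where T': "gen B (V # Vs) U T'" "fdiff V S Vs U T T'" by blast
 have "gen B (V # Ws) U (%x ws. T' x (map ((!) ws) (0 # map Suc js)))"
  using perm.hyps by (intro gen.perm[OF T'(1)]) (auto simp: distinct_map lessThan_Suc_eq_insert_0)
 moreover have "fdiff V S Ws U (%x ws. T x (map ((!) ws) js)) (%x ws. T' x (map ((!) ws) (0 # map Suc js)))"
  using perm.hyps T'(2) by (intro fdiff_perm) auto
 ultimately show ?case using perm.IH by blast
next
 case (plug W Vs U T Us A n)
 then obtain T' A' where T': "gen B (V # W # Vs) U T'" "fdiff V S (W # Vs) U T T'"
  and A': "gen B (V # Us) W A'" "fdiff V S Us W A A'" by blast
 have "gen B (V # Us @ Vs) U (plug_deriv (length Us) (length Vs) T T' A A')"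
  by (rule gen_plug_deriv[OF plug.hyps(1) T'(1) plug.hyps(2) A'(1)])
 moreover have "fdiff V S (Us @ Vs) U (%x ws. T x (A x (take n ws) # drop n ws)) (plug_deriv (length Us) (length Vs) T T' A A')"
  using fdiff_plug[OF T'(2) A'(2) _ _ SV] plug by simp
 ultimately show ?case using plug.IH by blast
qed


text \<open>A tower of \<open>fdiff\<close> steps contains everything \<open>Ck_forms\<close> asks
  for; continuity of level \<open>j\<close> comes from the Lipschitz bound that level
  \<open>j + 1\<close> provides.\<close>

lemma fdiff_imp_Ck_on:
 assumes D: "!!j. fdiff V S (replicate j V) U (D j) (D (Suc j))" and D0: "!!x. x:S==>D 0 x []=f x"
  and SV: "S<=V" "subspace V"
 shows "Ck_on \<infinity> V S f"
 unfolding Ck_on_def Ck_forms_def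
proof (intro exI[of _ D] conjI allI impI ballI)
 fix x vs assume "x:S" "vs:tuples V 0"
 then show "D 0 x vs=f x" using D0 by (auto simp: tuples_def)
next
 fix j x assume x: "x:S"
 have "mlin (replicate j V) U (D j x)" using D x by (auto simp: fdiff_def)
 then show "bounded_multilinear_on V (j + 0) (D j x)"
  unfolding mlin_def bounded_multilinear_on_def form_le_def form_norm_le_def tup_replicate by auto
next
 fix j x and e :: real assume x: "x:S" and e: "e>0"
 obtain K d where K: "K>0" "d>0" "!!y. y:S==>dist y x<d ==>
   form_le (replicate j V) (%vs. D j y vs - D j x vs) (K * norm (y - x))"
  by (fact fdiff_Lipschitz[OF D[of j] x SV])
 show "\<forall>\<^sub>F y in at x within S. form_norm_le V (j + 0) (%vs. D j y vs - D j x vs) e"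
  unfolding eventually_at
 proof (intro exI[of _ "min d (e / K)"] conjI ballI impI)
  fix y assume y: "y:S" "y~=x&dist y x<min d (e / K)"
  then have "K * norm (y - x)<=e" using K by (simp add: dist_norm pos_less_divide_eq mult.commute)
  then show "form_norm_le V (j + 0) (%vs. D j y vs - D j x vs) e"
   using form_le_mono[OF K(3)] y unfolding form_le_def form_norm_le_def tup_replicate by auto
 qed (use K e in auto)
next
 fix j x and e :: real assume x: "x:S" and e: "e>0"
 obtain d where d: "d>0" "!!y. y:S==>dist y x<d ==>
   form_le (replicate j V) (%vs. D j y vs - D j x vs - D (Suc j) x ((y - x) # vs)) (e * norm (y - x))"
  by (fact fdiffE[OF D[of j] x e])
 then show "\<forall>\<^sub>F y in at x within S. form_norm_le V (j + 0)
   (%vs. D j y vs - D j x vs - D (Suc j) x ((y - x) # vs)) (e * norm (y - x))"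
  unfolding eventually_at form_le_def form_norm_le_def tup_replicate by auto
qed

text \<open>No formula for higher derivatives is needed. Since every member of \<open>gen B\<close>
  has a derivative in \<open>gen B\<close>, recursive choice produces the whole tower.\<close>

lemma gen_imp_Ck_on:
 assumes B: "!!Vs U T. (Vs, U, T):B==>subspace U&(EX T'. gen B (V # Vs) U T'&fdiff V S Vs U T T')"
  and SV: "S<=V" "subspace V" and f: "gen B [] U (%x _. f x)"
 shows "Ck_on \<infinity> V S f"
proof -
 define nxt where "nxt=(%j T. SOME T'. gen B (V # replicate j V) U T'&fdiff V S (replicate j V) U T T')"
 define D where "D=rec_nat (%x _. f x) nxt"
 have D0: "D 0=(%x _. f x)" and DS: "!!j. D (Suc j)=nxt j (D j)" by (simp_all add: D_def)
 have ex: "EX T'. gen B (V # replicate j V) U T'&fdiff V S (replicate j V) U T T'"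
  if "gen B (replicate j V) U T" for j T
  using gen_derivative[OF B SV that] by blast
 have step: "gen B (V # replicate j V) U (nxt j T)&fdiff V S (replicate j V) U T (nxt j T)"
  if "gen B (replicate j V) U T" for j T
  unfolding nxt_def by (rule someI_ex[OF ex[OF that]])
 have g: "gen B (replicate j V) U (D j)" for j
  by (induction j) (use f step in \<open>auto simp: D0 DS\<close>)
 show ?thesis
  by (rule fdiff_imp_Ck_on[of V S U D]) (use step[OF g] SV in \<open>auto simp: DS D0\<close>)
qed

text \<open>The new information is that all derivatives take values in the closed subspace
  \<open>U\<close> when \<open>f\<close> does. With all but the direction frozen, level
  \<open>j + 1\<close> is a derivative of a map with values in \<open>U\<close>, so induction with
  \<open>has_fderiv_range\<close> applies.\<close>

lemma Ck_on_imp_fdiff: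
 assumes f: "Ck_on \<infinity> V S f" and V: "subspace V" and S: "openin (top_of_set V) S"
  and U: "subspace U" "closed U" "f ` S<=U"
 obtains D where "!!x. x:S==>D 0 x []=f x" "!!j. fdiff V S (replicate j V) U (D j) (D (Suc j))"
proof -
 obtain D where D: "ALL x:S. ALL vs:tuples V 0. D 0 x vs=f x"
  "ALL j. enat j<=\<infinity>-->(ALL x:S. bounded_multilinear_on V (j + 0) (D j x))"
  "ALL j. enat j<=\<infinity>-->(ALL x:S. ALL e>0. \<forall>\<^sub>F y in at x within S.
    form_norm_le V (j + 0) (%vs. D j y vs - D j x vs) e)"
  "ALL j. enat j<\<infinity>-->(ALL x:S. ALL e>0. \<forall>\<^sub>F y in at x within S.
    form_norm_le V (j + 0) (%vs. D j y vs - D j x vs - D (Suc j) x ((y - x) # vs)) (e * norm (y - x)))"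
  using f unfolding Ck_on_def Ck_forms_def by (elim exE conjE) (rule that, assumption+)
 have SV: "S<=V" using S by (auto simp: openin_top_of_set_ball)
 have pre: "mlin (replicate j V) UNIV (D j x)" if x: "x:S" for j x
 proof -
  have "bounded_multilinear_on V j (D j x)" using D(2) x by simp
  then obtain b where b: "form_le (replicate j V) (D j x) b"
   and l: "ALL vs:tup (replicate j V). ALL i<j. ALL u:V. ALL v:V. ALL a.
    D j x (vs[i := a *\<^sub>R u + v])=a *\<^sub>R D j x (vs[i := u]) + D j x (vs[i := v])"
   unfolding bounded_multilinear_on_def form_norm_le_def form_le_def tup_replicate by blast
  show ?thesis
   unfolding mlin_def using l form_le_mono[OF b, of "max b 0"] by (auto intro!: exI[of _ "max b 0"])
 qed
 have est: "EX d>0. ALL y:S. dist y x<d -->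
   form_le (replicate j V) (%vs. D j y vs - D j x vs - D (Suc j) x ((y - x) # vs)) (e * norm (y - x))"
  if x: "x:S" and e: "e>0" for j x and e :: real
 proof -
  have "\<forall>\<^sub>F y in at x within S. form_norm_le V j (%vs. D j y vs - D j x vs - D (Suc j) x ((y - x) # vs)) (e * norm (y - x))"
   using D(4)[rule_format, OF _ x e, of j] by simp
  then obtain d where d: "d>0" "!!y. y:S==>y~=x==>dist y x<d ==>
    form_le (replicate j V) (%vs. D j y vs - D j x vs - D (Suc j) x ((y - x) # vs)) (e * norm (y - x))"
   unfolding eventually_at form_le_def form_norm_le_def tup_replicate by blast
  have z: "D (Suc j) x (0 # vs)=0" if "vs:tup (replicate j V)" for vs
  proof -
   have "mlin (V # replicate j V) UNIV (D (Suc j) x)" using pre[OF x, of "Suc j"] by simp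
   from mlin_Cons_diff[OF this subspace_0[OF V] subspace_0[OF V] that] show ?thesis by simp
  qed
  have "form_le (replicate j V) (%vs. D j x vs - D j x vs - D (Suc j) x ((x - x) # vs)) (e * norm (x - x))"
   using z by (simp add: form_le_def)
  then show ?thesis using d by blast
 qed
 have slot: "has_fderiv V (%y. D j y vs) (%h. D (Suc j) x (h # vs)) x"
  if x: "x:S" and vs: "vs:tup (replicate j V)" for j x vs
  unfolding has_fderiv_iff
 proof (intro conjI allI impI)
  have m: "mlin (V # replicate j V) UNIV (D (Suc j) x)" using pre[OF x, of "Suc j"] by simp
  have lin: "D (Suc j) x ((a *\<^sub>R u + v) # vs)=a *\<^sub>R D (Suc j) x (u # vs) + D (Suc j) x (v # vs)"
   if "u:V" "v:V" for a u v using mlin_Cons[OF m that vs] .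
  have z: "D (Suc j) x (0 # vs)=0" using lin[of 0 0 1] V by (simp add: subspace_0)
  obtain b where b: "b>=0" "form_le (V # replicate j V) (D (Suc j) x) b" using mlin_bound[OF m] by blast
  have "norm (D (Suc j) x (h # vs))<=(b * prod_list (map norm vs)) * norm h" if "h:V" for h
   using form_leD[OF b(2), of "h # vs"] that vs by (simp add: mult_ac)
  then show "blinear_on V (%h. D (Suc j) x (h # vs))"
   unfolding blinear_on_def using lin[of _ _ 1] lin[of _ 0] z V by (auto simp: subspace_0)
  fix e :: real assume e: "e>0"
  define p where "p=prod_list (map norm vs)"
  have p: "p>=0" unfolding p_def by (rule prod_list_norm_nonneg)
  have "e / (p + 1)>0" using e p by simp
  then obtain d where d: "d>0" "!!y. y:S==>dist y x<d ==>
   form_le (replicate j V) (%vs. D j y vs - D j x vs - D (Suc j) x ((y - x) # vs)) (e / (p + 1) * norm (y - x))"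
   using est[OF x, of _ j] by blast
  obtain d1 where d1: "d1>0" "!!y. y:V==>dist y x<d1==>y:S"
   using S x unfolding openin_top_of_set_ball by meson
  have "norm (D j y vs - D j x vs - D (Suc j) x ((y - x) # vs))<=e * norm (y - x)"
   if y: "y:V" "dist y x<min d d1" for y
  proof -
   have "norm (D j y vs - D j x vs - D (Suc j) x ((y - x) # vs))<=e / (p + 1) * norm (y - x) * p"
    using form_leD[OF d(2)[of y] vs] d1 y by (auto simp: p_def)
   also have "...<=e / (p + 1) * norm (y - x) * (p + 1)" using e p by (intro mult_left_mono) auto
   also have "...=e * norm (y - x)" using p by simp
   finally show ?thesis .
  qed
  then show "EX d>0. ALL y:V. dist y x<d-->norm (D j y vs - D j x vs - D (Suc j) x ((y - x) # vs))<=e * norm (y - x)"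
   using d(1) d1(1) by (intro exI[of _ "min d d1"]) auto
 qed
 have rng: "ALL x:S. ALL vs:tup (replicate j V). D j x vs:U" for j
 proof (induction j)
  case 0
  then show ?case using D(1) U(3) by (auto simp: tuples_def)
 next
  case (Suc j)
  show ?case
  proof (intro ballI)
   fix x ws assume x: "x:S" and "ws:tup (replicate (Suc j) V)"
   then obtain h vs where ws: "ws=h # vs" "h:V" "vs:tup (replicate j V)"
    by (auto elim: tup_Cons_E)
   obtain d1 where d1: "d1>0" "!!y. y:V==>dist y x<d1==>y:S"
    using S x unfolding openin_top_of_set_ball by meson
   show "D (Suc j) x ws:U"
    unfolding ws(1)
    by (rule has_fderiv_range[OF slot[OF x ws(3)] V _ ws(2) U(1,2) d1(1)])
     (use x SV Suc.IH d1(2) ws(3) in auto)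
  qed
 qed
 have m: "mlin (replicate j V) U (D j x)" if x: "x:S" for j x
  using pre[OF x, of j] rng[of j] x unfolding mlin_def by blast
 show ?thesis
 proof (rule that[of D])
  show "D 0 x []=f x" if "x:S" for x using D(1) that by (auto simp: tuples_def)
  show "fdiff V S (replicate j V) U (D j) (D (Suc j))" for j
   unfolding fdiff_def using m[of _ j] m[of _ "Suc j"] est[of _ _ j] by simp
 qed
qed

lemma fdiff_compose:
 fixes V :: "'a::real_normed_vector set"
 assumes f: "fdiff V S [] W (%x _. f x) F" and fS: "f ` S<=S'"
  and G: "fdiff W S' Vs U G G'" and SV: "S<=V" "subspace V" and SW: "S'<=W" "subspace W"
 shows "fdiff V S Vs U (%x. G (f x)) (%x ws. G' (f x) (F x (take (Suc 0) ws) # drop (Suc 0) ws))"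
 unfolding fdiff_def
proof (intro ballI conjI allI impI)
 fix x assume x: "x:S"
 have fx: "f x:S'" using fS x by blast
 have m: "mlin Vs U (G (f x))" "mlin (W # Vs) U (G' (f x))" "mlin [V] W (F x)"
  using G f x fx by (auto simp: fdiff_def)
 show "mlin Vs U (G (f x))" by fact
 show "mlin (V # Vs) U (%ws. G' (f x) (F x (take (Suc 0) ws) # drop (Suc 0) ws))"
  using mlin_plug[OF m(2,3)] by simp
 obtain b where b: "b>=0" "form_le (W # Vs) (G' (f x)) b" using mlin_bound[OF m(2)] by blast
 obtain K d0 where K: "K>0" "d0>0" "!!y. y:S==>dist y x<d0==>form_le ([] :: 'a set list) (%_. f y - f x) (K * norm (y - x))"
  by (fact fdiff_Lipschitz[OF f x SV])
 fix e :: real assume e: "e>0"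
 \<comment> \<open>Half of \<open>e\<close> pays for the remainder of \<open>G\<close>, taken at a
   point at distance at most \<open>K * norm h\<close>; the other half for the remainder of
   \<open>f\<close> after application of \<open>G' (f x)\<close>, whose norm is at most
   \<open>b\<close>.\<close>
 have e1: "e / (2 * K)>0" and e2: "e / (2 * (b + 1))>0" using e K b by auto
 obtain d1 where d1: "d1>0" "!!y. y:S'==>dist y (f x)<d1 ==>
   form_le Vs (%vs. G y vs - G (f x) vs - G' (f x) ((y - f x) # vs)) (e / (2 * K) * norm (y - f x))"
  by (fact fdiffE[OF G fx e1])
 obtain d2 where d2: "d2>0" "!!y. y:S==>dist y x<d2 ==>
   form_le [] (%vs. f y - f x - F x ((y - x) # vs)) (e / (2 * (b + 1)) * norm (y - x))"
  by (fact fdiffE[OF f x e2])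
 define d where "d=Min {d0, d1 / K, d2}"
 have d: "d>0" "d<=d0" "d<=d1 / K" "d<=d2" using K d1 d2 by (auto simp: d_def)
 have "form_le Vs (%vs. G (f y) vs - G (f x) vs - G' (f x) (F x (take (Suc 0) ((y - x) # vs)) # drop (Suc 0) ((y - x) # vs))) (e * norm (y - x))"
  if y: "y:S" "dist y x<d" for y
 proof -
  define h where "h=y - x"
  have hV: "h:V" unfolding h_def using y x SV by (blast intro: subspace_diff)
  have fy: "f y:S'" using fS y by blast
  have FW: "F x [h]:W" using mlin_range[OF m(3), of "[h]"] hV by simp
  have dW: "f y - f x:W" "f y - f x - F x [h]:W"
   using fx fy SW FW by (blast intro: subspace_diff)+
  have n1: "norm (f y - f x)<=K * norm h"
   using K(3)[OF y(1)] y d by (auto simp: form_le_def h_def)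
  have "dist y x<d1 / K" using y(2) d(3) by linarith
  then have "K * norm h<d1" using K by (simp add: h_def dist_norm pos_less_divide_eq mult.commute)
  then have "form_le Vs (%vs. G (f y) vs - G (f x) vs - G' (f x) ((f y - f x) # vs)) (e / (2 * K) * norm (f y - f x))"
   using d1(2)[OF fy] n1 by (simp add: dist_norm)
  then have 1: "form_le Vs (%vs. G (f y) vs - G (f x) vs - G' (f x) ((f y - f x) # vs)) (e / 2 * norm h)"
  proof (rule form_le_mono)
   have "e / (2 * K) * norm (f y - f x)<=e / (2 * K) * (K * norm h)"
    using n1 e1 by (intro mult_left_mono) auto
   then show "e / (2 * K) * norm (f y - f x)<=e / 2 * norm h" using K by simp
  qed
  have "norm (f y - f x - F x [h])<=e / (2 * (b + 1)) * norm h"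
   using d2(2)[OF y(1)] y(2) d by (auto simp: form_le_def h_def)
  then have "b * norm (f y - f x - F x [h])<=(b + 1) * (e / (2 * (b + 1)) * norm h)"
   using b by (intro mult_mono) auto
  also have "...=e / 2 * norm h" using b by (simp add: field_simps)
  finally have n2: "b * norm (f y - f x - F x [h])<=e / 2 * norm h" .
  have 2: "form_le Vs (%vs. G' (f x) ((f y - f x - F x [h]) # vs)) (e / 2 * norm h)"
  proof (rule form_le_mono[OF _ n2], unfold form_le_def, rule ballI)
   fix vs assume "vs:tup Vs"
   then show "norm (G' (f x) ((f y - f x - F x [h]) # vs))<=b * norm (f y - f x - F x [h]) * prod_list (map norm vs)"
    using form_leD[OF b(2), of "(f y - f x - F x [h]) # vs"] dW by (simp add: mult.assoc)
  qed
  show ?thesis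
  proof (rule form_le_mono[OF form_le_cong[OF form_le_add[OF 1 2]]])
   show "e / 2 * norm h + e / 2 * norm h<=e * norm (y - x)" by (simp add: h_def)
   fix vs assume "vs:tup Vs"
   from mlin_Cons_diff[OF m(2) dW(1) FW this]
   show "G (f y) vs - G (f x) vs - G' (f x) ((f y - f x) # vs) + G' (f x) ((f y - f x - F x [h]) # vs) =
     G (f y) vs - G (f x) vs - G' (f x) (F x (take (Suc 0) ((y - x) # vs)) # drop (Suc 0) ((y - x) # vs))"
    by (simp add: h_def)
  qed
 qed
 then show "EX d>0. ALL y:S. dist y x<d-->form_le Vs (%vs. G (f y) vs - G (f x) vs -
   G' (f x) (F x (take (Suc 0) ((y - x) # vs)) # drop (Suc 0) ((y - x) # vs))) (e * norm (y - x))"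
  using d(1) by blast
qed

text \<open>The generators are the derivatives of \<open>f\<close> and the derivatives of
  \<open>g\<close> composed with \<open>f\<close>. The derivative of the latter is the next
  derivative of \<open>g\<close> at \<open>f x\<close> with \<open>F 1\<close> inserted, so the
  family is closed and no combinatorial formula for the higher derivatives of a composite
  appears.\<close>

theorem Ck_on_compose:
 fixes f g :: "'a::real_normed_vector=>'a"
 assumes f: "Ck_on \<infinity> V S f" and g: "Ck_on \<infinity> W S' g" and fS: "f ` S<=S'"
  and V: "subspace V" "openin (top_of_set V) S" and W: "subspace W" "closed W" "openin (top_of_set W) S'"
 shows "Ck_on \<infinity> V S (%x. g (f x))"
proof -
 have SV: "S<=V" "S'<=W" using V W by (auto simp: openin_top_of_set_ball)
 obtain F where F: "!!x. x:S==>F 0 x []=f x" "!!j. fdiff V S (replicate j V) W (F j) (F (Suc j))"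
  using Ck_on_imp_fdiff[OF f V W(1,2)] fS SV by (metis subset_trans)
 obtain G where G: "!!x. x:S'==>G 0 x []=g x" "!!j. fdiff W S' (replicate j W) UNIV (G j) (G (Suc j))"
  using Ck_on_imp_fdiff[OF g W(1,3) subspace_UNIV closed_UNIV] by (metis subset_UNIV)
 define B where "B=range (%j. (replicate j V, W, F j)) \<union> range (%j. (replicate j W, UNIV :: 'a set, %x. G j (f x)))"
 have F0: "fdiff V S [] W (%x _. f x) (F 1)"
  using F(2)[of 0] F(1) unfolding fdiff_def mlin_def form_le_def by simp
 have "Ck_on \<infinity> V S (%x. G 0 (f x) [])"
 proof (rule gen_imp_Ck_on[OF _ SV(1) V(1)])
  have "gen B (replicate 0 W) UNIV (%x. G 0 (f x))" by (rule gen.base) (auto simp: B_def)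
  from gen.perm[OF this, of "[]" "[]"] show "gen B [] UNIV (%x _. G 0 (f x) [])" by simp
  fix Vs U T assume "(Vs, U, T):B"
  then consider j where "Vs=replicate j V" "U=W" "T=F j"
   | j where "Vs=replicate j W" "U=UNIV" "T=(%x. G j (f x))"
   by (auto simp: B_def)
  then show "subspace U&(EX T'. gen B (V # Vs) U T'&fdiff V S Vs U T T')"
  proof cases
   case 1
   have "gen B (replicate (Suc j) V) W (F (Suc j))" by (rule gen.base) (unfold B_def, blast)
   then show ?thesis using F(2)[of j] 1 W by auto
  next
   case 2
   have "gen B (replicate (Suc j) W) UNIV (%x. G (Suc j) (f x))" by (rule gen.base) (unfold B_def, blast)
   then have g1: "gen B (W # replicate j W) UNIV (%x. G (Suc j) (f x))" by simp
   have "gen B (replicate 1 V) W (F 1)" by (rule gen.base) (unfold B_def, blast)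
   then have g2: "gen B [V] W (F 1)" by simp
   have "gen B ([V] @ replicate j W) UNIV (%x ws. G (Suc j) (f x) (F 1 x (take (Suc 0) ws) # drop (Suc 0) ws))"
    by (rule gen.plug[OF g1 g2]) simp
   then have g3: "gen B (V # replicate j W) UNIV (%x ws. G (Suc j) (f x) (F 1 x (take (Suc 0) ws) # drop (Suc 0) ws))"
    unfolding append_Cons append_Nil .
   show ?thesis
    unfolding 2
   proof (intro conjI exI)
    show "fdiff V S (replicate j W) UNIV (%x. G j (f x))
      (%x ws. G (Suc j) (f x) (F 1 x (take (Suc 0) ws) # drop (Suc 0) ws))"
     by (rule fdiff_compose[OF F0 fS G(2)[of j] SV(1) V(1) SV(2) W(1)])
   qed (rule subspace_UNIV, rule g3)
  qed
 qed
 moreover have "G 0 (f x) []=g (f x)" if "x:S" for x using G(1) fS that by blast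
 ultimately show ?thesis
  unfolding Ck_on_def Ck_forms_def by simp
qed


text \<open>
  The inverse \<open>Psi\<close> of \<open>Phi\<close> has derivative \<open>P y\<close>, the inverse of \<open>DPhi(Psi y)\<close>, and the derivative of \<open>P\<close> is
  \<open>- P y (D\<^sup>2Phi(Psi y) (P y h) (P y v))\<close>; so \<open>Psi\<close>, \<open>P\<close> and the \<open>D\<^sup>jPhi \<circ> Psi\<close> generate a family closed under
  derivatives.
\<close>

theorem Ck_on_inverse:
 fixes Phi Psi :: "'a::real_normed_vector=>'a"
 assumes Phi: "Ck_on \<infinity> V S Phi" and V: "subspace V" "closed V" and S: "openin (top_of_set V) S"
  and S': "openin (top_of_set V) S'" "Psi ` S'<=S" "Phi ` S<=V" "!!y. y:S'==>Phi (Psi y)=y"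
  and Lip: "!!y z. y:S'==>z:S'==>norm (Psi y - Psi z)<=L * norm (y - z)"
  and P: "!!y. y:S'==>blinear_on V (P y)" "!!y v. y:S'==>v:V==>P y v:V"
   "!!y v. y:S'==>v:V==>norm (P y v)<=L * norm v"
  and DP: "!!y v. y:S'==>v:V==>fderiv V Phi (Psi y) (P y v)=v"
   "!!y v. y:S'==>v:V==>P y (fderiv V Phi (Psi y) v)=v"
  and L: "L>0"
 shows "Ck_on \<infinity> V S' Psi"
proof -
 have SV: "S<=V" "S'<=V" using S S'(1) by (auto simp: openin_top_of_set_ball)
 obtain Q where Q: "!!x. x:S==>Q 0 x []=Phi x" "!!j. fdiff V S (replicate j V) V (Q j) (Q (Suc j))"
  by (fact Ck_on_imp_fdiff[OF Phi V(1) S V S'(3)])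
 have m: "mlin (replicate j V) V (Q j x)" if "x:S" for j x
  using Q(2)[of j] that by (simp add: fdiff_def)
 have m1: "mlin [V] V (Q 1 x)" and m2: "mlin [V, V] V (Q 2 x)" if "x:S" for x
  using m[OF that, of 1] m[OF that, of 2] by (simp_all add: numeral_2_eq_2)
 have "has_fderiv V Phi (%v. Q 1 x [v]) x" if x: "x:S" for x
  unfolding has_fderiv_iff
 proof (intro conjI allI impI)
  obtain b where b: "b>=0" "form_le [V] (Q 1 x) b" using mlin_bound[OF m1[OF x]] by blast
  have l: "Q 1 x [a *\<^sub>R u + v]=a *\<^sub>R Q 1 x [u] + Q 1 x [v]" if "u:V" "v:V" for a u v
   using mlin_Cons[OF m1[OF x] that, of "[]" a] by simp
  have z: "Q 1 x [0]=0" using l[of 0 0 1] V by (simp add: subspace_0)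
  have "norm (Q 1 x [v])<=b * norm v" if "v:V" for v using form_leD[OF b(2), of "[v]"] that by simp
  then show "blinear_on V (%v. Q 1 x [v])"
   unfolding blinear_on_def using l[of _ _ 1] l[of _ 0] z V by (auto simp: subspace_0)
  fix e :: real assume e: "e>0"
  have d: "fdiff V S [] V (Q 0) (Q 1)" using Q(2)[of 0] by simp
  obtain d where d: "d>0" "!!y. y:S==>dist y x<d ==>
    form_le [] (%vs. Q 0 y vs - Q 0 x vs - Q 1 x ((y - x) # vs)) (e * norm (y - x))"
   by (fact fdiffE[OF d x e])
  obtain d1 where d1: "d1>0" "!!y. y:V==>dist y x<d1==>y:S"
   using S x unfolding openin_top_of_set_ball by meson
  show "EX d>0. ALL y:V. dist y x<d-->norm (Phi y - Phi x - Q 1 x [y - x])<=e * norm (y - x)"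
   using d d1 Q(1) x by (intro exI[of _ "min d d1"]) (auto simp: form_le_def)
 qed
 then have DQ: "fderiv V Phi x v=Q 1 x [v]" if "x:S" "v:V" for x v
  using fderiv_eq[of V Phi "%v. Q 1 x [v]" x v] that SV V by blast
 have PsiS: "Psi y:S" if "y:S'" for y using S' that by blast
 have QP: "Q 1 (Psi y) [P y v]=v" and PQ: "P y (Q 1 (Psi y) [v])=v" if "y:S'" "v:V" for y v
  using DP[OF that] DQ[OF PsiS[OF that(1)]] P(2)[OF that] that by auto
 define PP where "PP=(%y ws. P y (hd ws))"
 have mPP: "mlin [V] V (PP y)" if y: "y:S'" for y
  unfolding mlin_def PP_def
 proof (intro conjI ballI allI impI)
  fix vs assume "vs:tup [V]"
  then obtain v where v: "vs=[v]" "v:V" by (auto elim!: tup_Cons_E)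
  show "P y (hd vs):V" using P(2)[OF y] v by simp
  fix i u w a assume "i<length [V]" "u:[V] ! i" "w:[V] ! i"
  then show "P y (hd (vs[i := a *\<^sub>R u + w]))=a *\<^sub>R P y (hd (vs[i := u])) + P y (hd (vs[i := w]))"
   using blinear_on_add[OF P(1)[OF y], of "a *\<^sub>R u" w] blinear_on_scale[OF P(1)[OF y], of u a] v V
   by (simp add: subspace_scale)
 next
  show "EX b>=0. form_le [V] (%ws. P y (hd ws)) b"
   using P(3)[OF y] L by (intro exI[of _ L]) (auto simp: form_le_def elim!: tup_Cons_E)
 qed
 \<comment> \<open>Up to sign, the remainder of \<open>Psi\<close> is \<open>P y\<close> applied to
   the remainder of \<open>Phi\<close> at \<open>Psi y\<close>. One factor \<open>L\<close> comes
   from \<open>P y\<close>, the other from the Lipschitz bound of \<open>Psi\<close>; hence the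
   tolerance \<open>e / (L * L)\<close>.\<close>
 have dPsi: "fdiff V S' [] V (%y _. Psi y) PP"
  unfolding fdiff_def
 proof (intro ballI conjI allI impI)
  fix y assume y: "y:S'"
  show "mlin [] V (%_. Psi y)"
   using PsiS[OF y] SV by (auto simp: mlin_def form_le_def intro: exI[of _ "norm (Psi y)"])
  show "mlin [V] V (PP y)" by (rule mPP[OF y])
  fix e :: real assume e: "e>0"
  have e': "e / (L * L)>0" using e L by simp
  have d0: "fdiff V S [] V (Q 0) (Q 1)" using Q(2)[of 0] by simp
  obtain d where d: "d>0" "!!x. x:S==>dist x (Psi y)<d ==>
    form_le [] (%vs. Q 0 x vs - Q 0 (Psi y) vs - Q 1 (Psi y) ((x - Psi y) # vs)) (e / (L * L) * norm (x - Psi y))"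
   by (fact fdiffE[OF d0 PsiS[OF y] e'])
  have "form_le [] (%vs. Psi z - Psi y - PP y ((z - y) # vs)) (e * norm (z - y))"
   if z: "z:S'" "dist z y<d / L" for z
  proof -
   define k where "k=Psi z - Psi y"
   have k: "k:V" "norm k<=L * norm (z - y)"
    using Lip[OF z(1) y] PsiS[OF y] PsiS[OF z(1)] SV V unfolding k_def by (auto simp: subspace_diff subset_iff)
   have "L * norm (z - y)<d" using z(2) L by (simp add: dist_norm pos_less_divide_eq mult.commute)
   then have "norm (z - y - Q 1 (Psi y) [k])<=e / (L * L) * norm k"
    using d(2)[OF PsiS[OF z(1)]] k Q(1)[OF PsiS[OF z(1)]] Q(1)[OF PsiS[OF y]] S'(4) z y
    by (auto simp: form_le_def dist_norm k_def)
   moreover have zy: "z - y:V" using z y SV V by (auto simp: subspace_diff subset_iff)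
   moreover have QV: "Q 1 (Psi y) [k]:V" using mlin_range[OF m1[OF PsiS[OF y]], of "[k]"] k by simp
   ultimately have "norm (P y (z - y - Q 1 (Psi y) [k]))<=L * (e / (L * L) * norm k)"
    using P(3)[OF y, of "z - y - Q 1 (Psi y) [k]"] V L by (smt (verit) mult_left_mono subspace_diff)
   also have "...<=L * (e / (L * L) * (L * norm (z - y)))"
    using k(2) e' L by (intro mult_left_mono) auto
   also have "...=e * norm (z - y)" using L by simp
   also have "P y (z - y - Q 1 (Psi y) [k])=P y (z - y) - k"
    using blinear_on_diff[OF P(1)[OF y] V(1) zy QV] PQ[OF y k(1)] by simp
   finally show ?thesis by (simp add: form_le_def PP_def k_def norm_minus_commute)
  qed
  then show "EX d>0. ALL z:S'. dist z y<d-->form_le [] (%vs. Psi z - Psi y - PP y ((z - y) # vs)) (e * norm (z - y))"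
   using d(1) L by (intro exI[of _ "d / L"]) auto
 qed
 have dQ: "fdiff V S' (replicate j V) V (%y. Q j (Psi y))
   (%y ws. Q (Suc j) (Psi y) (PP y (take (Suc 0) ws) # drop (Suc 0) ws))" for j
  by (rule fdiff_compose[OF dPsi S'(2) Q(2)[of j] SV(2) V(1) SV(1) V(1)])
 define PL :: "('a=>'a list=>'a)=>'a=>'a list=>'a"
  where "PL=(%T y ws. T y (PP y (take (Suc 0) ws) # drop (Suc 0) ws))"
 define SW :: "('a=>'a list=>'a)=>'a=>'a list=>'a"
  where "SW=(%T y ws. T y (map ((!) ws) [1, 0]))"
 define Q2 where "Q2=(%y. Q 2 (Psi y))"
 \<comment> \<open>\<open>PL\<close> inserts \<open>P\<close> into the first slot and
   \<open>SW\<close> exchanges the two slots; alternated twice they insert \<open>P\<close> into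
   both slots of the second derivative. The spelling stays within the operations of
   \<open>gen\<close>; \<open>PD_eq\<close> is the formula meant.\<close>
 define PD where "PD=(%y ws. - PP y (SW (PL (SW (PL Q2))) y (take (Suc (Suc 0)) ws) # drop (Suc (Suc 0)) ws))"
 have PD_eq: "PD y [h, v] = - P y (Q 2 (Psi y) [P y h, P y v])" for y h v
  by (simp add: PD_def SW_def PL_def PP_def Q2_def)
 have dP: "fdiff V S' [V] V PP PD"
  unfolding fdiff_def
 proof (intro ballI conjI allI impI)
  fix y assume y: "y:S'"
  show "mlin [V] V (PP y)" by (rule mPP[OF y])
  have sw: "mlin [V, V] V (SW T y)" if "mlin [V, V] V (T y)" for T
   unfolding SW_def by (rule mlin_perm) (use that in auto)
  have pl: "mlin [V, V] V (PL T y)" if "mlin [V, V] V (T y)" for T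
   using mlin_plug[OF that mPP[OF y]] by (simp add: PL_def)
  have "mlin [V, V] V (Q2 y)" unfolding Q2_def by (rule m2[OF PsiS[OF y]])
  then have "mlin [V, V] V (SW (PL (SW (PL Q2))) y)" by (intro sw pl)
  from mlin_uminus[OF mlin_plug[OF mPP[OF y] this] V(1)] show "mlin [V, V] V (PD y)"
   by (simp add: PD_def)
  obtain b where b: "b>=0" "form_le [V, V] (Q 2 (Psi y)) b" using mlin_bound[OF m2[OF PsiS[OF y]]] by blast
  have dQ1: "fdiff V S' [V] V (%y. Q 1 (Psi y)) (%y ws. Q 2 (Psi y) (PP y (take (Suc 0) ws) # drop (Suc 0) ws))"
   using dQ[of 1] by (simp add: numeral_2_eq_2)
  obtain K dK where K: "K>0" "dK>0" "!!z. z:S'==>dist z y<dK ==>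
    form_le [V] (%vs. Q 1 (Psi z) vs - Q 1 (Psi y) vs) (K * norm (z - y))"
   by (fact fdiff_Lipschitz[OF dQ1 y SV(2) V(1)])
  fix e :: real assume e: "e>0"
  define e1 where "e1=e / (2 * (L * L))"
  have e1: "e1>0" using e L by (simp add: e1_def)
  obtain d1 where d1: "d1>0" "!!z. z:S'==>dist z y<d1 ==>
    form_le [V] (%vs. Q 1 (Psi z) vs - Q 1 (Psi y) vs -
     Q 2 (Psi y) (PP y (take (Suc 0) ((z - y) # vs)) # drop (Suc 0) ((z - y) # vs))) (e1 * norm (z - y))"
   by (fact fdiffE[OF dQ1 y e1])
  \<comment> \<open>\<open>M\<close> is the constant of the second-order error made when
    \<open>P z q\<close> is replaced by \<open>P y q\<close>.\<close>
  define M where "M=L * (K * (L * (b * L * L)))"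
  have M: "M>=0" using L K b by (simp add: M_def)
  define d where "d=Min {d1, dK, e / (2 * (M + 1))}"
  have d: "d>0" "d<=d1" "d<=dK" "d<=e / (2 * (M + 1))" using d1 K e M by (auto simp: d_def)
  have "form_le [V] (%vs. PP z vs - PP y vs - PD y ((z - y) # vs)) (e * norm (z - y))"
   if z: "z:S'" "dist z y<d" for z
   unfolding form_le_def
  proof
   fix vs assume "vs:tup [V]"
   then obtain v where v: "vs=[v]" "v:V" by (auto elim!: tup_Cons_E)
   define h where "h=z - y"
   define w where "w=P y v"
   define q where "q=Q 2 (Psi y) [P y h, w]"
   define R where "R=Q 1 (Psi z) [w] - Q 1 (Psi y) [w] - q"
   have h: "h:V" unfolding h_def using z y SV V by (auto simp: subspace_diff subset_iff)
   have w: "w:V" "norm w<=L * norm v" unfolding w_def using P y v by auto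
   have Ph: "P y h:V" "norm (P y h)<=L * norm h" using P y h by auto
   have qV: "q:V" unfolding q_def using mlin_range[OF m2[OF PsiS[OF y]]] Ph w by simp
   have QV: "Q 1 (Psi z') [u]:V" if "z':S'" "u:V" for z' u
    using mlin_range[OF m1[OF PsiS[OF that(1)]], of "[u]"] that by simp
   have RV: "R:V" unfolding R_def using QV[OF z(1) w(1)] QV[OF y w(1)] qV V by (simp add: subspace_diff)
   have "norm R<=e1 * norm h * norm w"
    using form_leD[OF d1(2)[OF z(1)], of "[w]"] z(2) d w by (simp add: R_def q_def h_def PP_def)
   also have "...<=e1 * norm h * (L * norm v)" using w e1 by (intro mult_left_mono) auto
   finally have R: "norm R<=e1 * norm h * (L * norm v)" .
   have "norm (P z R)<=L * (e1 * norm h * (L * norm v))"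
    using P(3)[OF z(1) RV] mult_left_mono[OF R, of L] L by linarith
   also have "...=e / 2 * norm h * norm v" using L by (simp add: e1_def field_simps)
   finally have 1: "norm (P z R)<=e / 2 * norm h * norm v" .
   have "norm q<=b * (norm (P y h) * norm w)"
    using form_leD[OF b(2), of "[P y h, w]"] Ph w by (simp add: q_def)
   also have "...<=b * ((L * norm h) * (L * norm v))"
    using Ph w b L by (intro mult_left_mono mult_mono) auto
   finally have q: "norm q<=b * L * L * (norm h * norm v)" by (simp add: mult_ac)
   have PqV: "P y q:V" "norm (P y q)<=L * (b * L * L * (norm h * norm v))"
    by (rule P(2)[OF y qV]) (rule order_trans[OF P(3)[OF y qV] mult_left_mono[OF q]], use L in simp)
   define u where "u=Q 1 (Psi z) [P y q] - Q 1 (Psi y) [P y q]"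
   have uV: "u:V" unfolding u_def using QV[OF z(1) PqV(1)] QV[OF y PqV(1)] V by (simp add: subspace_diff)
   have "norm u<=K * norm h * norm (P y q)"
    using form_leD[OF K(3)[OF z(1)], of "[P y q]"] z(2) d PqV by (simp add: u_def h_def)
   also have "...<=K * norm h * (L * (b * L * L * (norm h * norm v)))"
    using PqV K by (intro mult_left_mono) auto
   finally have "norm (P z u)<=L * (K * norm h * (L * (b * L * L * (norm h * norm v))))"
    using P(3)[OF z(1) uV] mult_left_mono[of "norm u" _ L] L by (smt (verit))
   also have "...=M * norm h * (norm h * norm v)" by (simp add: M_def)
   also have "...<=e / 2 * (norm h * norm v)"
   proof (rule mult_right_mono)
    have "norm h<=e / (2 * (M + 1))" using z(2) d by (simp add: h_def dist_norm)
    then have "M * norm h<=(M + 1) * (e / (2 * (M + 1)))" using M by (intro mult_mono) auto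
    also have "...=e / 2" using M by (simp add: field_simps)
    finally show "M * norm h<=e / 2" .
   qed auto
   finally have 2: "norm (P z u)<=e / 2 * norm h * norm v" by simp
   \<comment> \<open>The resolvent identity for the inverses of \<open>Q 1 (Psi z)\<close> and
     \<open>Q 1 (Psi y)\<close>. It is used at \<open>v\<close> for the first-order term and again
     at \<open>q\<close> for the correction.\<close>
   have ey: "P z x - P y x = - P z (Q 1 (Psi z) [P y x] - Q 1 (Psi y) [P y x])" if x: "x:V" for x
   proof -
    have Pyx: "P y x:V" using P y x by blast
    have "P z (Q 1 (Psi z) [P y x] - Q 1 (Psi y) [P y x])=P y x - P z x"
     using blinear_on_diff[OF P(1)[OF z(1)] V(1) QV[OF z(1) Pyx] QV[OF y Pyx]] PQ[OF z(1) Pyx] QP[OF y x] by simp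
    then show ?thesis by simp
   qed
   have "P z v - P y v = - P z (R + q)" using ey[OF v(2)] by (simp add: R_def w_def)
   also have "... = - P z R - P z q" using blinear_on_add[OF P(1)[OF z(1)] RV qV] by simp
   finally have "P z v - P y v = - P z R - P z q" .
   moreover have "P y q=P z q + P z u" using ey[OF qV] by (simp add: u_def algebra_simps)
   ultimately have "P z v - P y v + P y q = - P z R + P z u" by simp
   then have "norm (P z v - P y v + P y q)<=norm (P z R) + norm (P z u)"
    using norm_triangle_ineq[of "- P z R" "P z u"] by simp
   also have "...<=e * norm h * norm v" using 1 2 by simp
   finally show "norm (PP z vs - PP y vs - PD y ((z - y) # vs))<=e * norm (z - y) * prod_list (map norm vs)"
    unfolding v(1) PD_eq h_def[symmetric] w_def[symmetric] q_def[symmetric] by (simp add: PP_def w_def)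
  qed
  then show "EX d>0. ALL z:S'. dist z y<d-->form_le [V] (%vs. PP z vs - PP y vs - PD y ((z - y) # vs)) (e * norm (z - y))"
   using d(1) by blast
 qed
 define B where "B=insert ([V], V, PP) (insert ([], V, %y _. Psi y) (range (%j. (replicate j V, V, %y. Q j (Psi y)))))"
 have gPP: "gen B [V] V PP" by (rule gen.base) (simp add: B_def)
 have gQ: "gen B (replicate j V) V (%y. Q j (Psi y))" for j by (rule gen.base) (unfold B_def, blast)
 show ?thesis
 proof (rule gen_imp_Ck_on[OF _ SV(2) V(1)])
  show "gen B [] V (%y _. Psi y)" by (rule gen.base) (simp add: B_def)
  fix Vs U T assume "(Vs, U, T):B"
  then consider "Vs=[V]" "U=V" "T=PP" | "Vs=[]" "U=V" "T=(%y _. Psi y)"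
   | j where "Vs=replicate j V" "U=V" "T=(%y. Q j (Psi y))"
   unfolding B_def by blast
  then show "subspace U&(EX T'. gen B (V # Vs) U T'&fdiff V S' Vs U T T')"
  proof cases
   case 1
   have sw: "gen B [V, V] V (SW T)" if "gen B [V, V] V T" for T
    unfolding SW_def by (rule gen.perm[OF that]) auto
   have pl: "gen B [V, V] V (PL T)" if "gen B [V, V] V T" for T
    using gen.plug[OF that gPP, of "Suc 0"] by (simp add: PL_def)
   have "gen B [V, V] V Q2" using gQ[of 2] by (simp add: Q2_def numeral_2_eq_2)
   then have "gen B [V, V] V (SW (PL (SW (PL Q2))))" by (intro sw pl)
   from gen.neg[OF gen.plug[OF gPP this, of "Suc (Suc 0)"]] have "gen B [V, V] V PD"
    by (simp add: PD_def)
   then show ?thesis unfolding 1 using dP V(1) by blast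
  next
   case 2
   show ?thesis unfolding 2 using gPP dPsi V(1) by blast
  next
   case 3
   have g1: "gen B (V # replicate j V) V (%y. Q (Suc j) (Psi y))" using gQ[of "Suc j"] by simp
   have "gen B ([V] @ replicate j V) V (%y ws. Q (Suc j) (Psi y) (PP y (take (Suc 0) ws) # drop (Suc 0) ws))"
    by (rule gen.plug[OF g1 gPP]) simp
   then have g3: "gen B (V # replicate j V) V (%y ws. Q (Suc j) (Psi y) (PP y (take (Suc 0) ws) # drop (Suc 0) ws))"
    unfolding append_Cons append_Nil .
   show ?thesis
    unfolding 3
   proof (intro conjI exI)
    show "fdiff V S' (replicate j V) V (%y. Q j (Psi y))
      (%y ws. Q (Suc j) (Psi y) (PP y (take (Suc 0) ws) # drop (Suc 0) ws))" by (rule dQ)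
   qed (rule V(1), rule g3)
  qed
 qed
qed

section \<open>Open mappings and local inverses in closed subspaces\<close>

text \<open>The classical argument: by Baire's theorem the closure of the image of some ball has
  interior points in \<open>B\<close>, so each \<open>b\<close> can be solved up to half its norm,
  and iterating the correction gives a geometric series whose sum stays in the closed space
  \<open>A\<close>.\<close>

theorem open_mapping_on:
 fixes T :: "'a::banach=>'b::banach"
 assumes A: "subspace A" "closed A" and B: "subspace B" "closed B"
  and T: "blinear_on A T" "T ` A=B"
 obtains C where "C>0" "!!b. b:B==>EX a:A. T a=b&norm a<=C * norm b"
proof -
 define X where "X=(%n::nat. {b:B. EX a:A. T a=b&norm a<=real n})"
 have XB: "X n<=B" for n by (auto simp: X_def)
 have UX: "(\<Union>n. closure (X n)) \<supseteq> B"
 proof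
  fix b assume "b:B"
  then obtain a where a: "a:A" "T a=b" using T(2) by blast
  obtain n where "norm a<=real n" using real_arch_simple by blast
  then have "b:X n" using a \<open>b:B\<close> by (auto simp: X_def)
  then show "b:(\<Union>n. closure (X n))" using closure_subset by blast
 qed
 have clB: "closure (X n)<=B" for n using XB B(2) closure_minimal by blast
 obtain n where n: "top_of_set B interior_of closure (X n)~={}"
 proof -
  have cm: "completely_metrizable_space (top_of_set B)"
   using B(2) by (intro completely_metrizable_space_closedin completely_metrizable_space_euclidean) auto
  have "top_of_set B interior_of (\<Union>n. closure (X n))~={}"
  proof -
   have "(\<Union>n. closure (X n))=topspace (top_of_set B)" using UX clB by auto
   then have "top_of_set B interior_of (\<Union>n. closure (X n))=B" by (metis interior_of_topspace topspace_euclidean_subtopology)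
   then show ?thesis using B(1) subspace_0 by auto
  qed
  then show ?thesis
   using Baire_category_alt[of "top_of_set B" "range (%n. closure (X n))"] cm clB that
   by (smt (verit, ccfv_threshold) closed_closure closed_subset countableI_type countable_image image_iff)
 qed
 then obtain b0 where b0: "b0:top_of_set B interior_of closure (X n)" by blast
 have "openin (top_of_set B) (top_of_set B interior_of closure (X n))" by simp
 then obtain e where e: "e>0" "!!b. b:B==>dist b b0<e==>b:top_of_set B interior_of closure (X n)"
  and b0B: "b0:B"
  using b0 unfolding openin_top_of_set_ball by (metis subsetD)
 have cl: "b:closure (X n)" if "b:B" "dist b b0<e" for b
  using e(2)[OF that] interior_of_subset by (metis subsetD)
 \<comment> \<open>Approximate preimages of \<open>b0 + b\<close> and of \<open>b0\<close> are
   subtracted, which moves the interior point to the origin and doubles the bound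
   \<open>real n\<close>.\<close>
 have step0: "EX a:A. norm a<=2 * real n&norm (b - T a)<=dlt" if b: "b:B" "norm b<e" and d: "dlt>0" for b dlt
 proof -
  have "b0 + b:closure (X n)" "b0:closure (X n)"
   using cl[of "b0 + b"] cl[of b0] b b0B e B by (auto simp: dist_norm subspace_add)
  then obtain x y where x: "x:X n" "dist x (b0 + b)<dlt / 2" and y: "y:X n" "dist y b0<dlt / 2"
   using d by (meson closure_approachable half_gt_zero)
  obtain a1 a2 where a: "a1:A" "T a1=x" "norm a1<=real n" "a2:A" "T a2=y" "norm a2<=real n"
   using x(1) y(1) by (auto simp: X_def)
  have "T (a1 - a2)=x - y" using blinear_on_diff[OF T(1) A(1)] a by simp
  moreover have "norm (b - (x - y))<=dlt"
  proof -
   have "b - (x - y)=(y - b0) - (x - (b0 + b))" by simp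
   then have "norm (b - (x - y))<=norm (y - b0) + norm (x - (b0 + b))" by (metis norm_triangle_ineq4)
   then show ?thesis using x(2) y(2) by (simp add: dist_norm)
  qed
  moreover have "norm (a1 - a2)<=2 * real n" using norm_triangle_ineq4[of a1 a2] a by linarith
  ultimately show ?thesis using a A by (intro bexI[of _ "a1 - a2"]) (auto simp: subspace_diff)
 qed
 define M where "M=4 * real n / e"
 have M: "M>=0" using e by (simp add: M_def)
 have step: "EX a:A. norm a<=M * norm b&norm (b - T a)<=norm b / 2" if b: "b:B" for b
 proof (cases "b=0")
  case True
  then show ?thesis using blinear_on_zero[OF T(1) A(1)] A by (intro bexI[of _ 0]) (auto simp: subspace_0)
 next
  case False
  \<comment> \<open>The scaling brings \<open>b\<close> to norm \<open>e / 2\<close>, where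
    \<open>step0\<close> applies; undoing it produces the constant \<open>M\<close>.\<close>
  define s where "s=e / (2 * norm b)"
  have s: "s>0" using e False by (simp add: s_def)
  have sb: "s *\<^sub>R b:B" "norm (s *\<^sub>R b)<e" using b B e False by (auto simp: subspace_scale s_def)
  obtain a where a: "a:A" "norm a<=2 * real n" "norm (s *\<^sub>R b - T a)<=s * norm b / 2"
   using step0[OF sb, of "s * norm b / 2"] s False by auto
  have "T (a /\<^sub>R s)=T a /\<^sub>R s" using blinear_on_scale[OF T(1) a(1)] .
  then have "b - T (a /\<^sub>R s)=(s *\<^sub>R b - T a) /\<^sub>R s" using s by (simp add: algebra_simps)
  then have "norm (b - T (a /\<^sub>R s))=norm (s *\<^sub>R b - T a) / s" using s by (simp add: divide_inverse mult.commute)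
  also have "...<=(s * norm b / 2) / s" using a s by (intro divide_right_mono) auto
  finally have "norm (b - T (a /\<^sub>R s))<=norm b / 2" using s by simp
  moreover have "norm (a /\<^sub>R s)<=M * norm b"
  proof -
   have "norm (a /\<^sub>R s)=norm a / s" using s by (simp add: divide_inverse mult.commute)
   also have "...<=2 * real n / s" using a s by (intro divide_right_mono) auto
   also have "...=M * norm b" using e False by (simp add: s_def M_def)
   finally show ?thesis .
  qed
  ultimately show ?thesis using a A by (intro bexI[of _ "a /\<^sub>R s"]) (auto simp: subspace_scale)
 qed
 then obtain sig where sig: "!!b. b:B==>sig b:A&norm (sig b)<=M * norm b&norm (b - T (sig b))<=norm b / 2"
  by metis
 have main: "EX a:A. T a=b&norm a<=(2 * M + 1) * norm b" if b: "b:B" for b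
 proof -
  \<comment> \<open>\<open>r k\<close> is the error left after \<open>k\<close> corrections and is
    at most half the previous one. The corrections sum to norm at most
    \<open>2 * M * norm b\<close>; the extra 1 in the final constant only makes it positive.\<close>
  define r where "r=(%k. ((%b. b - T (sig b)) ^^ k) b)"
  have r0: "r 0=b" and rS: "r (Suc k)=r k - T (sig (r k))" for k by (simp_all add: r_def)
  have rB: "r k:B" for k
   by (induction k) (use b sig T(2) B in \<open>auto simp: r0 rS subspace_diff\<close>)
  have rn: "norm (r k)<=norm b / 2 ^ k" for k
  proof (induction k)
   case (Suc k)
   have "norm (r (Suc k))<=norm (r k) / 2" using sig[OF rB[of k]] by (simp add: rS)
   also have "...<=(norm b / 2 ^ k) / 2" using Suc by (rule divide_right_mono) simp
   finally show ?case by simp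
  qed (simp add: r0)
  define a where "a=(%k. sig (r k))"
  have aA: "a k:A" for k using sig[OF rB[of k]] by (simp add: a_def)
  have an: "norm (a k)<=M * norm b * (1/2) ^ k" for k
  proof -
   have "norm (a k)<=M * norm (r k)" using sig[OF rB[of k]] by (simp add: a_def)
   also have "...<=M * (norm b / 2 ^ k)" using rn M by (intro mult_left_mono) auto
   also have "...=M * norm b * (1/2) ^ k" by (simp only: power_one_over) simp
   finally show ?thesis .
  qed
  have sg: "summable (%k. M * norm b * (1/2::real) ^ k)" by (intro summable_mult summable_geometric) simp
  have sn: "summable (%k. norm (a k))"
   by (rule summable_comparison_test'[OF sg, of 0]) (use an in simp)
  then have sa: "summable a" by (rule summable_norm_cancel)
  have parA: "(\<Sum>k<m. a k):A" for m using aA A by (intro subspace_sum)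
  have lim: "(%m. \<Sum>k<m. a k) \<longlonglongrightarrow> suminf a" using summable_LIMSEQ[OF sa] .
  have SA: "suminf a:A" by (rule closed_sequentially[OF A(2) parA lim])
  have Tp: "T (\<Sum>k<m. a k)=b - r m" for m
  proof (induction m)
   case 0
   show ?case using blinear_on_zero[OF T(1) A(1)] by (simp add: r0)
  next
   case (Suc m)
   then show ?case using blinear_on_add[OF T(1) parA[of m] aA[of m]] by (simp add: rS a_def)
  qed
  obtain K where K: "K>0" "!!v. v:A==>norm (T v)<=K * norm v" using blinear_on_bound[OF T(1)] by metis
  have "(%m. T (\<Sum>k<m. a k)) \<longlonglongrightarrow> T (suminf a)"
  proof (rule LIM_zero_cancel, rule Lim_null_comparison)
   have "norm (T (\<Sum>k<m. a k) - T (suminf a))<=K * norm ((\<Sum>k<m. a k) - suminf a)" for m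
    using K(2)[of "(\<Sum>k<m. a k) - suminf a"] blinear_on_diff[OF T(1) A(1) parA[of m] SA] parA SA A
    by (simp add: subspace_diff)
   then show "\<forall>\<^sub>F m in sequentially. norm (T (\<Sum>k<m. a k) - T (suminf a))<=K * norm ((\<Sum>k<m. a k) - suminf a)" by simp
   show "(%m. K * norm ((\<Sum>k<m. a k) - suminf a)) \<longlonglongrightarrow> 0"
    using tendsto_mult_right_zero[OF tendsto_norm_zero[OF LIM_zero[OF lim]]] by simp
  qed
  moreover have "(%m. T (\<Sum>k<m. a k)) \<longlonglongrightarrow> b"
  proof -
   have "(%m. norm b * (1/2) ^ m) \<longlonglongrightarrow> 0" by (intro tendsto_mult_right_zero LIMSEQ_realpow_zero) auto
   then have "r \<longlonglongrightarrow> 0"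
   proof (rule Lim_null_comparison[rotated])
    have "norm (r m)<=norm b * (1/2) ^ m" for m
    proof -
     have "norm b / 2 ^ m=norm b * (1/2) ^ m" by (simp only: power_one_over) simp
     then show ?thesis using rn[of m] by simp
    qed
    then show "\<forall>\<^sub>F m in sequentially. norm (r m)<=norm b * (1/2) ^ m" by simp
   qed
   then show ?thesis unfolding Tp using tendsto_diff[OF tendsto_const, of r 0 sequentially b] by simp
  qed
  ultimately have "T (suminf a)=b" by (rule LIMSEQ_unique)
  moreover have "norm (suminf a)<=(2 * M + 1) * norm b"
  proof -
   have "norm (suminf a)<=(\<Sum>k. norm (a k))" by (rule summable_norm[OF sn])
   also have "...<=(\<Sum>k. M * norm b * (1/2) ^ k)" by (rule suminf_le[OF an sn sg])
   also have "...=M * norm b * 2" by (subst suminf_mult) (auto simp: suminf_geometric)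
   also have "...<=(2 * M + 1) * norm b" by (simp add: distrib_right)
   finally show ?thesis .
  qed
  ultimately show ?thesis using SA by blast
 qed
 show ?thesis by (rule that[of "2 * M + 1"]) (use M main in auto)
qed

lemma blinear_on_inverse:
 fixes T :: "'a::banach=>'b::banach"
 assumes A: "subspace A" "closed A" and B: "subspace B" "closed B"
  and T: "blinear_on A T" "T ` A=B" "inj_on T A"
 shows "blinear_on B (inv_into A T)"
proof -
 obtain C where C: "C>0" "!!b. b:B==>EX a:A. T a=b&norm a<=C * norm b"
  by (fact open_mapping_on[OF A B T(1,2)])
 have inv: "inv_into A T (T a)=a" if "a:A" for a using that T(3) by simp
 show ?thesis
  unfolding blinear_on_def
 proof (intro conjI ballI allI)
  fix u v assume "u:B" "v:B"
  then obtain a b where "a:A" "b:A" "u=T a" "v=T b" using T(2) by blast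
  then show "inv_into A T (u + v)=inv_into A T u + inv_into A T v"
   using blinear_on_add[OF T(1), of a b] inv[of "a + b"] inv A by (simp add: subspace_add)
 next
  fix c v assume "v:B"
  then obtain a where "a:A" "v=T a" using T(2) by blast
  then show "inv_into A T (c *\<^sub>R v)=c *\<^sub>R inv_into A T v"
   using blinear_on_scale[OF T(1), of a c] inv[of "c *\<^sub>R a"] inv A by (simp add: subspace_scale)
 next
  show "EX K. ALL v:B. norm (inv_into A T v)<=K * norm v" using C(2) inv by metis
 qed
qed

text \<open>The solution is the fixed point of the map sending \<open>x\<close> to
  \<open>y - k x\<close>. The map stays in the ball because the contraction and the distance of
  \<open>y\<close> from \<open>a + k a\<close> each use up half of the radius.\<close>

lemma contraction_solve:
 fixes k :: "'a::banach=>'a"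
 assumes V: "subspace V" "closed V" and a: "a:V" and s: "s>=0"
  and k: "!!x. x:V==>dist x a<=s==>k x:V"
   "!!x y. x:V==>dist x a<=s==>y:V==>dist y a<=s==>norm (k x - k y)<=norm (x - y) / 2"
  and y: "y:V" "norm (y - (a + k a))<=s / 2"
 obtains x where "x:V" "dist x a<=s" "x + k x=y"
proof -
 define D where "D=V\<inter>cball a s"
 have D: "complete D" using V by (auto simp: D_def complete_eq_closed closed_Int)
 have aD: "a:D" using a s by (simp add: D_def)
 have "(%x. y - k x) ` D<=D"
 proof (intro image_subsetI)
  fix x assume "x:D"
  then have x: "x:V" "dist x a<=s" by (auto simp: D_def dist_commute)
  have "a - (y - k x)=(k x - k a) - (y - (a + k a))" by simp
  then have "norm (a - (y - k x))<=norm (k x - k a) + norm (y - (a + k a))" by (metis norm_triangle_ineq4)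
  also have "...<=s / 2 + s / 2" using k(2)[OF x a] y(2) s x by (intro add_mono) (auto simp: dist_norm)
  finally show "y - k x:D" using y k(1)[OF x] V by (simp add: D_def dist_norm subspace_diff)
 qed
 moreover have "ALL x:D. ALL z:D. dist (y - k x) (y - k z)<=1/2 * dist x z"
  using k(2) by (auto simp: D_def dist_norm dist_commute norm_minus_commute)
 ultimately have "\<exists>!x. x:D&y - k x=x"
  using Banach_fix[OF D, of "1/2" "%x. y - k x"] aD by auto
 then obtain x where "x:D" "y - k x=x" by blast
 then show ?thesis by (intro that[of x]) (auto simp: D_def dist_commute algebra_simps)
qed

section \<open>The inverse function theorem for smooth maps\<close>

lemma Ck_on_subset:
 assumes f: "Ck_on k V S f" and TS: "T<=S" shows "Ck_on k V T f"
proof -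
 obtain D where D: "ALL x:S. ALL vs:tuples V 0. D 0 x vs=f x"
  "ALL j. enat j<=k-->(ALL x:S. bounded_multilinear_on V (j + 0) (D j x))"
  "ALL j. enat j<=k-->(ALL x:S. ALL e>0. \<forall>\<^sub>F y in at x within S.
    form_norm_le V (j + 0) (%vs. D j y vs - D j x vs) e)"
  "ALL j. enat j<k-->(ALL x:S. ALL e>0. \<forall>\<^sub>F y in at x within S.
    form_norm_le V (j + 0) (%vs. D j y vs - D j x vs - D (Suc j) x ((y - x) # vs)) (e * norm (y - x)))"
  using f unfolding Ck_on_def Ck_forms_def by (elim exE conjE) (rule that, assumption+)
 have ev: "eventually P (at x within T)" if "eventually P (at x within S)" for P and x :: 'a
  using that at_le[OF TS] by (rule filter_leD[rotated])
 show ?thesis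
  unfolding Ck_on_def Ck_forms_def
 proof (intro exI[of _ D] conjI allI impI ballI)
  fix j x and e :: real assume "enat j<=k" "x:T" "e>0"
  then show "\<forall>\<^sub>F y in at x within T. form_norm_le V (j + 0) (%vs. D j y vs - D j x vs) e"
   using D(3) TS by (intro ev) blast
 next
  fix j x and e :: real assume "enat j<k" "x:T" "e>0"
  then show "\<forall>\<^sub>F y in at x within T. form_norm_le V (j + 0)
    (%vs. D j y vs - D j x vs - D (Suc j) x ((y - x) # vs)) (e * norm (y - x))"
   using D(4) TS by (intro ev) blast
 qed (use D(1,2) TS in auto)
qed

lemma Ck_on_cong: "Ck_on k V S f==>(!!x. x:S==>f x=g x)==>Ck_on k V S g"
 unfolding Ck_on_def Ck_forms_def by simp

text \<open>With derivative the identity at \<open>x0\<close>, the map \<open>Phi\<close> minus the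
  identity contracts by 1/2 near \<open>x0\<close>. This gives injectivity with Lipschitz constant 2
  for the inverse, openness of images by \<open>contraction_solve\<close>, and invertibility of
  nearby derivatives; smoothness of the inverse is then \<open>Ck_on_inverse\<close> with
  \<open>L = 2\<close>.\<close>

theorem smooth_local_inverse:
 fixes Phi :: "'a::banach=>'a"
 assumes Phi: "Ck_on \<infinity> V S Phi" and V: "subspace V" "closed V" and S: "openin (top_of_set V) S"
  and x0: "x0:S" and rng: "Phi ` S<=V" and id: "!!v. v:V==>fderiv V Phi x0 v=v"
 obtains rho Psi where "rho>0" "V\<inter>ball x0 rho<=S" "openin (top_of_set V) (Phi ` (V\<inter>ball x0 rho))"
  "!!x. x:V\<inter>ball x0 rho==>Psi (Phi x)=x" "Ck_on \<infinity> V (Phi ` (V\<inter>ball x0 rho)) Psi"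
proof -
 have "(1::enat)<=\<infinity>" by simp
 then obtain Phi' where Phi': "C1_on V S Phi Phi'" using Ck_on_imp_C1[OF Phi _ V(1) S] by metis
 have SV: "S<=V" using S by (auto simp: openin_top_of_set_ball)
 have dPhi: "fderiv V Phi x v=Phi' x v" if "x:S" "v:V" for x v
  using fderiv_eq[of V Phi "Phi' x" x v] Phi' that SV V by (auto simp: C1_on_def)
 have h: "(1/2::real)>0" by simp
 obtain d1 where d1: "d1>0" "!!y. y:V==>dist y x0<d1==>y:S"
  "!!y z. y:V==>dist y x0<d1==>z:V==>dist z x0<d1==>norm (Phi y - Phi z - Phi' x0 (y - z))<=(1/2) * norm (y - z)"
  by (fact C1_on_strict[OF Phi' V(1) S x0 h])
 obtain d2 where d2: "d2>0" "!!y v. y:S==>dist y x0<d2==>v:V==>norm (Phi' y v - Phi' x0 v)<=(1/2) * norm v"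
  using Phi' x0 h unfolding C1_on_def by meson
 define rho where "rho=min d1 d2"
 define B where "B=V\<inter>ball x0 rho"
 have rho: "rho>0" using d1 d2 by (simp add: rho_def)
 have BS: "B<=S" using d1 by (auto simp: B_def rho_def dist_commute)
 have BV: "B<=V" by (auto simp: B_def)
 have contr: "norm ((Phi y - y) - (Phi z - z))<=norm (y - z) / 2" if "y:B" "z:B" for y z
 proof -
  have "y - z:V" using that BV V by (auto simp: subspace_diff subset_iff)
  then have "Phi' x0 (y - z)=y - z" using id dPhi[OF x0] by simp
  then have "norm (Phi y - Phi z - (y - z))<=norm (y - z) / 2"
   using d1(3)[of y z] that by (simp add: B_def rho_def dist_commute)
  moreover have "Phi y - Phi z - (y - z)=(Phi y - y) - (Phi z - z)" by simp
  ultimately show ?thesis by simp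
 qed
 have lower: "norm (y - z)<=2 * norm (Phi y - Phi z)" if "y:B" "z:B" for y z
 proof -
  have "y - z=(Phi y - Phi z) - ((Phi y - y) - (Phi z - z))" by simp
  then have "norm (y - z)<=norm (Phi y - Phi z) + norm ((Phi y - y) - (Phi z - z))" by (metis norm_triangle_ineq4)
  then show ?thesis using contr[OF that] by simp
 qed
 have inj: "inj_on Phi B" by (rule inj_onI) (use lower in force)
 define Psi where "Psi=inv_into B Phi"
 have Psi: "Psi (Phi x)=x" if "x:B" for x using inj that by (simp add: Psi_def)
 have op: "openin (top_of_set V) (Phi ` B)"
  unfolding openin_top_of_set_ball
 proof (intro conjI ballI)
  show "Phi ` B<=V" using rng BS by blast
  fix y0 assume "y0:Phi ` B"
  then obtain a where a: "a:B" "y0=Phi a" by blast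
  have "openin (top_of_set V) B" unfolding B_def by (simp add: openin_open_Int)
  then obtain s where s: "s>0" "!!y. y:V==>dist y a<s==>y:B"
   using a unfolding openin_top_of_set_ball by meson
  have ball: "x:B" if "x:V" "dist x a<=s / 2" for x using s that by auto
  have "y:Phi ` B" if y: "y:V" "dist y y0<s / 4" for y
  proof -
   have kV: "Phi x - x:V" if "x:V" "dist x a<=s / 2" for x
    using ball[OF that] rng BS that V by (auto simp: subspace_diff image_subset_iff)
   have kc: "norm ((Phi x - x) - (Phi z - z))<=norm (x - z) / 2"
    if "x:V" "dist x a<=s / 2" "z:V" "dist z a<=s / 2" for x z
    using contr ball that by blast
   have "norm (y - (a + (Phi a - a)))<=(s / 2) / 2" using y a by (simp add: dist_norm)
   from contraction_solve[OF V subsetD[OF BV a(1)] _ kV kc y(1) this] s(1)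
   obtain x where "x:V" "dist x a<=s / 2" "x + (Phi x - x)=y" by auto
   then show ?thesis using ball by (intro image_eqI[of _ _ x]) auto
  qed
  then show "EX d>0. ALL y:V. dist y y0<d-->y:Phi ` B" using s(1) by (intro exI[of _ "s / 4"]) auto
 qed
 have lin: "blinear_on V (Phi' x)" and rng': "v:V==>Phi' x v:V" if xB: "x:B" for x v
 proof -
  have f: "has_fderiv V Phi (Phi' x) x" using Phi' xB BS by (auto simp: C1_on_def)
  show "blinear_on V (Phi' x)" by (rule has_fderiv_linear[OF f])
  obtain d where d: "d>0" "!!y. y:V==>dist y x<d==>y:S"
   using S xB BS unfolding openin_top_of_set_ball by (meson subsetD)
  show "Phi' x v:V" if "v:V"
   by (rule has_fderiv_range[OF f V(1) _ that V d(1)]) (use \<open>x:B\<close> BV d(2) rng in auto)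
 qed
 have near: "norm (Phi' x v - v)<=norm v / 2" if "x:B" "v:V" for x v
  using d2(2)[of x v] that BS dPhi[OF x0] id by (auto simp: B_def rho_def dist_commute)
 have lower': "norm v<=2 * norm (Phi' x v)" if "x:B" "v:V" for x v
  using near[OF that] norm_triangle_ineq4[of "Phi' x v" "Phi' x v - v"] by simp
 \<comment> \<open>The same contraction argument for the linear map \<open>Phi' x\<close>, centred
   at 0 with radius \<open>2 * norm w\<close>.\<close>
 have surj: "Phi' x ` V=V" if x: "x:B" for x
 proof
  show "Phi' x ` V<=V" using rng'[OF x] by blast
  show "V<=Phi' x ` V"
  proof
   fix w assume w: "w:V"
   have kV: "Phi' x v - v:V" if "v:V" for v using rng'[OF x that] that V by (simp add: subspace_diff)
   have kc: "norm ((Phi' x u - u) - (Phi' x v - v))<=norm (u - v) / 2" if "u:V" "v:V" for u v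
    using near[OF x, of "u - v"] blinear_on_diff[OF lin[OF x] V(1) that] that V
    by (simp add: subspace_diff algebra_simps)
   have "norm (w - (0 + (Phi' x 0 - 0)))<=(2 * norm w) / 2"
    using blinear_on_zero[OF lin[OF x] V(1)] by simp
   from contraction_solve[OF V subspace_0[OF V(1)] _ kV kc w this]
   obtain v where "v:V" "v + (Phi' x v - v)=w" by auto
   then show "w:Phi' x ` V" by (intro image_eqI[of _ _ v]) auto
  qed
 qed
 have inj': "inj_on (Phi' x) V" if x: "x:B" for x
 proof (rule inj_onI)
  fix u v assume uv: "u:V" "v:V" "Phi' x u=Phi' x v"
  then have "norm (u - v)<=2 * norm (Phi' x u - Phi' x v)"
   using lower'[OF x, of "u - v"] blinear_on_diff[OF lin[OF x] V(1) uv(1,2)] V by (simp add: subspace_diff)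
  then show "u=v" using uv by simp
 qed
 define P where "P=(%y. inv_into V (Phi' (Psi y)))"
 have PsiB: "Psi y:B" "Phi (Psi y)=y" if "y:Phi ` B" for y
  using that Psi by auto
 have P1: "P y w:V" "Phi' (Psi y) (P y w)=w" if "y:Phi ` B" "w:V" for y w
  using surj[OF PsiB(1)[OF that(1)]] that(2) unfolding P_def by (metis inv_into_into, metis f_inv_into_f)
 have "Ck_on \<infinity> V (Phi ` B) Psi"
 proof (rule Ck_on_inverse[OF Phi V S op, where P=P and L=2])
  show "Psi ` Phi ` B<=S" "Phi ` S<=V" using Psi BS rng by auto
  fix y assume y: "y:Phi ` B"
  note x=PsiB[OF y]
  show "Phi (Psi y)=y" by (rule x)
  show "norm (Psi y - Psi z)<=2 * norm (y - z)" if z: "z:Phi ` B" for z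
   using lower[OF x(1) PsiB(1)[OF z]] x(2) PsiB(2)[OF z] by simp
  show "blinear_on V (P y)"
   unfolding P_def by (rule blinear_on_inverse[OF V V lin[OF x(1)] surj[OF x(1)] inj'[OF x(1)]])
  fix v assume v: "v:V"
  show "P y v:V" by (rule P1[OF y v])
  show "norm (P y v)<=2 * norm v" using lower'[OF x(1) P1(1)[OF y v]] P1(2)[OF y v] by simp
  show "fderiv V Phi (Psi y) (P y v)=v" using dPhi x(1) BS P1[OF y v] by auto
  show "P y (fderiv V Phi (Psi y) v)=v" using dPhi x(1) BS v inj'[OF x(1)] by (auto simp: P_def)
 qed simp
 then show ?thesis using rho BS op Psi by (intro that[of rho Psi]) (auto simp: B_def)
qed

section \<open>Charts and tangent vectors\<close>

lemma chartD:
 assumes "is_chart T c"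
 shows "openin T (cdom c)" "subspace (cmodel c)" "closed (cmodel c)"
  "openin (top_of_set (cmodel c)) (cmap c ` cdom c)" "inj_on (cmap c) (cdom c)"
  "cdom c<=topspace T"
 using assms homeomorphic_imp_injective_map[of "subtopology T (cdom c)" _ "cmap c"] openin_subset[of T "cdom c"]
 by (auto simp: is_chart_def Int_absorb1)

lemma cinv_cmap [simp]: "is_chart T c==>m:cdom c==>cinv c (cmap c m)=m"
 by (simp add: cinv_def chartD(5))

lemma cmap_cinv: "x:cmap c ` cdom c==>cmap c (cinv c x)=x"
 and cinv_in: "x:cmap c ` cdom c==>cinv c x:cdom c"
 by (simp_all add: cinv_def f_inv_into_f inv_into_into)

lemma cmap_in_cmodel: "is_chart T c==>m:cdom c==>cmap c m:cmodel c"
 using chartD(4) openin_subset by fastforce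

lemma continuous_map_cmap:
 assumes "is_chart T c" shows "continuous_map (subtopology T (cdom c)) (top_of_set (cmap c ` cdom c)) (cmap c)"
 using assms by (auto simp: is_chart_def homeomorphic_imp_continuous_map)

lemma continuous_map_cinv:
 assumes "is_chart T c" shows "continuous_map (top_of_set (cmap c ` cdom c)) T (cinv c)"
proof -
 obtain g where g: "homeomorphic_maps (subtopology T (cdom c)) (top_of_set (cmap c ` cdom c)) (cmap c) g"
  using assms by (auto simp: is_chart_def homeomorphic_map_maps)
 have "continuous_map (top_of_set (cmap c ` cdom c)) T g"
  using g by (auto simp: homeomorphic_maps_def continuous_map_in_subtopology)
 moreover have "g x=cinv c x" if "x:cmap c ` cdom c" for x
  using g that chartD(6)[OF assms] assms by (auto simp: homeomorphic_maps_def Int_absorb1)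
 ultimately show ?thesis by (rule continuous_map_eq) auto
qed

lemma openin_cmap_image:
 assumes c: "is_chart T c" and U: "openin T U" "U<=cdom c"
 shows "openin (top_of_set (cmodel c)) (cmap c ` U)"
proof -
 have "homeomorphic_map (subtopology T (cdom c)) (top_of_set (cmap c ` cdom c)) (cmap c)"
  using c by (simp add: is_chart_def)
 moreover have "openin (subtopology T (cdom c)) U" using U by (auto simp: openin_subtopology)
 ultimately have "openin (top_of_set (cmap c ` cdom c)) (cmap c ` U)"
  by (meson homeomorphic_map_openness openin_subset)
 then show ?thesis using chartD(4)[OF c] openin_trans by blast
qed

lemma openin_cinv_image:
 assumes c: "is_chart T c" and U: "openin (top_of_set (cmodel c)) U" "U<=cmap c ` cdom c"
 shows "openin T (cinv c ` U)"
proof -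
 have "openin (subtopology T (cdom c)) {m:topspace (subtopology T (cdom c)). cmap c m:U}"
  by (rule openin_continuous_map_preimage[OF continuous_map_cmap[OF c] openin_subset_trans[OF U openin_imp_subset[OF chartD(4)[OF c]]]])
 moreover have "{m:topspace (subtopology T (cdom c)). cmap c m:U}=cinv c ` U"
  using U(2) chartD(6)[OF c] cinv_cmap[OF c] by (force simp: image_iff cinv_in cmap_cinv)
 ultimately show ?thesis using chartD(1)[OF c] openin_trans_full by fastforce
qed

text \<open>Chain rule through a chart \<open>d\<close>, for maps that are only defined on manifolds.\<close>

lemma chart_near:
 assumes c: "is_chart T c" and m: "m:U" "openin T U"  "m:cdom c"
 obtains d where "d>0" "!!y. y:cmodel c==>dist y (cmap c m)<d==>y:cmap c ` (cdom c\<inter>U)"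
proof -
 have "openin (top_of_set (cmodel c)) (cmap c ` (cdom c\<inter>U))"
  using chartD(1)[OF c] m by (intro openin_cmap_image[OF c]) auto
 moreover have "cmap c m:cmap c ` (cdom c\<inter>U)" using m by blast
 ultimately show ?thesis unfolding openin_top_of_set_ball using that by blast
qed

lemma chart_chain:
 assumes c: "is_chart TM c" and d: "is_chart TN d" and f: "continuous_map TM TN f"
  and m: "m:cdom c" "f m:cdom d"
  and f': "has_fderiv (cmodel c) (cmap d o f o cinv c) f' (cmap c m)"
  and h: "has_fderiv (cmodel d) (h o cinv d) h' (cmap d (f m))"
 shows "has_fderiv (cmodel c) (h o f o cinv c) (%v. h' (f' v)) (cmap c m)"
  and "v:cmodel c==>f' v:cmodel d"
proof -
 have op: "openin TM {x:topspace TM. f x:cdom d}"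
  by (rule openin_continuous_map_preimage[OF f chartD(1)[OF d]])
 have mem: "m:{x:topspace TM. f x:cdom d}" using m chartD(6)[OF c] by auto
 obtain e where e: "e>0" "!!y. y:cmodel c==>dist y (cmap c m)<e ==>
   y:cmap c ` (cdom c\<inter>{x:topspace TM. f x:cdom d})"
  by (fact chart_near[OF c mem op m(1)])
 have fd: "f (cinv c y):cdom d" if "y:cmodel c" "dist y (cmap c m)<e" for y
  using e(2)[OF that] c by auto
 have cm: "subspace (cmodel c)" "cmap c m:cmodel c" "subspace (cmodel d)" "closed (cmodel d)"
  using chartD[OF c] chartD[OF d] cmap_in_cmodel[OF c m(1)] by auto
 have in_d: "(cmap d o f o cinv c) y:cmodel d" if "y:cmodel c" "dist y (cmap c m)<e" for y
  using fd[OF that] cmap_in_cmodel[OF d] by simp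
 have "has_fderiv (cmodel c) (%y. (h o cinv d) ((cmap d o f o cinv c) y)) (%v. h' (f' v)) (cmap c m)"
  by (rule has_fderiv_compose[OF f' cm(1,2) _ cm(3,4) e(1) in_d]) (use h m c in \<open>simp add: o_def\<close>)
 then show "has_fderiv (cmodel c) (h o f o cinv c) (%v. h' (f' v)) (cmap c m)"
  by (rule has_fderiv_cong[OF _ refl cm(1,2) e(1)]) (use fd d in simp)
 show "f' v:cmodel d" if "v:cmodel c"
  by (rule has_fderiv_range[OF f' cm(1,2) that cm(3,4) e(1) in_d])
qed

text \<open>Tangent vectors and differentials need only differentiable chart changes. Products and
  fibre products are therefore verified only up to this weaker notion.\<close>

definition diff_manifold :: "('p, 'm::banach) manifold=>bool" where
 "diff_manifold M\<longleftrightarrow>(ALL c:atlas M. is_chart (mtop M) c)&(\<Union>c\<in>atlas M. cdom c)=mpoints M &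
   (ALL c:atlas M. ALL d:atlas M. ALL m:cdom c\<inter>cdom d.
    EX f'. has_fderiv (cmodel c) (cmap d o cinv c) f' (cmap c m))"

definition diff_map :: "('p, 'm::banach) manifold=>('q, 'n::banach) manifold=>('p=>'q)=>bool" where
 "diff_map M N f\<longleftrightarrow>continuous_map (mtop M) (mtop N) f &
   (ALL c:atlas M. ALL d:atlas N. ALL m:cdom c. f m:cdom d -->
    (EX f'. has_fderiv (cmodel c) (cmap d o f o cinv c) f' (cmap c m)))"

lemma dm_chart: "diff_manifold M==>c:atlas M==>is_chart (mtop M) c"
 by (simp add: diff_manifold_def)

lemma diff_manifold_cover:
 assumes "diff_manifold M" "m:mpoints M" obtains c where "c:atlas M" "m:cdom c"
 using assms unfolding diff_manifold_def by blast

lemma smooth_imp_has_fderiv: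
 assumes "Ck_on k V S f" "1<=k" "subspace V" "openin (top_of_set V) S" "x:S"
 shows "EX f'. has_fderiv V f f' x"
 using Ck_on_imp_C1[OF assms(1-4)] assms(5) unfolding C1_on_def by metis

lemma openin_transition_domain:
 assumes "is_chart T c" "openin T U"
 shows "openin (top_of_set (cmodel c)) (cmap c ` (cdom c\<inter>U))"
 using assms by (intro openin_cmap_image) (auto dest: chartD)

lemma smooth_transition_fderiv:
 assumes "is_chart T c" "is_chart T d" "smooth_transition c d" "m:cdom c" "m:cdom d"
 shows "EX f'. has_fderiv (cmodel c) (cmap d o cinv c) f' (cmap c m)"
 using assms unfolding smooth_transition_def
 by (intro smooth_imp_has_fderiv[of \<infinity> _ "cmap c ` (cdom c\<inter>cdom d)"] openin_transition_domain)
  (auto dest: chartD)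

lemma banach_imp_diff_manifold: "banach_manifold M==>diff_manifold M"
 unfolding banach_manifold_def diff_manifold_def
 by (elim conjE, intro conjI ballI) (auto intro: smooth_transition_fderiv[unfolded comp_def] simp: comp_def)

lemma smooth_imp_diff_map:
 assumes M: "diff_manifold M" and N: "diff_manifold N" and f: "smooth_map M N f"
 shows "diff_map M N f"
 unfolding diff_map_def
proof (intro conjI ballI impI)
 show cf: "continuous_map (mtop M) (mtop N) f" using f by (simp add: smooth_map_def)
 fix c d m assume c: "c:atlas M" and d: "d:atlas N" and m: "m:cdom c" "f m:cdom d"
 note cc=dm_chart[OF M c] and dd=dm_chart[OF N d]
 have "cdom c\<inter>f -` cdom d=cdom c\<inter>{x:mpoints M. f x:cdom d}" using chartD(6)[OF cc] by auto
 then have "openin (top_of_set (cmodel c)) (cmap c ` (cdom c\<inter>f -` cdom d))"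
  using openin_transition_domain[OF cc openin_continuous_map_preimage[OF cf chartD(1)[OF dd]]] by simp
 then show "EX f'. has_fderiv (cmodel c) (cmap d o f o cinv c) f' (cmap c m)"
  using f c d m chartD(2)[OF cc] unfolding smooth_map_def
  by (intro smooth_imp_has_fderiv[of \<infinity> _ "cmap c ` (cdom c\<inter>f -` cdom d)"]) auto
qed

lemma diff_manifold_trans:
 assumes M: "diff_manifold M" and c: "c:atlas M" "m:cdom c" and d: "d:atlas M" "m:cdom d"
 shows "has_fderiv (cmodel c) (cmap d o cinv c) (fderiv (cmodel c) (cmap d o cinv c) (cmap c m)) (cmap c m)"
 using assms has_fderiv_fderiv unfolding diff_manifold_def by blast

lemma diff_manifold_trans_range:
 assumes M: "diff_manifold M" and c: "c:atlas M" "m:cdom c" and d: "d:atlas M" "m:cdom d"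
  and v: "v:cmodel c"
 shows "fderiv (cmodel c) (cmap d o cinv c) (cmap c m) v:cmodel d"
proof -
 note cc=dm_chart[OF M c(1)] and dd=dm_chart[OF M d(1)]
 have *: "has_fderiv (cmodel c) (cmap d o id o cinv c) (fderiv (cmodel c) (cmap d o cinv c) (cmap c m)) (cmap c m)"
  using diff_manifold_trans[OF M c d] by simp
 have "has_fderiv (cmodel d) (cmap d o cinv d) (fderiv (cmodel d) (cmap d o cinv d) (cmap d (id m))) (cmap d (id m))"
  using diff_manifold_trans[OF M d d] by simp
 from chart_chain(2)[OF cc dd continuous_map_id c(2) _ * this v] d show ?thesis by simp
qed

lemma fderiv_chain:
 assumes M: "diff_manifold M" and c: "c:atlas M" "m:cdom c" and d: "d:atlas M" "m:cdom d"
  and h: "has_fderiv (cmodel d) (h o cinv d) h' (cmap d m)" and v: "v:cmodel c"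
 shows "has_fderiv (cmodel c) (h o cinv c) (%v. h' (fderiv (cmodel c) (cmap d o cinv c) (cmap c m) v)) (cmap c m)"
  and "fderiv (cmodel c) (h o cinv c) (cmap c m) v=fderiv (cmodel d) (h o cinv d) (cmap d m) (fderiv (cmodel c) (cmap d o cinv c) (cmap c m) v)"
proof -
 note cc=dm_chart[OF M c(1)] and dd=dm_chart[OF M d(1)]
 have *: "has_fderiv (cmodel c) (cmap d o id o cinv c) (fderiv (cmodel c) (cmap d o cinv c) (cmap c m)) (cmap c m)"
  using diff_manifold_trans[OF M c d] by simp
 show 1: "has_fderiv (cmodel c) (h o cinv c) (%v. h' (fderiv (cmodel c) (cmap d o cinv c) (cmap c m) v)) (cmap c m)"
  using chart_chain(1)[OF cc dd continuous_map_id c(2) _ *, of h h'] h d by simp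
 show "fderiv (cmodel c) (h o cinv c) (cmap c m) v=fderiv (cmodel d) (h o cinv d) (cmap d m) (fderiv (cmodel c) (cmap d o cinv c) (cmap c m) v)"
  using fderiv_eq[OF 1 _ _ v] fderiv_eq[OF h _ _ diff_manifold_trans_range[OF M c d v]]
   chartD(2)[OF cc] chartD(2)[OF dd] cmap_in_cmodel[OF cc c(2)] cmap_in_cmodel[OF dd d(2)] by simp
qed

section \<open>Tangent vectors and differentials in charts\<close>

lemma tvec_iff: "(d, w):tvec M m c v\<longleftrightarrow>d:atlas M&m:cdom d&w=fderiv (cmodel c) (cmap d o cinv c) (cmap c m) v"
 by (auto simp: tvec_def)

lemma tvec_change:
 assumes M: "diff_manifold M" and c: "c:atlas M" "m:cdom c" and d: "d:atlas M" "m:cdom d"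
  and v: "v:cmodel c"
 shows "tvec M m c v=tvec M m d (fderiv (cmodel c) (cmap d o cinv c) (cmap c m) v)"
proof -
 have "(e, w):tvec M m c v\<longleftrightarrow>(e, w):tvec M m d (fderiv (cmodel c) (cmap d o cinv c) (cmap c m) v)" for e w
 proof (cases "e:atlas M&m:cdom e")
  case True
  then show ?thesis
   using fderiv_chain(2)[OF M c d diff_manifold_trans[OF M d, of e] v] by (simp add: tvec_iff)
 qed (auto simp: tvec_iff)
 then show ?thesis by auto
qed

lemma fderiv_self:
 assumes c: "is_chart T c" "m:cdom c" and v: "v:cmodel c"
 shows "fderiv (cmodel c) (cmap c o cinv c) (cmap c m) v=v"
proof -
 obtain e where e: "e>0" "!!y. y:cmodel c==>dist y (cmap c m)<e==>y:cmap c ` cdom c"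
  using chart_near[OF c(1,2) _ c(2)] chartD(1)[OF c(1)] by auto
 have "has_fderiv (cmodel c) (%x. x) (%v. v) (cmap c m)"
  unfolding has_fderiv_iff blinear_on_def by (auto intro: exI[of _ 1])
 then have "has_fderiv (cmodel c) (cmap c o cinv c) (%v. v) (cmap c m)"
  using chartD[OF c(1)] cmap_in_cmodel[OF c] e
  by (rule_tac has_fderiv_cong[OF _ refl _ _ e(1)]) (auto simp: c cmap_cinv)
 then show ?thesis using fderiv_eq chartD[OF c(1)] cmap_in_cmodel[OF c] v by fastforce
qed

lemma tvec_self: "diff_manifold M==>c:atlas M==>m:cdom c==>v:cmodel c==>(c, v):tvec M m c v"
 unfolding tvec_iff using fderiv_self[OF dm_chart] by metis

lemma tvec_inject:
 assumes "diff_manifold M" "c:atlas M" "m:cdom c" "v:cmodel c" "w:cmodel c"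
 shows "tvec M m c v=tvec M m c w\<longleftrightarrow>v=w"
 using tvec_self[OF assms(1-3)] assms(4,5) fderiv_self[OF dm_chart[OF assms(1,2)] assms(3)]
 by (metis tvec_iff)

lemma tangent_space_eq:
 assumes M: "diff_manifold M" and c: "c:atlas M" "m:cdom c"
 shows "tangent_space M m=tvec M m c ` cmodel c"
 using tvec_change[OF M _ _ c] diff_manifold_trans_range[OF M _ _ c] c
 by (fastforce simp: tangent_space_def)

lemma tzero_eq:
 assumes M: "diff_manifold M" and c: "c:atlas M" "m:cdom c"
 shows "tzero M m=tvec M m c 0"
proof -
 have "fderiv (cmodel c) (cmap d o cinv c) (cmap c m) 0=0" if "d:atlas M" "m:cdom d" for d
  using blinear_on_zero[OF has_fderiv_linear[OF diff_manifold_trans[OF M c that]]]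
   chartD(2)[OF dm_chart[OF M c(1)]] by simp
 then show ?thesis by (auto simp: tzero_def tvec_def)
qed

text \<open>The set defining \<open>mdiff\<close> ranges over all representatives of the tangent
  vector and all target charts. The chain rule shows that they agree, so one chart on either side
  determines the result; all later computations go through this form.\<close>

lemma mdiff_tvec:
 assumes M: "diff_manifold M" and N: "diff_manifold N" and f: "diff_map M N f"
  and c: "c:atlas M" "m:cdom c" and d: "d:atlas N" "f m:cdom d" and v: "v:cmodel c"
 shows "mdiff M N f m (tvec M m c v)=tvec N (f m) d (fderiv (cmodel c) (cmap d o f o cinv c) (cmap c m) v)"
proof -
 have fd: "has_fderiv (cmodel c') (cmap d' o f o cinv c') (fderiv (cmodel c') (cmap d' o f o cinv c') (cmap c' m)) (cmap c' m)"
  if "c':atlas M" "m:cdom c'" "d':atlas N" "f m:cdom d'" for c' d'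
  using f that has_fderiv_fderiv unfolding diff_map_def by blast
 have cf: "continuous_map (mtop M) (mtop N) f" using f by (simp add: diff_map_def)
 have "(d', w):mdiff M N f m (tvec M m c v) \<longleftrightarrow>
   (d', w):tvec N (f m) d (fderiv (cmodel c) (cmap d o f o cinv c) (cmap c m) v)" for d' w
 proof (cases "d':atlas N&f m:cdom d'")
  case True
  then have d': "d':atlas N" "f m:cdom d'" by auto
  note cc=dm_chart[OF M c(1)] and dd=dm_chart[OF N d(1)]
  have 1: "fderiv (cmodel c') (cmap d' o f o cinv c') (cmap c' m) v'=fderiv (cmodel c) (cmap d' o f o cinv c) (cmap c m) v"
   if "(c', v'):tvec M m c v" for c' v'
   using that fderiv_chain(2)[OF M c, of c' "cmap d' o f", OF _ _ _ v] fd[OF _ _ d', of c']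
   by (auto simp: tvec_iff)
  have 2: "fderiv (cmodel c) (cmap d' o f o cinv c) (cmap c m) v =
    fderiv (cmodel d) (cmap d' o cinv d) (cmap d (f m)) (fderiv (cmodel c) (cmap d o f o cinv c) (cmap c m) v)"
   by (rule fderiv_eq[OF chart_chain(1)[OF cc dd cf c(2) d(2) fd[OF c d] diff_manifold_trans[OF N d d']]
      chartD(2)[OF cc] cmap_in_cmodel[OF cc c(2)] v])
  have "(EX (c', v'):tvec M m c v. w=fderiv (cmodel c') (cmap d' o f o cinv c') (cmap c' m) v') \<longleftrightarrow>
    w=fderiv (cmodel c) (cmap d' o f o cinv c) (cmap c m) v"
   using 1 tvec_self[OF M c v] by blast
  then show ?thesis
   using 2 d' by (simp add: mdiff_def tvec_iff)
 next
  case False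
  then show ?thesis by (auto simp: mdiff_def tvec_iff)
 qed
 then show ?thesis by auto
qed

lemma rdiff_tvec:
 assumes M: "diff_manifold M" and c: "c:atlas M" "m:cdom c" and v: "v:cmodel c"
  and F: "!!c. c:atlas M==>m:cdom c==>EX F'. has_fderiv (cmodel c) (F o cinv c) F' (cmap c m)"
 shows "rdiff F m (tvec M m c v)=fderiv (cmodel c) (F o cinv c) (cmap c m) v"
proof -
 have 1: "fderiv (cmodel c') (F o cinv c') (cmap c' m) v'=fderiv (cmodel c) (F o cinv c) (cmap c m) v"
  if cv: "(c', v'):tvec M m c v" for c' v'
 proof -
  have c': "c':atlas M" "m:cdom c'" and v': "v'=fderiv (cmodel c) (cmap c' o cinv c) (cmap c m) v"
   using cv by (auto simp: tvec_iff)
  obtain F' where "has_fderiv (cmodel c') (F o cinv c') F' (cmap c' m)" using F[OF c'] by blast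
  from fderiv_chain(2)[OF M c c' this v] show ?thesis by (simp add: v')
 qed
 show ?thesis
  unfolding rdiff_def
 proof (rule the_equality)
  show "EX (c', v'):tvec M m c v. fderiv (cmodel c) (F o cinv c) (cmap c m) v=fderiv (cmodel c') (F o cinv c') (cmap c' m) v'"
   by (rule bexI[OF _ tvec_self[OF M c v]]) simp
 next
  fix s assume "EX (c', v'):tvec M m c v. s=fderiv (cmodel c') (F o cinv c') (cmap c' m) v'"
  then show "s=fderiv (cmodel c) (F o cinv c) (cmap c m) v" using 1 by fast
 qed
qed

section \<open>Product charts\<close>

definition fvec :: "nat=>(nat=>'a::real_normed_vector)=>(nat \<Rightarrow>\<^sub>C 'a)" where
 "fvec r f=Bcontfun (%i. if i<r then f i else 0)"

definition vmodel :: "nat=>(nat=>'a::real_normed_vector set)=>(nat \<Rightarrow>\<^sub>C 'a) set" where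
 "vmodel r V={v. ALL i. if i<r then apply_bcontfun v i:V i else apply_bcontfun v i=0}"

lemma apply_fvec [simp]: "apply_bcontfun (fvec r f) i=(if i<r then f i else 0)"
proof -
 have "bounded (range (%i. if i<r then f i else 0))"
 proof (rule bounded_subset)
  show "range (%i. if i<r then f i else 0)<=insert 0 (f ` {..<r})" by auto
 qed (simp add: finite_imp_bounded)
 then have "(%i. if i<r then f i else 0):bcontfun" by (simp add: bcontfun_def)
 then show ?thesis by (simp add: fvec_def Bcontfun_inverse)
qed

lemma bounded_linear_eval: "bounded_linear (%v. apply_bcontfun v i)"
 by (rule bounded_linear_intro[where K=1]) (auto simp: norm_bounded)

lemma norm_fvec_le: "b>=0==>(!!i. i<r==>norm (f i)<=b)==>norm (fvec r f)<=b"
proof (rule norm_bound)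
 fix i assume b: "b>=0" "!!i. i<r==>norm (f i)<=b"
 show "norm (apply_bcontfun (fvec r f) i)<=b" using b(1) b(2)[of i] by (cases "i<r") auto
qed

lemma vmodel_iff: "v:vmodel r V\<longleftrightarrow>(ALL i<r. apply_bcontfun v i:V i)&(ALL i>=r. apply_bcontfun v i=0)"
 unfolding vmodel_def mem_Collect_eq by (metis linorder_not_le)

lemma fvec_eval: "v:vmodel r V==>fvec r (%i. apply_bcontfun v i)=v"
 by (rule bcontfun_eqI) (auto simp: vmodel_iff)

lemma fvec_in_vmodel [simp]: "fvec r f:vmodel r V\<longleftrightarrow>(ALL i<r. f i:V i)"
 by (auto simp: vmodel_iff)

lemma subspace_vmodel: "(!!i. i<r==>subspace (V i))==>subspace (vmodel r V)"
 by (rule subspaceI) (auto simp: vmodel_iff subspace_0 subspace_add subspace_scale)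

lemma closed_eval_vimage:
 fixes S :: "'a::real_normed_vector set"
 shows "closed S==>closed {v. apply_bcontfun v i:S}"
 using closed_vimage[OF _ linear_continuous_on[OF bounded_linear_eval], of S i] by (simp add: vimage_def)

lemma closed_vmodel:
 assumes "!!i. i<r==>closed (V i)" shows "closed (vmodel r V)"
proof -
 have "vmodel r V=(\<Inter>i. {v. apply_bcontfun v i:(if i<r then V i else {0})})"
 proof -
  have "apply_bcontfun v i:(if i<r then V i else {0}) \<longleftrightarrow>
    (if i<r then apply_bcontfun v i:V i else apply_bcontfun v i=0)" for v i by simp
  then show ?thesis by (simp only: vmodel_def) blast
 qed
 then show ?thesis using assms by (auto intro!: closed_INT closed_eval_vimage)
qed

lemma openin_vmodel:
 assumes "!!i. i<r==>openin (top_of_set (V i)) (S i)"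
 shows "openin (top_of_set (vmodel r V)) {v:vmodel r V. ALL i<r. apply_bcontfun v i:S i}"
 unfolding openin_top_of_set_ball
proof (intro conjI ballI)
 fix v assume v: "v:{v:vmodel r V. ALL i<r. apply_bcontfun v i:S i}"
 have "EX d>0. ALL y:V i. dist y (apply_bcontfun v i)<d-->y:S i" if "i<r" for i
  using assms[OF that] v that unfolding openin_top_of_set_ball by blast
 then obtain d where d: "!!i. i<r==>d i>0"
  "!!i y. i<r==>y:V i==>dist y (apply_bcontfun v i)<d i==>y:S i" by metis
 define m where "m=Min (insert 1 (d ` {..<r}))"
 have m: "m>0" "!!i. i<r==>m<=d i" using d(1) by (auto simp: m_def)
 have "apply_bcontfun y i:S i" if "y:vmodel r V" "dist y v<m" "i<r" for y i
  using d(2)[of i "apply_bcontfun y i"] that m(2)[of i] dist_bounded[of y i v] by (auto simp: vmodel_iff)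
 then show "EX d>0. ALL y:vmodel r V. dist y v<d-->y:{v:vmodel r V. ALL i<r. apply_bcontfun v i:S i}"
  using m(1) by (intro exI[of _ m]) auto
qed auto

lemma prod_list_eval_le: "prod_list (map norm (map (%w. apply_bcontfun w i) ws))<=prod_list (map norm ws)"
 by (induction ws) (auto intro!: mult_mono norm_bounded prod_list_norm_nonneg simp: comp_def simp flip: map_map)

text \<open>The tower is built coordinate by coordinate: evaluation at \<open>i\<close> does not
  increase norms, so it can be moved through arguments and values. For finitely many coordinates,
  bounds are added and radii minimised.\<close>

theorem Ck_on_fvec:
 fixes V :: "nat=>'a::real_normed_vector set" and kap :: "nat=>'a=>'b::real_normed_vector"
 assumes V: "!!i. i<r==>subspace (V i)" and S: "!!i. i<r==>openin (top_of_set (V i)) (S i)"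
  and kap: "!!i. i<r==>Ck_on \<infinity> (V i) (S i) (kap i)"
 shows "Ck_on \<infinity> (vmodel r V) {v:vmodel r V. ALL i<r. apply_bcontfun v i:S i}
  (%v. fvec r (%i. kap i (apply_bcontfun v i)))"
proof -
 let ?V="vmodel r V" and ?S="{v:vmodel r V. ALL i<r. apply_bcontfun v i:S i}"
 have "EX D. (ALL x:S i. D 0 x []=kap i x)&(ALL j. fdiff (V i) (S i) (replicate j (V i)) UNIV (D j) (D (Suc j)))"
  if "i<r" for i
  using Ck_on_imp_fdiff[OF kap[OF that] V[OF that] S[OF that] subspace_UNIV closed_UNIV] by (metis subset_UNIV)
 then obtain D where D: "!!i x. i<r==>x:S i==>D i 0 x []=kap i x"
  "!!i j. i<r==>fdiff (V i) (S i) (replicate j (V i)) UNIV (D i j) (D i (Suc j))"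
  by metis
 define DD where "DD=(%j v ws. fvec r (%i. D i j (apply_bcontfun v i) (map (%w. apply_bcontfun w i) ws)))"
 have ev: "map (%w. apply_bcontfun w i) ws:tup (replicate j (V i))" if "ws:tup (replicate j ?V)" "i<r" for ws i j
  using that by (auto simp: tup_replicate tuples_def vmodel_iff subset_iff)
 have m: "mlin (replicate j (V i)) UNIV (D i j x)" if "i<r" "x:S i" for i j x
  using D(2)[OF that(1), of j] that(2) by (simp add: fdiff_def)
 have M: "mlin (replicate j ?V) UNIV (DD j x)" if x: "x:?S" for j x
  unfolding mlin_def
 proof (intro conjI ballI allI impI)
  fix ws k u v a assume ws: "ws:tup (replicate j ?V)" and k: "k<length (replicate j ?V)"
   and uv: "u:replicate j ?V ! k" "v:replicate j ?V ! k"
  show "DD j x (ws[k := a *\<^sub>R u + v])=a *\<^sub>R DD j x (ws[k := u]) + DD j x (ws[k := v])"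
  proof (rule bcontfun_eqI)
   fix i show "apply_bcontfun (DD j x (ws[k := a *\<^sub>R u + v])) i =
     apply_bcontfun (a *\<^sub>R DD j x (ws[k := u]) + DD j x (ws[k := v])) i"
    using mlin_update[OF m[of i "apply_bcontfun x i" j] ev[OF ws, of i], of k "apply_bcontfun u i" "apply_bcontfun v i" a] k uv x
    by (cases "i<r") (auto simp: DD_def map_update vmodel_iff)
  qed
 next
  have "EX b>=0. form_le (replicate j (V i)) (D i j (apply_bcontfun x i)) b" if "i<r" for i
   using mlin_bound[OF m] that x by blast
  then obtain b where b: "!!i. i<r==>b i>=0" "!!i. i<r==>form_le (replicate j (V i)) (D i j (apply_bcontfun x i)) (b i)"
   by metis
  have b0: "0<=(\<Sum>i<r. b i)" using b(1) by (intro sum_nonneg) auto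
  have "form_le (replicate j ?V) (DD j x) (\<Sum>i<r. b i)"
   unfolding form_le_def DD_def
  proof (intro ballI norm_fvec_le)
   fix ws i assume ws: "ws:tup (replicate j ?V)" and i: "i<r"
   have "norm (D i j (apply_bcontfun x i) (map (%w. apply_bcontfun w i) ws))<=b i * prod_list (map norm (map (%w. apply_bcontfun w i) ws))"
    by (rule form_leD[OF b(2)[OF i] ev[OF ws i]])
   also have "...<=(\<Sum>i<r. b i) * prod_list (map norm ws)"
    using i b(1) b0 by (intro mult_mono prod_list_eval_le prod_list_norm_nonneg member_le_sum) auto
   finally show "norm (D i j (apply_bcontfun x i) (map (%w. apply_bcontfun w i) ws))<=(\<Sum>i<r. b i) * prod_list (map norm ws)" .
  qed (use b0 in \<open>simp add: prod_list_norm_nonneg\<close>)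
  then show "EX b>=0. form_le (replicate j ?V) (DD j x) b" using b0 by blast
 qed simp
 have "fdiff ?V ?S (replicate j ?V) UNIV (DD j) (DD (Suc j))" for j
  unfolding fdiff_def
 proof (intro ballI conjI allI impI)
  fix x assume x: "x:?S"
  show "mlin (replicate j ?V) UNIV (DD j x)" by (rule M[OF x])
  show "mlin (?V # replicate j ?V) UNIV (DD (Suc j) x)" using M[OF x, of "Suc j"] by simp
  fix e :: real assume e: "e>0"
  define near where "near=(%i d. d>0&(ALL y:S i. dist y (apply_bcontfun x i)<d-->form_le (replicate j (V i))
    (%vs. D i j y vs - D i j (apply_bcontfun x i) vs - D i (Suc j) (apply_bcontfun x i) ((y - apply_bcontfun x i) # vs))
    (e * norm (y - apply_bcontfun x i))))"
  have "EX d. near i d" if "i<r" for i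
   using D(2)[OF that, of j] x that e unfolding fdiff_def near_def by blast
  then obtain d where nd: "!!i. i<r==>near i (d i)" by metis
  then have d: "!!i. i<r==>d i>0" by (simp add: near_def)
  define m where "m=Min (insert 1 (d ` {..<r}))"
  have m: "m>0" "!!i. i<r==>m<=d i" using d by (auto simp: m_def)
  have "form_le (replicate j ?V) (%vs. DD j y vs - DD j x vs - DD (Suc j) x ((y - x) # vs)) (e * norm (y - x))"
   if y: "y:?S" "dist y x<m" for y
   unfolding form_le_def
  proof (intro ballI norm_bound)
   fix ws i assume ws: "ws:tup (replicate j ?V)"
   let ?ws="map (%w. apply_bcontfun w i) ws"
   show "norm (apply_bcontfun (DD j y ws - DD j x ws - DD (Suc j) x ((y - x) # ws)) i)<=e * norm (y - x) * prod_list (map norm ws)"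
   proof (cases "i<r")
    case True
    have "dist (apply_bcontfun y i) (apply_bcontfun x i)<d i"
     using dist_bounded[of y i x] y(2) m(2)[OF True] by linarith
    then have "form_le (replicate j (V i))
     (%vs. D i j (apply_bcontfun y i) vs - D i j (apply_bcontfun x i) vs - D i (Suc j) (apply_bcontfun x i) ((apply_bcontfun y i - apply_bcontfun x i) # vs))
     (e * norm (apply_bcontfun y i - apply_bcontfun x i))"
     using nd[OF True] y(1) True unfolding near_def by blast
    from form_leD[OF this ev[OF ws True]]
    have "norm (apply_bcontfun (DD j y ws - DD j x ws - DD (Suc j) x ((y - x) # ws)) i)
      <= e * norm (apply_bcontfun y i - apply_bcontfun x i) * prod_list (map norm ?ws)"
     using True by (simp add: DD_def comp_def)
    also have "...<=e * norm (y - x) * prod_list (map norm ws)"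
     using norm_bounded[of "y - x" i] e
     by (intro mult_mono prod_list_eval_le prod_list_norm_nonneg) auto
    finally show ?thesis .
   qed (use e in \<open>simp add: DD_def prod_list_norm_nonneg\<close>)
  qed
  then show "EX d>0. ALL y:?S. dist y x<d-->form_le (replicate j ?V)
    (%vs. DD j y vs - DD j x vs - DD (Suc j) x ((y - x) # vs)) (e * norm (y - x))" using m(1) by blast
 qed
 then show ?thesis
 proof (rule fdiff_imp_Ck_on)
  fix x assume "x:?S"
  then show "DD 0 x []=fvec r (%i. kap i (apply_bcontfun x i))"
   by (intro bcontfun_eqI) (auto simp: DD_def D(1))
 qed (use subspace_vmodel[of r V] V in auto)
qed

lemma prod_chart_sel:
 "cdom (prod_chart r c)=(\<Pi>\<^sub>E i\<in>{..<r}. cdom (c i))"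
 "cmap (prod_chart r c)=(%u. fvec r (%i. cmap (c i) (u i)))"
 "cmodel (prod_chart r c)=vmodel r (%i. cmodel (c i))"
 by (simp_all add: prod_chart_def fvec_def vmodel_def)

lemma prod_chart_image:
 assumes c: "!!i. i<r==>is_chart T (c i)" and A: "!!i. i<r==>A i<=cdom (c i)"
 shows "cmap (prod_chart r c) ` (\<Pi>\<^sub>E i\<in>{..<r}. A i) =
  {v:vmodel r (%i. cmodel (c i)). ALL i<r. apply_bcontfun v i:cmap (c i) ` A i}"
proof (intro equalityI subsetI)
 fix v assume "v:cmap (prod_chart r c) ` (\<Pi>\<^sub>E i\<in>{..<r}. A i)"
 then obtain u where "u:(\<Pi>\<^sub>E i\<in>{..<r}. A i)" "v=fvec r (%i. cmap (c i) (u i))"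
  by (auto simp: prod_chart_sel)
 then show "v:{v:vmodel r (%i. cmodel (c i)). ALL i<r. apply_bcontfun v i:cmap (c i) ` A i}"
  using A c by (auto simp: PiE_iff intro!: cmap_in_cmodel)
next
 fix v assume v: "v:{v:vmodel r (%i. cmodel (c i)). ALL i<r. apply_bcontfun v i:cmap (c i) ` A i}"
 then have "ALL i. EX m. i<r-->m:A i&apply_bcontfun v i=cmap (c i) m" by blast
 then obtain u where u: "!!i. i<r==>u i:A i&apply_bcontfun v i=cmap (c i) (u i)" by metis
 have "v=cmap (prod_chart r c) (restrict u {..<r})"
  using v u by (intro bcontfun_eqI) (auto simp: prod_chart_sel vmodel_iff)
 then show "v:cmap (prod_chart r c) ` (\<Pi>\<^sub>E i\<in>{..<r}. A i)" using u by auto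
qed

lemma continuous_map_fvec:
 assumes "!!i. i<r==>continuous_map X euclidean (%x. f x i)"
 shows "continuous_map X euclidean (%x. fvec r (f x))"
proof -
 define emb where "emb=(%i (x::'b). fvec r (%j. if j=i then x else 0))"
 have emb: "bounded_linear (emb i)" for i
  by (rule bounded_linear_intro[where K=1]) (auto simp: emb_def intro!: bcontfun_eqI norm_fvec_le)
 have "fvec r (f x)=(\<Sum>i<r. emb i (f x i))" for x
 proof (rule bcontfun_eqI)
  fix j
  have "apply_bcontfun (\<Sum>i<r. emb i (f x i)) j=(\<Sum>i<r. apply_bcontfun (emb i (f x i)) j)"
   by (rule linear_sum[OF bounded_linear.linear[OF bounded_linear_eval]])
  also have "...=apply_bcontfun (fvec r (f x)) j"
   by (cases "j<r") (simp_all add: emb_def)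
  finally show "apply_bcontfun (fvec r (f x)) j=apply_bcontfun (\<Sum>i<r. emb i (f x i)) j" by simp
 qed
 moreover have "continuous_map X euclidean (%x. emb i (f x i))" if "i<r" for i
  using continuous_map_compose[OF assms[OF that], of euclidean "emb i"] linear_continuous_on[OF emb, of UNIV i]
  by (simp add: comp_def)
 ultimately show ?thesis by (auto intro!: continuous_map_sum)
qed

lemma is_chart_prod:
 assumes c: "!!i. i<r==>is_chart T (c i)"
 shows "is_chart (product_topology (%_. T) {..<r}) (prod_chart r c)"
proof -
 let ?P="product_topology (%_. T) {..<r}" and ?D="\<Pi>\<^sub>E i\<in>{..<r}. cdom (c i)"
 let ?I="{v:vmodel r (%i. cmodel (c i)). ALL i<r. apply_bcontfun v i:cmap (c i) ` cdom (c i)}"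
 have img: "cmap (prod_chart r c) ` ?D=?I" by (rule prod_chart_image[OF c]) auto
 have 1: "openin ?P ?D" using c chartD(1) by (auto simp: openin_PiE_gen)
 have 2: "subspace (cmodel (prod_chart r c))" "closed (cmodel (prod_chart r c))"
  using chartD(2,3)[OF c] by (auto simp: prod_chart_sel intro!: subspace_vmodel closed_vmodel)
 have 3: "openin (top_of_set (vmodel r (%i. cmodel (c i)))) ?I"
  using c chartD(4) by (intro openin_vmodel) auto
 have f1: "continuous_map (subtopology ?P ?D) euclidean (%u. fvec r (%i. cmap (c i) (u i)))"
 proof (rule continuous_map_fvec)
  fix i assume i: "i<r"
  have "continuous_map (subtopology ?P ?D) (subtopology T (cdom (c i))) (%u. u i)"
   using i by (intro continuous_map_into_subtopology continuous_map_from_subtopology continuous_map_product_projection) auto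
  from continuous_map_compose[OF this continuous_map_cmap[OF c[OF i]]]
  show "continuous_map (subtopology ?P ?D) euclidean (%u. cmap (c i) (u i))"
   by (simp add: comp_def continuous_map_in_subtopology)
 qed
 have f: "continuous_map (subtopology ?P ?D) (top_of_set ?I) (cmap (prod_chart r c))"
  using f1 img by (auto simp: continuous_map_in_subtopology prod_chart_sel)
 define G where "G=(%v. \<lambda>i\<in>{..<r}. cinv (c i) (apply_bcontfun v i))"
 have g: "continuous_map (top_of_set ?I) (subtopology ?P ?D) G"
 proof (rule continuous_map_into_subtopology)
  show "G:topspace (top_of_set ?I) \<rightarrow> ?D"
   unfolding G_def by (intro Pi_I restrict_PiE_iff[THEN iffD2] ballI cinv_in) auto
  show "continuous_map (top_of_set ?I) ?P G"
   unfolding continuous_map_componentwise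
  proof (intro conjI ballI)
   fix i assume "i:{..<r}"
   then have i: "i<r" by simp
   have "continuous_map (top_of_set ?I) (top_of_set (cmap (c i) ` cdom (c i))) (%v. apply_bcontfun v i)"
    using i linear_continuous_on[OF bounded_linear_eval] by (auto simp: continuous_map_in_subtopology)
   from continuous_map_compose[OF this continuous_map_cinv[OF c[OF i]]]
   show "continuous_map (top_of_set ?I) T (%v. G v i)" using i by (simp add: G_def comp_def)
  qed (unfold G_def, rule image_subsetI, rule restrict_extensional)
 qed
 have "homeomorphic_maps (subtopology ?P ?D) (top_of_set ?I) (cmap (prod_chart r c)) G"
  unfolding homeomorphic_maps_def
 proof (intro conjI f g ballI)
  fix u assume "u:topspace (subtopology ?P ?D)"
  then have u: "u:?D" by simp
  show "G (cmap (prod_chart r c) u)=u"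
  proof (rule ext)
   fix i show "G (cmap (prod_chart r c) u) i=u i"
    using u cinv_cmap[OF c, of i "u i"] by (cases "i<r") (auto simp: G_def prod_chart_sel PiE_iff extensional_def)
  qed
 next
  fix v assume "v:topspace (top_of_set ?I)"
  then show "cmap (prod_chart r c) (G v)=v"
   by (intro bcontfun_eqI) (auto simp: G_def prod_chart_sel cmap_cinv vmodel_iff)
 qed
 then have "homeomorphic_map (subtopology ?P ?D) (top_of_set ?I) (cmap (prod_chart r c))"
  by (rule homeomorphic_maps_imp_map)
 then show ?thesis
  unfolding is_chart_def using 1 2 3 img by (simp add: prod_chart_sel(1,3))
qed

lemma cinv_prod_chart:
 assumes c: "!!i. i<r==>is_chart T (c i)" and v: "v:cmap (prod_chart r c) ` cdom (prod_chart r c)" and i: "i<r"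
 shows "cinv (prod_chart r c) v i=cinv (c i) (apply_bcontfun v i)"
proof -
 obtain u where u: "u:cdom (prod_chart r c)" "v=cmap (prod_chart r c) u" using v by blast
 then have "cinv (prod_chart r c) v=u" using cinv_cmap[OF is_chart_prod[OF c]] by simp
 moreover have "cinv (c i) (apply_bcontfun v i)=u i" using u i cinv_cmap[OF c[OF i], of "u i"] by (simp add: prod_chart_sel PiE_iff)
 ultimately show ?thesis by simp
qed

lemma smooth_transition_prod:
 assumes c: "!!i. i<r==>is_chart T (c i)" and d: "!!i. i<r==>is_chart T (d i)"
  and s: "!!i. i<r==>smooth_transition (c i) (d i)"
 shows "smooth_transition (prod_chart r c) (prod_chart r d)"
 unfolding smooth_transition_def
proof -
 let ?S="%i. cmap (c i) ` (cdom (c i)\<inter>cdom (d i))"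
 have dom: "cdom (prod_chart r c)\<inter>cdom (prod_chart r d)=(\<Pi>\<^sub>E i\<in>{..<r}. cdom (c i)\<inter>cdom (d i))"
  by (auto simp: prod_chart_sel PiE_iff)
 have img: "cmap (prod_chart r c) ` (cdom (prod_chart r c)\<inter>cdom (prod_chart r d)) =
   {v:vmodel r (%i. cmodel (c i)). ALL i<r. apply_bcontfun v i:?S i}"
  unfolding dom by (rule prod_chart_image[OF c]) auto
 have "Ck_on \<infinity> (vmodel r (%i. cmodel (c i))) {v:vmodel r (%i. cmodel (c i)). ALL i<r. apply_bcontfun v i:?S i}
   (%v. fvec r (%i. (cmap (d i) o cinv (c i)) (apply_bcontfun v i)))"
 proof (rule Ck_on_fvec)
  fix i assume i: "i<r"
  show "subspace (cmodel (c i))" using chartD(2)[OF c[OF i]] .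
  show "openin (top_of_set (cmodel (c i))) (?S i)"
   by (rule openin_transition_domain[OF c[OF i] chartD(1)[OF d[OF i]]])
  show "Ck_on \<infinity> (cmodel (c i)) (?S i) (cmap (d i) o cinv (c i))"
   using s[OF i] by (simp add: smooth_transition_def)
 qed
 then show "Ck_on \<infinity> (cmodel (prod_chart r c)) (cmap (prod_chart r c) ` (cdom (prod_chart r c)\<inter>cdom (prod_chart r d)))
   (cmap (prod_chart r d) o cinv (prod_chart r c))"
  unfolding img prod_chart_sel(3)
 proof (rule Ck_on_cong)
  fix v assume "v:{v:vmodel r (%i. cmodel (c i)). ALL i<r. apply_bcontfun v i:?S i}"
  then have "v:cmap (prod_chart r c) ` cdom (prod_chart r c)" unfolding img[symmetric] by blast
  then show "fvec r (%i. (cmap (d i) o cinv (c i)) (apply_bcontfun v i))=(cmap (prod_chart r d) o cinv (prod_chart r c)) v"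
   using cinv_prod_chart[OF c] by (intro bcontfun_eqI) (simp add: prod_chart_sel(2))
 qed
qed

lemma mtop_prod_manifold: "mtop (prod_manifold r M)=product_topology (%_. mtop M) {..<r}"
 by (simp add: prod_manifold_def)

lemma atlas_prod_manifold: "atlas (prod_manifold r M)={prod_chart r c | c. ALL i<r. c i:atlas M}"
 by (simp add: prod_manifold_def)

lemma diff_manifold_prod:
 assumes M: "banach_manifold M" shows "diff_manifold (prod_manifold r M)"
 unfolding diff_manifold_def
proof (intro conjI ballI)
 have ch: "is_chart (mtop M) c" if "c:atlas M" for c using M that by (auto simp: banach_manifold_def)
 show chart: "is_chart (mtop (prod_manifold r M)) c" if "c:atlas (prod_manifold r M)" for c
  using that ch by (auto simp: mtop_prod_manifold atlas_prod_manifold intro!: is_chart_prod)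
 show "(\<Union>c\<in>atlas (prod_manifold r M). cdom c)=mpoints (prod_manifold r M)"
 proof (intro equalityI subsetI)
  fix u assume "u:(\<Union>c\<in>atlas (prod_manifold r M). cdom c)"
  then show "u:mpoints (prod_manifold r M)" using chart chartD(6) by blast
 next
  fix u assume "u:mpoints (prod_manifold r M)"
  then have u: "u:(\<Pi>\<^sub>E i\<in>{..<r}. mpoints M)" by (simp add: mtop_prod_manifold)
  then have "ALL i. EX c. i<r-->c:atlas M&u i:cdom c"
   using diff_manifold_cover[OF banach_imp_diff_manifold[OF M]] by (metis PiE_mem lessThan_iff)
  then obtain c where c: "!!i. i<r==>c i:atlas M&u i:cdom (c i)" by metis
  then have "u:cdom (prod_chart r c)" using u by (auto simp: prod_chart_sel PiE_iff)
  moreover have "prod_chart r c:atlas (prod_manifold r M)" using c by (auto simp: atlas_prod_manifold)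
  ultimately show "u:(\<Union>c\<in>atlas (prod_manifold r M). cdom c)" by blast
 qed
 fix c d u assume cd: "c:atlas (prod_manifold r M)" "d:atlas (prod_manifold r M)" and u: "u:cdom c\<inter>cdom d"
 obtain c' d' where c': "c=prod_chart r c'" "ALL i<r. c' i:atlas M" and d': "d=prod_chart r d'" "ALL i<r. d' i:atlas M"
  using cd by (auto simp: atlas_prod_manifold)
 have "smooth_transition c d"
  unfolding c'(1) d'(1) using M c'(2) d'(2) ch
  by (intro smooth_transition_prod[of r "mtop M"]) (auto simp: banach_manifold_def)
 then show "EX f'. has_fderiv (cmodel c) (cmap d o cinv c) f' (cmap c u)"
  using smooth_transition_fderiv[OF chart[OF cd(1)] chart[OF cd(2)]] u by blast
qed

text \<open>The straightening charts of a submersion lie only in the maximal atlas of the factor;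
  submanifold charts are taken from the maximal atlas of the power.\<close>

lemma max_atlas_prod:
 assumes M: "banach_manifold M" and c: "!!i. i<r==>c i:max_atlas M"
 shows "prod_chart r c:max_atlas (prod_manifold r M)"
 unfolding max_atlas_def mem_Collect_eq
proof (intro conjI ballI)
 have ch: "is_chart (mtop M) c" if "c:atlas M" for c using M that by (auto simp: banach_manifold_def)
 have cc: "is_chart (mtop M) (c i)" if "i<r" for i using c[OF that] by (simp add: max_atlas_def)
 show "is_chart (mtop (prod_manifold r M)) (prod_chart r c)"
  unfolding mtop_prod_manifold by (rule is_chart_prod[OF cc])
 fix d assume "d:atlas (prod_manifold r M)"
 then obtain d' where d: "d=prod_chart r d'" "ALL i<r. d' i:atlas M" by (auto simp: atlas_prod_manifold)
 show "smooth_transition (prod_chart r c) d" "smooth_transition d (prod_chart r c)"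
  unfolding d(1) using c d(2) ch cc
  by (auto intro!: smooth_transition_prod[of r "mtop M"] simp: max_atlas_def)
qed

section \<open>Submersions in charts and the fiber product manifold\<close>

lemma blinear_on_continuous_on: "blinear_on V T==>subspace V==>continuous_on V T"
proof -
 assume T: "blinear_on V T" and V: "subspace V"
 have "has_fderiv V T T x" if "x:V" for x
  unfolding has_fderiv_iff using T blinear_on_diff[OF T V] that V by (auto intro: exI[of _ 1])
 then show ?thesis
  using has_fderiv_continuous[OF _ V] continuous_on_eq_continuous_within by blast
qed

lemma blinear_on_has_fderiv:
 "blinear_on V T==>subspace V==>x:V==>has_fderiv V T T x"
 unfolding has_fderiv_iff using blinear_on_diff[of V T] by (auto intro: exI[of _ 1])

lemma blinear_on_plus:
 assumes "blinear_on V f" "blinear_on V g" shows "blinear_on V (%v. f v + g v)"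
proof -
 obtain K where K: "!!v. v:V==>norm (f v)<=K * norm v" using blinear_on_bound[OF assms(1)] by metis
 obtain L where L: "!!v. v:V==>norm (g v)<=L * norm v" using blinear_on_bound[OF assms(2)] by metis
 have "norm (f v + g v)<=(K + L) * norm v" if "v:V" for v
  using norm_triangle_ineq[of "f v" "g v"] K[OF that] L[OF that] by (simp add: distrib_right)
 then show ?thesis
  using assms unfolding blinear_on_def by (auto simp: scaleR_add_right)
qed

lemma has_fderiv_add:
 assumes f: "has_fderiv V f f' x" and g: "has_fderiv V g g' x"
 shows "has_fderiv V (%y. f y + g y) (%v. f' v + g' v) x"
 unfolding has_fderiv_iff
proof (intro conjI allI impI)
 show "blinear_on V (%v. f' v + g' v)"
  by (rule blinear_on_plus[OF has_fderiv_linear[OF f] has_fderiv_linear[OF g]])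
 fix e :: real assume "e>0"
 then have e2: "e / 2>0" by simp
 obtain d1 where d1: "d1>0" "!!y. y:V==>dist y x<d1==>norm (f y - f x - f' (y - x))<=e / 2 * norm (y - x)"
  by (fact has_fderivD[OF f e2])
 obtain d2 where d2: "d2>0" "!!y. y:V==>dist y x<d2==>norm (g y - g x - g' (y - x))<=e / 2 * norm (y - x)"
  by (fact has_fderivD[OF g e2])
 have "norm (f y + g y - (f x + g x) - (f' (y - x) + g' (y - x)))<=e * norm (y - x)"
  if "y:V" "dist y x<min d1 d2" for y
 proof -
  have "f y + g y - (f x + g x) - (f' (y - x) + g' (y - x))=(f y - f x - f' (y - x)) + (g y - g x - g' (y - x))" by simp
  also have "norm ...<=e / 2 * norm (y - x) + e / 2 * norm (y - x)"
   using d1(2)[of y] d2(2)[of y] that by (intro norm_triangle_mono) auto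
  also have "...=e * norm (y - x)" by simp
  finally show ?thesis .
 qed
 then show "EX d>0. ALL y:V. dist y x<d-->norm (f y + g y - (f x + g x) - (f' (y - x) + g' (y - x)))<=e * norm (y - x)"
  using d1(1) d2(1) by (intro exI[of _ "min d1 d2"]) auto
qed

section \<open>Linear images and reparametrisations of smooth maps\<close>

lemma mlin_blinear_on:
 assumes F: "mlin Vs N F" and L: "blinear_on N L" and N: "subspace N"
 shows "mlin Vs UNIV (%vs. L (F vs))"
 unfolding mlin_def
proof (intro conjI ballI allI impI)
 fix vs i u v a assume *: "vs:tup Vs" "i<length Vs" "u:Vs ! i" "v:Vs ! i"
 then have "F (vs[i := u]):N" "F (vs[i := v]):N" by (auto intro!: mlin_range[OF F] tup_update)
 then show "L (F (vs[i := a *\<^sub>R u + v]))=a *\<^sub>R L (F (vs[i := u])) + L (F (vs[i := v]))"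
  using mlin_update[OF F *] blinear_on_add[OF L, of "a *\<^sub>R F (vs[i := u])"] blinear_on_scale[OF L] N
  by (simp add: subspace_scale)
next
 obtain b where b: "b>=0" "form_le Vs F b" using mlin_bound[OF F] by blast
 obtain K where K: "K>0" "!!v. v:N==>norm (L v)<=K * norm v" using blinear_on_bound[OF L] by metis
 have "norm (L (F vs))<=(K * b) * prod_list (map norm vs)" if "vs:tup Vs" for vs
 proof -
  have "norm (L (F vs))<=K * norm (F vs)" by (rule K(2)[OF mlin_range[OF F that]])
  also have "...<=K * (b * prod_list (map norm vs))" using form_leD[OF b(2) that] K(1) by simp
  finally show ?thesis by simp
 qed
 then show "EX b>=0. form_le Vs (%vs. L (F vs)) b"
  using K b by (intro exI[of _ "K * b"]) (simp add: form_le_def)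
qed simp

lemma fdiff_blinear_on:
 assumes F: "fdiff V S Vs N F F'" and L: "blinear_on N L" and N: "subspace N" and SV: "S<=V" "subspace V"
 shows "fdiff V S Vs UNIV (%x vs. L (F x vs)) (%x vs. L (F' x vs))"
 unfolding fdiff_def
proof (intro ballI conjI allI impI)
 fix x assume x: "x:S"
 have m: "mlin Vs N (F x)" "mlin (V # Vs) N (F' x)" using F x by (auto simp: fdiff_def)
 show "mlin Vs UNIV (%vs. L (F x vs))" "mlin (V # Vs) UNIV (%vs. L (F' x vs))"
  using m L N by (auto intro: mlin_blinear_on)
 obtain K where K: "K>0" "!!v. v:N==>norm (L v)<=K * norm v" using blinear_on_bound[OF L] by metis
 fix e :: real assume e: "e>0"
 have eK: "e / K>0" using e K by simp
 obtain d where d: "d>0" "!!y. y:S==>dist y x<d ==>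
   form_le Vs (%vs. F y vs - F x vs - F' x ((y - x) # vs)) (e / K * norm (y - x))"
  by (fact fdiffE[OF F x eK])
 have "form_le Vs (%vs. L (F y vs) - L (F x vs) - L (F' x ((y - x) # vs))) (e * norm (y - x))"
  if y: "y:S" "dist y x<d" for y
  unfolding form_le_def
 proof
  fix vs assume vs: "vs:tup Vs"
  have "y - x:V" using y x SV by (blast intro: subspace_diff)
  then have N3: "F y vs:N" "F x vs:N" "F' x ((y - x) # vs):N"
   using F x y vs mlin_range unfolding fdiff_def by (metis, metis, metis tup_Cons)
  then have "L (F y vs) - L (F x vs) - L (F' x ((y - x) # vs))=L (F y vs - F x vs - F' x ((y - x) # vs))"
   using blinear_on_diff[OF L N] N by (simp add: subspace_diff)
  also have "norm ...<=K * norm (F y vs - F x vs - F' x ((y - x) # vs))"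
   using K(2) N3 N by (simp add: subspace_diff)
  also have "...<=K * (e / K * norm (y - x) * prod_list (map norm vs))"
   using form_leD[OF d(2)[OF y] vs] K by (intro mult_left_mono) auto
  finally show "norm (L (F y vs) - L (F x vs) - L (F' x ((y - x) # vs)))<=e * norm (y - x) * prod_list (map norm vs)"
   using K by simp
 qed
 then show "EX d>0. ALL y:S. dist y x<d-->form_le Vs
   (%vs. L (F y vs) - L (F x vs) - L (F' x ((y - x) # vs))) (e * norm (y - x))" using d(1) by blast
qed

text \<open>Here \<open>f\<close> takes values in another type than its argument, which
  \<open>gen\<close> excludes, so the tower is written down: \<open>L\<close> is applied to each
  level of the tower of \<open>f\<close>, while \<open>T\<close> contributes \<open>T x\<close> at
  level 0, \<open>T\<close> at level 1 and zero above.\<close>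

lemma Ck_on_linear_plus:
 fixes f :: "'a::real_normed_vector=>'b::real_normed_vector" and T :: "'a=>'c::real_normed_vector"
 assumes f: "Ck_on \<infinity> V S f" and V: "subspace V" and S: "openin (top_of_set V) S"
  and N: "subspace N" "closed N" "f ` S<=N" and L: "blinear_on N L" and T: "blinear_on V T"
 shows "Ck_on \<infinity> V S (%x. T x + L (f x))"
proof -
 have SV: "S<=V" using S by (auto simp: openin_top_of_set_ball)
 obtain F where F: "!!x. x:S==>F 0 x []=f x" "!!j. fdiff V S (replicate j V) N (F j) (F (Suc j))"
  by (fact Ck_on_imp_fdiff[OF f V S N])
 define G where "G=(%j x vs. if j=0 then T x else if j=Suc 0 then T (hd vs) else (0::'c))"
 have z: "mlin Vs UNIV (%vs. 0::'c)" for Vs :: "'a set list"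
  by (auto simp: mlin_def form_le_def intro: exI[of _ 0])
 have mT: "mlin [V] UNIV (%vs. T (hd vs))"
  unfolding mlin_def
 proof (intro conjI ballI allI impI)
  fix vs i u v a assume "vs:tup [V]" "i<length [V]" "u:[V] ! i" "v:[V] ! i"
  then show "T (hd (vs[i := a *\<^sub>R u + v]))=a *\<^sub>R T (hd (vs[i := u])) + T (hd (vs[i := v]))"
   using blinear_on_add[OF T, of "a *\<^sub>R u" v] blinear_on_scale[OF T, of u a] V
   by (auto elim!: tup_Cons_E simp: subspace_scale)
 next
  obtain K where "K>0" "!!v. v:V==>norm (T v)<=K * norm v" using blinear_on_bound[OF T] by metis
  then show "EX b>=0. form_le [V] (%vs. T (hd vs)) b"
   by (intro exI[of _ K]) (auto simp: form_le_def elim!: tup_Cons_E)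
 qed simp
 have mG: "mlin (replicate j V) UNIV (G j x)" for j x
 proof -
  consider "j=0" | "j=Suc 0" | "j~=0" "j~=Suc 0" by blast
  then show ?thesis
  proof cases
   case 1
   then show ?thesis by (auto simp: G_def mlin_def form_le_def intro: exI[of _ "norm (T x)"])
  next
   case 2
   then show ?thesis using mT by (simp add: G_def)
  next
   case 3
   then show ?thesis using z by (simp add: G_def)
  qed
 qed
 have "G j y vs - G j x vs - G (Suc j) x ((y - x) # vs)=0" if "x:S" "y:S" for j x y vs
  using blinear_on_diff[OF T V subsetD[OF SV that(2)] subsetD[OF SV that(1)]] by (simp add: G_def)
 then have "fdiff V S (replicate j V) UNIV (G j) (G (Suc j))" for j
  unfolding fdiff_def using mG[of j] mG[of "Suc j"]
  by (auto intro!: exI[of _ 1] simp: form_le_def prod_list_norm_nonneg)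
 from fdiff_add[OF this fdiff_blinear_on[OF F(2) L N(1) SV V] subspace_UNIV]
 have "fdiff V S (replicate j V) UNIV (%x vs. G j x vs + L (F j x vs)) (%x vs. G (Suc j) x vs + L (F (Suc j) x vs))" for j .
 then show ?thesis
  by (rule fdiff_imp_Ck_on[where D="%j x vs. G j x vs + L (F j x vs)"]) (use F(1) SV V in \<open>auto simp: G_def\<close>)
qed

lemma Ck_on_imp_continuous_on:
 assumes "Ck_on k V S f" "1<=k" "subspace V" "openin (top_of_set V) S"
 shows "continuous_on S f"
 using Ck_on_imp_C1[OF assms] C1_on_continuous_on assms(3,4) openin_imp_subset by metis

text \<open>A chart followed by a smooth map with smooth inverse is compatible with every chart of
  the atlas; the chart changes are composites with \<open>Phi\<close> and
  \<open>Psi\<close>.\<close>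

lemma max_atlas_reparam:
 assumes M: "banach_manifold M" and c: "c:atlas M" and U: "openin (mtop M) U" "U<=cdom c"
  and Phi: "Ck_on \<infinity> (cmodel c) (cmap c ` U) Phi" "openin (top_of_set (cmodel c)) (Phi ` cmap c ` U)"
  and Psi: "!!x. x:cmap c ` U==>Psi (Phi x)=x" "Ck_on \<infinity> (cmodel c) (Phi ` cmap c ` U) Psi"
 shows "\<lparr>cdom=U, cmap=Phi o cmap c, cmodel=cmodel c\<rparr>:max_atlas M" (is "?c:_")
proof -
 have ch: "is_chart (mtop M) d" if "d:atlas M" for d using M that by (auto simp: banach_manifold_def)
 have tr: "smooth_transition d d'" if "d:atlas M" "d':atlas M" for d d'
  using M that by (auto simp: banach_manifold_def)
 note cc=ch[OF c] and V=chartD(2,3)[OF ch[OF c]]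
 let ?B="cmap c ` U"
 have B: "openin (top_of_set (cmodel c)) ?B" by (rule openin_cmap_image[OF cc U])
 have Bc: "?B<=cmap c ` cdom c" using U by blast
 have one: "(1::enat)<=\<infinity>" by simp
 have h1: "homeomorphic_map (subtopology (mtop M) U) (top_of_set ?B) (cmap c)"
 proof -
  have "homeomorphic_map (subtopology (subtopology (mtop M) (cdom c)) U) (subtopology (top_of_set (cmap c ` cdom c)) ?B) (cmap c)"
   by (rule homeomorphic_map_subtopologies) (use cc U chartD(6)[OF cc] in \<open>auto simp: is_chart_def\<close>)
  then show ?thesis using U(2) Bc by (simp add: subtopology_subtopology Int_absorb1)
 qed
 have "homeomorphic_maps (top_of_set ?B) (top_of_set (Phi ` ?B)) Phi Psi"
  unfolding homeomorphic_maps_def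
  using Ck_on_imp_continuous_on[OF Phi(1) one V(1) B] Ck_on_imp_continuous_on[OF Psi(2) one V(1) Phi(2)] Psi(1)
  by (auto simp: continuous_map_in_subtopology)
 from homeomorphic_map_compose[OF h1 homeomorphic_maps_imp_map[OF this]]
 have chart: "is_chart (mtop M) ?c"
  unfolding is_chart_def using U V Phi(2) by (simp add: image_comp)
 have cinv': "cinv ?c y=cinv c (Psi y)" if "y:Phi ` ?B" for y
 proof -
  obtain m where m: "m:U" "y=Phi (cmap c m)" using \<open>y:Phi ` ?B\<close> by blast
  have "cinv ?c y=m" using cinv_cmap[OF chart, of m] m by simp
  moreover have "cinv c (Psi y)=m" using Psi(1) m cinv_cmap[OF cc, of m] U by auto
  ultimately show ?thesis by simp
 qed
 have "smooth_transition ?c d&smooth_transition d ?c" if d: "d:atlas M" for d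
 proof
  note dd=ch[OF d]
  have oUd: "openin (mtop M) (U\<inter>cdom d)" using U(1) chartD(1)[OF dd] by blast
  have S1: "openin (top_of_set (cmodel c)) (cmap ?c ` (cdom ?c\<inter>cdom d))"
   using openin_cmap_image[OF chart oUd] by simp
  have S1B: "cmap ?c ` (cdom ?c\<inter>cdom d)<=Phi ` ?B" by auto
  have "Ck_on \<infinity> (cmodel c) (cmap ?c ` (cdom ?c\<inter>cdom d)) (%x. (cmap d o cinv c) (Psi x))"
  proof (rule Ck_on_compose[where f=Psi and g="cmap d o cinv c"])
   show "Ck_on \<infinity> (cmodel c) (cmap ?c ` (cdom ?c\<inter>cdom d)) Psi" by (rule Ck_on_subset[OF Psi(2) S1B])
   show "Ck_on \<infinity> (cmodel c) (cmap c ` (cdom c\<inter>cdom d)) (cmap d o cinv c)"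
    using tr[OF c d] by (simp add: smooth_transition_def)
   show "Psi ` cmap ?c ` (cdom ?c\<inter>cdom d)<=cmap c ` (cdom c\<inter>cdom d)"
    using Psi(1) U(2) by auto
   show "openin (top_of_set (cmodel c)) (cmap c ` (cdom c\<inter>cdom d))"
    by (rule openin_transition_domain[OF cc chartD(1)[OF dd]])
  qed (use V S1 in auto)
  then show "smooth_transition ?c d"
   unfolding smooth_transition_def chart.select_convs
   by (rule Ck_on_cong) (use cinv' S1B in auto)
  have S2: "openin (top_of_set (cmodel d)) (cmap d ` (cdom d\<inter>U))"
   by (rule openin_transition_domain[OF dd U(1)])
  have "Ck_on \<infinity> (cmodel d) (cmap d ` (cdom d\<inter>U)) (%x. Phi ((cmap c o cinv d) x))"
  proof (rule Ck_on_compose[OF _ Phi(1)])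
   show "Ck_on \<infinity> (cmodel d) (cmap d ` (cdom d\<inter>U)) (cmap c o cinv d)"
    using tr[OF d c] U(2) unfolding smooth_transition_def by (rule_tac Ck_on_subset) auto
   show "(cmap c o cinv d) ` cmap d ` (cdom d\<inter>U)<=?B" using dd by auto
  qed (use chartD[OF dd] V S2 B in auto)
  then show "smooth_transition d ?c"
   unfolding smooth_transition_def by (simp add: comp_assoc comp_def)
 qed
 with chart show ?thesis by (simp add: max_atlas_def)
qed

text \<open>In this chart \<open>p\<close> becomes a linear map \<open>A\<close>, namely its
  derivative at \<open>e\<close> in the old charts. The complement \<open>Z\<close> of the kernel
  comes from the splitting in the definition of a submersion, and \<open>L\<close>, the inverse of
  \<open>A\<close> on \<open>Z\<close>, is bounded by the open mapping theorem.\<close>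

theorem submersion_chart:
 fixes E :: "('e, 'm::banach) manifold" and X :: "('x, 'n::banach) manifold"
 assumes E: "banach_manifold E" and X: "banach_manifold X" and p: "submersion E X p"
  and e: "e:mpoints E" and psi: "psi:atlas X" "p e:cdom psi"
 obtains c A Z L where "c:max_atlas E" "e:cdom c" "p ` cdom c<=cdom psi"
  "blinear_on (cmodel c) A" "!!m. m:cdom c==>cmap psi (p m)=A (cmap c m)"
  "!!v. v:cmodel c==>A v:cmodel psi"
  "subspace Z" "closed Z" "Z<=cmodel c" "!!z. z:Z==>L (A z)=z"
  "!!n. n:cmodel psi==>L n:Z&A (L n)=n"
proof -
 note DE=banach_imp_diff_manifold[OF E] and DX=banach_imp_diff_manifold[OF X]
 have sp: "smooth_map E X p" using p by (simp add: submersion_def)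
 have cp: "continuous_map (mtop E) (mtop X) p" using sp by (simp add: smooth_map_def)
 obtain c where c: "c:atlas E" "e:cdom c" by (rule diff_manifold_cover[OF DE e])
 note cc=dm_chart[OF DE c(1)] and pp=dm_chart[OF DX psi(1)]
 define V N where "V=cmodel c" and "N=cmodel psi"
 have V: "subspace V" "closed V" and N: "subspace N" "closed N"
  using chartD[OF cc] chartD[OF pp] by (auto simp: V_def N_def)
 define f where "f=cmap psi o p o cinv c"
 define S where "S=cmap c ` (cdom c\<inter>p -` cdom psi)"
 define x0 where "x0=cmap c e"
 have "cdom c\<inter>p -` cdom psi=cdom c\<inter>{x:mpoints E. p x:cdom psi}" using chartD(6)[OF cc] by auto
 then have S: "openin (top_of_set V) S"
  using openin_transition_domain[OF cc openin_continuous_map_preimage[OF cp chartD(1)[OF pp]]] by (simp add: V_def S_def)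
 have SV: "S<=V" by (rule openin_imp_subset[OF S])
 have x0: "x0:S" "x0:V" using c psi SV by (auto simp: S_def x0_def)
 have f: "Ck_on \<infinity> V S f" using sp c(1) psi(1) by (simp add: smooth_map_def V_def S_def f_def)
 have fN: "f ` S<=N" using cc pp by (auto simp: f_def S_def N_def intro: cmap_in_cmodel)
 define A where "A=fderiv V f x0"
 have dp: "diff_map E X p" by (rule smooth_imp_diff_map[OF DE DX sp])
 have fd: "has_fderiv V f A x0"
  using dp c psi has_fderiv_fderiv unfolding diff_map_def V_def f_def A_def x0_def by blast
 have A: "blinear_on V A" by (rule has_fderiv_linear[OF fd])
 have AN: "A v:N" if "v:V" for v
  using chart_chain(2)[OF cc pp cp c(2) psi(2) fd[unfolded V_def f_def x0_def] diff_manifold_trans[OF DX psi psi]] that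
  by (simp add: V_def N_def)
 have md: "mdiff E X p e (tvec E e c v)=tvec X (p e) psi (A v)" if "v:V" for v
  using mdiff_tvec[OF DE DX dp c psi] that by (simp add: V_def f_def A_def x0_def)
 have surj: "A ` V=N"
 proof
  show "A ` V<=N" using AN by blast
  show "N<=A ` V"
  proof
   fix n assume n: "n:N"
   have "tvec X (p e) psi n:tangent_space X (p e)" using n tangent_space_eq[OF DX psi] by (simp add: N_def)
   also have "...=mdiff E X p e ` tangent_space E e" using p e by (simp add: submersion_def)
   also have "...=(%v. mdiff E X p e (tvec E e c v)) ` V"
    using tangent_space_eq[OF DE c] by (simp add: V_def image_image)
   finally obtain v where v: "v:V" "tvec X (p e) psi n=tvec X (p e) psi (A v)" using md by auto
   then have "n=A v" using tvec_inject[OF DX psi] n AN by (simp add: N_def)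
   then show "n:A ` V" using v by blast
  qed
 qed
 have "{v:cmodel c. tvec E e c v:Ver E X p e}={v:V. A v=0}"
 proof -
  have "tvec E e c v:Ver E X p e\<longleftrightarrow>A v=0" if v: "v:V" for v
  proof -
   have "tvec E e c v:tangent_space E e" using v tangent_space_eq[OF DE c] by (simp add: V_def)
   then have "tvec E e c v:Ver E X p e\<longleftrightarrow>tvec X (p e) psi (A v)=tvec X (p e) psi 0"
    using md[OF v] tzero_eq[OF DX psi] by (simp add: Ver_def)
   then show ?thesis using tvec_inject[OF DX psi] AN[OF v] N by (simp add: N_def subspace_0)
  qed
  then show ?thesis by (auto simp: V_def)
 qed
 moreover have "splits (cmodel c) {v:cmodel c. tvec E e c v:Ver E X p e}"
  using p e c by (simp add: submersion_def)
 ultimately have sp: "splits V {v:V. A v=0}" by (simp add: V_def)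
 obtain Z where Z: "subspace Z" "closed Z" "Z<=V" "{v:V. A v=0}\<inter>Z={0}"
  "V={w + z | w z. w:{v:V. A v=0}&z:Z}"
  using sp unfolding splits_def by blast
 have AZ: "blinear_on Z A" by (rule blinear_on_subset[OF A Z(3)])
 have AZN: "A ` Z=N"
 proof
  show "A ` Z<=N" using AN Z(3) by blast
  show "N<=A ` Z"
  proof
   fix n assume "n:N"
   then obtain v where v: "v:V" "n=A v" using surj by blast
   have "v:{w + z | w z. w:{v:V. A v=0}&z:Z}"
    by (rule back_subst[where P="%V. v:V", OF v(1) Z(5)])
   then obtain w z where wz: "w:V" "A w=0" "z:Z" "v=w + z" by blast
   then have "w:V" "A w=0" "z:Z" "n=A (w + z)" using \<open>n=A v\<close> by auto
   then show "n:A ` Z" using blinear_on_add[OF A, of w z] Z(3) by auto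
  qed
 qed
 have injZ: "inj_on A Z"
 proof (rule inj_onI)
  fix y z assume yz: "y:Z" "z:Z" "A y=A z"
  then have "A (y - z)=0" using blinear_on_diff[OF A V(1)] Z(3) by (simp add: subset_iff)
  then have "y - z:{v:V. A v=0}\<inter>Z" using yz Z(1,3) V by (auto simp: subspace_diff subset_iff)
  then show "y=z" using Z(4) by simp
 qed
 define L where "L=inv_into Z A"
 have L: "blinear_on N L" unfolding L_def by (rule blinear_on_inverse[OF Z(1,2) N AZ AZN injZ])
 have LA: "L (A z)=z" if "z:Z" for z using injZ that by (simp add: L_def)
 have AL: "L n:Z&A (L n)=n" if "n:N" for n
  using that AZN unfolding L_def by (metis f_inv_into_f inv_into_into)
 \<comment> \<open>\<open>T\<close> projects \<open>V\<close> onto the kernel of \<open>A\<close>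
   along \<open>Z\<close>. Adding \<open>L (f x)\<close> replaces the linear component in
   \<open>Z\<close> by the nonlinear one: then \<open>A (Phi x) = f x\<close>, and the derivative at
   \<open>x0\<close> is still the identity, as \<open>smooth_local_inverse\<close> requires.\<close>
 define T where "T=(%v. v + (-1) *\<^sub>R L (A v))"
 have LAlin: "blinear_on V (%v. L (A v))" by (rule blinear_on_compose[OF A L AN])
 have T: "blinear_on V T"
  unfolding T_def
  by (intro blinear_on_plus blinear_on_compose[OF LAlin bounded_linear_imp_on[OF bounded_linear_scaleR_right, of UNIV]]
    bounded_linear_imp_on bounded_linear_ident) auto
 define Phi where "Phi=(%x. T x + L (f x))"
 have Phi: "Ck_on \<infinity> V S Phi" unfolding Phi_def by (rule Ck_on_linear_plus[OF f V(1) S N fN L T])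
 have TV: "T v:V" if "v:V" for v
  unfolding T_def using that AL[OF AN[OF that]] Z(3) V by (intro subspace_add subspace_scale) auto
 have LV: "L n:V" if "n:N" for n using AL[OF that] Z(3) by auto
 have PhiV: "Phi ` S<=V" using TV LV fN SV V by (auto simp: Phi_def intro!: subspace_add)
 have APhi: "A (Phi x)=f x" if "x:S" for x
 proof -
  have x: "x:V" "f x:N" using that SV fN by auto
  have "A (T x)=A x - A (L (A x))"
   using blinear_on_diff[OF A V(1) x(1) LV[OF AN[OF x(1)]]] by (simp add: T_def)
  then have "A (T x)=0" using AL[OF AN[OF x(1)]] by simp
  then show ?thesis
   using blinear_on_add[OF A TV[OF x(1)] LV[OF x(2)]] AL[OF x(2)] by (simp add: Phi_def)
 qed
 have id: "fderiv V Phi x0 v=v" if "v:V" for v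
 proof -
  obtain d where d: "d>0" "!!y. y:V==>dist y x0<d==>y:S"
   using S x0 unfolding openin_top_of_set_ball by meson
  have "has_fderiv V (%y. L (f y)) (%v. L (A v)) x0"
   by (rule has_fderiv_compose[OF fd V(1) x0(2) blinear_on_has_fderiv[OF L N(1)] N d(1)])
    (use d(2) fN x0 in auto)
  from has_fderiv_add[OF blinear_on_has_fderiv[OF T V(1) x0(2)] this]
  have "has_fderiv V Phi (%v. T v + L (A v)) x0" by (simp add: Phi_def)
  from fderiv_eq[OF this V(1) x0(2) that] show ?thesis by (simp add: T_def)
 qed
 obtain rho Psi where rho: "rho>0" "V\<inter>ball x0 rho<=S" "openin (top_of_set V) (Phi ` (V\<inter>ball x0 rho))"
  and Psi: "!!x. x:V\<inter>ball x0 rho==>Psi (Phi x)=x" "Ck_on \<infinity> V (Phi ` (V\<inter>ball x0 rho)) Psi"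
 proof (rule smooth_local_inverse[OF Phi V S x0(1) PhiV])
  show "fderiv V Phi x0 v=v" if "v:V" for v by (rule id[OF that])
 qed (rule that, blast+)
 define B where "B=V\<inter>ball x0 rho"
 have BS: "B<=S" using rho by (simp add: B_def)
 have Bi: "B<=cmap c ` cdom c" using BS by (auto simp: S_def)
 define U where "U=cinv c ` B"
 have U: "openin (mtop E) U" "U<=cdom c"
  using openin_cinv_image[OF cc _ Bi] Bi cinv_in[of _ c] by (auto simp: U_def B_def V_def openin_open_Int)
 have cU: "cmap c ` U=B" using Bi cmap_cinv[of _ c] by (force simp: U_def image_iff)
 define c' where "c'=\<lparr>cdom=U, cmap=Phi o cmap c, cmodel=cmodel c\<rparr>"
 show ?thesis
 proof (rule that[of c' A Z L])
  show "c':max_atlas E"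
   unfolding c'_def
   by (rule max_atlas_reparam[OF E c(1) U, where Psi=Psi], unfold cU)
    (use rho Psi Ck_on_subset[OF Phi BS] in \<open>auto simp: B_def V_def\<close>)
  have "x0:B" using x0 rho by (simp add: B_def)
  then show "e:cdom c'" using c cinv_cmap[OF cc c(2)] unfolding c'_def U_def x0_def by (simp add: rev_image_eqI)
  have Up: "m:cdom c" "cmap c m:S" "p m:cdom psi" if "m:U" for m
  proof -
   show m: "m:cdom c" using that U by blast
   show s: "cmap c m:S" using that cU BS by blast
   then obtain m' where "m':cdom c" "p m':cdom psi" "cmap c m=cmap c m'" by (auto simp: S_def)
   then show "p m:cdom psi" using m chartD(5)[OF cc] by (metis inj_onD)
  qed
  show "p ` cdom c'<=cdom psi" using Up by (auto simp: c'_def)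
  show "cmap psi (p m)=A (cmap c' m)" if "m:cdom c'" for m
  proof -
   have "m:U" using that by (simp add: c'_def)
   then show ?thesis using APhi[OF Up(2)] cinv_cmap[OF cc Up(1)] by (simp add: c'_def f_def)
  qed
 qed (use A AN Z LA AL in \<open>auto simp: c'_def V_def N_def\<close>)
qed


lemma diff_manifold_submanifold:
 assumes D: "diff_manifold M" and S: "S<=mpoints M"
  and cover: "!!u. u:S==>EX c W. c:max_atlas M&splits (cmodel c) W &
   cmap c ` (cdom c\<inter>S)=cmap c ` cdom c\<inter>W&u:cdom c"
 shows "diff_manifold (submanifold_of M S)"
 unfolding diff_manifold_def
proof (intro conjI ballI)
 let ?Y="submanifold_of M S"
 have top: "mtop ?Y=subtopology (mtop M) S" by (simp add: submanifold_of_def)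
 have atl: "EX c W. C=\<lparr>cdom=cdom c\<inter>S, cmap=cmap c, cmodel=W\<rparr>&c:max_atlas M &
   splits (cmodel c) W&cmap c ` (cdom c\<inter>S)=cmap c ` cdom c\<inter>W" if "C:atlas ?Y" for C
  using that by (auto simp: submanifold_of_def)
 show chart: "is_chart (mtop ?Y) C" if CY: "C:atlas ?Y" for C
 proof -
  obtain c W where C: "C=\<lparr>cdom=cdom c\<inter>S, cmap=cmap c, cmodel=W\<rparr>" and c: "c:max_atlas M"
   and W: "splits (cmodel c) W" and eq: "cmap c ` (cdom c\<inter>S)=cmap c ` cdom c\<inter>W"
   using atl[OF CY] by blast
  have cc: "is_chart (mtop M) c" using c by (simp add: max_atlas_def)
  have Wc: "subspace W" "closed W" "W<=cmodel c" using W by (auto simp: splits_def)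
  have o: "openin (top_of_set W) (cmap c ` cdom c\<inter>W)"
   using chartD(4)[OF cc] Wc(3) unfolding openin_open by blast
  have "homeomorphic_map (subtopology (subtopology (mtop M) (cdom c)) S) (subtopology (top_of_set (cmap c ` cdom c)) (cmap c ` cdom c\<inter>W)) (cmap c)"
   by (rule homeomorphic_map_subtopologies) (use cc chartD(6)[OF cc] S eq in \<open>auto simp: is_chart_def Int_absorb1\<close>)
  then have h: "homeomorphic_map (subtopology (mtop M) (cdom c\<inter>S)) (top_of_set (cmap c ` cdom c\<inter>W)) (cmap c)"
   by (simp add: subtopology_subtopology Int_left_absorb)
  have oS: "openin (subtopology (mtop M) S) (cdom c\<inter>S)"
   using chartD(1)[OF cc] by (simp add: openin_subtopology_Int)
  have Sc: "S\<inter>(cdom c\<inter>S)=cdom c\<inter>S" by blast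
  show ?thesis
   unfolding is_chart_def C top chart.select_convs subtopology_subtopology eq Sc
   by (intro conjI oS Wc o h)
 qed
 show "(\<Union>C\<in>atlas ?Y. cdom C)=mpoints ?Y"
 proof (intro equalityI subsetI)
  fix u assume "u:(\<Union>C\<in>atlas ?Y. cdom C)"
  then show "u:mpoints ?Y" using chart chartD(6) by blast
 next
  fix u assume "u:mpoints ?Y"
  then have u: "u:S" by (simp add: top)
  then obtain c W where "c:max_atlas M&splits (cmodel c) W &
   cmap c ` (cdom c\<inter>S)=cmap c ` cdom c\<inter>W&u:cdom c" using cover by blast
  then have "\<lparr>cdom=cdom c\<inter>S, cmap=cmap c, cmodel=W\<rparr>:atlas ?Y" "u:cdom c\<inter>S"
   using u unfolding submanifold_of_def manifold.select_convs by blast+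
  then show "u:(\<Union>C\<in>atlas ?Y. cdom C)" by (metis UN_I chart.select_convs(1))
 qed
 fix C C' u assume CC: "C:atlas ?Y" "C':atlas ?Y" and u: "u:cdom C\<inter>cdom C'"
 obtain c W where C: "C=\<lparr>cdom=cdom c\<inter>S, cmap=cmap c, cmodel=W\<rparr>" and c: "c:max_atlas M"
  and W: "splits (cmodel c) W" and eq: "cmap c ` (cdom c\<inter>S)=cmap c ` cdom c\<inter>W"
  using atl[OF CC(1)] by blast
 obtain c' W' where C': "C'=\<lparr>cdom=cdom c'\<inter>S, cmap=cmap c', cmodel=W'\<rparr>" and c': "c':max_atlas M"
  using atl[OF CC(2)] by blast
 have cc: "is_chart (mtop M) c" and cc': "is_chart (mtop M) c'" using c c' by (auto simp: max_atlas_def)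
 have u: "u:cdom c" "u:cdom c'" "u:S" using u C C' by auto
 \<comment> \<open>Charts of the maximal atlas are related only to charts of the atlas, so the chart
   change is factored through one of the latter.\<close>
 obtain e where e: "e:atlas M" "u:cdom e" using diff_manifold_cover[OF D, of u] u S by blast
 note ee=dm_chart[OF D e(1)]
 obtain f' where f': "has_fderiv (cmodel c) (cmap e o cinv c) f' (cmap c u)"
  using smooth_transition_fderiv[OF cc ee _ u(1) e(2)] c e by (auto simp: max_atlas_def)
 obtain h' where h': "has_fderiv (cmodel e) (cmap c' o cinv e) h' (cmap e u)"
  using smooth_transition_fderiv[OF ee cc' _ e(2) u(2)] c' e by (auto simp: max_atlas_def)
 have "has_fderiv (cmodel c) (cmap c' o cinv c) (%v. h' (f' v)) (cmap c u)"
  using chart_chain(1)[OF cc ee continuous_map_id u(1), of f' "cmap c'" h'] f' h' e by simp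
 moreover have WV: "subspace W" "W<=cmodel c" using W by (auto simp: splits_def)
 ultimately have 1: "has_fderiv W (cmap c' o cinv c) (%v. h' (f' v)) (cmap c u)" by (blast intro: has_fderiv_subset)
 have uW: "cmap c u:W" using u eq by blast
 obtain d where d: "d>0" "!!y. y:cmodel c==>dist y (cmap c u)<d==>y:cmap c ` cdom c"
  using chart_near[OF cc u(1) chartD(1)[OF cc] u(1)] by auto
 have "has_fderiv W (cmap c' o cinv C) (%v. h' (f' v)) (cmap c u)"
 proof (rule has_fderiv_cong[OF 1 refl WV(1) uW d(1)])
  fix y assume y: "y:W" "dist y (cmap c u)<d"
  then obtain m where m: "m:cdom c" "m:S" "y=cmap c m" using d(2) WV(2) eq by blast
  then show "(cmap c' o cinv c) y=(cmap c' o cinv C) y"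
   using cinv_cmap[OF cc, of m] cinv_cmap[OF chart[OF CC(1)], of m] C by simp
 qed
 then show "EX f'. has_fderiv (cmodel C) (cmap C' o cinv C) f' (cmap C u)" by (auto simp: C C')
qed


text \<open>All factors are straightened over one chart \<open>psi\<close> around the common image
  point. There the condition that the images agree becomes the linear system that \<open>A i\<close>
  of coordinate \<open>i\<close> equals \<open>A 0\<close> of coordinate 0. A complement of its
  solution space consists of the vectors with coordinate 0 zero and coordinate \<open>i\<close> in
  \<open>Z i\<close>.\<close>

lemma fiber_product_chart:
 fixes E :: "('e, 'm::banach) manifold" and X :: "('x, 'n::banach) manifold"
 assumes E: "banach_manifold E" and X: "banach_manifold X" and p: "submersion E X p" and r: "0<r"
  and u: "u:fiber_product r (mtop E) p"
 shows "EX c W. c:max_atlas (prod_manifold r E)&splits (cmodel c) W &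
  cmap c ` (cdom c\<inter>fiber_product r (mtop E) p)=cmap c ` cdom c\<inter>W&u:cdom c"
proof -
 let ?S="fiber_product r (mtop E) p"
 have uE: "u:(\<Pi>\<^sub>E i\<in>{..<r}. mpoints E)" and up: "!!i j. i<r==>j<r==>p (u i)=p (u j)"
  using u unfolding fiber_product_def by blast+
 note DX=banach_imp_diff_manifold[OF X]
 have "continuous_map (mtop E) (mtop X) p" using p by (auto simp: submersion_def smooth_map_def)
 then have "p (u 0):mpoints X" using uE r by (auto simp: continuous_map_def)
 then obtain psi where psi: "psi:atlas X" "p (u 0):cdom psi" by (rule diff_manifold_cover[OF DX])
 note pp=dm_chart[OF DX psi(1)]
 define N where "N=cmodel psi"
 define good where "good=(%e c A Z L. c:max_atlas E&e:cdom c&p ` cdom c<=cdom psi &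
  blinear_on (cmodel c) A&(ALL m:cdom c. cmap psi (p m)=A (cmap c m)) &
  (ALL v:cmodel c. A v:N)&subspace Z&closed Z&Z<=cmodel c&(ALL z:Z. L (A z)=z) &
  (ALL n:N. L n:Z&A (L n)=n))"
 have "EX c A Z L. good (u i) c A Z L" if i: "i<r" for i
 proof -
  have e: "u i:mpoints E" "p (u i):cdom psi" using uE i up[OF i r] psi by auto
  show ?thesis
   by (rule submersion_chart[OF E X p e(1) psi(1) e(2)]) (unfold good_def N_def, blast)
 qed
 then obtain c A Z L where good: "!!i. i<r==>good (u i) (c i) (A i) (Z i) (L i)" by metis
 have c: "c i:max_atlas E" "u i:cdom (c i)" "p ` cdom (c i)<=cdom psi"
  and A: "blinear_on (cmodel (c i)) (A i)" "!!m. m:cdom (c i)==>cmap psi (p m)=A i (cmap (c i) m)"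
   "!!v. v:cmodel (c i)==>A i v:N"
  and Z: "subspace (Z i)" "closed (Z i)" "Z i<=cmodel (c i)"
  and L: "!!z. z:Z i==>L i (A i z)=z" "!!n. n:N==>L i n:Z i" "!!n. n:N==>A i (L i n)=n"
  if "i<r" for i
  using good[OF that] by (auto simp: good_def)
 have cc: "is_chart (mtop E) (c i)" if "i<r" for i using c(1)[OF that] by (simp add: max_atlas_def)
 have V: "subspace (cmodel (c i))" "closed (cmodel (c i))" if "i<r" for i using chartD[OF cc[OF that]] by auto
 have N: "subspace N" using chartD(2)[OF pp] by (simp add: N_def)
 define C where "C=prod_chart r c"
 define V where "V=vmodel r (%i. cmodel (c i))"
 have CV: "cmodel C=V" by (simp add: C_def V_def prod_chart_sel)
 let ?ev="%v i. apply_bcontfun v i"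
 have ev: "?ev v i:cmodel (c i)" if "v:V" "i<r" for v i using that by (simp add: V_def vmodel_iff)
 define W where "W={v:V. ALL i<r. A i (?ev v i) - A 0 (?ev v 0)=0}"
 define Y where "Y={v:V. ?ev v 0=0&(ALL i<r. ?ev v i:Z i)}"
 have sV: "subspace V" and clV: "closed V" unfolding V_def using \<open>!!i. i<r==>subspace (cmodel (c i))\<close>
   \<open>!!i. i<r==>closed (cmodel (c i))\<close> by (auto intro: subspace_vmodel closed_vmodel)
 have Aev: "blinear_on V (%v. A i (?ev v i))" if "i<r" for i
  by (rule blinear_on_compose[OF bounded_linear_imp_on[OF bounded_linear_eval] A(1)[OF that]]) (use ev that in blast)
 have sW: "subspace W"
 proof (rule subspaceI)
  show "0:W" using blinear_on_zero[OF Aev sV] r subspace_0[OF sV] by (simp add: W_def)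
  show "x + y:W" if "x:W" "y:W" for x y
  proof -
   have xy: "x:V" "y:V" and eq: "!!i. i<r==>A i (?ev x i)=A 0 (?ev x 0)" "!!i. i<r==>A i (?ev y i)=A 0 (?ev y 0)"
    using that unfolding W_def mem_Collect_eq right_minus_eq by blast+
   have "A i (?ev (x + y) i)=A 0 (?ev x 0) + A 0 (?ev y 0)" if "i<r" for i
    using blinear_on_add[OF Aev[OF that] xy] eq[OF that] by simp
   from this this[OF r] show ?thesis using subspace_add[OF sV xy] unfolding W_def by simp
  qed
  show "a *\<^sub>R x:W" if "x:W" for a x
  proof -
   have x: "x:V" and eq: "!!i. i<r==>A i (?ev x i)=A 0 (?ev x 0)"
    using that unfolding W_def mem_Collect_eq right_minus_eq by blast+
   have "A i (?ev (a *\<^sub>R x) i)=a *\<^sub>R A 0 (?ev x 0)" if "i<r" for i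
    using blinear_on_scale[OF Aev[OF that] x, of a] eq[OF that] by simp
   from this this[OF r] show ?thesis using subspace_scale[OF sV x] unfolding W_def by simp
  qed
 qed
 have clW: "closed W"
 proof -
  have "closed {v:V. A i (?ev v i) - A 0 (?ev v 0)=0}" if "i<r" for i
   by (intro continuous_closed_preimage_constant continuous_on_diff blinear_on_continuous_on Aev sV clV that r)
  then have "closed (V\<inter>(\<Inter>i\<in>{..<r}. {v:V. A i (?ev v i) - A 0 (?ev v 0)=0}))" using clV by (intro closed_Int closed_INT) auto
  also have "V\<inter>(\<Inter>i\<in>{..<r}. {v:V. A i (?ev v i) - A 0 (?ev v 0)=0})=W" by (auto simp: W_def)
  finally show ?thesis .
 qed
 have sY: "subspace Y"
 proof (rule subspaceI)
  show "0:Y" using subspace_0[OF sV] Z(1) by (simp add: Y_def subspace_0)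
  show "x + y:Y" if "x:Y" "y:Y" for x y
   using that Z(1) subspace_add[OF sV, of x y] by (simp add: Y_def subspace_add)
  show "a *\<^sub>R x:Y" if "x:Y" for a x
   using that Z(1) subspace_scale[OF sV, of x a] by (simp add: Y_def subspace_scale)
 qed
 have clY: "closed Y"
 proof -
  have "closed (V\<inter>{v. ?ev v 0:{0}}\<inter>(\<Inter>i\<in>{..<r}. {v. ?ev v i:Z i}))"
   using clV Z(2) by (intro closed_Int closed_INT closed_eval_vimage ballI) auto
  also have "V\<inter>{v. ?ev v 0:{0}}\<inter>(\<Inter>i\<in>{..<r}. {v. ?ev v i:Z i})=Y" by (auto simp: Y_def)
  finally show ?thesis .
 qed
 have WY: "W\<inter>Y={0}"
 proof (intro equalityI subsetI)
  fix v assume v: "v:W\<inter>Y"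
  have "v=0"
  proof (rule bcontfun_eqI)
   fix i show "?ev v i=?ev 0 i"
   proof (cases "i<r")
    case True
    have "A i (?ev v i)=A 0 0" using v True by (simp add: W_def Y_def)
    also have "...=0" using blinear_on_zero[OF A(1)[OF r]] \<open>!!i. i<r==>subspace (cmodel (c i))\<close> r by blast
    finally have "?ev v i=L i 0" using L(1)[OF True, of "?ev v i"] v True by (simp add: Y_def)
    also have "...=0" using L(1)[OF True subspace_0[OF Z(1)[OF True]]] blinear_on_zero[OF A(1)[OF True]]
      \<open>!!i. i<r==>subspace (cmodel (c i))\<close>[OF True] by simp
    finally show ?thesis by simp
   next
    case False
    then show ?thesis using v by (simp add: W_def V_def vmodel_iff)
   qed
  qed
  then show "v:{0}" by simp
 qed (use subspace_0[OF sW] subspace_0[OF sY] in auto)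
 have VWY: "V={w + z |w z. w:W&z:Y}"
 proof (intro equalityI subsetI)
  fix v assume v: "v:V"
  \<comment> \<open>The defect of coordinate \<open>i\<close> in the linear system; subtracting
    \<open>L i (n i)\<close> repairs it. For \<open>i = 0\<close> the defect is zero, so coordinate
    0 is left alone.\<close>
  define n where "n=(%i. A i (?ev v i) - A 0 (?ev v 0))"
  have nN: "n i:N" if "i<r" for i using A(3) ev[OF v] that r N by (simp add: n_def subspace_diff)
  define z where "z=fvec r (%i. L i (n i))"
  have zi: "?ev z i=L i (n i)" if "i<r" for i using that by (simp add: z_def)
  have L0: "L i 0=0" if "i<r" for i
   using L(1)[OF that subspace_0[OF Z(1)[OF that]]] blinear_on_zero[OF A(1)[OF that]]
      \<open>!!i. i<r==>subspace (cmodel (c i))\<close>[OF that] by simp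
  have zV: "z:V" using L(2)[OF _ nN] Z(3) unfolding z_def V_def fvec_in_vmodel by blast
  have zY: "z:Y" using zV L(2)[OF _ nN] zi r L0 by (auto simp: Y_def n_def)
  have "v - z:W"
  proof -
   have "A i (?ev (v - z) i) - A 0 (?ev (v - z) 0)=0" if i: "i<r" for i
   proof -
    have *: "A i (?ev (v - z) i)=A i (?ev v i) - n i" if "i<r" for i
     using blinear_on_diff[OF Aev[OF that] sV v zV] L(3)[OF that nN[OF that]] zi[OF that] by simp
    show ?thesis unfolding *[OF i] *[OF r] by (simp add: n_def)
   qed
   then show ?thesis using subspace_diff[OF sV v zV] unfolding W_def by blast
  qed
  then show "v:{w + z |w z. w:W&z:Y}" using zY by (intro CollectI exI[of _ "v - z"] exI[of _ z]) simp
 next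
  fix v assume "v:{w + z |w z. w:W&z:Y}"
  then show "v:V" using subspace_add[OF sV] by (auto simp: W_def Y_def)
 qed
 have "W<=V" "Y<=V" unfolding W_def Y_def by blast+
 then have sp: "splits (cmodel C) W"
  unfolding splits_def CV by (intro conjI exI[of _ Y] sW clW sY clY WY VWY)
 have inS: "w:?S\<longleftrightarrow>cmap C w:W" if w: "w:cdom C" for w
 proof -
  have wc: "w i:cdom (c i)" if "i<r" for i using w that by (simp add: C_def prod_chart_sel PiE_iff)
  have we: "w:extensional {..<r}" using w by (simp add: C_def prod_chart_sel PiE_iff)
  have wE: "w:(\<Pi>\<^sub>E i\<in>{..<r}. mpoints E)"
   unfolding PiE_iff using we wc chartD(6)[OF cc] by blast
  have CwV: "cmap C w:V" using cmap_in_cmodel[OF cc wc] by (simp add: C_def V_def prod_chart_sel)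
  have Aw: "A i (?ev (cmap C w) i)=cmap psi (p (w i))" if "i<r" for i
   using A(2)[OF that wc[OF that]] that by (simp add: C_def prod_chart_sel)
  \<comment> \<open>Injectivity of \<open>psi\<close> is applicable because every chart
    \<open>c i\<close> is mapped into the domain of \<open>psi\<close>.\<close>
  have eqiff: "cmap psi (p (w i))=cmap psi (p (w j))\<longleftrightarrow>p (w i)=p (w j)" if "i<r" "j<r" for i j
   by (rule inj_on_eq_iff[OF chartD(5)[OF pp]]) (use c(3) wc that in blast)+
  have "w:?S\<longleftrightarrow>(ALL i<r. p (w i)=p (w 0))"
   unfolding fiber_product_def mem_Collect_eq using wE r by metis
  also have "...\<longleftrightarrow>(ALL i<r. A i (?ev (cmap C w) i) - A 0 (?ev (cmap C w) 0)=0)"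
   using Aw eqiff r by simp
  finally show ?thesis using CwV by (simp add: W_def)
 qed
 have "C:max_atlas (prod_manifold r E)" unfolding C_def by (rule max_atlas_prod[OF E c(1)])
 moreover have "cmap C ` (cdom C\<inter>?S)=cmap C ` cdom C\<inter>W" using inS by auto
 moreover have "u:cdom C" using uE c(2) by (simp add: C_def prod_chart_sel PiE_iff)
 ultimately show ?thesis using sp by blast
qed

theorem diff_manifold_fiber_product:
 assumes "banach_manifold E" "banach_manifold X" "submersion E X p" "0<r"
 shows "diff_manifold (fiber_product_manifold r E p)"
 unfolding fiber_product_manifold_def
proof (rule diff_manifold_submanifold[OF diff_manifold_prod[OF assms(1)]])
 show "fiber_product r (mtop E) p<=mpoints (prod_manifold r E)"
  by (auto simp: fiber_product_def mtop_prod_manifold)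
qed (rule fiber_product_chart[OF assms])

section \<open>Deformations in complete metric spaces\<close>

abbreviation UI :: "real topology" where "UI \<equiv> top_of_set {0..1}"

text \<open>The classical proof that metric spaces are paracompact, by a well-order of the index
  set. Only disjointness within each of countably many layers is kept, so that the moves of one
  layer can be performed simultaneously.\<close>

lemma (in Metric_space) sigma_disjoint_refinement:
 assumes C: "!!x. x:R==>openin mtopology (C x)&x:C x"
 obtains D :: "nat=>'a=>'a set" where "!!n x. openin mtopology (D n x)" "!!n x. x:R==>D n x<=C x"
  "!!n x y. x:R==>y:R==>x~=y==>D n x\<inter>D n y={}" "R<=(\<Union>n. \<Union>x\<in>R. D n x)"
proof -
 obtain r :: "('a \<times> 'a) set" where r: "well_order_on UNIV r" using well_order_on by blast
 then have tot: "total r" and wf: "wf (r - Id)"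
  by (auto simp: well_order_on_def linear_order_on_def)
 \<comment> \<open>A point enters layer \<open>n\<close> of \<open>x\<close> if \<open>x\<close> is
   the first index whose set contains it, with room \<open>3 / 2^n\<close>. Centres belonging to
   different indices are then at least that far apart, and balls of radius \<open>1 / 2^n\<close>
   around them cannot meet.\<close>
 define Z where "Z=(%n x. {z:M. mball z (3 / 2^n)<=C x&(ALL y:R. (y, x):r - Id-->z \<notin> C y)})"
 define D where "D=(%n x. \<Union>z\<in>Z n x. mball z (1 / 2^n))"
 have le3: "mball z (1 / 2^n)<=mball z (3 / 2^n)" for z and n :: nat
  by (rule mball_subset_concentric) (simp add: divide_right_mono)
 have sep: False if x: "x:R" "y:R" "(x, y):r - Id" and w: "w:D n x" "w:D n y" for n x y w
 proof -
  obtain z z' where z: "z:Z n x" "w:mball z (1 / 2^n)" and z': "z':Z n y" "w:mball z' (1 / 2^n)"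
   using w by (auto simp: D_def)
  have "z' \<notin> C x" using z' x by (auto simp: Z_def)
  then have "z' \<notin> mball z (3 / 2^n)" using z by (auto simp: Z_def)
  then have "3 / 2^n<=d z z'" using z z' by (auto simp: Z_def)
  moreover have "d z z'<=d z w + d z' w" using z z' by (intro triangle') auto
  moreover have "d z w<1 / 2^n" "d z' w<1 / 2^n" using z z' by auto
  moreover have "(3::real) / 2^n>=1 / 2^n + 1 / 2^n" by (simp add: divide_simps)
  ultimately show False by linarith
 qed
 show ?thesis
 proof (rule that[of D])
  show "openin mtopology (D n x)" for n x by (auto simp: D_def)
  show "D n x<=C x" if "x:R" for n x using le3 by (auto simp: D_def Z_def)
  show "D n x\<inter>D n y={}" if "x:R" "y:R" "x~=y" for n x y
  proof -
   have "(x, y):r - Id \<or> (y, x):r - Id" using tot that by (auto simp: total_on_def)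
   then show ?thesis using sep that by blast
  qed
  show "R<=(\<Union>n. \<Union>x\<in>R. D n x)"
  proof
   fix z assume z: "z:R"
   then have "z:{x:R. z:C x}" using C by blast
   from wf[unfolded wf_eq_minimal, rule_format, OF this]
   have "EX x:{x:R. z:C x}. ALL y. (y, x):r - Id-->y \<notin> {x:R. z:C x}" .
   then obtain x where x: "x:R" "z:C x" and xm: "ALL y. (y, x):r - Id-->y \<notin> {x:R. z:C x}"
    by auto
   obtain e where e: "e>0" "mball z e<=C x" using C[OF x(1)] x(2) by (auto simp: openin_mtopology)
   have zM: "z:M" using C[OF z] openin_subset by fastforce
   obtain n where "(1/2::real) ^ n<e / 3" using real_arch_pow_inv[of "e/3" "1/2"] e by auto
   then have "3 / 2^n<=e" by (simp add: power_one_over field_simps)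
   then have "mball z (3 / 2^n)<=C x" using e mball_subset_concentric by blast
   then have "z:Z n x" using zM x xm by (auto simp: Z_def)
   then have "z:D n x" using zM by (auto simp: D_def)
   then show "z:(\<Union>n. \<Union>x\<in>R. D n x)" using x by blast
  qed
 qed
qed

text \<open>A substitute for a piece of flow: the time bounds the distance travelled, so
  \<open>F\<close> drops by at least \<open>sig\<close> times that distance. This ratio survives
  composition, while times of different moves need not be comparable.\<close>

definition (in Metric_space) local_descent :: "('a=>real)=>real=>'a set=>real=>('a \<times> real=>'a)=>bool" where
 "local_descent F sig N dlt H\<longleftrightarrow>openin mtopology N&dlt>0 &
   continuous_map (prod_topology (subtopology mtopology N) (top_of_set {0..dlt})) mtopology H &
   (ALL y:N. ALL t:{0..dlt}. d (H (y, t)) y<=t&F (H (y, t))<=F y - sig * t)"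

text \<open>The distance to the complement, truncated at 1; the inserted 1 also gives a positive
  value when the complement is empty.\<close>

lemma (in Metric_space) dist_to_complement:
 assumes U: "openin mtopology U"
 obtains tau where "!!y z. y:M==>z:M==>z \<notin> U==>tau y<=d y z" "!!y. y:U==>tau y>0"
  "continuous_map mtopology euclideanreal tau"
proof -
 define tau where "tau=(%y. Inf (insert 1 (d y ` (M - U))))"
 have bdd: "bdd_below (insert 1 (d y ` (M - U)))" for y by (rule bdd_belowI[of _ 0]) auto
 have le: "tau y<=d y z" if "z:M" "z \<notin> U" for y z
  unfolding tau_def using bdd that by (intro cInf_lower) auto
 have le1: "tau y<=1" for y unfolding tau_def using bdd by (intro cInf_lower) auto
 have ge: "c<=tau y" if "c<=1" "!!z. z:M==>z \<notin> U==>c<=d y z" for c y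
  unfolding tau_def using that by (intro cInf_greatest) auto
 have Lip: "tau y - d y y'<=tau y'" if "y:M" "y':M" for y y'
 proof (rule ge)
  show "tau y - d y y'<=1" using le1[of y] nonneg[of y y'] by linarith
  fix z assume "z:M" "z \<notin> U"
  then show "tau y - d y y'<=d y' z" using le[of z y] triangle[OF that, of z] by linarith
 qed
 have "continuous_map mtopology euclideanreal tau"
  unfolding mtopology_is_euclidean[symmetric]
 proof (subst metric_continuous_map[OF Met_TC.Metric_space_axioms], intro conjI ballI allI impI)
  fix y e assume y: "y:M" and "(0::real)<e"
  then show "EX dlt>0. ALL x. x:M&d y x<dlt-->dist (tau y) (tau x)<e"
   using Lip[OF y] Lip[OF _ y] commute by (intro exI[of _ e]) (fastforce simp: dist_real_def abs_less_iff)
 qed auto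
 moreover have "tau y>0" if y: "y:U" for y
 proof -
  obtain e where e: "e>0" "mball y e<=U" using U y by (auto simp: openin_mtopology)
  have yM: "y:M" using U y openin_subset by fastforce
  have "min 1 e<=tau y" by (rule ge) (use e yM in \<open>auto simp: not_less min_le_iff_disj\<close>)
  then show ?thesis using e by linarith
 qed
 ultimately show ?thesis using le by (intro that[of tau]) auto
qed

text \<open>On \<open>D x\<close> the descent \<open>H x\<close> runs for a time not exceeding the
  distance to the complement of the union. It fades out at the boundary, so the identity extends it
  continuously, and it is nontrivial at every point of the union.\<close>

lemma (in Metric_space) disjoint_descent:
 fixes F :: "'a=>real"
 assumes D: "!!x. x:R==>openin mtopology (D x)&D x<=N x"
  and disj: "!!x y. x:R==>y:R==>x~=y==>D x\<inter>D y={}"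
  and H: "!!x. x:R==>local_descent F sig (N x) (dlt x) (H x)" and sig: "sig>0"
 obtains S where "continuous_map (prod_topology mtopology UI) mtopology S" "!!y. y:M==>S (y, 0)=y"
  "!!y s. y:M==>s:{0..1}==>F (S (y, s))<=F y - sig * d (S (y, s)) y"
  "!!y x. x:R==>y:D x==>F (S (y, 1))<F y"
proof -
 define U where "U=(\<Union>x\<in>R. D x)"
 have U: "openin mtopology U" using D by (auto simp: U_def)
 have UM: "U<=M" using openin_subset[OF U] by simp
 obtain tau where tau: "!!y z. y:M==>z:M==>z \<notin> U==>tau y<=d y z" "!!y. y:U==>tau y>0"
  "continuous_map mtopology euclideanreal tau" using dist_to_complement[OF U] by blast
 define idx where "idx=(%y. THE x. x:R&y:D x)"
 have idx: "idx y=x" if "x:R" "y:D x" for x y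
  unfolding idx_def by (rule the_equality) (use disj that in blast)+
 define T where "T=(%x (p::'a \<times> real). (fst p, snd p * min (dlt x) (tau (fst p))))"
 define S where "S=(%p. if fst p:U then H (idx (fst p)) (T (idx (fst p)) p) else fst p)"
 have dlt: "dlt x>0" if "x:R" for x using H[OF that] by (simp add: local_descent_def)
 have tx: "s * min (dlt x) (tau y):{0..dlt x}" "s * min (dlt x) (tau y)<=tau y"
  if "x:R" "y:U" "s:{0..1}" for x y s
  using that dlt[of x] tau(2)[of y] mult_left_le_one_le[of "min (dlt x) (tau y)" s] by auto
 have HM: "H x (y, t):M" if "x:R" "y:N x" "t:{0..dlt x}" for x y t
 proof -
  have "N x<=M" using H[OF that(1)] openin_subset[of mtopology "N x"] by (auto simp: local_descent_def)
  then show ?thesis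
   using H[OF that(1)] that unfolding local_descent_def continuous_map_def by auto
 qed
 have Hd: "d (H x (y, t)) y<=t" "F (H x (y, t))<=F y - sig * t" if "x:R" "y:N x" "t:{0..dlt x}" for x y t
  using H[OF that(1)] that by (auto simp: local_descent_def)
 have SU: "S (y, s)=H x (y, s * min (dlt x) (tau y))" if "x:R" "y:D x" for x y s
  using that idx[OF that] by (auto simp: S_def T_def U_def)
 have bnd: "S (y, s):M&d (S (y, s)) y<=max 0 (tau y)&F (S (y, s))<=F y - sig * d (S (y, s)) y"
  if y: "y:M" and s: "s:{0..1}" for y s
 proof (cases "y:U")
  case True
  then obtain x where x: "x:R" "y:D x" by (auto simp: U_def)
  let ?t="s * min (dlt x) (tau y)"
  have yN: "y:N x" using D x by blast
  note t=tx[OF x(1) True s]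
  have "sig * d (H x (y, ?t)) y<=sig * ?t" using Hd(1)[OF x(1) yN t(1)] sig by (intro mult_left_mono) auto
  then show ?thesis
   unfolding SU[OF x] using HM[OF x(1) yN t(1)] Hd[OF x(1) yN t(1)] t(2) by linarith
 next
  case False
  then show ?thesis using y by (simp add: S_def)
 qed
 have cont: "continuous_map (prod_topology mtopology UI) mtopology S"
  unfolding continuous_map_def
 proof (intro conjI allI impI)
  show "S:topspace (prod_topology mtopology UI) \<rightarrow> topspace mtopology" using bnd by auto
  fix W assume W: "openin mtopology W"
  let ?P="prod_topology mtopology UI"
  show "openin ?P {p:topspace ?P. S p:W}"
  proof (subst openin_subopen, intro ballI)
   fix p assume p: "p:{p:topspace ?P. S p:W}"
   obtain y s where ys: "p=(y, s)" by (cases p)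
   have y: "y:M" and s: "s:{0..1}" and SW: "S (y, s):W" using p ys by auto
   show "EX V. openin ?P V&p:V&V<={p:topspace ?P. S p:W}"
   proof (cases "y:U")
    case True
    then obtain x where x: "x:R" "y:D x" by (auto simp: U_def)
    have DM: "openin mtopology (D x)" "D x<=N x" "D x<=U" using D x by (auto simp: U_def)
    let ?Q="prod_topology (subtopology mtopology (D x)) UI"
    have "continuous_map ?Q (prod_topology (subtopology mtopology (N x)) (top_of_set {0..dlt x})) (T x)"
     unfolding T_def
    proof (intro continuous_map_pairedI continuous_map_into_subtopology)
     have c1: "continuous_map ?Q mtopology fst"
      using continuous_map_fst[of "subtopology mtopology (D x)" UI] by (simp add: continuous_map_in_subtopology)
     then show "continuous_map ?Q mtopology fst" .
     show "fst:topspace ?Q \<rightarrow> N x" using DM by auto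
     have c2: "continuous_map ?Q euclideanreal snd"
      using continuous_map_snd[of "subtopology mtopology (D x)" UI] by (simp add: continuous_map_in_subtopology)
     have c3: "continuous_map ?Q euclideanreal (%p. tau (fst p))"
      using continuous_map_compose[OF c1 tau(3)] by (simp add: comp_def)
     show "continuous_map ?Q euclideanreal (%p. snd p * min (dlt x) (tau (fst p)))"
      by (intro continuous_intros c2 c3)
     show "(%p. snd p * min (dlt x) (tau (fst p))):topspace ?Q \<rightarrow> {0..dlt x}"
      using tx(1)[OF x(1)] DM(3) by (auto simp del: atLeastAtMost_iff)
    qed
    from continuous_map_compose[OF this] H[OF x(1)]
    have "continuous_map ?Q mtopology (H x o T x)" by (auto simp: local_descent_def)
    from openin_continuous_map_preimage[OF this W]
    have o: "openin ?Q {p:topspace ?Q. (H x o T x) p:W}" .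
    have Q: "?Q=subtopology ?P (D x \<times> {0..1})" by (simp add: subtopology_Times subtopology_subtopology)
    have "openin ?P (D x \<times> {0..1})" using DM(1) by (simp add: openin_prod_Times_iff)
    with o have "openin ?P {p:topspace ?Q. (H x o T x) p:W}" unfolding Q by (rule openin_trans_full)
    moreover have "{p:topspace ?Q. (H x o T x) p:W}<={p:topspace ?P. S p:W}"
     using SU[OF x(1)] by (auto simp: T_def)
    moreover have "p:{p:topspace ?Q. (H x o T x) p:W}"
     using SU[OF x] SW ys x(2) y s by (auto simp: T_def)
    ultimately show ?thesis by blast
   next
    case False
    then have "y:W" using SW by (simp add: S_def)
    then obtain e where e: "e>0" "mball y e<=W" using W by (auto simp: openin_mtopology)
    \<comment> \<open>A nearby point moves by no more than its distance to \<open>y\<close>, since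
      \<open>y\<close> lies outside \<open>U\<close>; half the radius is therefore enough.\<close>
    have "mball y (e / 2) \<times> {0..1}<={p:topspace ?P. S p:W}"
    proof clarify
     fix z t assume z: "z:mball y (e / 2)" and t: "t:{0..1::real}"
     then have zM: "z:M" by simp
     have "max 0 (tau z)<=d z y" using tau(1)[OF zM y False] by simp
     then have "d (S (z, t)) z<=d z y" using bnd[OF zM t] by linarith
     then have "d y (S (z, t))<e"
      using triangle[OF y zM, of "S (z, t)"] bnd[OF zM t] z commute[of z y] commute[of z "S (z, t)"] by auto
     then have "S (z, t):W" using e y bnd[OF zM t] by auto
     then show "(z, t):topspace ?P&S (z, t):W" using zM t by auto
    qed
    moreover have "openin ?P (mball y (e / 2) \<times> {0..1})" by (simp add: openin_prod_Times_iff)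
    ultimately show ?thesis using ys y s e by (intro exI[of _ "mball y (e / 2) \<times> {0..1}"]) auto
   qed
  qed
 qed
 show ?thesis
 proof (rule that[OF cont])
  fix y assume y: "y:M"
  show "S (y, 0)=y"
  proof (cases "y:U")
   case True
   then obtain x where x: "x:R" "y:D x" by (auto simp: U_def)
   have yN: "y:N x" and 0: "0:{0..dlt x}" using D x dlt[OF x(1)] by auto
   have "d (H x (y, 0)) y=0" using Hd(1)[OF x(1) yN 0] nonneg[of "H x (y, 0)" y] by linarith
   then show ?thesis using SU[OF x, of 0] HM[OF x(1) yN 0] y by simp
  qed (simp add: S_def)
  show "F (S (y, s))<=F y - sig * d (S (y, s)) y" if "s:{0..1}" for s using bnd[OF y that] by blast
 next
  fix y x assume x: "x:R" "y:D x"
  then have yU: "y:U" and yN: "y:N x" using D by (auto simp: U_def)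
  let ?t="min (dlt x) (tau y)"
  have "?t>0" using dlt[OF x(1)] tau(2)[OF yU] by simp
  then have "sig * ?t>0" using sig by simp
  then show "F (S (y, 1))<F y"
   using SU[OF x, of 1] Hd(2)[OF x(1) yN, of ?t] tx(1)[OF x(1) yU, of 1] by simp
 qed
qed

text \<open>Each layer of the refinement gives a global move, and the moves are performed one after
  the other, each infinitely often. An orbit that never falls below \<open>a1\<close> is Cauchy
  because \<open>F\<close> pays for every distance; its limit lies in \<open>R\<close> by
  \<open>reach\<close>, where some move still lowers \<open>F\<close> strictly, a contradiction. The
  homotopy follows these moves but is slowed down below \<open>a2\<close> and stopped below
  \<open>a1\<close>, so that near each point only finitely many moves matter.\<close>

theorem (in Metric_space) deformation:
 fixes F :: "'a=>real"
 assumes complete: "mcomplete" and F: "continuous_map mtopology euclideanreal F" and sig: "sig>0"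
  and R: "!!x. x:R==>EX N dlt H. x:N&local_descent F sig N dlt H"
  and a: "a1<a2" and A: "A<=M"
  and reach: "!!y z. y:A==>z:M==>a1<=F z==>sig * d y z<=F y - F z==>z:R"
 obtains G b where "openin mtopology G" "A<=G"
  "continuous_map (prod_topology (subtopology mtopology G) UI) mtopology b"
  "!!y. y:G==>b (y, 0)=y" "!!y. y:G==>F (b (y, 1))<a2"
proof -
 let ?P="prod_topology mtopology UI"
 obtain N dlt H where H: "!!x. x:R==>x:N x&local_descent F sig (N x) (dlt x) (H x)"
  using R by metis
 then have "!!x. x:R==>openin mtopology (N x)&x:N x" by (simp add: local_descent_def)
 from sigma_disjoint_refinement[OF this] obtain D :: "nat=>'a=>'a set"
  where D: "!!n x. openin mtopology (D n x)" "!!n x. x:R==>D n x<=N x"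
  "!!n x y. x:R==>y:R==>x~=y==>D n x\<inter>D n y={}" "R<=(\<Union>n. \<Union>x\<in>R. D n x)" by blast
 define good where "good=(%n S. continuous_map ?P mtopology S&(ALL y:M. S (y, 0)=y) &
  (ALL y:M. ALL s:{0..1}. F (S (y, s))<=F y - sig * d (S (y, s)) y)&(ALL x:R. ALL y:D n x. F (S (y, 1))<F y))"
 have "EX S. good n S" for n
  by (rule disjoint_descent[of R "D n" N F sig dlt H]) (use D H sig in \<open>auto simp: good_def\<close>)
 then obtain S where S: "!!n. good n (S n)" by metis
 have Sc: "continuous_map ?P mtopology (S n)" and S0: "y:M==>S n (y, 0)=y"
  and SF: "y:M==>s:{0..1}==>F (S n (y, s))<=F y - sig * d (S n (y, s)) y"
  and SD: "x:R==>y:D n x==>F (S n (y, 1))<F y" for n x y s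
  using S[of n] by (auto simp: good_def)
 have SM: "S n (y, s):M" if "y:M" "s:{0..1}" for n y s
  using Sc[of n] that by (auto simp: continuous_map_def)
 \<comment> \<open>Decoding pairs makes every index \<open>n\<close> recur: it is the first
   component of the code of \<open>(n, K)\<close> for every \<open>K\<close>.\<close>
 define e where "e=(%k. fst (prod_decode k))"
 define a where "a=(%k. rec_nat (%y. y) (%k f y. S (e k) (f y, 1)) k)"
 have a0: "a 0 y=y" and aS: "a (Suc k) y=S (e k) (a k y, 1)" for k y by (simp_all add: a_def)
 have ac: "continuous_map mtopology mtopology (a k)" for k
 proof (induction k)
  case 0
  then show ?case by (simp add: a_def)
 next
  case (Suc k)
  have "continuous_map mtopology ?P (%y. (a k y, 1))" by (intro continuous_map_pairedI Suc) auto
  from continuous_map_compose[OF this Sc] show ?case by (simp add: comp_def aS)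
 qed
 have aM: "a k y:M" if "y:M" for k y using ac[of k] that by (auto simp: continuous_map_def)
 have astep: "F (a (Suc k) y)<=F (a k y) - sig * d (a k y) (a (Suc k) y)" if "y:M" for k y
  using SF[OF aM[OF that], of 1 "e k"] commute by (simp add: aS)
 have adist: "sig * d (a j y) (a k y)<=F (a j y) - F (a k y)" if y: "y:M" and "j<=k" for j k y
  using \<open>j<=k\<close>
 proof (induction k rule: dec_induct)
  case base
  then show ?case using aM[OF y] by simp
 next
  case (step k)
  have "sig * d (a j y) (a (Suc k) y)<=sig * (d (a j y) (a k y) + d (a k y) (a (Suc k) y))"
   using sig aM[OF y] by (intro mult_left_mono triangle) auto
  then show ?case using step.IH astep[OF y, of k] by (simp add: distrib_left)
 qed
 have amono: "F (a k y)<=F (a j y)" if "y:M" "j<=k" for j k y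
 proof -
  have "0<=sig * d (a j y) (a k y)" using sig by simp
  then show ?thesis using adist[OF that] by linarith
 qed
 have reached: "EX k. F (a k y)<a1" if y: "y:A" for y
 proof (rule ccontr)
  assume "\<not> ?thesis"
  then have ge: "a1<=F (a k y)" for k by (auto simp: not_less)
  have yM: "y:M" using A y by blast
  have "decseq (%k. F (a k y))" using amono[OF yM] by (auto simp: decseq_def)
  then obtain l where l: "(%k. F (a k y)) \<longlonglongrightarrow> l" and lle: "!!k. l<=F (a k y)"
   using decseq_convergent[of "%k. F (a k y)" a1] ge by blast
  have "MCauchy (%k. a k y)"
   unfolding MCauchy_def
  proof (intro conjI allI impI)
   show "range (%k. a k y)<=M" using aM[OF yM] by blast
   fix eps :: real assume eps: "eps>0"
   have "\<forall>\<^sub>F k in sequentially. F (a k y)<l + sig * eps" using order_tendstoD(2)[OF l] sig eps by simp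
   then obtain K where K: "F (a k y)<l + sig * eps" if "k>=K" for k by (auto simp: eventually_sequentially)
   have lt: "d (a j y) (a k y)<eps" if "K<=j" "j<=k" for j k
   proof -
    have "sig * d (a j y) (a k y)<sig * eps" using adist[OF yM that(2)] K[OF that(1)] lle[of k] by linarith
    then show ?thesis using sig by simp
   qed
   show "EX N. ALL n n'. N<=n-->N<=n'-->d (a n y) (a n' y)<eps"
   proof (intro exI[of _ K] allI impI)
    fix n n' assume "K<=n" "K<=n'"
    then show "d (a n y) (a n' y)<eps"
     using lt[of n n'] lt[of n' n] commute by (cases "n<=n'") auto
   qed
  qed
  then obtain z where z: "limitin mtopology (%k. a k y) z sequentially"
   using complete by (auto simp: mcomplete_def)
  have zM: "z:M" using z by (simp add: limitin_def)
  have "limitin euclideanreal (F o (%k. a k y)) (F z) sequentially" by (rule continuous_map_limit[OF F z])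
  then have "(%k. F (a k y)) \<longlonglongrightarrow> F z" by (simp add: comp_def)
  then have Fz: "F z=l" using l LIMSEQ_unique by blast
  \<comment> \<open>The drop of \<open>F\<close> dominates the distance from the starting point also
    in the limit, which is the form in which \<open>reach\<close> recognises points of
    \<open>R\<close>.\<close>
  have zd: "sig * d y z<=F y - F z"
  proof -
   have "sig * d y z<=F y - F z + sig * eps" if eps: "eps>0" for eps
   proof -
    have "\<forall>\<^sub>F k in sequentially. a k y:M&d (a k y) z<eps" using z eps by (simp add: limitin_metric)
    then obtain k where k: "d (a k y) z<eps" by (auto simp: eventually_sequentially)
    have "sig * d y z<=sig * (d y (a k y) + d (a k y) z)"
     using sig aM[OF yM] yM zM by (intro mult_left_mono triangle) auto
    also have "...<=(F y - F (a k y)) + sig * eps"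
     using adist[OF yM, of 0 k] mult_strict_left_mono[OF k sig] by (simp add: a0 distrib_left)
    finally show ?thesis using lle[of k] Fz by linarith
   qed
   then show ?thesis
    using field_le_epsilon[of "sig * d y z" "F y - F z"] sig by (metis divide_pos_pos nonzero_mult_div_cancel_left order_less_irrefl times_divide_eq_right)
  qed
  have "a1<=l" using LIMSEQ_le_const[OF l] ge by blast
  then have "z:R" using reach[OF y zM _ zd] Fz by simp
  then obtain n x where x: "x:R" "z:D n x" using D(4) by blast
  have lt: "F (S n (z, 1))<l" using SD[OF x] Fz by simp
  have "continuous_map mtopology ?P (%y. (y, 1))" by (intro continuous_map_pairedI) auto
  from continuous_map_compose[OF continuous_map_compose[OF this Sc[of n]] F]
  have "continuous_map mtopology euclideanreal (%y. F (S n (y, 1)))" by (simp add: comp_def)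
  from continuous_map_limit[OF this z] have "(%k. F (S n (a k y, 1))) \<longlonglongrightarrow> F (S n (z, 1))" by (simp add: comp_def)
  then have "\<forall>\<^sub>F k in sequentially. F (S n (a k y, 1))<l" using lt by (rule order_tendstoD)
  then obtain K where K: "F (S n (a k y, 1))<l" if "k>=K" for k by (auto simp: eventually_sequentially)
  \<comment> \<open>The code of a pair is at least its second component, so this is an occurrence of
    move \<open>n\<close> after stage \<open>K\<close>.\<close>
  define k where "k=prod_encode (n, K)"
  have "k>=K" "e k=n" by (auto simp: k_def e_def le_prod_encode_2)
  then have "F (a (Suc k) y)<l" using K[of k] by (simp add: aS)
  then show False using lle[of "Suc k"] by linarith
 qed
 \<comment> \<open>The cutoff is 1 as long as the orbit is at or above \<open>a2\<close> and 0 once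
   it is below \<open>a1\<close>.\<close>
 define cut where "cut=(%k y. max 0 (min 1 ((F (a k y) - a1) / (a2 - a1))))"
 have cut01: "cut k y:{0..1}" for k y by (auto simp: cut_def)
 have cutc: "continuous_map mtopology euclideanreal (cut k)" for k
 proof -
  have "continuous_map mtopology euclideanreal (%y. F (a k y))"
   using continuous_map_compose[OF ac F] by (simp add: comp_def)
  then show ?thesis unfolding cut_def using a by (intro continuous_intros) auto
 qed
 have cut0: "cut k y=0" if "F (a k y)<a1" for k y
  using that a by (auto simp: cut_def max_def min_def divide_simps)
 have cut1: "cut k y=1" if "a2<=F (a k y)" for k y
  using that a by (auto simp: cut_def max_def min_def divide_simps)
 \<comment> \<open>The cutoff is read off the unslowed orbit \<open>a\<close>, not from
   \<open>b\<close> itself. Thus the open sets \<open>Gk k\<close>, on which the moves from stage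
   \<open>k\<close> on are stationary, do not depend on the homotopy parameter.\<close>
 define b where "b=(%k. rec_nat fst (%k f p. S (e k) (f p, snd p * cut k (fst p))) k)"
 have b0: "b 0 p=fst p" and bS: "b (Suc k) p=S (e k) (b k p, snd p * cut k (fst p))" for k p by (simp_all add: b_def)
 have scut: "s * cut k y:{0..1}" if "s:{0..1}" for s k y
  using that cut01[of k y] by (auto intro: mult_le_one)
 have bc: "continuous_map ?P mtopology (b k)" for k
 proof (induction k)
  case 0
  then show ?case by (simp add: b_def continuous_map_fst)
 next
  case (Suc k)
  have "continuous_map ?P UI (%p. snd p * cut k (fst p))"
  proof (rule continuous_map_into_subtopology)
   have "continuous_map ?P euclideanreal snd"
    using continuous_map_snd[of mtopology UI] by (simp add: continuous_map_in_subtopology)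
   moreover have "continuous_map ?P euclideanreal (%p. cut k (fst p))"
    using continuous_map_compose[OF continuous_map_fst cutc] by (simp add: comp_def)
   ultimately show "continuous_map ?P euclideanreal (%p. snd p * cut k (fst p))" by (intro continuous_intros)
   show "(%p. snd p * cut k (fst p)):topspace ?P \<rightarrow> {0..1}" using scut by (auto simp del: atLeastAtMost_iff)
  qed
  then have "continuous_map ?P ?P (%p. (b k p, snd p * cut k (fst p)))" by (intro continuous_map_pairedI Suc)
  from continuous_map_compose[OF this Sc] show ?case by (simp add: comp_def bS)
 qed
 have bM: "b k (y, s):M" if "y:M" "s:{0..1}" for k y s using bc[of k] that by (auto simp: continuous_map_def)
 have bstart: "b k (y, 0)=y" if "y:M" for k y by (induction k) (use that S0 in \<open>auto simp: b0 bS\<close>)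
 have bmono: "F (b k (y, s))<=F (b j (y, s))" if "y:M" "s:{0..1}" "j<=k" for j k y s
  using \<open>j<=k\<close>
 proof (induction k rule: dec_induct)
  case (step k)
  have "F (b (Suc k) (y, s))<=F (b k (y, s)) - sig * d (b (Suc k) (y, s)) (b k (y, s))"
   unfolding bS using SF[OF bM[OF that(1,2)] scut[OF that(2)]] by simp
  moreover have "0<=sig * d (b (Suc k) (y, s)) (b k (y, s))" using sig by simp
  ultimately show ?case using step.IH by linarith
 qed simp
 have b1: "b k (y, 1)=a k y" if "!!j. j<k==>a2<=F (a j y)" for k y
  using that by (induction k) (auto simp: b0 bS a0 aS cut1)
 have bstop: "b j (y, s)=b k (y, s)" if y: "y:M" "s:{0..1}" and k: "F (a k y)<a1" and "k<=j" for j k y s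
  using \<open>k<=j\<close>
 proof (induction j rule: dec_induct)
  case (step j)
  have "F (a j y)<a1" using amono[OF y(1) step.hyps(1)] k by linarith
  then show ?case using step.IH S0[OF bM[OF y]] by (simp add: bS cut0)
 qed simp
 define Gk where "Gk=(%k. {y:M. F (a k y)<a1})"
 have Gko: "openin mtopology (Gk k)" for k
 proof -
  have "continuous_map mtopology euclideanreal (%y. F (a k y))"
   using continuous_map_compose[OF ac F] by (simp add: comp_def)
  from openin_continuous_map_preimage[OF this, of "{..<a1}"] show ?thesis by (simp add: Gk_def)
 qed
 define G where "G=(\<Union>k. Gk k)"
 define B where "B=(%p. b (LEAST k. fst p:Gk k) p)"
 have B: "B (y, s)=b k (y, s)" if "y:Gk k" "s:{0..1}" for k y s
 proof -
  define m where "m=(LEAST k. y:Gk k)"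
  have m: "y:Gk m" "m<=k" unfolding m_def using that by (auto intro: LeastI Least_le)
  then have "y:M" "F (a m y)<a1" by (auto simp: Gk_def)
  from bstop[OF this(1) that(2) this(2) m(2)] show ?thesis by (simp add: B_def m_def[symmetric])
 qed
 have GM: "G<=M" by (auto simp: G_def Gk_def)
 show ?thesis
 proof (rule that[of G B])
  show "openin mtopology G" using Gko by (auto simp: G_def)
  show "A<=G" using reached A by (fastforce simp: G_def Gk_def)
  show "continuous_map (prod_topology (subtopology mtopology G) UI) mtopology B"
   unfolding continuous_map_def
  proof (intro conjI allI impI)
   let ?Q="prod_topology (subtopology mtopology G) UI"
   show "B:topspace ?Q \<rightarrow> topspace mtopology" using B bM GM by (fastforce simp: G_def Gk_def)
   fix W assume W: "openin mtopology W"
   have "{p:topspace ?Q. B p:W}=(\<Union>k. {p:topspace ?P. b k p:W}\<inter>(Gk k \<times> {0..1}))"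
    using B GM by (fastforce simp: G_def Gk_def)
   also have "openin ?P ..."
    using openin_continuous_map_preimage[OF bc W] Gko by (intro openin_Union ballI) (auto simp: openin_prod_Times_iff)
   finally have "openin (subtopology ?P (G \<times> {0..1})) ({p:topspace ?Q. B p:W}\<inter>(G \<times> {0..1}))"
    by (rule openin_subtopology_Int)
   moreover have "{p:topspace ?Q. B p:W}\<inter>(G \<times> {0..1})={p:topspace ?Q. B p:W}" by auto
   moreover have "?Q=subtopology ?P (G \<times> {0..1})" by (simp add: subtopology_Times subtopology_subtopology)
   ultimately show "openin ?Q {p:topspace ?Q. B p:W}" by simp
  qed
  fix y assume y: "y:G"
  then obtain k where k: "y:Gk k" by (auto simp: G_def)
  have yM: "y:M" using y GM by blast
  show "B (y, 0)=y" using B[OF k, of 0] bstart[OF yM] by simp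
  \<comment> \<open>Before stage \<open>k0\<close> the cutoff is 1, so at parameter 1 the homotopy
    agrees with the orbit up to its first value below \<open>a2\<close>; the later slowed moves can
    only lower \<open>F\<close> further.\<close>
  define k0 where "k0=(LEAST k. F (a k y)<a2)"
  have ex: "F (a k y)<a2" using k a by (simp add: Gk_def)
  have k0: "F (a k0 y)<a2" "k0<=k"
   unfolding k0_def by (rule LeastI[of "%k. F (a k y)<a2", OF ex], rule Least_le[of "%k. F (a k y)<a2", OF ex])
  have below: "a2<=F (a j y)" if "j<k0" for j
   using not_less_Least[of j "%k. F (a k y)<a2"] that unfolding k0_def by simp
  have "F (B (y, 1))=F (b k (y, 1))" using B[OF k] by simp
  also have "...<=F (b k0 (y, 1))" using bmono[OF yM _ k0(2)] by simp
  also have "...<a2" using b1[OF below] k0(1) by simp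
  finally show "F (B (y, 1))<a2" .
 qed
qed

section \<open>Properties of the sequential parametrized complexity\<close>

text \<open>Sections of \<open>\<Pi>\<^sub>r\<close> over \<open>U\<close>, as maps on \<open>U \<times> [0, 1]\<close>.\<close>

definition fiber_section :: "nat=>'e topology=>('e=>'x)=>(nat=>'e) set=>((nat=>'e) \<times> real=>'e)=>bool" where
 "fiber_section r TE p U sig \<longleftrightarrow>
   continuous_map (prod_topology (subtopology (fiber_product_topology r TE p) U) UI) TE sig &
   (ALL u:U. (ALL t:{0..1}. p (sig (u, t))=p (u 0))&(ALL i<r. sig (u, real i / real (r - 1))=u i))"

definition sectional :: "nat=>'e topology=>('e=>'x)=>(nat=>'e) set=>bool" where
 "sectional r TE p U\<longleftrightarrow>openin (fiber_product_topology r TE p) U&(EX sig. fiber_section r TE p U sig)"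

section \<open>Open sets with local sections and covering numbers\<close>

lemma topspace_fiber_product: "topspace (fiber_product_topology r TE p)=fiber_product r TE p"
 by (auto simp: fiber_product_topology_def fiber_product_def)

lemma continuous_map_fiber_coord:
 "i<r==>continuous_map (fiber_product_topology r TE p) TE (%u. u i)"
 unfolding fiber_product_topology_def
 by (intro continuous_map_from_subtopology continuous_map_product_projection) simp

lemma node_in_unit: "2<=r==>i<r==>real i / real (r - 1):{0..1}"
 by (auto simp: divide_simps)

text \<open>The exponential law: evaluation turns a map into the path space into a map on the
  product with the interval, and currying goes back. Constructions of sections can then be done on
  products, without the compact-open topology.\<close>

lemma sectional_iff:
 assumes r: "2<=r" and U: "openin (fiber_product_topology r TE p) U"
 shows "(EX s. continuous_map (subtopology (fiber_product_topology r TE p) U) (fiber_paths TE p) s &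
   (ALL u:U. path_eval r (s u)=u))\<longleftrightarrow>(EX sig. fiber_section r TE p U sig)"
proof
 let ?Y="subtopology (fiber_product_topology r TE p) U"
 have UT: "topspace ?Y=U" "U<=fiber_product r TE p"
  using openin_subset[OF U] unfolding topspace_fiber_product[of r TE p] topspace_subtopology by auto
 have r1: "real (r - 1)>0" using r by simp
 assume "EX s. continuous_map ?Y (fiber_paths TE p) s&(ALL u:U. path_eval r (s u)=u)"
 then obtain s where s: "continuous_map ?Y (fiber_paths TE p) s" "!!u. u:U==>path_eval r (s u)=u" by blast
 have sc: "continuous_map ?Y (compact_open_topology UI TE) s"
  using s(1) by (auto simp: fiber_paths_def continuous_map_in_subtopology)
 have sp: "p (s u t)=p (s u 0)" if "u:U" "t:{0..1}" for u t
 proof -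
  have "s u:topspace (fiber_paths TE p)"
   using continuous_map_funspace[OF s(1)] that(1) unfolding UT(1) by (rule funcset_mem)
  then show ?thesis using that(2) unfolding fiber_paths_def topspace_subtopology Int_iff mem_Collect_eq by blast
 qed
 have su: "s u (real i / real (r - 1))=u i" if "u:U" "i<r" for u i
  using fun_cong[OF s(2)[OF that(1)], of i] that(2) by (simp add: path_eval_def)
 have "continuous_map (prod_topology ?Y UI) (prod_topology (compact_open_topology UI TE) UI) (%z. (s (fst z), snd z))"
  using continuous_map_compose[OF continuous_map_fst sc] by (intro continuous_map_pairedI continuous_map_snd) (simp add: comp_def)
 from continuous_map_compose[OF this continuous_map_path_eval]
 have "continuous_map (prod_topology ?Y UI) TE (%z. s (fst z) (snd z))" by (simp add: comp_def)
 moreover have "p (s u t)=p (u 0)" if "u:U" "t:{0..1}" for u t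
  using sp[OF that] su[OF that(1), of 0] r by simp
 ultimately have "fiber_section r TE p U (%z. s (fst z) (snd z))"
  using su by (simp add: fiber_section_def)
 then show "EX sig. fiber_section r TE p U sig" by blast
next
 let ?Y="subtopology (fiber_product_topology r TE p) U"
 have UT: "topspace ?Y=U" "U<=fiber_product r TE p"
  using openin_subset[OF U] unfolding topspace_fiber_product[of r TE p] topspace_subtopology by auto
 assume "EX sig. fiber_section r TE p U sig"
 then obtain sig where sig: "continuous_map (prod_topology ?Y UI) TE sig"
  "!!u t. u:U==>t:{0..1}==>p (sig (u, t))=p (u 0)" "!!u i. u:U==>i<r==>sig (u, real i / real (r - 1))=u i"
  by (auto simp: fiber_section_def)
 let ?s="%u. \<lambda>t\<in>{0..1}. sig (u, t)"
 have "continuous_map ?Y (fiber_paths TE p) ?s"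
  unfolding fiber_paths_def
  by (rule continuous_map_into_subtopology[OF continuous_map_path_curry[OF sig(1)]]) (use sig(2) UT in auto)
 moreover have "path_eval r (?s u)=u" if u: "u:U" for u
 proof (rule ext)
  fix i
  have "u:extensional {..<r}" using u UT by (auto simp: fiber_product_def PiE_def)
  then show "path_eval r (?s u) i=u i"
   using sig(3)[OF u, of i] node_in_unit[OF r, of i] by (auto simp: path_eval_def extensional_def)
 qed
 ultimately show "EX s. continuous_map ?Y (fiber_paths TE p) s&(ALL u:U. path_eval r (s u)=u)" by blast
qed

lemma TC_eq:
 assumes "2<=r"
 shows "TC r TE p A=(INF n\<in>{n. EX U:: nat=>(nat=>'e) set. A<=(\<Union>i<n. U i)&(ALL i<n. sectional r TE p (U i))}. enat n)"
 unfolding TC_def sectional_def using sectional_iff[OF assms] by (intro arg_cong[where f=Inf] image_cong Collect_cong ex_cong1) blast+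

lemma TC_leI:
 assumes "2<=r" "A<=(\<Union>i<n. U i)" "!!i. i<n==>sectional r TE p (U i)"
 shows "TC r TE p A<=enat n"
 unfolding TC_eq[OF assms(1)] using assms(2,3) by (intro INF_lower) blast

text \<open>The infimum of a nonempty set of extended natural numbers is attained, and a shorter
  cover may be padded by empty sets to have exactly \<open>n\<close> members.\<close>

lemma TC_leE:
 assumes r: "2<=r" and TC: "TC r TE p A<=enat n"
 obtains U where "A<=(\<Union>i<n. U i)" "!!i. i<n==>sectional r TE p (U i)"
proof -
 let ?N="{n. EX U:: nat=>(nat=>'a) set. A<=(\<Union>i<n. U i)&(ALL i<n. sectional r TE p (U i))}"
 have "enat ` ?N~={}"
 proof
  assume "enat ` ?N={}"
  then have "TC r TE p A=\<infinity>" unfolding TC_eq[OF r] by (simp only: Inf_empty top_enat_def)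
  then show False using TC by simp
 qed
 then have "(INF n\<in>?N. enat n):enat ` ?N" unfolding Inf_enat_def by (simp only: if_False) (rule LeastI_ex, blast)
 then obtain m where m: "m:?N" "TC r TE p A=enat m" unfolding TC_eq[OF r] by auto
 then obtain U where U: "A<=(\<Union>i<m. U i)" "!!i. i<m==>sectional r TE p (U i)" by auto
 have mn: "m<=n" using m TC by simp
 have "sectional r TE p {}"
 proof -
  have "subtopology (fiber_product_topology r TE p) {}=discrete_topology {}"
   by (simp add: subtopology_eq_discrete_topology_empty)
  then show ?thesis by (auto simp: sectional_def fiber_section_def continuous_map_def)
 qed
 then show ?thesis
 proof (intro that[of "%i. if i<m then U i else {}"])
  show "A<=(\<Union>i<n. if i<m then U i else {})"
  proof
   fix x assume "x:A"
   then obtain i where "i<m" "x:U i" using U(1) by blast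
   then show "x:(\<Union>i<n. if i<m then U i else {})" using mn by (intro UN_I[of i]) auto
  qed
 qed (use U(2) in simp)
qed

lemma TC_mono: "2<=r==>A<=B==>TC r TE p A<=TC r TE p B"
proof (cases "TC r TE p B")
 case (enat n)
 assume r: "2<=r" and "A<=B"
 from enat have "TC r TE p B<=enat n" by simp
 from TC_leE[OF r this] obtain U where "B<=(\<Union>i<n. U i)" "!!i. i<n==>sectional r TE p (U i)" by blast
 then show ?thesis unfolding enat using r \<open>A<=B\<close> by (intro TC_leI[where U=U]) auto
qed simp

lemma TC_Un_le:
 assumes r: "2<=r" shows "TC r TE p (A \<union> B)<=TC r TE p A + TC r TE p B"
proof (cases "TC r TE p A=\<infinity> \<or> TC r TE p B=\<infinity>")
 case False
 then obtain m n where mn: "TC r TE p A=enat m" "TC r TE p B=enat n" by auto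
 then have le: "TC r TE p A<=enat m" "TC r TE p B<=enat n" by auto
 obtain U where U: "A<=(\<Union>i<m. U i)" "!!i. i<m==>sectional r TE p (U i)" using TC_leE[OF r le(1)] by blast
 obtain V where V: "B<=(\<Union>i<n. V i)" "!!i. i<n==>sectional r TE p (V i)" using TC_leE[OF r le(2)] by blast
 define W where "W=(%i. if i<m then U i else V (i - m))"
 have WU: "W i=U i" if "i<m" for i using that by (simp add: W_def)
 have WV: "W (m + i)=V i" for i by (simp add: W_def)
 have "TC r TE p (A \<union> B)<=enat (m + n)"
 proof (rule TC_leI[OF r])
  show "sectional r TE p (W i)" if "i<m + n" for i using U(2) V(2) that by (auto simp: W_def)
  show "A \<union> B<=(\<Union>i<m + n. W i)"
  proof
   fix x assume "x:A \<union> B"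
   then consider i where "i<m" "x:U i" | i where "i<n" "x:V i" using U(1) V(1) by blast
   then show "x:(\<Union>i<m + n. W i)"
   proof cases
    case 1
    then show ?thesis using WU[of i] by (intro UN_I[of i]) auto
   next
    case 2
    then show ?thesis using WV[of i] by (intro UN_I[of "m + i"]) auto
   qed
  qed
 qed
 then show ?thesis by (simp add: mn)
qed auto

lemma sectional_disjoint_union:
 assumes A: "sectional r TE p A" and B: "sectional r TE p B" and AB: "A\<inter>B={}"
 shows "sectional r TE p (A \<union> B)"
proof -
 let ?T="fiber_product_topology r TE p"
 obtain alp bet where alp: "fiber_section r TE p A alp" and bet: "fiber_section r TE p B bet" and o: "openin ?T A" "openin ?T B"
  using A B by (auto simp: sectional_def)
 define sig where "sig=(%z. if fst z:A then alp z else bet z)"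
 let ?Q="prod_topology (subtopology ?T (A \<union> B)) UI"
 have sub: "subtopology ?Q (C \<times> {0..1})=prod_topology (subtopology ?T C) UI" if "C<=A \<union> B" for C
  using that by (simp add: subtopology_Times subtopology_subtopology Int_absorb1)
 have "continuous_map ?Q TE sig"
 proof (rule pasting_lemma[where I=UNIV and T="%b. (if b then A else B) \<times> {0..1}" and f="%b. if b then alp else bet"])
  show "openin ?Q ((if b then A else B) \<times> {0..1})" for b
   using o by (auto simp: openin_prod_Times_iff openin_subtopology)
  show "continuous_map (subtopology ?Q ((if b then A else B) \<times> {0..1})) TE (if b then alp else bet)" for b
   using alp bet sub[of A] sub[of B] by (auto simp: fiber_section_def)
  show "(if b then alp else bet) x=(if c then alp else bet) x"
   if "x:topspace ?Q\<inter>(if b then A else B) \<times> {0..1}\<inter>(if c then A else B) \<times> {0..1}" for b c x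
   using that AB by (auto split: if_splits)
  show "EX j. j:UNIV&x:(if j then A else B) \<times> {0..1}&sig x=(if j then alp else bet) x" if "x:topspace ?Q" for x
   using that by (intro exI[of _ "fst x:A"]) (auto simp: sig_def)
 qed
 then have "fiber_section r TE p (A \<union> B) sig"
  using alp bet AB by (auto simp: fiber_section_def sig_def)
 then show ?thesis using o by (auto simp: sectional_def)
qed

lemma fiber_section_subset:
 assumes "fiber_section r TE p U sig" "V<=U" shows "fiber_section r TE p V sig"
proof -
 let ?T="fiber_product_topology r TE p"
 have "subtopology (prod_topology (subtopology ?T U) UI) (V \<times> {0..1})=prod_topology (subtopology ?T V) UI"
  using assms(2) by (simp add: subtopology_Times subtopology_subtopology Int_absorb1)
 then show ?thesis
  using assms continuous_map_from_subtopology[of "prod_topology (subtopology ?T U) UI" TE sig "V \<times> {0..1}"]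
  by (auto simp: fiber_section_def)
qed

lemma sectional_Int:
 "sectional r TE p U==>openin (fiber_product_topology r TE p) W==>sectional r TE p (U\<inter>W)"
 unfolding sectional_def using fiber_section_subset by blast

text \<open>Disjoint compact sets have disjoint open neighbourhoods. After shrinking to them, the
  \<open>i\<close>-th sets of both covers are disjoint and can be united, so the larger of the two
  numbers suffices instead of their sum.\<close>

lemma TC_disjoint_compact:
 assumes r: "2<=r" and H: "Hausdorff_space (fiber_product_topology r TE p)"
  and K: "compactin (fiber_product_topology r TE p) K" "compactin (fiber_product_topology r TE p) L" "disjnt K L"
  and le: "TC r TE p K<=enat n" "TC r TE p L<=enat n"
 shows "TC r TE p (K \<union> L)<=enat n"
proof -
 let ?T="fiber_product_topology r TE p"
 obtain W W' where W: "openin ?T W" "openin ?T W'" "K<=W" "L<=W'" "disjnt W W'"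
  using H[unfolded Hausdorff_space_compact_sets, rule_format, OF conjI[OF K(1) conjI[OF K(2,3)]]] by blast
 obtain U where U: "K<=(\<Union>i<n. U i)" "!!i. i<n==>sectional r TE p (U i)" using TC_leE[OF r le(1)] by blast
 obtain V where V: "L<=(\<Union>i<n. V i)" "!!i. i<n==>sectional r TE p (V i)" using TC_leE[OF r le(2)] by blast
 show ?thesis
 proof (rule TC_leI[OF r, where U="%i. (U i\<inter>W) \<union> (V i\<inter>W')"])
  show "sectional r TE p (U i\<inter>W \<union> V i\<inter>W')" if "i<n" for i
   using W(1,2,5) U(2)[OF that] V(2)[OF that] by (intro sectional_disjoint_union sectional_Int) (auto simp: disjnt_def)
  show "K \<union> L<=(\<Union>i<n. U i\<inter>W \<union> V i\<inter>W')"
  proof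
   fix x assume "x:K \<union> L"
   then consider i where "i<n" "x:U i" "x:W" | i where "i<n" "x:V i" "x:W'" using U(1) V(1) W(3,4) by blast
   then show "x:(\<Union>i<n. U i\<inter>W \<union> V i\<inter>W')" by cases auto
  qed
 qed
qed

text \<open>In a compact Hausdorff space components are quasi-components, so an open cover of a
  component also covers a set around it that is open and closed in \<open>K\<close>. Finitely many
  such sets cover \<open>K\<close>; made disjoint they are combined by
  \<open>TC_disjoint_compact\<close> without increasing the number.\<close>

theorem TC_compact_le_components:
 assumes r: "2<=r" and H: "Hausdorff_space (fiber_product_topology r TE p)"
  and K: "compactin (fiber_product_topology r TE p) K"
 shows "TC r TE p K<=(SUP C\<in>connected_components_of (subtopology (fiber_product_topology r TE p) K). TC r TE p C)"
  (is "_<=?s")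
proof (cases ?s)
 case (enat n)
 let ?T="fiber_product_topology r TE p"
 let ?X="subtopology ?T K"
 have topK: "topspace ?X=K" using compactin_subset_topspace[OF K] by auto
 have cX: "compact_space ?X" using K by (rule compact_space_subtopology)
 have hX: "Hausdorff_space ?X" using H by (rule Hausdorff_space_subtopology)
 have qc: "quasi_components_of ?X=connected_components_of ?X"
  using cX hX by (intro quasi_eq_connected_components_of) auto
 have ex: "EX S. openin ?X S&closedin ?X S&x:S&TC r TE p S<=enat n" if x: "x:K" for x
 proof -
  obtain C where C: "C:connected_components_of ?X" "x:C"
   using Union_connected_components_of[of ?X] topK x by blast
  have "TC r TE p C<=?s" using C(1) by (rule SUP_upper)
  then have "TC r TE p C<=enat n" using enat by simp
  then obtain U where U: "C<=(\<Union>i<n. U i)" "!!i. i<n==>sectional r TE p (U i)" using TC_leE[OF r] by blast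
  define O' where "O'=(\<Union>i<n. U i)"
  have oO: "openin ?T O'" unfolding O'_def using U(2) by (intro openin_Union) (auto simp: sectional_def)
  have "closedin ?X (K - O')" using oO topK by (metis closedin_diff closedin_topspace openin_subtopology_Int2 Diff_Int_distrib Diff_Int Diff_cancel Un_empty_left)
  then have "compactin ?X (K - O')" by (rule closedin_compact_space[OF cX])
  moreover have "disjnt C (K - O')" using U(1) by (auto simp: disjnt_def O'_def)
  ultimately have "separated_between ?X C (K - O')"
   using separated_between_quasi_component_compact[of C ?X "K - O'"] C(1) qc by simp
  then obtain S S' where S: "openin ?X S" "openin ?X S'" "S \<union> S'=K" "disjnt S S'" "C<=S" "K - O'<=S'"
   unfolding separated_between_def topK by blast
  have "S=K - S'" using S by (auto simp: disjnt_def)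
  then have "closedin ?X S" using S(2) topK by (metis closedin_def openin_closedin_eq)
  moreover have "TC r TE p S<=enat n"
   using S(4,6) openin_subset[OF S(1)] topK U(2) by (intro TC_leI[OF r, where U=U]) (auto simp: O'_def disjnt_def)
  ultimately show ?thesis using S C(2) by blast
 qed
 then obtain S where S: "!!x. x:K==>openin ?X (S x)&closedin ?X (S x)&x:S x&TC r TE p (S x)<=enat n"
  by metis
 have "\<exists>\<F>. finite \<F>&\<F><=S ` K&topspace ?X<=\<Union>\<F>"
 proof (rule compact_space_alt[THEN iffD1, OF cX, rule_format], intro conjI)
  show "ALL U:S ` K. openin ?X U" using S by blast
  show "topspace ?X<=\<Union>(S ` K)" unfolding topK using S by blast
 qed
 then obtain \<F> where \<F>: "finite \<F>" "\<F><=S ` K" "K<=\<Union>\<F>" using topK by auto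
 have comp: "compactin ?T A" if "closedin ?X A" for A
  using closedin_compact_space[OF cX that] by (simp add: compactin_subtopology)
 have "TC r TE p (\<Union>\<G>)<=enat n&closedin ?X (\<Union>\<G>)" if "finite \<G>" "\<G><=S ` K" for \<G>
  using that
 proof (induction \<G>)
  case empty
  have "TC r TE p {}<=enat 0" by (rule TC_leI[OF r, where U="%_. {}"]) auto
  then show ?case by (simp add: order_trans[OF _ enat_0_iff(1)[THEN eq_refl]] zero_enat_def[symmetric])
 next
  case (insert A \<G>)
  then have IH: "TC r TE p (\<Union>\<G>)<=enat n" "closedin ?X (\<Union>\<G>)" by auto
  have "A:S ` K" using insert.prems by simp
  then obtain x where "x:K" "A=S x" by (rule imageE) simp
  then have A: "openin ?X A" "closedin ?X A" "TC r TE p A<=enat n" using S by auto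
  \<comment> \<open>Because \<open>A\<close> is also open in \<open>K\<close>, removing it leaves a
    closed, hence compact, set.\<close>
  have cl: "closedin ?X (\<Union>\<G> - A)" using IH(2) A(1) by (rule closedin_diff)
  have "TC r TE p (\<Union>\<G> - A)<=enat n" using TC_mono[OF r, of "\<Union>\<G> - A" "\<Union>\<G>"] IH(1) order_trans by blast
  then have "TC r TE p (A \<union> (\<Union>\<G> - A))<=enat n"
   using A by (intro TC_disjoint_compact[OF r H] comp cl) (auto simp: disjnt_def)
  then show ?case using IH(2) A(2) by (simp add: closedin_Un)
 qed
 from this[OF \<F>(1,2)] have "TC r TE p (\<Union>\<F>)<=enat n" by blast
 then show ?thesis using TC_mono[OF r \<F>(3)] enat order_trans by metis
qed simp

text \<open>\<open>alp\<close> vanishes at the nodes \<open>i / N\<close> and is \<open>1\<close> away from them; \<open>bet\<close> rests at \<open>i / N\<close> near the node.\<close>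

lemma node_functions:
 assumes N: "N>=(1::nat)"
 obtains alp bet :: "real=>real" where "continuous_on UNIV alp" "continuous_on UNIV bet"
  "!!t. alp t:{0..1}" "!!t. bet t:{0..1}"
  "!!i. i<=N==>alp (real i / real N)=0"
  "!!t. (ALL i<=N. 1/3<=\<bar>real N * t - real i\<bar>)==>alp t=1"
  "!!t i. i<=N==>\<bar>real N * t - real i\<bar><=1/3==>bet t=real i / real N"
proof -
 define alp where "alp=(%t. min 1 (3 * infdist (real N * t) (real ` {..N})))"
 \<comment> \<open>A ramp from 0 to 1 while \<open>real N * t\<close> runs from
   \<open>j - 2/3\<close> to \<open>j - 1/3\<close>. Their sum \<open>bet\<close> is a staircase
   that is flat within 1/3 of each integer, while \<open>alp\<close> has already reached 1 at
   distance 1/3 from all of them.\<close>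
 define k where "k=(%j t. max 0 (min 1 (3 * (real N * t - real j) + 2)))"
 define bet where "bet=(%t. (\<Sum>j\<in>{1..N}. k j t) / real N)"
 have k01: "0<=k j t" "k j t<=1" for j t by (auto simp: k_def)
 show thesis
 proof (rule that[of alp bet])
  show "continuous_on UNIV alp" unfolding alp_def by (intro continuous_intros)
  show "continuous_on UNIV bet" unfolding bet_def k_def using N by (intro continuous_intros) auto
  show "alp t:{0..1}" for t by (auto simp: alp_def infdist_nonneg)
  have "(\<Sum>j\<in>{1..N}. k j t)<=(\<Sum>j\<in>{1..N}. 1)" for t by (intro sum_mono k01)
  moreover have "0<=(\<Sum>j\<in>{1..N}. k j t)" for t by (intro sum_nonneg k01)
  ultimately show "bet t:{0..1}" for t using N by (auto simp: bet_def divide_simps)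
  show "alp (real i / real N)=0" if "i<=N" for i
   using that N by (simp add: alp_def)
  show "alp t=1" if t: "ALL i<=N. 1/3<=\<bar>real N * t - real i\<bar>" for t
  proof -
   have "1/3<=infdist (real N * t) (real ` {..N})"
   proof -
    have "1/3<=Inf (dist (real N * t) ` real ` {..N})"
     by (rule cINF_greatest) (use t in \<open>auto simp: dist_real_def\<close>)
    then show ?thesis by (simp add: infdist_def)
   qed
   then show ?thesis by (simp add: alp_def)
  qed
  show "bet t=real i / real N" if i: "i<=N" "\<bar>real N * t - real i\<bar><=1/3" for t i
  proof -
   have "k j t=(if j<=i then 1 else 0)" for j
   proof (cases "j<=i")
    case True
    then have "real j<=real i" by simp
    then have "1<=3 * (real N * t - real j) + 2" using i(2) unfolding abs_le_iff by argo
    then show ?thesis using True by (simp add: k_def)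
   next
    case False
    then have "real i + 1<=real j" by simp
    then have "3 * (real N * t - real j) + 2<=0" using i(2) unfolding abs_le_iff by argo
    then show ?thesis using False by (simp add: k_def)
   qed
   then have "(\<Sum>j\<in>{1..N}. k j t)=(\<Sum>j\<in>{1..N}\<inter>{..i}. 1)"
    by (subst sum.inter_restrict) auto
   also have "{1..N}\<inter>{..i}={1..i}" using i by auto
   finally show ?thesis by (simp add: bet_def)
  qed
 qed
qed

text \<open>The obstacle is that a lift moves the whole path, whereas its values at the nodes are
  prescribed. The projection of the path \<open>Gam\<close> is contracted to the point
  \<open>p (u 0)\<close>, and along the vertical lines over the nodes this contraction is constant.
  The section therefore runs through the lifted square along a curve that climbs and descends over
  the nodes and crosses between them only at the far side, where everything lies in the
  fibre.\<close>

theorem sectional_homotopy: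
 assumes r: "2<=r" and p: "hurewicz_fibration TE TX p"
  and G: "openin (fiber_product_topology r TE p) G"
  and b: "continuous_map (prod_topology (subtopology (fiber_product_topology r TE p) G) UI)
    (fiber_product_topology r TE p) b"
  and b0: "!!u. u:G==>b (u, 0)=u"
  and V: "sectional r TE p V"
 shows "sectional r TE p {u:G. b (u, 1):V}"
proof -
 let ?T="fiber_product_topology r TE p"
 define N where "N=r - 1"
 have N: "N>=1" and Nr: "i<=N\<longleftrightarrow>i<r" for i using r by (auto simp: N_def)
 obtain alp bet :: "real=>real" where ab: "continuous_on UNIV alp" "continuous_on UNIV bet"
  "!!t. alp t:{0..1}" "!!t. bet t:{0..1}"
  "!!i. i<=N==>alp (real i / real N)=0"
  "!!t. (ALL i<=N. 1/3<=\<bar>real N * t - real i\<bar>)==>alp t=1"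
  "!!t i. i<=N==>\<bar>real N * t - real i\<bar><=1/3==>bet t=real i / real N"
  by (fact node_functions[OF N])
 have cab: "continuous_map UI UI alp" "continuous_map UI UI bet"
  using ab(1-4) by (auto simp: continuous_map_in_subtopology intro: continuous_on_subset)
 have oV: "openin ?T V" using V by (simp add: sectional_def)
 obtain sig where sig: "fiber_section r TE p V sig" using V by (auto simp: sectional_def)
 have cp: "continuous_map TE TX p" using p by (simp add: hurewicz_fibration_def)
 define G' where "G'={u:G. b (u, 1):V}"
 have GT: "topspace (subtopology ?T G)=G" using openin_subset[OF G] by auto
 have c1: "continuous_map (subtopology ?T G) ?T (%u. b (u, 1))"
 proof -
  have "continuous_map (subtopology ?T G) (prod_topology (subtopology ?T G) UI) (%u. (u, 1))"
   by (intro continuous_map_pairedI) auto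
  from continuous_map_compose[OF this b] show ?thesis by (simp add: comp_def)
 qed
 have oG': "openin ?T G'"
 proof -
  have "openin (subtopology ?T G) {u:topspace (subtopology ?T G). b (u, 1):V}"
   by (rule openin_continuous_map_preimage[OF c1 oV])
  then have "openin (subtopology ?T G) G'" unfolding GT G'_def .
  then show ?thesis by (rule openin_trans_full[OF _ G])
 qed
 define Z where "Z=subtopology ?T G'"
 have ZT: "topspace Z=G'" using openin_subset[OF oG'] by (auto simp: Z_def)
 let ?Z2="prod_topology Z UI"
 have iG: "continuous_map Z (subtopology ?T G) (%u. u)"
  unfolding Z_def by (auto simp: continuous_map_in_subtopology G'_def)
 have c1': "continuous_map Z (subtopology ?T V) (%u. b (u, 1))"
  using continuous_map_compose[OF iG c1] unfolding continuous_map_in_subtopology ZT by (auto simp: comp_def G'_def)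
 have bY: "b (u, t):fiber_product r TE p" if "u:G" "t:{0..1}" for u t
  using continuous_map_funspace[OF b] that unfolding topspace_fiber_product topspace_prod_topology GT by (auto simp: Pi_iff)
 have pb: "p (b (u, t) i)=p (b (u, t) 0)" if "u:G" "t:{0..1}" "i<r" for u t i
 proof -
  have "ALL i<r. ALL j<r. p (b (u, t) i)=p (b (u, t) j)"
   using bY[OF that(1,2)] unfolding fiber_product_def by blast
  moreover have "0<r" using r by simp
  ultimately show ?thesis using that(3) by blast
 qed
 have fc: "continuous_map ?Z2 TE (%z. b (fst z, alp (snd z)) i)" if "i<r" for i
 proof -
  have "continuous_map ?Z2 (prod_topology (subtopology ?T G) UI) (%z. (fst z, alp (snd z)))"
   using continuous_map_compose[OF continuous_map_fst iG, of UI] continuous_map_compose[OF continuous_map_snd cab(1), of Z]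
   by (intro continuous_map_pairedI) (simp_all add: comp_def)
  from continuous_map_compose[OF continuous_map_compose[OF this b] continuous_map_fiber_coord[OF that]]
  show ?thesis by (simp add: comp_def)
 qed
 have fq: "continuous_map ?Z2 TE (%z. sig (b (fst z, 1), bet (snd z)))"
 proof -
  have "continuous_map ?Z2 (prod_topology (subtopology ?T V) UI) (%z. (b (fst z, 1), bet (snd z)))"
   using continuous_map_compose[OF continuous_map_fst c1', of UI] continuous_map_compose[OF continuous_map_snd cab(2), of Z]
   by (intro continuous_map_pairedI) (simp_all add: comp_def)
  from continuous_map_compose[OF this] sig show ?thesis by (auto simp: comp_def fiber_section_def)
 qed
 define near where "near=(%i t. i<=N&\<bar>real N * t - real i\<bar><=1/3)"
 define P where "P=(%i. {t:{0..1::real}. if i<=N then \<bar>real N * t - real i\<bar><=1/3 else ALL j<=N. 1/3<=\<bar>real N * t - real j\<bar>})"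
 define f where "f=(%i z. if i<=N then b (fst z, alp (snd z)) i else sig (b (fst z, 1), bet (snd z)))"
 \<comment> \<open>Near node \<open>i\<close> the path follows the track of coordinate
   \<open>i\<close> under the homotopy, out and back; between nodes it runs along the fibre path
   given over the end of the homotopy. The pieces fit because \<open>alp\<close> is 1 and
   \<open>bet\<close> rests at a node where they meet.\<close>
 define Gam where "Gam=(%z. if EX i. near i (snd z) then f (THE i. near i (snd z)) z else f (Suc N) z)"
 have near_unique: "i=j" if "near i t" "near j t" for i j t
 proof -
  have "\<bar>real N * t - real i\<bar><=1/3" "\<bar>real N * t - real j\<bar><=1/3" using that by (simp_all add: near_def)
  then have "\<bar>real i - real j\<bar><1" by argo
  then show ?thesis by linarith
 qed
 have Gamnear: "Gam z=f i z" if "near i (snd z)" for i z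
 proof -
  have "(THE i. near i (snd z))=i" using that near_unique by (intro the_equality)
  then show ?thesis using that by (auto simp: Gam_def)
 qed
 have sign: "sig (v, real i / real N)=v i" if "v:V" "i<=N" for v i
  using sig that unfolding N_def[symmetric] Nr fiber_section_def by auto
 have sigp: "p (sig (v, t))=p (v 0)" if "v:V" "t:{0..1}" for v t
  using sig that unfolding fiber_section_def by auto
 have P_closed: "closed (P i)" for i
 proof (cases "i<=N")
  case True
  then have "P i={0..1}\<inter>{t. \<bar>real N * t - real i\<bar><=1/3}" by (auto simp: P_def)
  then show ?thesis by (simp add: closed_Int closed_Collect_le continuous_intros)
 next
  case False
  then have "P i={0..1}\<inter>(\<Inter>j\<in>{..N}. {t. 1/3<=\<bar>real N * t - real j\<bar>})" by (auto simp: P_def)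
  then show ?thesis by (auto intro!: closed_Int closed_INT closed_Collect_le continuous_intros)
 qed
 have overlap: "f i (u, t)=f (Suc N) (u, t)" if "i<=N" "t:P i" "t:P (Suc N)" "u:G'" for i u t
 proof -
  have "alp t=1" using that(3) by (intro ab(6)) (auto simp: P_def)
  moreover have "bet t=real i / real N" using that(1,2) by (intro ab(7)) (auto simp: P_def)
  moreover have "b (u, 1):V" using that(4) by (simp add: G'_def)
  ultimately show ?thesis using that(1) sign by (simp add: f_def)
 qed
 have Gamc: "continuous_map ?Z2 TE Gam"
 proof (rule pasting_lemma_closed[where I="{..Suc N}" and T="%i. G' \<times> P i" and f=f])
  show "closedin ?Z2 (G' \<times> P i)" for i
   using P_closed[of i] closedin_topspace[of Z] unfolding ZT
   by (auto simp: closedin_prod_Times_iff P_def intro!: closed_subset)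
  show "continuous_map (subtopology ?Z2 (G' \<times> P i)) TE (f i)" for i
  proof (rule continuous_map_from_subtopology)
   show "continuous_map ?Z2 TE (f i)" using fc[of i] fq by (cases "i<=N") (simp_all add: f_def[abs_def] Nr)
  qed
  show "f i z=f j z" if ij: "i:{..Suc N}" "j:{..Suc N}" and zz: "z:topspace ?Z2\<inter>G' \<times> P i\<inter>G' \<times> P j" for i j z
  proof -
   obtain u t where z: "z=(u, t)" by (cases z)
   have uP: "u:G'" "t:P i" "t:P j" using zz z by auto
   consider "i=j" | "i<=N" "j<=N" | "i<=N" "j=Suc N" | "i=Suc N" "j<=N" using ij unfolding atMost_iff le_Suc_eq by blast
   then show ?thesis
   proof cases
    case 2
    then have "near i t" "near j t" using uP by (auto simp: near_def P_def)
    then show ?thesis using near_unique by blast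
   next
    case 3
    then show ?thesis using overlap uP z by simp
   next
    case 4
    then show ?thesis using overlap[of j t u] uP z by simp
   qed simp
  qed
  show "EX j. j:{..Suc N}&z:G' \<times> P j&Gam z=f j z" if "z:topspace ?Z2" for z
  proof (cases "EX i. near i (snd z)")
   case True
   then obtain i where i: "near i (snd z)" by blast
   then show ?thesis using that Gamnear[OF i] unfolding topspace_prod_topology ZT
    by (intro exI[of _ i]) (auto simp: near_def P_def)
  next
   case False
   then have "Gam z=f (Suc N) z" by (simp add: Gam_def)
   moreover have "snd z:P (Suc N)" using False that by (force simp: near_def P_def)
   ultimately show ?thesis using that unfolding topspace_prod_topology ZT
    by (intro exI[of _ "Suc N"]) auto
  qed
 qed simp
 have pGam: "p (Gam (u, t))=p (b (u, alp t) 0)" if u: "u:G'" and t: "t:{0..1}" for u t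
 proof (cases "EX i. near i t")
  case True
  then obtain i where i: "near i t" by blast
  then show ?thesis using Gamnear[of i "(u, t)"] u ab(3) pb[of u "alp t" i] by (auto simp: f_def near_def Nr G'_def)
 next
  case False
  then have alp1: "alp t=1" by (intro ab(6)) (force simp: near_def)
  have "Gam (u, t)=sig (b (u, 1), bet t)" using False by (simp add: Gam_def f_def)
  then show ?thesis using sigp[of "b (u, 1)" "bet t"] ab(4) u alp1 by (simp add: G'_def)
 qed
 \<comment> \<open>At parameter 0 this is the projection of \<open>Gam\<close>, at parameter 1 it is
   constantly \<open>p (u 0)\<close>, and it is constant in the parameter wherever
   \<open>alp\<close> vanishes.\<close>
 define h where "h=(%(z, tau). p (b (fst z, (1 - tau) * alp (snd z)) 0))"
 have hc: "continuous_map (prod_topology ?Z2 UI) TX h"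
 proof -
  have "continuous_map (prod_topology ?Z2 UI) UI (%w. (1 - snd w) * alp (snd (fst w)))"
   unfolding continuous_map_in_subtopology
  proof (intro conjI)
   have "continuous_map (prod_topology ?Z2 UI) euclideanreal (%w. alp (snd (fst w)))"
    using continuous_map_compose[OF continuous_map_fst continuous_map_compose[OF continuous_map_snd continuous_map_into_fulltopology[OF cab(1)]], of Z UI]
    by (simp add: comp_def)
   then show "continuous_map (prod_topology ?Z2 UI) euclideanreal (%w. (1 - snd w) * alp (snd (fst w)))"
    using continuous_map_into_fulltopology[OF continuous_map_snd, of ?Z2 euclidean "{0..1}"]
    by (intro continuous_map_real_mult continuous_map_diff) auto
   show "(%w. (1 - snd w) * alp (snd (fst w))):topspace (prod_topology ?Z2 UI) \<rightarrow> {0..1}"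
   proof -
    have "(1 - tau) * alp t<=1" if "0<=tau" "tau<=1" for tau t
     using mult_le_one[of "1 - tau" "alp t"] ab(3)[of t] that by simp
    then show ?thesis using ab(3) by auto
   qed
  qed
  then have "continuous_map (prod_topology ?Z2 UI) (prod_topology (subtopology ?T G) UI) (%w. (fst (fst w), (1 - snd w) * alp (snd (fst w))))"
   using continuous_map_compose[OF continuous_map_fst continuous_map_compose[OF continuous_map_fst iG], of UI UI]
   by (intro continuous_map_pairedI) (simp_all add: comp_def)
  from continuous_map_compose[OF continuous_map_compose[OF continuous_map_compose[OF this b] continuous_map_fiber_coord[of 0]] cp] r
  show ?thesis by (simp add: comp_def h_def case_prod_unfold)
 qed
 have "ALL z:topspace ?Z2. h (z, 0)=p (Gam z)"
  using pGam by (auto simp: h_def ZT)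
 with hurewicz_fibration_lifting[OF p, of ?Z2] Gamc hc
 obtain L where L: "continuous_map (prod_topology ?Z2 UI) TE L" "!!z. z:topspace ?Z2==>L (z, 0)=Gam z"
  "!!z t. z:topspace ?Z2==>t:{0..1}==>p (L (z, t))=h (z, t)"
  unfolding homotopy_lifting_def by blast
 \<comment> \<open>Within 1/3 of node \<open>i\<close> the first coordinate \<open>bet t\<close>
   rests at the node while the second varies from 1 to 0 and back; elsewhere the second is 1. In
   both cases the product in \<open>h\<close> vanishes, and at the node itself the value is that of
   \<open>Gam\<close>, namely \<open>u i\<close>.\<close>
 have "fiber_section r TE p G' (%z. L ((fst z, bet (snd z)), alp (snd z)))"
  unfolding fiber_section_def Z_def[symmetric] N_def[symmetric]
 proof (intro conjI ballI allI impI)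
  have "continuous_map ?Z2 (prod_topology ?Z2 UI) (%z. ((fst z, bet (snd z)), alp (snd z)))"
   using continuous_map_compose[OF continuous_map_snd cab(1), of Z] continuous_map_compose[OF continuous_map_snd cab(2), of Z]
   by (intro continuous_map_pairedI continuous_map_fst) (simp_all add: comp_def)
  from continuous_map_compose[OF this L(1)]
  show "continuous_map ?Z2 TE (%z. L ((fst z, bet (snd z)), alp (snd z)))" by (simp add: comp_def)
 next
  fix u t assume u: "u:G'" and t: "t:{0..1::real}"
  have z: "(1 - alp t) * alp (bet t)=0"
  proof (cases "EX i. near i t")
   case True
   then show ?thesis using ab(5,7) by (auto simp: near_def)
  next
   case False
   then have "alp t=1" by (intro ab(6)) (force simp: near_def)
   then show ?thesis by simp
  qed
  have "u:G" using u by (simp add: G'_def)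
  then have "h ((u, bet t), alp t)=p (u 0)" by (simp only: h_def prod.case fst_conv snd_conv z b0)
  then show "p (L ((fst (u, t), bet (snd (u, t))), alp (snd (u, t))))=p (u 0)"
   using L(3)[of "(u, bet t)" "alp t"] ab(3,4) u by (simp add: ZT)
 next
  fix u i assume u: "u:G'" and i: "i<r"
  let ?t="real i / real N"
  have ne: "near i ?t" using i N Nr by (auto simp: near_def)
  then have "alp ?t=0" "bet ?t=?t" using ab(5,7) by (auto simp: near_def)
  moreover have "Gam (u, ?t)=u i" using Gamnear[of i "(u, ?t)"] ne b0 u calculation(1) by (simp add: f_def near_def G'_def)
  moreover have "?t:{0..1}" using ne N by (auto simp: near_def divide_simps)
  ultimately show "L ((fst (u, ?t), bet (snd (u, ?t))), alp (snd (u, ?t)))=u i"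
   using L(2)[of "(u, ?t)"] u by (simp add: ZT)
 qed
 then show ?thesis using oG' unfolding sectional_def G'_def by blast
qed

corollary TC_homotopy_le:
 assumes r: "2<=r" and p: "hurewicz_fibration TE TX p"
  and G: "openin (fiber_product_topology r TE p) G"
  and b: "continuous_map (prod_topology (subtopology (fiber_product_topology r TE p) G) UI)
    (fiber_product_topology r TE p) b"
  and b0: "!!u. u:G==>b (u, 0)=u"
  and AG: "A<=G" and AB: "!!u. u:A==>b (u, 1):B"
 shows "TC r TE p A<=TC r TE p B"
proof (cases "TC r TE p B")
 case (enat n)
 then have "TC r TE p B<=enat n" by simp
 from TC_leE[OF r this] obtain U where U: "B<=(\<Union>i<n. U i)" "!!i. i<n==>sectional r TE p (U i)" by blast
 show ?thesis unfolding enat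
 proof (rule TC_leI[OF r])
  show "A<=(\<Union>i<n. {u:G. b (u, 1):U i})" using AG AB U(1) by blast
  show "sectional r TE p {u:G. b (u, 1):U i}" if "i<n" for i
   by (rule sectional_homotopy[OF r p G b b0 U(2)[OF that]])
 qed
qed simp

section \<open>Distances of Riemannian metrics\<close>

text \<open>The integrand of \<open>curve_length\<close> is not known to be measurable; for such functions the library's
  integral is a lower integral, and only inequalities are available.\<close>

lemma nn_integral_leI:
 assumes "!!g. g:borel_measurable M==>(!!x. g x<=f x)==>integral\<^sup>N M g<=C"
 shows "integral\<^sup>N M f<=C"
 unfolding nn_integral_def
proof (rule SUP_least)
 fix g assume "g:{g. simple_function M g&g<=f}"
 then have g: "simple_function M g" "!!x. g x<=f x" by (auto simp: le_fun_def)
 show "integral\<^sup>S M g<=C"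
  using assms[OF borel_measurable_simple_function[OF g(1)] g(2)] nn_integral_eq_simple_integral[OF g(1)] by simp
qed

lemma nn_integral_split_le:
 assumes A: "A:sets M"
 shows "integral\<^sup>N M f<=(\<integral>\<^sup>+x. f x * indicator A x \<partial>M) + (\<integral>\<^sup>+x. f x * indicator (- A) x \<partial>M)"
proof (rule nn_integral_leI)
 fix g assume g: "g:borel_measurable M" "!!x. g x<=f x"
 have "integral\<^sup>N M g=(\<integral>\<^sup>+x. g x * indicator A x + g x * indicator (space M - A) x \<partial>M)"
  by (rule nn_integral_cong) (auto simp: indicator_def)
 also have "...=(\<integral>\<^sup>+x. g x * indicator A x \<partial>M) + (\<integral>\<^sup>+x. g x * indicator (space M - A) x \<partial>M)"
  using g(1) A by (intro nn_integral_add) auto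
 also have "...<=(\<integral>\<^sup>+x. f x * indicator A x \<partial>M) + (\<integral>\<^sup>+x. f x * indicator (- A) x \<partial>M)"
  using g(2) by (intro add_mono nn_integral_mono) (auto simp: indicator_def)
 finally show "integral\<^sup>N M g<=..." .
qed

lemma nn_integral_affine_le:
 fixes h :: "real=>ennreal"
 assumes c: "c>0"
 shows "(\<integral>\<^sup>+t. ennreal c * h (b + c * t) \<partial>lborel)<=integral\<^sup>N lborel h"
proof (rule nn_integral_leI)
 fix g :: "real=>ennreal" assume g: "g:borel_measurable lborel" "!!t. g t<=ennreal c * h (b + c * t)"
 have "integral\<^sup>N lborel g=(\<integral>\<^sup>+u. ennreal (1 / c) * g (- b / c + (1 / c) * u) \<partial>lborel)"
  using g(1) c by (subst nn_integral_real_affine[of g "1 / c" "- b / c"]) (auto simp: nn_integral_cmult)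
 also have "...<=integral\<^sup>N lborel h"
 proof (rule nn_integral_mono)
  fix u
  have "ennreal (1 / c) * g (- b / c + (1 / c) * u)<=ennreal (1 / c) * (ennreal c * h (b + c * (- b / c + (1 / c) * u)))"
   by (intro mult_left_mono g(2)) auto
  also have "b + c * (- b / c + (1 / c) * u)=u" using c by (simp add: field_simps)
  also have "ennreal (1 / c) * (ennreal c * h u)=h u"
   using c by (simp add: mult.assoc[symmetric] ennreal_mult[symmetric])
  finally show "ennreal (1 / c) * g (- b / c + (1 / c) * u)<=h u" .
 qed
 finally show "integral\<^sup>N lborel g<=integral\<^sup>N lborel h" .
qed

lemma has_fderiv_UNIV_iff:
 "has_fderiv UNIV f (%h. h *\<^sub>R w) s\<longleftrightarrow>(f has_vector_derivative w) (at s)"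
proof -
 have "blinear_on UNIV (%h. h *\<^sub>R w)"
  by (intro bounded_linear_imp_on bounded_linear_scaleR_left)
 then show ?thesis
  unfolding has_fderiv_iff has_vector_derivative_def has_derivative_at_alt
  using bounded_linear_scaleR_left[of w] by (simp add: dist_norm)
qed

section \<open>Velocities, the metric in charts and reparametrised curves\<close>

lemma pathin_near:
 assumes gam: "pathin T gam" and s: "0<s" "s<1" and U: "openin T U" "gam s:U"
 obtains e where "e>0" "!!y. dist y s<e==>0<y&y<1&gam y:U"
proof -
 have "openin (top_of_set {0..1}) {t:{0..1}. gam t:U}"
  using openin_continuous_map_preimage[OF gam[unfolded pathin_def] U(1)] by simp
 then obtain e where e: "e>0" "!!y. y:{0..1}==>dist y s<e==>gam y:U"
 proof -
  have "s:{t:{0..1}. gam t:U}" using s U(2) by simp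
  then show ?thesis using \<open>openin (top_of_set {0..1}) {t:{0..1}. gam t:U}\<close> that
   unfolding openin_euclidean_subtopology_iff by blast
 qed
 show thesis
 proof (rule that[of "min e (min s (1 - s))"])
  show "0<y&y<1&gam y:U" if "dist y s<min e (min s (1 - s))" for y
  proof -
   have "0<y" "y<1" using that by (auto simp: dist_real_def)
   then show ?thesis using e(2)[of y] that by auto
  qed
 qed (use e s in auto)
qed

text \<open>The derivative in one chart determines those in all others by the chain rule, so the set
  \<open>velocity\<close> is a full equivalence class. Its representative lies in the model space
  because the curve stays there near \<open>s\<close>.\<close>

lemma velocity_tvec:
 assumes E: "diff_manifold E" and c: "c:atlas E" and gams: "gam s:cdom c"
  and near: "e>0" "!!y. dist y s<e==>gam y:cdom c"
  and w: "((cmap c o gam) has_vector_derivative w) (at s)"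
 shows "w:cmodel c" "velocity E gam s=tvec E (gam s) c w"
  and "d:atlas E==>gam s:cdom d ==>
   ((cmap d o gam) has_vector_derivative fderiv (cmodel c) (cmap d o cinv c) (cmap c (gam s)) w) (at s)"
proof -
 note ch=dm_chart[OF E c]
 have fw: "has_fderiv UNIV (cmap c o gam) (%h. h *\<^sub>R w) s" using w by (simp only: has_fderiv_UNIV_iff)
 have inV: "(cmap c o gam) y:cmodel c" if "dist y s<e" for y
  using cmap_in_cmodel[OF ch near(2)[OF that]] by simp
 have "1 *\<^sub>R w:cmodel c"
  using inV near(1) by (intro has_fderiv_range[OF fw subspace_UNIV _ _ chartD(2,3)[OF ch]]) auto
 then show wc: "w:cmodel c" by simp
 have der: "((cmap d o gam) has_vector_derivative fderiv (cmodel c) (cmap d o cinv c) (cmap c (gam s)) w) (at s)"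
  if d: "d:atlas E" "gam s:cdom d" for d
 proof -
  let ?D="fderiv (cmodel c) (cmap d o cinv c) (cmap c (gam s))"
  have D: "has_fderiv (cmodel c) (cmap d o cinv c) ?D ((cmap c o gam) s)"
   using diff_manifold_trans[OF E c gams d] by simp
  have "has_fderiv UNIV (%y. (cmap d o cinv c) ((cmap c o gam) y)) (%h. ?D (h *\<^sub>R w)) s"
   using inV near(1) by (intro has_fderiv_compose[OF fw subspace_UNIV UNIV_I D chartD(2,3)[OF ch]]) auto
  then have "has_fderiv UNIV (cmap d o gam) (%h. h *\<^sub>R ?D w) s"
  proof (rule has_fderiv_cong)
   show "?D (h *\<^sub>R w)=h *\<^sub>R ?D w" for h using blinear_on_scale[OF has_fderiv_linear[OF D] wc] .
   show "(cmap d o cinv c) ((cmap c o gam) y)=(cmap d o gam) y" if "dist y s<e" for y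
    using cinv_cmap[OF ch near(2)[OF that]] by simp
  qed (use near in auto)
  then show ?thesis by (simp only: has_fderiv_UNIV_iff)
 qed
 then show "d:atlas E==>gam s:cdom d ==>
   ((cmap d o gam) has_vector_derivative fderiv (cmodel c) (cmap d o cinv c) (cmap c (gam s)) w) (at s)" .
 show "velocity E gam s=tvec E (gam s) c w"
 proof (intro set_eqI iffI; clarify)
  fix d x assume "(d, x):velocity E gam s"
  then have d: "d:atlas E" "gam s:cdom d" "((cmap d o gam) has_vector_derivative x) (at s)" by (auto simp: velocity_def)
  then show "(d, x):tvec E (gam s) c w"
   using vector_derivative_unique_at[OF d(3) der[OF d(1,2)]] by (simp add: tvec_iff)
 next
  fix d x assume "(d, x):tvec E (gam s) c w"
  then show "(d, x):velocity E gam s" using der[of d] by (simp add: tvec_iff velocity_def)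
 qed
qed

lemma metric_chart:
 assumes g: "riemannian_metric E g" and E: "diff_manifold E" and c: "c:atlas E" and m: "m:cdom c"
 shows metric_chart_linear: "u:cmodel c==>v:cmodel c==>w:cmodel c ==>
   g m (tvec E m c (a *\<^sub>R u + v)) (tvec E m c w)=a * g m (tvec E m c u) (tvec E m c w) + g m (tvec E m c v) (tvec E m c w)"
  and metric_chart_sym: "v:cmodel c==>w:cmodel c==>g m (tvec E m c v) (tvec E m c w)=g m (tvec E m c w) (tvec E m c v)"
  and metric_chart_bound: "EX b>0. ALL v:cmodel c. ALL w:cmodel c. \<bar>g m (tvec E m c v) (tvec E m c w)\<bar><=b * norm v * norm w"
  and metric_chart_coercive: "EX k>0. ALL v:cmodel c. k * (norm v)\<^sup>2<=g m (tvec E m c v) (tvec E m c v)"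
  and metric_chart_cont: "e>0==>EX d>0. ALL y:cdom c. dist (cmap c y) (cmap c m)<d-->(ALL v:cmodel c.
   \<bar>g y (tvec E y c v) (tvec E y c v) - g m (tvec E m c v) (tvec E m c v)\<bar><=e * (norm v)\<^sup>2)"
proof -
 note ch=dm_chart[OF E c]
 let ?S="cmap c ` cdom c"
 obtain D where D0: "!!x vs. x:?S==>vs:tuples (cmodel c) 2 ==>
   D 0 x vs=g (cinv c x) (tvec E (cinv c x) c (vs ! 0)) (tvec E (cinv c x) c (vs ! 1))"
  and Dm: "!!x. x:?S==>bounded_multilinear_on (cmodel c) 2 (D (0::nat) x)"
  and Dc: "!!x e. x:?S==>e>0==>\<forall>\<^sub>F y in at x within ?S. form_norm_le (cmodel c) 2 (%vs. D 0 y vs - D 0 x vs) e"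
 proof -
  from g c have "Ck_forms \<infinity> 2 (cmodel c) ?S (%x vs. g (cinv c x) (tvec E (cinv c x) c (vs ! 0)) (tvec E (cinv c x) c (vs ! 1)))"
   by (simp add: riemannian_metric_def)
  then obtain D :: "nat=>'b=>'b list=>real" where D: "ALL x:?S. ALL vs:tuples (cmodel c) 2. D 0 x vs=g (cinv c x) (tvec E (cinv c x) c (vs ! 0)) (tvec E (cinv c x) c (vs ! 1))"
   "ALL j. enat j<=\<infinity>-->(ALL x:?S. bounded_multilinear_on (cmodel c) (j + 2) (D j x))"
   "ALL j. enat j<=\<infinity>-->(ALL x:?S. ALL e>0. \<forall>\<^sub>F y in at x within ?S. form_norm_le (cmodel c) (j + 2) (%vs. D j y vs - D j x vs) e)"
   unfolding Ck_forms_def by blast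
  show thesis
  proof (rule that[of D])
   show "D 0 x vs=g (cinv c x) (tvec E (cinv c x) c (vs ! 0)) (tvec E (cinv c x) c (vs ! 1))"
    if "x:?S" "vs:tuples (cmodel c) 2" for x vs using D(1) that by blast
   show "bounded_multilinear_on (cmodel c) 2 (D (0::nat) x)" if "x:?S" for x
    using D(2)[rule_format, of 0 x] that by (simp add: numeral_2_eq_2)
   show "\<forall>\<^sub>F y in at x within ?S. form_norm_le (cmodel c) 2 (%vs. D 0 y vs - D 0 x vs) e" if "x:?S" "e>0" for x e
    using D(3)[rule_format, of 0 x e] that by (simp add: numeral_2_eq_2)
  qed
 qed
 have tup: "[v, w]:tuples (cmodel c) 2\<longleftrightarrow>v:cmodel c&w:cmodel c" for v w by (auto simp: tuples_def)
 have Dg: "D 0 (cmap c y) [v, w]=g y (tvec E y c v) (tvec E y c w)" if "y:cdom c" "v:cmodel c" "w:cmodel c" for y v w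
  using D0[of "cmap c y" "[v, w]"] that tup cinv_cmap[OF ch that(1)] by simp
 have mS: "cmap c m:?S" using m by blast
 show "g m (tvec E m c (a *\<^sub>R u + v)) (tvec E m c w)=a * g m (tvec E m c u) (tvec E m c w) + g m (tvec E m c v) (tvec E m c w)"
  if uvw: "u:cmodel c" "v:cmodel c" "w:cmodel c"
 proof -
  have *: "ALL vs:tuples (cmodel c) 2. ALL i<2. ALL u:cmodel c. ALL v:cmodel c. ALL a. D 0 (cmap c m) (vs[i := a *\<^sub>R u + v])=a *\<^sub>R D 0 (cmap c m) (vs[i := u]) + D 0 (cmap c m) (vs[i := v])"
   using Dm[OF mS] unfolding bounded_multilinear_on_def by blast
  have "D 0 (cmap c m) ([u, w][0 := a *\<^sub>R u + v])=a *\<^sub>R D 0 (cmap c m) ([u, w][0 := u]) + D 0 (cmap c m) ([u, w][0 := v])"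
   by (rule *[rule_format]) (use uvw tup in auto)
  moreover have "a *\<^sub>R u + v:cmodel c" using chartD(2)[OF ch] uvw by (simp add: subspace_add subspace_scale)
  ultimately show ?thesis using Dg[OF m] uvw by simp
 qed
 show "g m (tvec E m c v) (tvec E m c w)=g m (tvec E m c w) (tvec E m c v)" if "v:cmodel c" "w:cmodel c"
 proof -
  have "m:mpoints E" using m chartD(6)[OF ch] by blast
  then show ?thesis using g that tangent_space_eq[OF E c m] unfolding riemannian_metric_def by blast
 qed
 show "EX b>0. ALL v:cmodel c. ALL w:cmodel c. \<bar>g m (tvec E m c v) (tvec E m c w)\<bar><=b * norm v * norm w"
 proof -
  obtain b where "form_norm_le (cmodel c) 2 (D 0 (cmap c m)) b" using Dm[OF mS] unfolding bounded_multilinear_on_def by blast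
  then have b: "\<bar>g m (tvec E m c v) (tvec E m c w)\<bar><=b * (norm v * norm w)" if "v:cmodel c" "w:cmodel c" for v w
  proof -
   have "norm (D 0 (cmap c m) [v, w])<=b * prod_list (map norm [v, w])"
    using \<open>form_norm_le _ _ _ b\<close> tup that unfolding form_norm_le_def by blast
   then show ?thesis using Dg[OF m that] by simp
  qed
  show ?thesis
  proof (intro exI[of _ "\<bar>b\<bar> + 1"] conjI ballI)
   fix v w assume vw: "v:cmodel c" "w:cmodel c"
   have "b * (norm v * norm w)<=(\<bar>b\<bar> + 1) * (norm v * norm w)" by (intro mult_right_mono) auto
   then show "\<bar>g m (tvec E m c v) (tvec E m c w)\<bar><=(\<bar>b\<bar> + 1) * norm v * norm w" using b[OF vw] by (simp add: mult.assoc)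
  qed auto
 qed
 show "EX k>0. ALL v:cmodel c. k * (norm v)\<^sup>2<=g m (tvec E m c v) (tvec E m c v)"
  using g c m by (simp add: riemannian_metric_def)
 show "EX d>0. ALL y:cdom c. dist (cmap c y) (cmap c m)<d-->(ALL v:cmodel c.
   \<bar>g y (tvec E y c v) (tvec E y c v) - g m (tvec E m c v) (tvec E m c v)\<bar><=e * (norm v)\<^sup>2)" if e: "e>0"
 proof -
  obtain d where d: "d>0" "!!y. y:?S==>y~=cmap c m==>dist y (cmap c m)<d==>form_norm_le (cmodel c) 2 (%vs. D 0 y vs - D 0 (cmap c m) vs) e"
   using Dc[OF mS e] unfolding eventually_at by blast
  show ?thesis
  proof (intro exI[of _ d] conjI ballI impI)
   fix y v assume y: "y:cdom c" "dist (cmap c y) (cmap c m)<d" and v: "v:cmodel c"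
   show "\<bar>g y (tvec E y c v) (tvec E y c v) - g m (tvec E m c v) (tvec E m c v)\<bar><=e * (norm v)\<^sup>2"
   proof (cases "cmap c y=cmap c m")
    case True
    then have "y=m" using y(1) m chartD(5)[OF ch] by (simp add: inj_on_def)
    then show ?thesis using e by simp
   next
    case False
    then have "form_norm_le (cmodel c) 2 (%vs. D 0 (cmap c y) vs - D 0 (cmap c m) vs) e" using d(2) y by blast
    then have "norm (D 0 (cmap c y) [v, v] - D 0 (cmap c m) [v, v])<=e * prod_list (map norm [v, v])"
     unfolding form_norm_le_def using tup v by blast
    then show ?thesis using Dg[OF y(1) v v] Dg[OF m v v] by (simp add: power2_eq_square)
   qed
  qed (use d in auto)
 qed
qed

lemma metric_chart_scale:
 assumes g: "riemannian_metric E g" and E: "diff_manifold E" and c: "c:atlas E" and m: "m:cdom c"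
  and v: "v:cmodel c"
 shows "g m (tvec E m c (a *\<^sub>R v)) (tvec E m c (a *\<^sub>R v))=a\<^sup>2 * g m (tvec E m c v) (tvec E m c v)"
proof -
 note ch=dm_chart[OF E c]
 note L=metric_chart_linear[OF g E c m] and S=metric_chart_sym[OF g E c m]
 have V: "0:cmodel c" "a *\<^sub>R v:cmodel c" using chartD(2)[OF ch] v by (simp_all add: subspace_0 subspace_scale)
 have z: "g m (tvec E m c 0) (tvec E m c w)=0" if "w:cmodel c" for w
  using L[OF V(1) V(1) that, of 1] by simp
 have *: "g m (tvec E m c (a *\<^sub>R v)) (tvec E m c w)=a * g m (tvec E m c v) (tvec E m c w)" if "w:cmodel c" for w
  using L[OF v V(1) that, of a] z[OF that] by simp
 show ?thesis using *[OF V(2)] *[OF v] S[OF v V(2)] by (simp add: power2_eq_square)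
qed

lemma tnorm_scale:
 assumes "riemannian_metric E g" "diff_manifold E" "c:atlas E" "m:cdom c" "v:cmodel c"
 shows "tnorm g m (tvec E m c (a *\<^sub>R v))=\<bar>a\<bar> * tnorm g m (tvec E m c v)"
 using metric_chart_scale[OF assms] by (simp add: tnorm_def real_sqrt_mult)

lemma curve_length_alt: "curve_length M g gam=(\<integral>\<^sup>+t. ennreal (tnorm g (gam t) (velocity M gam t)) * indicator {0..1} t \<partial>lborel)"
 by (simp add: curve_length_def)

lemma AE_not_finite: "finite P==>AE t in lborel. t \<notin> (P :: real set)"
 by (intro AE_not_in finite_imp_null_set_lborel)

text \<open>Agreement with an affine reparametrisation is required only near \<open>t\<close>, so
  that the result applies to each half of a concatenation. The curve parameter has to be interior
  since velocities are two-sided.\<close>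

lemma velocity_reparam:
 assumes E: "diff_manifold E" and g: "riemannian_metric E g" and gam: "pathin (mtop E) gam"
  and C1: "!!c. c:atlas E==>(cmap c o gam) C1_differentiable_on (({0..1} - P)\<inter>gam -` cdom c)"
  and s: "0<b + a * t" "b + a * t<1" "b + a * t \<notin> P"
  and e: "e>0" "!!y. dist y t<e==>gam' y=gam (b + a * y)"
 shows "tnorm g (gam' t) (velocity E gam' t)=\<bar>a\<bar> * tnorm g (gam (b + a * t)) (velocity E gam (b + a * t))"
  and "c:atlas E==>gam' t:cdom c ==>
   ((cmap c o gam') has_vector_derivative a *\<^sub>R vector_derivative (cmap c o gam) (at (b + a * t))) (at t)"
proof -
 let ?s="b + a * t"
 have gamt: "gam' t=gam ?s" using e by simp
 have der: "((cmap c o gam) has_vector_derivative vector_derivative (cmap c o gam) (at ?s)) (at ?s)"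
  "((cmap c o gam') has_vector_derivative a *\<^sub>R vector_derivative (cmap c o gam) (at ?s)) (at t)"
  if c: "c:atlas E" "gam ?s:cdom c" for c
 proof -
  have "?s:({0..1} - P)\<inter>gam -` cdom c" using s c by auto
  then show 1: "((cmap c o gam) has_vector_derivative vector_derivative (cmap c o gam) (at ?s)) (at ?s)"
   using C1[OF c(1)] unfolding C1_differentiable_on_eq vector_derivative_works[symmetric] by blast
  have "((%y. b + a * y) has_vector_derivative a) (at t)"
   by (auto intro!: derivative_eq_intros simp: has_real_derivative_iff_has_vector_derivative[symmetric])
  from vector_diff_chain_at[OF this 1]
  show "((cmap c o gam') has_vector_derivative a *\<^sub>R vector_derivative (cmap c o gam) (at ?s)) (at t)"
   by (rule has_vector_derivative_transform_within[OF _ e(1)]) (use e(2) in auto)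
 qed
 show "((cmap c o gam') has_vector_derivative a *\<^sub>R vector_derivative (cmap c o gam) (at ?s)) (at t)"
  if "c:atlas E" "gam' t:cdom c" using der(2)[of c] that gamt by simp
 have "gam ?s:mpoints E" using path_image_subset_topspace[OF gam] s by auto
 then obtain c where c: "c:atlas E" "gam ?s:cdom c" by (rule diff_manifold_cover[OF E])
 note ch=dm_chart[OF E c(1)]
 obtain e1 where e1: "e1>0" "!!y. dist y ?s<e1==>0<y&y<1&gam y:cdom c"
  using pathin_near[OF gam s(1,2) chartD(1)[OF ch] c(2)] by metis
 have e2: "min e (e1 / (\<bar>a\<bar> + 1))>0" using e e1 by simp
 have near: "gam' y:cdom c" if "dist y t<min e (e1 / (\<bar>a\<bar> + 1))" for y
 proof -
  have "dist (b + a * y) ?s=\<bar>a\<bar> * dist y t" by (simp add: dist_real_def abs_mult[symmetric] algebra_simps)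
  also have "...<=(\<bar>a\<bar> + 1) * dist y t" by (intro mult_right_mono) auto
  also have "...<e1" using that by (simp add: field_simps add_pos_nonneg)
  finally show ?thesis using e1(2) e(2)[of y] that by simp
 qed
 let ?w="vector_derivative (cmap c o gam) (at ?s)"
 have "velocity E gam' t=tvec E (gam' t) c (a *\<^sub>R ?w)"
  by (rule velocity_tvec(2)[OF E c(1) _ e2 near der(2)[OF c]]) (use c gamt in auto)
 moreover have "velocity E gam ?s=tvec E (gam ?s) c ?w" "?w:cmodel c"
  using e1(2) by (intro velocity_tvec(1,2)[OF E c e1(1) _ der(1)[OF c]]; blast)+
 ultimately show "tnorm g (gam' t) (velocity E gam' t)=\<bar>a\<bar> * tnorm g (gam ?s) (velocity E gam ?s)"
  using tnorm_scale[OF g E c] gamt by simp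
qed

lemma pathin_join:
 assumes 1: "pathin T gam1" and 2: "pathin T gam2" and eq: "gam1 1=gam2 0"
 shows "pathin T (%t. if t<=1/2 then gam1 (2 * t) else gam2 (2 * t - 1))"
 unfolding pathin_def
proof (rule continuous_map_cases_le)
 show "continuous_map (subtopology UI {x:topspace UI. x<=1/2}) T (%t. gam1 (2 * t))"
  by (rule continuous_map_compose[OF _ 1[unfolded pathin_def], unfolded comp_def])
   (auto simp: continuous_map_in_subtopology subtopology_subtopology intro!: continuous_intros)
 show "continuous_map (subtopology UI {x:topspace UI. 1/2<=x}) T (%t. gam2 (2 * t - 1))"
  by (rule continuous_map_compose[OF _ 2[unfolded pathin_def], unfolded comp_def])
   (auto simp: continuous_map_in_subtopology subtopology_subtopology intro!: continuous_intros)
 show "gam1 (2 * t)=gam2 (2 * t - 1)" if "t:topspace UI" "t=1/2" for t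
  unfolding that(2) using eq by simp
qed (auto intro!: continuous_map_into_fulltopology)

text \<open>Nearly optimal curves are concatenated. As the speed is not known to be measurable, the
  length of the result is only bounded above by the two lengths, first by splitting the lower
  integral and then by affine substitution in each half.\<close>

lemma rdist_triangle:
 assumes E: "diff_manifold E" and g: "riemannian_metric E g"
 shows "rdist E g x z<=rdist E g x y + rdist E g y z"
proof (rule ennreal_le_epsilon)
 fix eps :: real assume eps: "eps>0" and fin: "rdist E g x y + rdist E g y z<top"
 have "rdist E g x y<rdist E g x y + ennreal (eps/2)" "rdist E g y z<rdist E g y z + ennreal (eps/2)"
  using eps fin by (auto simp: ennreal_add_left_cancel_less[of _ 0, simplified] less_top)
 then obtain gam1 gam2 where c1: "piecewise_C1_curve E gam1" "gam1 0=x" "gam1 1=y" "curve_length E g gam1<rdist E g x y + ennreal (eps/2)"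
  and c2: "piecewise_C1_curve E gam2" "gam2 0=y" "gam2 1=z" "curve_length E g gam2<rdist E g y z + ennreal (eps/2)"
  unfolding rdist_def INF_less_iff by blast
 obtain P1 P2 where P: "finite P1" "finite P2"
  "!!c. c:atlas E==>(cmap c o gam1) C1_differentiable_on (({0..1} - P1)\<inter>gam1 -` cdom c)"
  "!!c. c:atlas E==>(cmap c o gam2) C1_differentiable_on (({0..1} - P2)\<inter>gam2 -` cdom c)"
  using c1(1) c2(1) unfolding piecewise_C1_curve_def by blast
 have p12: "pathin (mtop E) gam1" "pathin (mtop E) gam2" using c1(1) c2(1) by (simp_all add: piecewise_C1_curve_def)
 define gam where "gam=(%t. if t<=1/2 then gam1 (2 * t) else gam2 (2 * t - 1))"
 \<comment> \<open>The junction and both end points are exceptional, along with the rescaled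
   exceptional parameters of the two curves; this leaves two open pieces on which the derivative is
   continuous.\<close>
 define P where "P={0, 1/2, 1} \<union> (%t. t/2) ` P1 \<union> (%t. (t + 1)/2) ` P2"
 have finP: "finite P" using P by (simp add: P_def)
 have l: "gam y=gam1 (0 + 2 * y)" if "dist y t<1/2 - t" for y t
  using that by (auto simp: gam_def dist_real_def)
 have r: "gam y=gam2 (- 1 + 2 * y)" if "dist y t<t - 1/2" for y t
 proof -
  have "y>1/2" using that by (auto simp: dist_real_def)
  then show ?thesis by (simp add: gam_def algebra_simps)
 qed
 have inl: "0<0 + 2 * t" "0 + 2 * t<1" "0 + 2 * t \<notin> P1" "1/2 - t>0" if "t:{0..1} - P" "t<1/2" for t
 proof -
  have "0 + 2 * t \<notin> P1"
  proof
   assume "0 + 2 * t:P1"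
   then have "(0 + 2 * t) / 2:P" unfolding P_def by blast
   then show False using that by simp
  qed
  then show "0<0 + 2 * t" "0 + 2 * t<1" "0 + 2 * t \<notin> P1" "1/2 - t>0" using that by (auto simp: P_def)
 qed
 have inr: "0 < - 1 + 2 * t" "- 1 + 2 * t<1" "- 1 + 2 * t \<notin> P2" "t - 1/2>0" if "t:{0..1} - P" "t>1/2" for t
 proof -
  have "- 1 + 2 * t \<notin> P2"
  proof
   assume "- 1 + 2 * t:P2"
   then have "(- 1 + 2 * t + 1) / 2:P" unfolding P_def by blast
   then show False using that by simp
  qed
  then show "0 < - 1 + 2 * t" "- 1 + 2 * t<1" "- 1 + 2 * t \<notin> P2" "t - 1/2>0" using that by (auto simp: P_def)
 qed
 have ne: "t<1/2 \<or> t>1/2" if "t:{0..1} - P" for t using that by (force simp: P_def)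
 have "piecewise_C1_curve E gam"
  unfolding piecewise_C1_curve_def
 proof (intro conjI exI[of _ P] ballI finP)
  show "pathin (mtop E) gam" unfolding gam_def using p12 c1(3) c2(2) by (intro pathin_join) auto
  fix c assume c: "c:atlas E"
  let ?S="({0..1} - P)\<inter>gam -` cdom c"
  define D where "D=(%t. if t<1/2 then 2 *\<^sub>R vector_derivative (cmap c o gam1) (at (0 + 2 * t)) else 2 *\<^sub>R vector_derivative (cmap c o gam2) (at (- 1 + 2 * t)))"
  have dl: "((cmap c o gam) has_vector_derivative D t) (at t)" if t: "t:?S" for t
  proof (cases "t<1/2")
   case True
   then show ?thesis using velocity_reparam(2)[OF E g p12(1) P(3) inl(1,2,3) inl(4) l c] t by (auto simp: D_def)
  next
   case False
   then have "t>1/2" using ne[of t] t by auto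
   then show ?thesis using velocity_reparam(2)[OF E g p12(2) P(4) inr(1,2,3) inr(4) r c] t False by (auto simp: D_def)
  qed
  have half: "openin (top_of_set ?S) (?S\<inter>{..<1/2})" "openin (top_of_set ?S) (?S\<inter>{1/2<..})"
   by (rule openin_open_Int; simp)+
  have "continuous_on (?S\<inter>{..<1/2}) D"
  proof (rule continuous_on_eq)
   have "continuous_on ((%t. 0 + 2 * t) ` (?S\<inter>{..<1/2})) (%s. vector_derivative (cmap c o gam1) (at s))"
    using P(3)[OF c] unfolding C1_differentiable_on_eq
   proof (elim conjE continuous_on_subset, intro image_subsetI)
    fix t assume "t:?S\<inter>{..<1/2}"
    then have t: "t:{0..1} - P" "t<1/2" "gam t:cdom c" by auto
    have "gam t=gam1 (0 + 2 * t)" using t(2) by (simp add: gam_def)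
    then show "0 + 2 * t:({0..1} - P1)\<inter>gam1 -` cdom c" using inl(1-3)[OF t(1,2)] t(3) by simp
   qed
   then show "continuous_on (?S\<inter>{..<1/2}) (%t. 2 *\<^sub>R vector_derivative (cmap c o gam1) (at (0 + 2 * t)))"
   proof (intro continuous_on_scaleR continuous_on_const)
    assume *: "continuous_on ((%t. 0 + 2 * t) ` (?S\<inter>{..<1/2})) (%s. vector_derivative (cmap c o gam1) (at s))"
    have "continuous_on (?S\<inter>{..<1/2}) (%t. 0 + 2 * t)" by (intro continuous_intros)
    from continuous_on_compose[OF this *]
    show "continuous_on (?S\<inter>{..<1/2}) (%t. vector_derivative (cmap c o gam1) (at (0 + 2 * t)))" unfolding comp_def .
   qed
  qed (auto simp: D_def)
  moreover have "continuous_on (?S\<inter>{1/2<..}) D"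
  proof (rule continuous_on_eq)
   have "continuous_on ((%t. - 1 + 2 * t) ` (?S\<inter>{1/2<..})) (%s. vector_derivative (cmap c o gam2) (at s))"
    using P(4)[OF c] unfolding C1_differentiable_on_eq
   proof (elim conjE continuous_on_subset, intro image_subsetI)
    fix t assume "t:?S\<inter>{1/2<..}"
    then have t: "t:{0..1} - P" "t>1/2" "gam t:cdom c" by auto
    have "gam t=gam2 (- 1 + 2 * t)" using t(2) by (simp add: gam_def)
    then show "- 1 + 2 * t:({0..1} - P2)\<inter>gam2 -` cdom c" using inr(1-3)[OF t(1,2)] t(3) by simp
   qed
   then show "continuous_on (?S\<inter>{1/2<..}) (%t. 2 *\<^sub>R vector_derivative (cmap c o gam2) (at (- 1 + 2 * t)))"
   proof (intro continuous_on_scaleR continuous_on_const)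
    assume *: "continuous_on ((%t. - 1 + 2 * t) ` (?S\<inter>{1/2<..})) (%s. vector_derivative (cmap c o gam2) (at s))"
    have "continuous_on (?S\<inter>{1/2<..}) (%t. - 1 + 2 * t)" by (intro continuous_intros)
    from continuous_on_compose[OF this *]
    show "continuous_on (?S\<inter>{1/2<..}) (%t. vector_derivative (cmap c o gam2) (at (- 1 + 2 * t)))" unfolding comp_def .
   qed
  qed (auto simp: D_def)
  moreover have SS: "?S\<inter>{..<1/2} \<union> ?S\<inter>{1/2<..}=?S"
  proof (intro equalityI subsetI)
   fix t assume t: "t:?S"
   then have "t<1/2 \<or> t>1/2" by (intro ne) blast
   then show "t:?S\<inter>{..<1/2} \<union> ?S\<inter>{1/2<..}" using t by blast
  qed blast
  ultimately have "continuous_on ?S D"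
   using continuous_on_Un_local_open[of "?S\<inter>{..<1/2}" "?S\<inter>{1/2<..}" D, unfolded SS, OF half] by blast
  then show "(cmap c o gam) C1_differentiable_on ?S"
   unfolding C1_differentiable_on_def using dl by blast
 qed
 moreover have "gam 0=x" "gam 1=z" using c1 c2 by (auto simp: gam_def)
 ultimately have "rdist E g x z<=curve_length E g gam" unfolding rdist_def by (intro INF_lower) auto
 also have "...<=curve_length E g gam1 + curve_length E g gam2"
 proof -
  let ?f="%gam t. ennreal (tnorm g (gam t) (velocity E gam t)) * indicator {0..1} t"
  have "curve_length E g gam<=(\<integral>\<^sup>+t. ?f gam t * indicator {..1/2} t \<partial>lborel) + (\<integral>\<^sup>+t. ?f gam t * indicator (- {..1/2}) t \<partial>lborel)"
   unfolding curve_length_alt by (rule nn_integral_split_le) simp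
  also have "(\<integral>\<^sup>+t. ?f gam t * indicator {..1/2} t \<partial>lborel)<=(\<integral>\<^sup>+t. ennreal 2 * ?f gam1 (0 + 2 * t) \<partial>lborel)"
  proof (rule nn_integral_mono_AE, use AE_not_finite[OF finP] in eventually_elim)
   fix t assume t: "t \<notin> P"
   show "?f gam t * indicator {..1/2} t<=ennreal 2 * ?f gam1 (0 + 2 * t)"
   proof (cases "0<=t&t<=1/2")
    case True
    then have tt: "t:{0..1} - P" "t<1/2" using t by (auto simp: P_def)
    have "tnorm g (gam t) (velocity E gam t)=\<bar>2\<bar> * tnorm g (gam1 (0 + 2 * t)) (velocity E gam1 (0 + 2 * t))"
     by (rule velocity_reparam(1)[OF E g p12(1) P(3) inl(1-3)[OF tt] inl(4)[OF tt] l])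
    then show ?thesis using tt inl(1,2)[OF tt] by (simp add: ennreal_mult')
   qed (auto simp: indicator_def)
  qed
  also have "...<=curve_length E g gam1" unfolding curve_length_alt by (rule nn_integral_affine_le) simp
  also have "(\<integral>\<^sup>+t. ?f gam t * indicator (- {..1/2}) t \<partial>lborel)<=(\<integral>\<^sup>+t. ennreal 2 * ?f gam2 (- 1 + 2 * t) \<partial>lborel)"
  proof (rule nn_integral_mono_AE, use AE_not_finite[OF finP] in eventually_elim)
   fix t assume t: "t \<notin> P"
   show "?f gam t * indicator (- {..1/2}) t<=ennreal 2 * ?f gam2 (- 1 + 2 * t)"
   proof (cases "1/2<t&t<=1")
    case True
    then have tt: "t:{0..1} - P" "t>1/2" using t by (auto simp: P_def)
    have "tnorm g (gam t) (velocity E gam t)=\<bar>2\<bar> * tnorm g (gam2 (- 1 + 2 * t)) (velocity E gam2 (- 1 + 2 * t))"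
     by (rule velocity_reparam(1)[OF E g p12(2) P(4) inr(1-3)[OF tt] inr(4)[OF tt] r])
    then show ?thesis using tt inr(1,2)[OF tt] by (simp add: ennreal_mult')
   qed (auto simp: indicator_def)
  qed
  also have "...<=curve_length E g gam2" unfolding curve_length_alt by (rule nn_integral_affine_le) simp
  finally show ?thesis by (simp add: add_mono)
 qed
 also have "...<=(rdist E g x y + ennreal (eps/2)) + (rdist E g y z + ennreal (eps/2))"
  using c1(4) c2(4) by (intro add_mono) auto
 also have "...=(rdist E g x y + rdist E g y z) + ennreal eps"
  using eps by (simp add: ac_simps ennreal_plus[symmetric] del: ennreal_plus)
 finally show "rdist E g x z<=rdist E g x y + rdist E g y z + ennreal eps" .
qed

section \<open>Comparison of the Riemannian distance with chart norms\<close>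

lemma C1_on_deriv_continuous:
 assumes f: "C1_on V S f f'" and v: "v:V"
 shows "continuous_on S (%x. f' x v)"
 unfolding continuous_on_iff
proof (intro ballI allI impI)
 fix x and e :: real assume x: "x:S" and e: "e>0"
 have pos: "norm v + 1>0" by (simp add: add_nonneg_pos)
 then have "e / (norm v + 1) / 2>0" using e by simp
 then obtain d where d: "d>0" "!!y. y:S==>dist y x<d==>norm (f' y v - f' x v)<=e / (norm v + 1) / 2 * norm v"
  using f x v unfolding C1_on_def by meson
 have "e / (norm v + 1) / 2 * norm v<e"
 proof -
  have "e * norm v<=e * (norm v + 1)" using e by simp
  also have "...<e * (norm v + 1) * 2" using e pos by (simp add: mult_pos_pos)
  finally show ?thesis using pos by (simp add: field_simps)
 qed
 then show "EX d>0. ALL y:S. dist y x<d-->dist (f' y v) (f' x v)<e"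
  using d by (intro exI[of _ d]) (auto simp: dist_norm intro: order_le_less_trans)
qed

text \<open>The straight segment in the chart is used as competitor. The continuity tolerance
  \<open>3 * k\<close>, with \<open>k\<close> the coercivity constant at \<open>m\<close>, makes the
  metric nearby at most four times the one at \<open>m\<close>, hence the factor 2 for
  norms.\<close>

lemma rdist_upper:
 assumes E: "banach_manifold E" and g: "riemannian_metric E g" and c: "c:atlas E" "m:cdom c"
 obtains d where "d>0" "!!v. v:cmodel c==>dist v (cmap c m)<d==>v:cmap c ` cdom c"
  "!!x y. x:cdom c==>y:cdom c==>dist (cmap c x) (cmap c m)<d==>dist (cmap c y) (cmap c m)<d ==>
   rdist E g x y<=ennreal (2 * tnorm g m (tvec E m c (cmap c y - cmap c x)))"
proof -
 note DE=banach_imp_diff_manifold[OF E]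
 note ch=dm_chart[OF DE c(1)]
 obtain d0 where d0: "d0>0" "!!v. v:cmodel c==>dist v (cmap c m)<d0==>v:cmap c ` (cdom c\<inter>cdom c)"
  using chart_near[OF ch c(2) chartD(1)[OF ch] c(2)] by metis
 obtain k where k: "k>0" "!!v. v:cmodel c==>k * (norm v)\<^sup>2<=g m (tvec E m c v) (tvec E m c v)"
  using metric_chart_coercive[OF g DE c] by blast
 have "3 * k>0" using k by simp
 from metric_chart_cont[OF g DE c this]
 obtain d1 where d1: "d1>0" "!!y v. y:cdom c==>dist (cmap c y) (cmap c m)<d1==>v:cmodel c ==>
   \<bar>g y (tvec E y c v) (tvec E y c v) - g m (tvec E m c v) (tvec E m c v)\<bar><=3 * k * (norm v)\<^sup>2" by blast
 show thesis
 proof (rule that[of "min d0 d1"])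
  show "min d0 d1>0" using d0 d1 by simp
  show "v:cmap c ` cdom c" if "v:cmodel c" "dist v (cmap c m)<min d0 d1" for v using d0(2)[of v] that by simp
  fix x y assume xy: "x:cdom c" "y:cdom c" "dist (cmap c x) (cmap c m)<min d0 d1" "dist (cmap c y) (cmap c m)<min d0 d1"
  define v where "v=cmap c y - cmap c x"
  have v: "v:cmodel c" unfolding v_def using cmap_in_cmodel[OF ch] xy(1,2) chartD(2)[OF ch] by (simp add: subspace_diff)
  define l where "l=(%t::real. cmap c x + t *\<^sub>R v)"
  have lV: "l t:cmodel c" for t unfolding l_def using cmap_in_cmodel[OF ch] xy(1) v chartD(2)[OF ch] by (simp add: subspace_add subspace_scale)
  have lb: "dist (l t) (cmap c m)<min d0 d1" if "t:{0..1}" for t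
  proof -
   have "l t=(1 - t) *\<^sub>R cmap c x + t *\<^sub>R cmap c y" by (simp add: l_def v_def algebra_simps)
   moreover have "...:ball (cmap c m) (min d0 d1)"
    using convex_ball[of "cmap c m" "min d0 d1", unfolded convex_alt, rule_format, of "cmap c x" "cmap c y" t] xy that
    by (simp add: dist_commute)
   ultimately show ?thesis by (simp add: dist_commute)
  qed
  have lS: "l t:cmap c ` cdom c" if "t:{0..1}" for t using d0(2)[OF lV, of t] lb[OF that] by simp
  define gam where "gam=(%t. cinv c (l t))"
  have gamc: "gam t:cdom c" "cmap c (gam t)=l t" if "t:{0..1}" for t
   using cinv_in[OF lS[OF that]] cmap_cinv[OF lS[OF that]] by (simp_all add: gam_def)
  have path: "pathin (mtop E) gam"
  proof -
   have "continuous_map UI (top_of_set (cmap c ` cdom c)) l"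
    using lS by (auto simp: l_def continuous_map_in_subtopology intro!: continuous_intros)
   from continuous_map_compose[OF this continuous_map_cinv[OF ch]] show ?thesis by (simp add: pathin_def gam_def comp_def)
  qed
  have near01: "s:{0..1}" if "dist s t<min t (1 - t)" for s t :: real
  proof -
   have "\<bar>s - t\<bar><t" "\<bar>s - t\<bar><1 - t" using that by (simp_all add: dist_real_def)
   then show ?thesis unfolding abs_less_iff by simp
  qed
  have der: "((cmap c o gam) has_vector_derivative v) (at t)" if t: "0<t" "t<1" for t
  proof (rule has_vector_derivative_transform_within[where f=l])
   show "(l has_vector_derivative v) (at t)" unfolding l_def by (auto intro!: derivative_eq_intros)
   show "min t (1 - t)>0" using t by simp
   show "l s=(cmap c o gam) s" if "dist s t<min t (1 - t)" for s
    using gamc(2)[OF near01[OF that]] by simp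
  qed simp
  have near: "min t (1 - t)>0" "!!s. dist s t<min t (1 - t)==>gam s:cdom c" if t: "0<t" "t<1" for t
   using t gamc(1)[OF near01] by auto
  have vel: "velocity E gam t=tvec E (gam t) c v"
   "d:atlas E==>gam t:cdom d==>((cmap d o gam) has_vector_derivative fderiv (cmodel c) (cmap d o cinv c) (cmap c (gam t)) v) (at t)"
   if t: "0<t" "t<1" for t d
   using velocity_tvec(2,3)[OF DE c(1) gamc(1)[of t] near(1)[OF t] near(2)[OF t] der[OF t]] t by auto
  have "piecewise_C1_curve E gam"
   unfolding piecewise_C1_curve_def
  proof (intro conjI path exI[of _ "{0, 1}"] ballI)
   fix d assume d: "d:atlas E"
   note dh=dm_chart[OF DE d]
   let ?S="cmap c ` (cdom c\<inter>cdom d)"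
   let ?T="({0..1} - {0, 1})\<inter>gam -` cdom d"
   have So: "openin (top_of_set (cmodel c)) ?S" by (rule openin_transition_domain[OF ch chartD(1)[OF dh]])
   have "Ck_on \<infinity> (cmodel c) ?S (cmap d o cinv c)" using E c d by (simp add: banach_manifold_def smooth_transition_def)
   then obtain f' where f': "C1_on (cmodel c) ?S (cmap d o cinv c) f'"
    using Ck_on_imp_C1[OF _ _ chartD(2)[OF ch] So] by (metis enat_ord_code(3))
   have feq: "fderiv (cmodel c) (cmap d o cinv c) z v=f' z v" if "z:?S" for z
   proof (rule fderiv_eq[OF _ chartD(2)[OF ch] _ v])
    show "has_fderiv (cmodel c) (cmap d o cinv c) (f' z) z" using f' that unfolding C1_on_def by blast
    show "z:cmodel c" using that cmap_in_cmodel[OF ch] by blast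
   qed
   have lT: "l t:?S" if "t:?T" for t
   proof -
    have "t:{0..1}" "gam t:cdom d" using that by blast+
    then show ?thesis using gamc[of t] by (metis IntI imageI)
   qed
   have cont: "continuous_on ?T (%t. f' (l t) v)"
   proof (rule continuous_on_compose2[OF C1_on_deriv_continuous[OF f' v]])
    show "continuous_on ?T l" unfolding l_def by (intro continuous_intros)
    show "l ` ?T<=?S" using lT by blast
   qed
   have "((cmap d o gam) has_vector_derivative f' (l t) v) (at t)" if t: "t:?T" for t
   proof -
    have t01: "0<t" "t<1" "t:{0..1}" "gam t:cdom d" using t by auto
    show ?thesis using vel(2)[OF t01(1,2) d t01(4)] unfolding gamc(2)[OF t01(3)] feq[OF lT[OF t]] .
   qed
   then show "(cmap d o gam) C1_differentiable_on ?T"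
    unfolding C1_differentiable_on_def by (intro exI[of _ "%t. f' (l t) v"] conjI ballI cont)
  qed simp
  moreover have "gam 0=x" "gam 1=y" using cinv_cmap[OF ch] xy(1,2) by (simp_all add: gam_def l_def v_def)
  ultimately have "rdist E g x y<=curve_length E g gam" unfolding rdist_def by (intro INF_lower) auto
  have fin01: "finite {0, 1::real}" by simp
  note \<open>rdist E g x y<=curve_length E g gam\<close>
  also have "curve_length E g gam<=(\<integral>\<^sup>+t. ennreal (2 * tnorm g m (tvec E m c v)) * indicator {0..1::real} t \<partial>lborel)"
   unfolding curve_length_alt
  proof (rule nn_integral_mono_AE, use AE_not_finite[OF fin01] in eventually_elim)
   fix t :: real assume t: "t \<notin> {0, 1}"
   show "ennreal (tnorm g (gam t) (velocity E gam t)) * indicator {0..1} t<=ennreal (2 * tnorm g m (tvec E m c v)) * indicator {0..1} t"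
   proof (cases "t:{0..1}")
    case True
    then have t01: "0<t" "t<1" using t by auto
    let ?y="gam t"
    have "\<bar>g ?y (tvec E ?y c v) (tvec E ?y c v) - g m (tvec E m c v) (tvec E m c v)\<bar><=3 * k * (norm v)\<^sup>2"
     using d1(2)[OF gamc(1)[OF True] _ v] gamc(2)[OF True] lb[OF True] by simp
    then have "g ?y (tvec E ?y c v) (tvec E ?y c v)<=4 * g m (tvec E m c v) (tvec E m c v)"
     using k(2)[OF v] by (simp add: abs_le_iff)
    then have "sqrt (g ?y (tvec E ?y c v) (tvec E ?y c v))<=sqrt (4 * g m (tvec E m c v) (tvec E m c v))" by (rule real_sqrt_le_mono)
    then have "tnorm g ?y (velocity E gam t)<=2 * tnorm g m (tvec E m c v)"
     unfolding vel(1)[OF t01] by (simp add: tnorm_def real_sqrt_mult)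
    then show ?thesis by (intro mult_right_mono ennreal_leI) auto
   qed simp
  qed
  also have "...=ennreal (2 * tnorm g m (tvec E m c v))" by (simp add: nn_integral_cmult)
  finally show "rdist E g x y<=ennreal (2 * tnorm g m (tvec E m c (cmap c y - cmap c x)))" by (simp add: v_def)
 qed
qed

text \<open>Points different from \<open>x\<close> have neighbourhoods whose closure misses
  \<open>x\<close>; together with \<open>U\<close> they form a cover. In a locally finite refinement
  the closure of a union is the union of closures, so \<open>x\<close> is separated from all members
  not contained in \<open>U\<close>. This is needed to have chart balls that are closed in the whole
  manifold.\<close>

lemma paracompact_regular:
 assumes T: "paracompact_space T" and U: "openin T U" "x:U"
 obtains W where "openin T W" "x:W" "T closure_of W<=U"
proof -
 have H: "Hausdorff_space T" using T by (simp add: paracompact_space_def)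
 define \<V> where "\<V>={V. openin T V&x \<notin> T closure_of V}"
 have xT: "x:topspace T" using U openin_subset by blast
 have cover: "\<Union>(insert U \<V>)=topspace T"
 proof (rule antisym)
  show "\<Union>(insert U \<V>)<=topspace T" using U(1) openin_subset unfolding \<V>_def by blast
  show "topspace T<=\<Union>(insert U \<V>)"
  proof
   fix y assume y: "y:topspace T"
   show "y:\<Union>(insert U \<V>)"
   proof (cases "y=x")
    case False
    then obtain A B where AB: "openin T A" "openin T B" "y:A" "x:B" "disjnt A B"
     using H xT y unfolding Hausdorff_space_def by blast
    then have "x \<notin> T closure_of A" unfolding in_closure_of disjnt_def by blast
    then show ?thesis using AB by (auto simp: \<V>_def)
   qed (use U in auto)
  qed
 qed
 have "ALL V:insert U \<V>. openin T V" using U(1) unfolding \<V>_def by blast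
 then have "\<exists>\<W>. (ALL V:\<W>. openin T V)&\<Union>\<W>=topspace T&(ALL V:\<W>. EX W:insert U \<V>. V<=W)&locally_finite_in T \<W>"
  by (intro mp[OF spec[OF conjunct2[OF T[unfolded paracompact_space_def]]]] conjI cover)
 then obtain \<W> where W0: "ALL V:\<W>. openin T V" "\<Union>\<W>=topspace T" "ALL V:\<W>. EX W:insert U \<V>. V<=W" "locally_finite_in T \<W>"
  by (elim exE conjE)
 note W=bspec[OF W0(1)] W0(2) bspec[OF W0(3)] W0(4)
 define \<A> where "\<A>={V:\<W>. \<not> V<=U}"
 have "locally_finite_in T \<A>" by (rule locally_finite_in_subset[OF W(4)]) (auto simp: \<A>_def)
 then have cl: "T closure_of (\<Union>\<A>)=(\<Union>V\<in>\<A>. T closure_of V)" by (rule closure_of_locally_finite_Union)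
 have nx: "x \<notin> T closure_of (\<Union>\<A>)"
 proof
  assume "x:T closure_of (\<Union>\<A>)"
  then obtain V where V: "V:\<A>" "x:T closure_of V" unfolding cl by blast
  then obtain W where "W:\<V>" "V<=W" using W(3)[of V] unfolding \<A>_def by blast
  then show False using V(2) closure_of_mono[of V W T] unfolding \<V>_def by blast
 qed
 show thesis
 proof (rule that[of "topspace T - T closure_of (\<Union>\<A>)"])
  show "openin T (topspace T - T closure_of (\<Union>\<A>))" by (simp add: openin_diff)
  show "x:topspace T - T closure_of (\<Union>\<A>)" using nx xT by blast
  have "\<Union>\<A><=topspace T" using W(2) unfolding \<A>_def by blast
  then have sub: "topspace T - T closure_of (\<Union>\<A>)<=topspace T - \<Union>\<A>" using closure_of_subset[of "\<Union>\<A>" T] by blast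
  have "openin T (\<Union>\<A>)" using W(1) unfolding \<A>_def by blast
  then have "closedin T (topspace T - \<Union>\<A>)" by blast
  then have "T closure_of (topspace T - T closure_of (\<Union>\<A>))<=topspace T - \<Union>\<A>" using sub by (rule closure_of_minimal[rotated])
  also have "...<=U" using W(2) unfolding \<A>_def by blast
  finally show "T closure_of (topspace T - T closure_of (\<Union>\<A>))<=U" .
 qed
qed

text \<open>The hitting parameter nearest to \<open>t0\<close> exists by compactness. Segments are
  unoriented, so \<open>t1\<close> may lie on either side of \<open>t0\<close>.\<close>

lemma first_hitting:
 fixes f :: "real=>real"
 assumes f: "continuous_on {0..1} f" and t: "t0:{0..1}" "t1:{0..1}" and h: "f t0<=rho" "rho<=f t1"
 obtains s where "s:{0..1}" "f s=rho" "!!t. t:closed_segment t0 s==>f t<=rho"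
proof -
 have ivt: "EX s:closed_segment t0 t. f s=rho" if "t:{0..1}" "rho<=f t" for t
 proof -
  have sub: "closed_segment t0 t<={0..1}" using t(1) that(1) by (auto simp: closed_segment_eq_real_ivl split: if_splits)
  have "connected (f ` closed_segment t0 t)"
   by (intro connected_continuous_image continuous_on_subset[OF f sub] connected_segment)
  then have "{f t0..f t}<=f ` closed_segment t0 t" by (intro connected_contains_Icc) auto
  then show ?thesis using h(1) that(2) by (auto simp: subset_iff image_iff)
 qed
 let ?S="{s:{0..1}. f s=rho}"
 have "?S~={}"
 proof -
  obtain s where s: "s:closed_segment t0 t1" "f s=rho" using ivt[OF t(2) h(2)] by blast
  then have "s:?S" using t by (auto simp: closed_segment_eq_real_ivl split: if_splits)
  then show ?thesis by blast
 qed
 moreover have "compact ?S"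
 proof -
  have "closed ?S" using continuous_closed_preimage[OF f closed_atLeastAtMost closed_singleton[of rho]] by (simp add: vimage_def Int_def)
  then show ?thesis using compact_Int_closed[OF compact_Icc, of ?S 0 1] by (simp add: Int_absorb1 Collect_mono_iff subset_iff Int_absorb2)
 qed
 moreover have "continuous_on ?S (%s. \<bar>s - t0\<bar>)" by (intro continuous_intros)
 ultimately obtain s where s: "s:?S" "!!s'. s':?S==>\<bar>s - t0\<bar><=\<bar>s' - t0\<bar>"
  using continuous_attains_inf[of ?S] by blast
 show thesis
 proof (rule that[of s])
  fix u assume u: "u:closed_segment t0 s"
  show "f u<=rho"
  proof (rule ccontr)
   assume "\<not> f u<=rho"
   then have lt: "rho<f u" by simp
   have u01: "u:{0..1}" using u s t by (auto simp: closed_segment_eq_real_ivl split: if_splits)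
   obtain s' where s': "s':closed_segment t0 u" "f s'=rho" using ivt[OF u01] lt by auto
   have "s':?S" using s' u01 t by (auto simp: closed_segment_eq_real_ivl split: if_splits)
   then have "\<bar>s - t0\<bar><=\<bar>s' - t0\<bar>" by (rule s(2))
   then have "u=s" using s'(1) u s'(2) lt by (auto simp: closed_segment_eq_real_ivl split: if_splits)
   then show False using lt s by simp
  qed
 qed (use s in auto)
qed

text \<open>A curve that leaves a small closed chart ball around \<open>m\<close> must reach radius
  \<open>rho / 2\<close>, where the chart speed is at most the Riemannian speed divided by
  \<open>kap\<close>. This costs at least \<open>kap * rho / 2\<close>, twice the bound chosen. Two
  free parameters \<open>t0\<close> and \<open>t1\<close> cover curves starting and curves ending at
  \<open>m\<close>.\<close>

lemma rdist_lower:
 assumes E: "banach_manifold E" and par: "paracompact_space (mtop E)" and g: "riemannian_metric E g"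
  and U: "openin (mtop E) U" "m:U"
 obtains eps where "eps>0" "!!gam (t0::real) t1. piecewise_C1_curve E gam==>curve_length E g gam<ennreal eps ==>
   t0:{0..1}==>t1:{0..1}==>gam t0=m==>gam t1:U"
proof -
 note DE=banach_imp_diff_manifold[OF E]
 let ?T="mtop E"
 have "m:mpoints E" using U openin_subset by blast
 then obtain c where c: "c:atlas E" "m:cdom c" by (rule diff_manifold_cover[OF DE])
 note ch=dm_chart[OF DE c(1)]
 have "openin ?T (cdom c\<inter>U)" "m:cdom c\<inter>U" using chartD(1)[OF ch] U c by auto
 then obtain W where W: "openin ?T W" "m:W" "?T closure_of W<=cdom c\<inter>U" by (rule paracompact_regular[OF par])
 obtain d0 where d0: "d0>0" "!!y. y:cmodel c==>dist y (cmap c m)<d0==>y:cmap c ` (cdom c\<inter>W)"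
  using chart_near[OF ch W(2,1) c(2)] by metis
 obtain k where k: "k>0" "!!v. v:cmodel c==>k * (norm v)\<^sup>2<=g m (tvec E m c v) (tvec E m c v)"
  using metric_chart_coercive[OF g DE c] by blast
 have "k / 2>0" using k by simp
 from metric_chart_cont[OF g DE c this]
 obtain d1 where d1: "d1>0" "!!y v. y:cdom c==>dist (cmap c y) (cmap c m)<d1==>v:cmodel c ==>
   \<bar>g y (tvec E y c v) (tvec E y c v) - g m (tvec E m c v) (tvec E m c v)\<bar><=k / 2 * (norm v)\<^sup>2" by blast
 define rho where "rho=min d0 d1 / 2"
 have rho: "rho>0" "rho<d0" "rho<d1" using d0 d1 by (auto simp: rho_def)
 define kap where "kap=sqrt (k / 2)"
 have kap: "kap>0" using k by (simp add: kap_def)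
 have speed: "kap * norm v<=tnorm g y (tvec E y c v)"
  if "y:cdom c" "dist (cmap c y) (cmap c m)<=rho" "v:cmodel c" for y v
 proof -
  have "k / 2 * (norm v)\<^sup>2<=g y (tvec E y c v) (tvec E y c v)"
  proof -
   have "dist (cmap c y) (cmap c m)<d1" using that(2) rho(3) by simp
   from d1(2)[OF that(1) this that(3)] k(2)[OF that(3)] show ?thesis unfolding abs_le_iff by argo
  qed
  moreover have "sqrt (k / 2 * (norm v)\<^sup>2)=kap * norm v"
   unfolding kap_def real_sqrt_mult[of "k / 2"] by simp
  ultimately show ?thesis using real_sqrt_le_mono unfolding tnorm_def by metis
 qed
 define K where "K={y:cdom c. dist (cmap c y) (cmap c m)<=rho}"
 have KW: "K<=W"
 proof
  fix y assume y: "y:K"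
  then have "cmap c y:cmap c ` (cdom c\<inter>W)" using d0(2)[OF cmap_in_cmodel[OF ch], of y] rho(2) by (auto simp: K_def)
  then show "y:W" using y chartD(5)[OF ch] by (auto simp: K_def inj_on_def)
 qed
 have ccont: "continuous_map (subtopology ?T (cdom c)) euclidean (cmap c)"
  using continuous_map_into_fulltopology[OF continuous_map_cmap[OF ch]] .
 have dcont: "continuous_map (subtopology ?T (cdom c)) euclideanreal (%y. dist (cmap c y) (cmap c m))"
  using continuous_map_compose[OF ccont, of euclideanreal "%z. dist z (cmap c m)"]
  by (simp add: comp_def continuous_on_dist)
 have topc: "topspace (subtopology ?T (cdom c))=cdom c" using chartD(6)[OF ch] by auto
 have clK: "closedin ?T K"
 proof -
  have "closedin (subtopology ?T (cdom c)) {y:topspace (subtopology ?T (cdom c)). dist (cmap c y) (cmap c m):{..rho}}"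
   by (rule closedin_continuous_map_preimage[OF dcont]) simp
  then have "closedin (subtopology ?T (cdom c)) K" unfolding topc K_def by simp
  then obtain S where S: "closedin ?T S" "K=S\<inter>cdom c" unfolding closedin_subtopology by blast
  have "?T closure_of K<=S" using S closure_of_minimal[of K S ?T] by blast
  moreover have "?T closure_of K<=cdom c" using closure_of_mono[OF KW, of ?T] W(3) by blast
  ultimately have "?T closure_of K<=K" using S(2) by blast
  moreover have "K<=mpoints E" using chartD(6)[OF ch] by (auto simp: K_def)
  ultimately show ?thesis using closure_of_subset_eq by blast
 qed
 \<comment> \<open>The chart radius, continued by the constant \<open>rho\<close> outside the ball.
   It is continuous on the whole manifold because \<open>K\<close> is closed there, so first hitting
   applies to curves that may leave the chart.\<close>
 define f where "f=(%y. if y:K then dist (cmap c y) (cmap c m) else rho)"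
 have fc: "continuous_map ?T euclideanreal f"
 proof (rule pasting_lemma[where I=UNIV and T="%b. if b then cdom c else mpoints E - K"
    and f="%b. if b then (%y. min (dist (cmap c y) (cmap c m)) rho) else (%_. rho)"])
  show "openin ?T (if b then cdom c else mpoints E - K)" for b using chartD(1)[OF ch] clK by auto
  show "continuous_map (subtopology ?T (if b then cdom c else mpoints E - K)) euclideanreal
    (if b then (%y. min (dist (cmap c y) (cmap c m)) rho) else (%_. rho))" for b
   using dcont by (cases b) (simp_all add: continuous_map_real_min)
  show "(if b then (%y. min (dist (cmap c y) (cmap c m)) rho) else (%_. rho)) x=(if b' then (%y. min (dist (cmap c y) (cmap c m)) rho) else (%_. rho)) x"
   if "x:mpoints E\<inter>(if b then cdom c else mpoints E - K)\<inter>(if b' then cdom c else mpoints E - K)" for b b' x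
   using that by (auto simp: K_def split: if_splits)
  show "EX j. j:UNIV&x:(if j then cdom c else mpoints E - K) &
    f x=(if j then (%y. min (dist (cmap c y) (cmap c m)) rho) else (%_. rho)) x" if "x:mpoints E" for x
   using that by (intro exI[of _ "x:K"]) (auto simp: f_def K_def)
 qed
 show thesis
 proof (rule that[of "kap * rho / 4"])
  show "kap * rho / 4>0" using kap rho by simp
  fix gam and t0 t1 :: real
  assume gam: "piecewise_C1_curve E gam" and len: "curve_length E g gam<ennreal (kap * rho / 4)"
   and t: "t0:{0..1}" "t1:{0..1}" and m: "gam t0=m"
  have path: "pathin ?T gam" using gam by (simp add: piecewise_C1_curve_def)
  obtain P where P: "finite P" "(cmap c o gam) C1_differentiable_on (({0..1} - P)\<inter>gam -` cdom c)"
   using gam c(1) unfolding piecewise_C1_curve_def by blast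
  have fcont: "continuous_on {0..1} (f o gam)"
   using continuous_map_compose[OF path[unfolded pathin_def] fc] by simp
  have mK: "m:K" using c rho by (simp add: K_def)
  have "gam t1:K"
  proof (rule ccontr)
   assume "gam t1 \<notin> K"
   then have f1: "rho / 2<=(f o gam) t1" using rho by (simp add: f_def)
   have f0: "(f o gam) t0<=rho / 2" using mK m rho by (simp add: f_def)
   obtain s where s: "s:{0..1}" "(f o gam) s=rho / 2" "!!t. t:closed_segment t0 s==>(f o gam) t<=rho / 2"
    using first_hitting[OF fcont t f0 f1] by blast
   define a where "a=min t0 s"
   define b where "b=max t0 s"
   have ab: "a<=b" "{a..b}<={0..1}" "closed_segment t0 s={a..b}"
    using t(1) s(1) by (auto simp: a_def b_def closed_segment_eq_real_ivl)
   have inK: "gam t:K" if "t:{a..b}" for t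
   proof (rule ccontr)
    assume "gam t \<notin> K"
    then show False using s(3)[of t] that ab(3) rho by (simp add: f_def)
   qed
   define w where "w=cmap c o gam"
   have wc: "continuous_on {a..b} w"
   proof -
    have "continuous_map (top_of_set {a..b}) (subtopology ?T (cdom c)) gam"
     unfolding continuous_map_in_subtopology
     using continuous_map_from_subtopology_mono[OF path[unfolded pathin_def] ab(2)] inK by (auto simp: K_def)
    from continuous_map_compose[OF this ccont] show ?thesis by (simp add: w_def)
   qed
   define S where "S={a<..<b} - P"
   have Ssub: "t:{0..1} - P" "0<t" "t<1" "t:{a..b}" "gam t:cdom c" if "t:S" for t
   proof -
    have "0<=a" "b<=1" using t(1) s(1) by (auto simp: a_def b_def)
    then show "t:{0..1} - P" "0<t" "t<1" "t:{a..b}" using that by (auto simp: S_def)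
    then show "gam t:cdom c" using inK by (auto simp: K_def)
   qed
   define w' where "w'=(%t. indicator S t *\<^sub>R vector_derivative w (at t))"
   have wd: "(w has_vector_derivative vector_derivative w (at t)) (at t)" if "t:S" for t
    using P(2) Ssub[OF that] unfolding C1_differentiable_on_eq w_def[symmetric] vector_derivative_works[symmetric] by blast
   have "continuous_on S (%t. vector_derivative w (at t))"
    using P(2) unfolding C1_differentiable_on_eq w_def[symmetric]
    by (elim conjE continuous_on_subset) (use Ssub in blast)
   then have nc: "continuous_on S (%t. kap * norm (vector_derivative w (at t)))" by (intro continuous_intros)
   \<comment> \<open>A measurable minorant of the speed: \<open>kap\<close> times the chart speed,
     zero off the good parameters. It links the lower integral in \<open>curve_length\<close> to the
     fundamental theorem of calculus for the curve in the chart.\<close>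
   define H where "H=(%t. indicator S t *\<^sub>R (kap * norm (vector_derivative w (at t))))"
   have Hm: "H:borel_measurable borel"
    unfolding H_def by (rule borel_measurable_continuous_on_indicator[OF _ nc]) (simp add: S_def P(1) finite_imp_closed borel_closed sets.Diff)
   have H0: "H t>=0" for t using kap by (simp add: H_def)
   have "(\<integral>\<^sup>+t. ennreal (H t) \<partial>lborel)<=curve_length E g gam"
    unfolding curve_length_alt
   proof (rule nn_integral_mono)
    fix t
    show "ennreal (H t)<=ennreal (tnorm g (gam t) (velocity E gam t)) * indicator {0..1} t"
    proof (cases "t:S")
     case True
     note tS=Ssub[OF True]
     obtain e where e: "e>0" "!!y. dist y t<e==>0<y&y<1&gam y:cdom c"
      using pathin_near[OF path tS(2,3) chartD(1)[OF ch] tS(5)] by metis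
     have v: "vector_derivative w (at t):cmodel c" "velocity E gam t=tvec E (gam t) c (vector_derivative w (at t))"
      using velocity_tvec(1,2)[OF DE c(1) tS(5) e(1) _ wd[OF True, unfolded w_def]] e(2) unfolding w_def by blast+
     have "H t<=tnorm g (gam t) (velocity E gam t)"
      unfolding v(2) using speed[OF tS(5) _ v(1)] inK[OF tS(4)] True by (simp add: H_def K_def)
     then show ?thesis using tS by (simp add: ennreal_leI)
    qed (simp add: H_def)
   qed
   also note len
   finally have Hlt: "(\<integral>\<^sup>+t. ennreal (H t) \<partial>lborel)<ennreal (kap * rho / 4)" .
   then have "(\<integral>\<^sup>+t. ennreal (H t) \<partial>lborel)<\<infinity>" using order_less_trans[OF _ ennreal_less_top] by fastforce
   then have Hi: "integrable lborel H" using H0 Hm by (intro integrableI_nonneg) auto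
   have "ennreal (integral\<^sup>L lborel H)<ennreal (kap * rho / 4)"
    using Hlt nn_integral_eq_integral[OF Hi] H0 by simp
   then have I: "integral\<^sup>L lborel H<kap * rho / 4"
    using H0 by (subst (asm) ennreal_less_iff) (auto intro: integral_nonneg_AE)
   have Hint: "(H has_integral integral\<^sup>L lborel H) {a..b}"
   proof -
    have "((%t. if t:{a..b} then H t else 0) has_integral integral\<^sup>L lborel H) UNIV"
    proof (rule has_integral_eq[OF _ has_integral_integral_lborel[OF Hi]])
     show "H t=(if t:{a..b} then H t else 0)" for t by (auto simp: H_def S_def)
    qed
    then show ?thesis by (simp only: has_integral_restrict_UNIV)
   qed
   have "(w' has_integral (w b - w a)) {a..b}"
   proof (rule fundamental_theorem_of_calculus_interior_strong[OF P(1) ab(1) _ wc])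
    show "(w has_vector_derivative w' t) (at t)" if "t:{a<..<b} - P" for t
     using wd[of t] that by (simp add: w'_def S_def)
   qed
   then have wi: "((%t. kap *\<^sub>R w' t) has_integral (kap *\<^sub>R (w b - w a))) {a..b}" by (rule has_integral_cmul)
   have "norm (integral {a..b} (%t. kap *\<^sub>R w' t))<=integral {a..b} H"
   proof (rule Henstock_Kurzweil_Integration.integral_norm_bound_integral)
    show "norm (kap *\<^sub>R w' t)<=H t" for t using kap by (simp add: w'_def H_def indicator_def)
   qed (use wi Hint in \<open>auto simp: integrable_on_def\<close>)
   then have "norm (kap *\<^sub>R (w b - w a))<=integral\<^sup>L lborel H"
    unfolding integral_unique[OF wi] integral_unique[OF Hint] .
   moreover have "norm (w b - w a)=rho / 2"
   proof -
    have "s:{a..b}" by (auto simp: a_def b_def)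
    then have "dist (w s) (w t0)=rho / 2" using inK[of s] s(2) m by (simp add: f_def w_def)
    then show ?thesis by (cases "t0<=s") (auto simp: a_def b_def dist_norm norm_minus_commute)
   qed
   ultimately have "kap * rho / 2<=integral\<^sup>L lborel H" using kap by simp
   moreover have "kap * rho>0" using kap rho by simp
   ultimately show False using I by linarith
  qed
  then have "gam t1:W" using KW by blast
  then show "gam t1:U" using W(1,3) closure_of_subset[OF openin_subset[OF W(1)]] by blast
 qed
qed

section \<open>The metric space structure of fibre products\<close>

text \<open>Truncation at 1 makes infinite distances finite and keeps topology and Cauchy sequences.
  The maximum of both directions makes symmetry immediate, without reversing curves.\<close>

definition mdist :: "('p, 'm::banach) manifold=>('p, 'm) metric=>'p=>'p=>real" where
 "mdist E g x y=enn2real (min 1 (max (rdist E g x y) (rdist E g y x)))"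

lemma mdist_ennreal: "ennreal (mdist E g x y)=min 1 (max (rdist E g x y) (rdist E g y x))"
proof -
 have "min 1 (max (rdist E g x y) (rdist E g y x))<\<infinity>" by (simp add: min_less_iff_disj)
 then show ?thesis by (simp add: mdist_def ennreal_enn2real)
qed

lemma mdist_leI:
 assumes "rdist E g x y<=ennreal b" "rdist E g y x<=ennreal b" "0<=b"
 shows "mdist E g x y<=b"
proof -
 have "ennreal (mdist E g x y)<=ennreal b"
  unfolding mdist_ennreal by (rule min.coboundedI2[OF max.boundedI[OF assms(1,2)]])
 then show ?thesis unfolding ennreal_le_iff[OF assms(3)] .
qed

lemma rdist_less_of_mdist:
 assumes "mdist E g x y<e" "e<=1" shows "rdist E g x y<ennreal e"
proof -
 have "0<=mdist E g x y" by (simp add: mdist_def)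
 then have "min 1 (max (rdist E g x y) (rdist E g y x))<ennreal e"
  unfolding mdist_ennreal[symmetric] using assms by (simp add: ennreal_less_iff)
 moreover have "ennreal e<=1" using assms(2) by (simp add: ennreal_le_1)
 ultimately show ?thesis by (auto simp: min_less_iff_disj max_less_iff_conj)
qed

lemma mdist_commute: "mdist E g x y=mdist E g y x"
 by (simp add: mdist_def max.commute)

lemma mdist_nonneg: "0<=mdist E g x y"
 by (simp add: mdist_def)

lemma min_one_add:
 fixes a b c :: ennreal
 assumes "a<=b + c" shows "min 1 a<=min 1 b + min 1 c"
proof -
 consider "1<=b" | "1<=c" | "b<1" "c<1" by (meson not_le)
 then show ?thesis
 proof cases
  case 1
  have "min 1 a<=1 + 0" by simp
  also have "...<=min 1 b + min 1 c" using 1 by (intro add_mono) auto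
  finally show ?thesis .
 next
  case 2
  have "min 1 a<=0 + 1" by simp
  also have "...<=min 1 b + min 1 c" using 2 by (intro add_mono) auto
  finally show ?thesis .
 next
  case 3
  then have "min 1 b=b" "min 1 c=c" by (simp_all add: min_def)
  then show ?thesis using min.coboundedI2[OF assms] by simp
 qed
qed

lemma mdist_triangle:
 assumes "diff_manifold E" "riemannian_metric E g"
 shows "mdist E g x z<=mdist E g x y + mdist E g y z"
proof -
 let ?D="%x y. max (rdist E g x y) (rdist E g y x)"
 have "?D x z<=?D x y + ?D y z"
 proof (rule max.boundedI)
  show "rdist E g x z<=?D x y + ?D y z"
   using rdist_triangle[OF assms, of x z y] by (rule order_trans) (intro add_mono; simp)
  show "rdist E g z x<=?D x y + ?D y z"
   using rdist_triangle[OF assms, of z x y] by (rule order_trans) (subst add.commute, intro add_mono; simp)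
 qed
 then have "min 1 (?D x z)<=min 1 (?D x y) + min 1 (?D y z)"
  by (rule min_one_add)
 then have "ennreal (mdist E g x z)<=ennreal (mdist E g x y + mdist E g y z)"
  by (simp add: mdist_ennreal mdist_nonneg)
 then show ?thesis unfolding ennreal_le_iff[OF add_nonneg_nonneg[OF mdist_nonneg mdist_nonneg]] .
qed

lemma mdist_upper:
 assumes E: "banach_manifold E" and g: "riemannian_metric E g" and c: "c:atlas E" "m:cdom c"
 obtains d where "d>0" "!!v. v:cmodel c==>dist v (cmap c m)<d==>v:cmap c ` cdom c"
  "!!x y. x:cdom c==>y:cdom c==>dist (cmap c x) (cmap c m)<d==>dist (cmap c y) (cmap c m)<d ==>
   mdist E g x y<=2 * tnorm g m (tvec E m c (cmap c x - cmap c y))"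
proof -
 note DE=banach_imp_diff_manifold[OF E]
 note ch=dm_chart[OF DE c(1)]
 obtain d where d: "d>0" "!!v. v:cmodel c==>dist v (cmap c m)<d==>v:cmap c ` cdom c"
  "!!x y. x:cdom c==>y:cdom c==>dist (cmap c x) (cmap c m)<d==>dist (cmap c y) (cmap c m)<d ==>
   rdist E g x y<=ennreal (2 * tnorm g m (tvec E m c (cmap c y - cmap c x)))" by (fact rdist_upper[OF E g c])
 show thesis
 proof (rule that[OF d(1,2)])
  fix x y assume xy: "x:cdom c" "y:cdom c" "dist (cmap c x) (cmap c m)<d" "dist (cmap c y) (cmap c m)<d"
  define v where "v=cmap c x - cmap c y"
  have v: "v:cmodel c" unfolding v_def using cmap_in_cmodel[OF ch] xy(1,2) chartD(2)[OF ch] by (simp add: subspace_diff)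
  have "tnorm g m (tvec E m c (cmap c y - cmap c x))=tnorm g m (tvec E m c v)"
   using tnorm_scale[OF g DE c v, of "-1"] by (simp add: v_def)
  moreover obtain k where "k>0" "k * (norm v)\<^sup>2<=g m (tvec E m c v) (tvec E m c v)"
   using metric_chart_coercive[OF g DE c] v by blast
  then have "0<=tnorm g m (tvec E m c v)" unfolding tnorm_def by (meson mult_nonneg_nonneg less_imp_le order_trans real_sqrt_ge_zero zero_le_power2)
  ultimately show "mdist E g x y<=2 * tnorm g m (tvec E m c (cmap c x - cmap c y))"
   using d(3)[OF xy] d(3)[OF xy(2,1,4,3)] unfolding v_def by (intro mdist_leI) auto
 qed
qed

lemma mdist_self:
 assumes E: "banach_manifold E" and g: "riemannian_metric E g" and x: "x:mpoints E"
 shows "mdist E g x x=0"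
proof -
 note DE=banach_imp_diff_manifold[OF E]
 obtain c where c: "c:atlas E" "x:cdom c" using diff_manifold_cover[OF DE x] by blast
 note ch=dm_chart[OF DE c(1)]
 obtain d where d: "d>0" "!!v. v:cmodel c==>dist v (cmap c x)<d==>v:cmap c ` cdom c"
  "!!y z. y:cdom c==>z:cdom c==>dist (cmap c y) (cmap c x)<d==>dist (cmap c z) (cmap c x)<d ==>
   mdist E g y z<=2 * tnorm g x (tvec E x c (cmap c y - cmap c z))" by (fact mdist_upper[OF E g c])
 have "tnorm g x (tvec E x c (0 *\<^sub>R 0))=0"
  by (subst tnorm_scale[OF g DE c subspace_0[OF chartD(2)[OF ch]]]) simp
 then have "mdist E g x x<=0" using d(3)[OF c(2,2)] d(1) by simp
 then show ?thesis using mdist_nonneg[of E g x x] by simp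
qed

lemma mdist_lower:
 assumes E: "banach_manifold E" and par: "paracompact_space (mtop E)" and g: "riemannian_metric E g"
  and U: "openin (mtop E) U" "m:U"
 obtains eps where "eps>0" "!!y. rdist E g m y<ennreal eps \<or> rdist E g y m<ennreal eps==>y:U"
proof -
 obtain eps where eps: "eps>0" "!!gam (t0::real) t1. piecewise_C1_curve E gam==>curve_length E g gam<ennreal eps ==>
   t0:{0..1}==>t1:{0..1}==>gam t0=m==>gam t1:U" by (fact rdist_lower[OF E par g U])
 show thesis
 proof (rule that[OF eps(1)])
  fix y assume "rdist E g m y<ennreal eps \<or> rdist E g y m<ennreal eps"
  then obtain gam where "piecewise_C1_curve E gam" "curve_length E g gam<ennreal eps" "gam 0=m&gam 1=y \<or> gam 0=y&gam 1=m"
   unfolding rdist_def INF_less_iff by blast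
  then show "y:U" using eps(2)[of gam 0 1] eps(2)[of gam 1 0] by auto
 qed
qed

text \<open>Small chart balls lie in metric balls by the segment estimate, and metric balls lie in
  prescribed neighbourhoods by the crossing estimate; the latter, with the Hausdorff property, also
  makes the distance of distinct points positive.\<close>

theorem mdist_metric_space:
 assumes E: "banach_manifold E" and par: "paracompact_space (mtop E)" and g: "riemannian_metric E g"
 shows "Metric_space (mpoints E) (mdist E g)" and "Metric_space.mtopology (mpoints E) (mdist E g)=mtop E"
proof -
 note DE=banach_imp_diff_manifold[OF E]
 have H: "Hausdorff_space (mtop E)" using E by (simp add: banach_manifold_def)
 show M: "Metric_space (mpoints E) (mdist E g)"
 proof
  show "0<=mdist E g x y" "mdist E g x y=mdist E g y x" for x y by (rule mdist_nonneg mdist_commute)+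
  show "mdist E g x z<=mdist E g x y + mdist E g y z" for x y z by (rule mdist_triangle[OF DE g])
  fix x y assume xy: "x:mpoints E" "y:mpoints E"
  show "mdist E g x y=0\<longleftrightarrow>x=y"
  proof
   assume 0: "mdist E g x y=0"
   show "x=y"
   proof (rule ccontr)
    assume "x~=y"
    then obtain U V where U: "openin (mtop E) U" "x:U" "y:V" "disjnt U V" using H xy unfolding Hausdorff_space_def by blast
    obtain eps where eps: "eps>0" "!!y. rdist E g x y<ennreal eps \<or> rdist E g y x<ennreal eps==>y:U"
     by (fact mdist_lower[OF E par g U(1,2)])
    have "rdist E g x y<ennreal (min eps 1)" by (rule rdist_less_of_mdist) (use 0 eps in auto)
    also have "...<=ennreal eps" by (intro ennreal_leI) simp
    finally show False using eps(2)[of y] U by (auto simp: disjnt_def)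
   qed
  qed (use mdist_self[OF E g] xy in simp)
 qed
 interpret Metric_space "mpoints E" "mdist E g" by (rule M)
 show "mtopology=mtop E"
  unfolding topology_eq
 proof (intro allI iffI)
  fix U assume U: "openin mtopology U"
  show "openin (mtop E) U"
  proof (subst openin_subopen, intro ballI)
   fix x assume x: "x:U"
   then obtain r where r: "r>0" "mball x r<=U" using U unfolding openin_mtopology by blast
   have xE: "x:mpoints E" using U x unfolding openin_mtopology by blast
   obtain c where c: "c:atlas E" "x:cdom c" using diff_manifold_cover[OF DE xE] by blast
   note ch=dm_chart[OF DE c(1)]
   obtain d where d: "d>0" "!!v. v:cmodel c==>dist v (cmap c x)<d==>v:cmap c ` cdom c"
    "!!y z. y:cdom c==>z:cdom c==>dist (cmap c y) (cmap c x)<d==>dist (cmap c z) (cmap c x)<d ==>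
     mdist E g y z<=2 * tnorm g x (tvec E x c (cmap c y - cmap c z))" by (fact mdist_upper[OF E g c])
   obtain b where b: "b>0" "!!v w. v:cmodel c==>w:cmodel c==>\<bar>g x (tvec E x c v) (tvec E x c w)\<bar><=b * norm v * norm w"
    using metric_chart_bound[OF g DE c] by blast
   define dlt where "dlt=min d (r / (2 * sqrt b))"
   have dlt: "dlt>0" using d r b by (simp add: dlt_def)
   let ?S="{v:cmodel c. dist v (cmap c x)<dlt}"
   have Sc: "?S<=cmap c ` cdom c" using d(2) by (auto simp: dlt_def)
   have "openin (top_of_set (cmodel c)) ?S"
    using openin_open_Int[OF open_ball[of "cmap c x" dlt], of "cmodel c"] by (simp add: Int_def dist_commute ball_def)
   then have o: "openin (mtop E) (cinv c ` ?S)" by (rule openin_cinv_image[OF ch _ Sc])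
   moreover have "x:cinv c ` ?S"
    using cinv_cmap[OF ch c(2)] cmap_in_cmodel[OF ch c(2)] dlt by (intro image_eqI[of _ _ "cmap c x"]) auto
   moreover have "cinv c ` ?S<=U"
   proof (rule subsetI, erule imageE)
    fix y v assume y: "y=cinv c v" and v: "v:?S"
    have vc: "v:cmap c ` cdom c" using Sc v by blast
    have yc: "y:cdom c" "cmap c y=v" unfolding y by (rule cinv_in[OF vc], rule cmap_cinv[OF vc])
    have w: "cmap c x - cmap c y:cmodel c" using chartD(2)[OF ch] cmap_in_cmodel[OF ch] c(2) yc(1) by (simp add: subspace_diff)
    have dv: "dist v (cmap c x)<dlt" using v by simp
    have "mdist E g x y<=2 * tnorm g x (tvec E x c (cmap c x - cmap c y))"
     using d(1) dv yc c(2) by (intro d(3)) (auto simp: dlt_def)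
    also have "...<=2 * (sqrt b * norm (cmap c x - cmap c y))"
    proof -
     have "g x (tvec E x c (cmap c x - cmap c y)) (tvec E x c (cmap c x - cmap c y))<=b * (norm (cmap c x - cmap c y))\<^sup>2"
      using b(2)[OF w w] by (simp add: power2_eq_square mult.assoc)
     from real_sqrt_le_mono[OF this] show ?thesis by (simp add: tnorm_def real_sqrt_mult)
    qed
    also have "...<r"
    proof -
     have "norm (cmap c x - cmap c y)<r / (2 * sqrt b)" using dv yc(2) by (simp add: dlt_def dist_norm norm_minus_commute)
     then show ?thesis using b(1) by (simp add: field_simps)
    qed
    finally have "y:mball x r" using xE yc(1) chartD(6)[OF ch] by auto
    then show "y:U" using r by blast
   qed
   ultimately show "EX T. openin (mtop E) T&x:T&T<=U" by blast
  qed
 next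
  fix U assume U: "openin (mtop E) U"
  show "openin mtopology U"
   unfolding openin_mtopology
  proof (intro conjI allI impI)
   show "U<=mpoints E" using U by (rule openin_subset)
   fix x assume x: "x:U"
   obtain eps where eps: "eps>0" "!!y. rdist E g x y<ennreal eps \<or> rdist E g y x<ennreal eps==>y:U"
    by (fact mdist_lower[OF E par g U x])
   show "EX r>0. mball x r<=U"
   proof (intro exI[of _ "min eps 1"] conjI subsetI)
    fix y assume "y:mball x (min eps 1)"
    then have "rdist E g x y<ennreal (min eps 1)" by (intro rdist_less_of_mdist) auto
    also have "...<=ennreal eps" by (intro ennreal_leI) simp
    finally show "y:U" using eps(2) by blast
   qed (use eps in simp)
  qed
 qed
qed

theorem mdist_mcomplete:
 assumes E: "banach_manifold E" and par: "paracompact_space (mtop E)" and g: "riemannian_metric E g"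
  and c: "complete_metric E g"
 shows "Metric_space.mcomplete (mpoints E) (mdist E g)"
proof -
 interpret Metric_space "mpoints E" "mdist E g" by (rule mdist_metric_space[OF E par g])
 note top=mdist_metric_space(2)[OF E par g]
 show ?thesis
  unfolding mcomplete_def
 proof (intro allI impI)
  fix s assume s: "MCauchy s"
  have "EX n0. ALL i>=n0. ALL j>=n0. rdist E g (s i) (s j)<e" if e: "e>0" for e
  proof -
   have "EX e'>0. ennreal e'<=e"
   proof (cases e)
    case (real q)
    then show ?thesis using e by (intro exI[of _ q]) auto
   next
    case top
    then show ?thesis by (intro exI[of _ 1]) simp
   qed
   then obtain e' where e': "e'>0" "ennreal e'<=e" by blast
   \<comment> \<open>Below 1 the truncation is invisible, so a bound for \<open>mdist\<close> is one
     for \<open>rdist\<close>.\<close>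
   then have "min e' 1>0" by simp
   then obtain n0 where n0: "!!i j. n0<=i==>n0<=j==>mdist E g (s i) (s j)<min e' 1"
    using s unfolding MCauchy_def by blast
   have "rdist E g (s i) (s j)<e" if "n0<=i" "n0<=j" for i j
   proof -
    have "rdist E g (s i) (s j)<ennreal (min e' 1)" by (rule rdist_less_of_mdist[OF n0[OF that]]) simp
    also have "...<=ennreal e'" by (intro ennreal_leI) simp
    also note e'(2)
    finally show ?thesis .
   qed
   then show ?thesis by blast
  qed
  moreover have "range s<=mpoints E" using s by (simp add: MCauchy_def)
  ultimately obtain l where l: "l:mpoints E" "(%i. rdist E g (s i) l) \<longlonglongrightarrow> 0"
   using c unfolding complete_metric_def by blast
  have "limitin (mtop E) s l sequentially"
   unfolding limitin_def
  proof (intro conjI allI impI l(1))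
   fix U assume U: "openin (mtop E) U&l:U"
   obtain eps where eps: "eps>0" "!!y. rdist E g l y<ennreal eps \<or> rdist E g y l<ennreal eps==>y:U"
    by (fact mdist_lower[OF E par g conjunct1[OF U] conjunct2[OF U]])
   have "\<forall>\<^sub>F i in sequentially. rdist E g (s i) l<ennreal eps"
    using order_tendstoD(2)[OF l(2), of "ennreal eps"] eps(1) by simp
   then show "\<forall>\<^sub>F i in sequentially. s i:U" by (rule eventually_mono) (use eps(2) in blast)
  qed
  then show "EX x. limitin mtopology s x sequentially" using top by auto
 qed
qed

definition sum_dist :: "nat=>('a=>'a=>real)=>(nat=>'a)=>(nat=>'a)=>real" where
 "sum_dist r d u w=(\<Sum>i<r. d (u i) (w i))"

lemma sum_dist_coord: "(!!x y. 0<=d x y)==>i<r==>d (u i) (w i)<=sum_dist r d u w"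
 unfolding sum_dist_def by (rule member_le_sum[of i "{..<r}" "%i. d (u i) (w i)"]) auto

section \<open>The sum metric on subsets of finite powers\<close>

context Metric_space
begin

lemma Metric_space_sum:
 assumes F: "F<=(\<Pi>\<^sub>E i\<in>{..<r}. M)"
 shows "Metric_space F (sum_dist r d)"
proof
 show "0<=sum_dist r d x y" for x y by (simp add: sum_dist_def sum_nonneg)
 show "sum_dist r d x y=sum_dist r d y x" for x y unfolding sum_dist_def using commute by (intro sum.cong) auto
 have mem: "u i:M" if "u:F" "i<r" for u i using F that by (auto simp: PiE_iff subset_iff)
 show "sum_dist r d x y=0\<longleftrightarrow>x=y" if "x:F" "y:F" for x y
 proof
  assume "sum_dist r d x y=0"
  then have "ALL i:{..<r}. d (x i) (y i)=0" unfolding sum_dist_def by (subst (asm) sum_nonneg_eq_0_iff) auto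
  then have "x i=y i" if i: "i<r" for i
   using zero[OF mem[OF \<open>x:F\<close> i] mem[OF \<open>y:F\<close> i]] i by blast
  then show "x=y" using F that by (intro PiE_ext[of x "{..<r}" "%_. M" y]) auto
 next
  assume "x=y"
  then show "sum_dist r d x y=0" using mem[OF that(2)] by (simp add: sum_dist_def)
 qed
 show "sum_dist r d x z<=sum_dist r d x y + sum_dist r d y z" if "x:F" "y:F" "z:F" for x y z
  unfolding sum_dist_def sum.distrib[symmetric] using mem that by (intro sum_mono triangle) auto
qed

lemma mtopology_sum:
 assumes F: "F<=(\<Pi>\<^sub>E i\<in>{..<r}. M)"
 shows "Metric_space.mtopology F (sum_dist r d)=subtopology (product_topology (%_. mtopology) {..<r}) F"
proof -
 interpret P: Metric_space F "sum_dist r d" by (rule Metric_space_sum[OF F])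
 let ?T="product_topology (%_. mtopology) {..<r}"
 have mem: "u i:M" if "u:F" "i<r" for u i using F that by (auto simp: PiE_iff subset_iff)
 have ext: "u:extensional {..<r}" if "u:F" for u using F that by (auto simp: PiE_iff subset_iff)
 show ?thesis
  unfolding topology_eq
 proof (intro allI iffI)
  fix U assume U: "openin P.mtopology U"
  show "openin (subtopology ?T F) U"
  proof (subst openin_subopen, intro ballI)
   fix u assume u: "u:U"
   obtain e where e: "e>0" "P.mball u e<=U" using U u unfolding P.openin_mtopology by blast
   have uF: "u:F" using U u unfolding P.openin_mtopology by blast
   \<comment> \<open>Dividing by \<open>real r + 1\<close> rather than \<open>real r\<close> keeps
     the sum of the radii strictly below \<open>e\<close> and covers \<open>r = 0\<close>.\<close>
   define N where "N=(\<Pi>\<^sub>E i\<in>{..<r}. mball (u i) (e / (real r + 1)))"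
   have "openin (subtopology ?T F) (F\<inter>N)"
    unfolding N_def by (intro openin_subtopology_Int2) (auto simp: openin_PiE)
   moreover have "u:F\<inter>N" using uF e mem[OF uF] ext[OF uF] by (auto simp: N_def PiE_iff)
   moreover have "F\<inter>N<=U"
   proof
    fix w assume w: "w:F\<inter>N"
    have "sum_dist r d u w<=(\<Sum>i<r. e / (real r + 1))"
     unfolding sum_dist_def using w by (intro sum_mono) (auto simp: N_def PiE_iff less_imp_le)
    also have "...<e" using e by (simp add: field_simps)
    finally show "w:U" using e(2) uF w by auto
   qed
   ultimately show "EX T. openin (subtopology ?T F) T&u:T&T<=U" by blast
  qed
 next
  fix U assume "openin (subtopology ?T F) U"
  then obtain V where V: "openin ?T V" "U=V\<inter>F" unfolding openin_subtopology by blast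
  show "openin P.mtopology U"
   unfolding P.openin_mtopology
  proof (intro conjI allI impI)
   show "U<=F" using V by blast
   fix u assume u: "u:U"
   have "u:V" using u V(2) by blast
   from bspec[OF V(1)[unfolded openin_product_topology_alt] this]
   obtain X where X0: "ALL i:{..<r}. openin mtopology (X i)" and X1: "u:PiE {..<r} X" "PiE {..<r} X<=V"
    by (elim exE conjE)
   have X: "!!i. i<r==>openin mtopology (X i)" "u:PiE {..<r} X" "PiE {..<r} X<=V" using X0 X1 by simp_all
   have "EX e>0. mball (u i) e<=X i" if "i<r" for i
    using X(1)[OF that] X(2) that unfolding openin_mtopology by (auto simp: PiE_iff)
   then obtain eps where eps: "!!i. i<r==>eps i>0" "!!i. i<r==>mball (u i) (eps i)<=X i" by metis
   define e where "e=Min (insert 1 (eps ` {..<r}))"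
   have e: "e>0" "!!i. i<r==>e<=eps i" using eps(1) by (auto simp: e_def)
   show "EX e>0. P.mball u e<=U"
   proof (intro exI[of _ e] conjI subsetI e(1))
    fix w assume w: "w:P.mball u e"
    have "w i:X i" if i: "i<r" for i
    proof -
     have "d (u i) (w i)<=sum_dist r d u w" by (rule sum_dist_coord) (use i in auto)
     also have "...<eps i" using w e(2)[OF i] by auto
     finally show ?thesis using eps(2)[OF i] mem[of u i] mem[of w i] w i by auto
    qed
    then have "w:PiE {..<r} X" using ext[of w] w by (auto simp: PiE_iff)
    then show "w:U" using X(3) V(2) w by auto
   qed
  qed
 qed
qed

lemma mcomplete_sum:
 assumes F: "F<=(\<Pi>\<^sub>E i\<in>{..<r}. M)" and c: mcomplete
  and closed: "!!s l. range s<=F==>l:(\<Pi>\<^sub>E i\<in>{..<r}. M) ==>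
   (!!i. i<r==>limitin mtopology (%n. s n i) (l i) sequentially)==>l:F"
 shows "Metric_space.mcomplete F (sum_dist r d)"
proof -
 interpret P: Metric_space F "sum_dist r d" by (rule Metric_space_sum[OF F])
 have mem: "u i:M" if "u:F" "i<r" for u i using F that by (auto simp: PiE_iff subset_iff)
 show ?thesis
  unfolding P.mcomplete_def
 proof (intro allI impI)
  fix s assume s: "P.MCauchy s"
  have sF: "range s<=F" using s by (simp add: P.MCauchy_def)
  have "EX x. limitin mtopology (%n. s n i) x sequentially" if i: "i<r" for i
  proof -
   have "MCauchy (%n. s n i)"
    unfolding MCauchy_def
   proof (intro conjI allI impI)
    show "range (%n. s n i)<=M" using mem sF i by blast
    fix e :: real assume "e>0"
    then obtain N where N: "!!n n'. N<=n==>N<=n'==>sum_dist r d (s n) (s n')<e" using s unfolding P.MCauchy_def by blast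
    have "d (s n i) (s n' i)<e" if "N<=n" "N<=n'" for n n'
     using order_le_less_trans[OF sum_dist_coord[of d i r "s n" "s n'"] N[OF that]] i by simp
    then show "EX N. ALL n n'. N<=n-->N<=n'-->d (s n i) (s n' i)<e" by blast
   qed
   then show ?thesis using c by (simp add: mcomplete_def)
  qed
  then obtain l0 where l0: "!!i. i<r==>limitin mtopology (%n. s n i) (l0 i) sequentially" by metis
  define l where "l=restrict l0 {..<r}"
  have lim: "limitin mtopology (%n. s n i) (l i) sequentially" if "i<r" for i using l0[OF that] that by (simp add: l_def)
  have lM: "l:(\<Pi>\<^sub>E i\<in>{..<r}. M)" 
  proof -
   have "l0 i:M" if "i<r" for i using limitin_topspace[OF l0[OF that]] by simp
   then show ?thesis by (simp add: l_def PiE_iff)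
  qed
  have lF: "l:F" using closed[OF sF lM lim] .
  have "limitin P.mtopology s l sequentially"
   unfolding P.limitin_metric
  proof (intro conjI allI impI lF)
   fix e :: real assume e: "e>0"
   have "\<forall>\<^sub>F n in sequentially. ALL i:{..<r}. d (s n i) (l i)<e / (real r + 1)"
   proof (rule eventually_ball_finite, simp, intro ballI)
    fix i assume "i:{..<r}"
    then show "\<forall>\<^sub>F n in sequentially. d (s n i) (l i)<e / (real r + 1)"
     using lim[of i] e unfolding limitin_metric by (auto elim!: allE[of _ "e / (real r + 1)"] eventually_mono)
   qed
   then show "\<forall>\<^sub>F n in sequentially. s n:F&sum_dist r d (s n) l<e"
   proof (rule eventually_mono)
    fix n assume n: "ALL i:{..<r}. d (s n i) (l i)<e / (real r + 1)"
    have "sum_dist r d (s n) l<=(\<Sum>i<r. e / (real r + 1))" unfolding sum_dist_def using n by (intro sum_mono) (auto simp: less_imp_le)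
    also have "...<e" using e by (simp add: field_simps)
    finally show "s n:F&sum_dist r d (s n) l<e" using sF by blast
   qed
  qed
  then show "EX x. limitin P.mtopology s x sequentially" by blast
 qed
qed

end

text \<open>Completeness holds because the fibre product is closed under coordinatewise limits:
  \<open>p\<close> is continuous and limits in the Hausdorff base are unique.\<close>

theorem fiber_product_metric_space:
 fixes E :: "('e, 'm::banach) manifold" and p :: "'e=>'x" and r :: nat
 assumes E: "banach_manifold E" and par: "paracompact_space (mtop E)" and g: "riemannian_metric E g"
  and c: "complete_metric E g" and X: "Hausdorff_space TX" and p: "continuous_map (mtop E) TX p"
 defines "F \<equiv> fiber_product r (mtop E) p" and "D \<equiv> sum_dist r (mdist E g)"
 shows "Metric_space F D" "Metric_space.mtopology F D=fiber_product_topology r (mtop E) p" "Metric_space.mcomplete F D"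
proof -
 interpret M: Metric_space "mpoints E" "mdist E g" by (rule mdist_metric_space[OF E par g])
 have top: "M.mtopology=mtop E" by (rule mdist_metric_space(2)[OF E par g])
 have FM: "F<=(\<Pi>\<^sub>E i\<in>{..<r}. mpoints E)" unfolding F_def fiber_product_def by blast
 show "Metric_space F D" unfolding D_def by (rule M.Metric_space_sum[OF FM])
 show "Metric_space.mtopology F D=fiber_product_topology r (mtop E) p"
  unfolding D_def M.mtopology_sum[OF FM] top unfolding fiber_product_topology_def F_def ..
 show "Metric_space.mcomplete F D"
  unfolding D_def
 proof (rule M.mcomplete_sum[OF FM mdist_mcomplete[OF E par g c]])
  fix s l assume s: "range s<=F" and l: "l:(\<Pi>\<^sub>E i\<in>{..<r}. mpoints E)"
   and lim: "!!i. i<r==>limitin M.mtopology (%n. s n i) (l i) sequentially"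
  have plim: "limitin TX (%n. p (s n i)) (p (l i)) sequentially" if "i<r" for i
   using continuous_map_limit[OF p lim[OF that, unfolded top]] by (simp add: comp_def)
  have eq: "p (s n i)=p (s n j)" if "i<r" "j<r" for n i j
  proof -
   have "s n:F" using s by blast
   then show ?thesis unfolding F_def fiber_product_def using that by blast
  qed
  have "p (l i)=p (l j)" if "i<r" "j<r" for i j
  proof -
   have "(%n. p (s n i))=(%n. p (s n j))" using eq[OF that] by blast
   then show ?thesis using limitin_Hausdorff_unique[OF plim[OF that(1)] _ _ X] plim[OF that(2)] by simp
  qed
  then show "l:F" using l unfolding F_def fiber_product_def by blast
 qed
qed

section \<open>The gradient in coordinates\<close>

text \<open>The representing vector minimises the energy \<open>B v v / 2 - L v\<close> on
  \<open>V\<close>. Coercivity bounds the energy below and, through the parallelogram identity,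
  makes minimising sequences Cauchy.\<close>

lemma riesz_on:
 fixes V :: "'m::banach set" and B :: "'m=>'m=>real"
 assumes V: "subspace V" "closed V" and L: "blinear_on V L"
  and lin: "!!a u v w. u:V==>v:V==>w:V==>B (a *\<^sub>R u + v) w=a * B u w + B v w"
  and sym: "!!v w. v:V==>w:V==>B v w=B w v"
  and bd: "!!v w. v:V==>w:V==>\<bar>B v w\<bar><=b * norm v * norm w"
  and k: "k>0" "!!v. v:V==>k * (norm v)\<^sup>2<=B v v"
 shows "EX x:V. ALL w:V. B x w=L w"
proof -
 define J where "J=(%v. B v v / 2 - L v)"
 have comb: "a *\<^sub>R u + v:V" if "u:V" "v:V" for a u v using V(1) that by (simp add: subspace_add subspace_scale)
 have lin2: "B w (a *\<^sub>R u + v)=a * B w u + B w v" if "u:V" "v:V" "w:V" for a u v w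
  using lin[OF that, of a] sym comb that by simp
 have Bexp: "B (a *\<^sub>R u + v) (a *\<^sub>R u + v)=a\<^sup>2 * B u u + 2 * a * B u v + B v v" if "u:V" "v:V" for a u v
  using lin[OF that comb[OF that], of a a] lin2[OF that that(1)] lin2[OF that that(2)] sym[OF that]
  by (simp add: algebra_simps power2_eq_square)
 have Lexp: "L (a *\<^sub>R u + v)=a * L u + L v" if "u:V" "v:V" for a u v
  using blinear_on_add[OF L subspace_scale[OF V(1) that(1)] that(2)] blinear_on_scale[OF L that(1)] by simp
 obtain M where M: "M>0" "!!v. v:V==>norm (L v)<=M * norm v" by (fact blinear_on_bound[OF L])
 have lower: "- (M\<^sup>2 / (2 * k))<=J v" if "v:V" for v
 proof -
  have "L v<=M * norm v" using M(2)[OF that] by simp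
  moreover have "0<=(k * norm v - M)\<^sup>2 / (2 * k)" using k by simp
  then have "M * norm v<=k * (norm v)\<^sup>2 / 2 + M\<^sup>2 / (2 * k)" using k(1) by (simp add: field_simps power2_eq_square)
  ultimately show ?thesis using k(2)[OF that] unfolding J_def by linarith
 qed
 have bb: "bdd_below (J ` V)" using lower by (intro bdd_belowI2)
 have ne: "J ` V~={}" using V(1) subspace_0 by blast
 define m where "m=Inf (J ` V)"
 have mle: "m<=J v" if "v:V" for v unfolding m_def using bb that by (intro cInf_lower) auto
 have "EX x:V. J x<m + 1 / real (Suc n)" for n
  using cInf_lessD[OF ne, of "m + 1 / real (Suc n)"] by (auto simp: m_def)
 then obtain x where x: "!!n. x n:V" "!!n. J (x n)<m + 1 / real (Suc n)" by metis
 \<comment> \<open>The energy of the midpoint of \<open>u\<close> and \<open>v\<close> is at least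
   the infimum \<open>m\<close>; expanding it leaves an eighth of \<open>B (u - v) (u - v)\<close>
   under control.\<close>
 have par: "k / 4 * (norm (u - v))\<^sup>2<=J u + J v - 2 * m" if uv: "u:V" "v:V" for u v
 proof -
  have h: "(1/2) *\<^sub>R u:V" "(1/2) *\<^sub>R v:V" "- v:V" using V(1) uv by (simp_all add: subspace_scale subspace_neg)
  have mid: "(1/2) *\<^sub>R u + (1/2) *\<^sub>R v:V" using comb uv(1) h(2) by blast
  have z: "0:V" "B 0 w=0" if "w:V" for w using V(1) lin[of 0 0 w 1] that by (simp_all add: subspace_0)
  have s: "B ((1/2) *\<^sub>R v) ((1/2) *\<^sub>R v)=B v v / 4" "B u ((1/2) *\<^sub>R v)=B u v / 2" "L ((1/2) *\<^sub>R v)=L v / 2"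
   using Bexp[OF uv(2) z(1)[OF uv(1)], of "1/2"] z(2) sym[OF uv(2) z(1)[OF uv(1)]] uv lin2[OF uv(2) z(1)[OF uv(1)] uv(1), of "1/2"] sym[OF uv(1) z(1)[OF uv(1)]]
    z(1)[OF uv(1)] blinear_on_scale[OF L uv(2), of "1/2"]
   by (simp_all add: power2_eq_square)
  have "m<=J ((1/2) *\<^sub>R u + (1/2) *\<^sub>R v)" by (rule mle[OF mid])
  also have "...=B u u / 8 + B u v / 4 + B v v / 8 - L u / 2 - L v / 2"
   unfolding J_def Bexp[OF uv(1) h(2)] Lexp[OF uv(1) h(2)] s by (simp add: power2_eq_square)
  finally have "8 * m<=4 * J u + 4 * J v - B u u + 2 * B u v - B v v" by (simp add: J_def field_simps)
  moreover have "B (u - v) (u - v)=B u u - 2 * B u v + B v v"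
   using Bexp[OF uv(2,1), of "-1"] sym[OF uv] by simp
  ultimately have *: "B (u - v) (u - v)<=4 * J u + 4 * J v - 8 * m" by linarith
  have "u - v:V" using V(1) uv by (simp add: subspace_diff)
  then have "k * (norm (u - v))\<^sup>2<=4 * J u + 4 * J v - 8 * m" using k(2)[of "u - v"] * by linarith
  then show ?thesis by simp
 qed
 have "Cauchy x"
  unfolding Cauchy_altdef2
 proof (intro allI impI)
  fix e :: real assume e: "e>0"
  then have "k * e\<^sup>2 / 8>0" using k by simp
  then obtain N where N: "1 / real (Suc N)<k * e\<^sup>2 / 8" using nat_approx_posE by blast
  have "dist (x n) (x N)<e" if "N<=n" for n
  proof -
   have "1 / real (Suc n)<=1 / real (Suc N)" using that by (simp add: frac_le)
   then have "J (x n) + J (x N) - 2 * m<k / 4 * e\<^sup>2" using x(2)[of n] x(2)[of N] N by linarith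
   then have "k / 4 * (norm (x n - x N))\<^sup>2<k / 4 * e\<^sup>2" using par[OF x(1) x(1), of n N] by linarith
   then have "(norm (x n - x N))\<^sup>2<e\<^sup>2" using k(1) by simp
   then show ?thesis using e by (simp add: dist_norm power_less_imp_less_base less_imp_le)
  qed
  then show "EX N. ALL n>=N. dist (x n) (x N)<e" by blast
 qed
 then obtain l where l: "x \<longlonglongrightarrow> l" by (auto simp: Cauchy_convergent_iff convergent_def)
 have lV: "l:V" using closed_sequentially[OF V(2) _ l] x(1) by blast
 show ?thesis
 proof (intro bexI[OF _ lV] ballI)
  fix w assume w: "w:V"
  define q where "q=B l w - L w"
  have ww: "0<=B w w" using k w by (meson mult_nonneg_nonneg less_imp_le order_trans zero_le_power2)
  have Bl: "(%n. B (x n) w) \<longlonglongrightarrow> B l w"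
  proof (rule Lim_null_comparison[THEN LIM_zero_cancel])
   show "\<forall>\<^sub>F n in sequentially. norm (B (x n) w - B l w)<=b * norm (x n - l) * norm w"
   proof (rule always_eventually, rule allI)
    fix n
    have "B (x n - l) w=B (x n) w - B l w" using lin[OF lV x(1) w, of "-1" n] by simp
    then show "norm (B (x n) w - B l w)<=b * norm (x n - l) * norm w"
     using bd[OF subspace_diff[OF V(1) x(1) lV] w, of n] by simp
   qed
   show "(%n. b * norm (x n - l) * norm w) \<longlonglongrightarrow> 0"
    using tendsto_mult_left_zero[OF tendsto_mult_right_zero[OF tendsto_norm_zero[OF LIM_zero[OF l]]]] .
  qed
  have ineq: "0<=t * q + t\<^sup>2 * B w w / 2" for t
  proof -
   have "- 1 / real (Suc n)<=t * (B (x n) w - L w) + t\<^sup>2 * B w w / 2" for n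
   proof -
    have "m<=J (t *\<^sub>R w + x n)" by (rule mle[OF comb[OF w x(1)]])
    also have "...=J (x n) + t * (B (x n) w - L w) + t\<^sup>2 * B w w / 2"
     unfolding J_def Bexp[OF w x(1)] Lexp[OF w x(1)] using sym[OF w x(1)] by (simp add: algebra_simps add_divide_distrib)
    finally show ?thesis using x(2)[of n] by simp
   qed
   moreover have "(%n. - 1 / real (Suc n)) \<longlonglongrightarrow> 0" using tendsto_minus[OF LIMSEQ_Suc[OF lim_1_over_n]] by simp
   moreover have "(%n. t * (B (x n) w - L w) + t\<^sup>2 * B w w / 2) \<longlonglongrightarrow> t * q + t\<^sup>2 * B w w / 2"
    unfolding q_def by (intro tendsto_intros Bl)
   ultimately show ?thesis by (intro LIMSEQ_le[where X="%n. - 1 / real (Suc n)"]) auto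
  qed
  have "q=0"
  proof (rule ccontr)
   assume "q~=0"
   \<comment> \<open>If the first variation \<open>q\<close> were nonzero, a step
     \<open>- q / c\<close> would lower the energy below its minimum. The summand 1 keeps the step
     defined when \<open>B w w\<close> is zero.\<close>
   define c where "c=B w w + 1"
   have c: "c>=1" "B w w=c - 1" using ww by (simp_all add: c_def)
   have "(- q / c) * q + (- q / c)\<^sup>2 * B w w / 2 = - (q\<^sup>2 * (c + 1) / (2 * c\<^sup>2))"
    unfolding c(2) using c(1) by (simp add: field_simps power2_eq_square)
   moreover have "q\<^sup>2 * (c + 1) / (2 * c\<^sup>2)>0" using c \<open>q~=0\<close> by simp
   ultimately show False using ineq[of "- q / c"] by linarith
  qed
  then show "B l w=L w" by (simp add: q_def)
 qed
qed

section \<open>Coordinates of the fibre product and its gradient\<close>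

lemma diff_map_proj:
 assumes E: "banach_manifold E" and i: "i<r" and dO: "ALL i<r. d i:atlas E" and w: "w:cdom (prod_chart r d)"
 shows "has_fderiv (cmodel (prod_chart r d)) (cmap (d i) o (%w. w i) o cinv (prod_chart r d)) (%v. apply_bcontfun v i) (cmap (prod_chart r d) w)"
proof -
 have d: "d i:atlas E" if "i<r" for i using dO that by blast
 note DE=banach_imp_diff_manifold[OF E]
 let ?D="prod_chart r d"
 have ch: "is_chart (mtop E) (d i)" if "i<r" for i using dm_chart[OF DE d[OF that]] .
 have chD: "is_chart (product_topology (%_. mtop E) {..<r}) ?D" by (rule is_chart_prod[OF ch])
 obtain e where e: "e>0" "!!y. y:cmodel ?D==>dist y (cmap ?D w)<e==>y:cmap ?D ` (cdom ?D\<inter>cdom ?D)"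
  using chart_near[OF chD w chartD(1)[OF chD] w] by metis
 have lin: "has_fderiv (cmodel ?D) (%v. apply_bcontfun v i) (%v. apply_bcontfun v i) (cmap ?D w)"
  by (rule blinear_on_has_fderiv[OF bounded_linear_imp_on[OF bounded_linear_eval] chartD(2)[OF chD] cmap_in_cmodel[OF chD w]])
 show ?thesis
 proof (rule has_fderiv_cong[OF lin refl chartD(2)[OF chD] cmap_in_cmodel[OF chD w] e(1)])
  fix y assume y: "y:cmodel ?D" "dist y (cmap ?D w)<e"
  have yD: "y:cmap ?D ` cdom ?D" using e(2)[OF y] by simp
  have "cmap ?D ` cdom ?D={v:vmodel r (%i. cmodel (d i)). ALL i<r. apply_bcontfun v i:cmap (d i) ` cdom (d i)}"
   unfolding prod_chart_sel(1) by (rule prod_chart_image[OF ch order_refl])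
  then have "apply_bcontfun y i:cmap (d i) ` cdom (d i)" using yD i by blast
  then show "apply_bcontfun y i=(cmap (d i) o (%w. w i) o cinv ?D) y"
   using cinv_prod_chart[OF ch yD i] cmap_cinv[of "apply_bcontfun y i" "d i"] by simp
 qed
qed

lemma diff_map_prod_proj:
 assumes E: "banach_manifold E" and i: "i<r"
 shows "diff_map (prod_manifold r E) E (%w. w i)"
 unfolding diff_map_def
proof (intro conjI ballI impI)
 note DE=banach_imp_diff_manifold[OF E] and DP=diff_manifold_prod[OF E, of r]
 show pc: "continuous_map (mtop (prod_manifold r E)) (mtop E) (%w. w i)"
  unfolding mtop_prod_manifold using i by (intro continuous_map_product_projection) simp
 fix D c w assume D: "D:atlas (prod_manifold r E)" and c: "c:atlas E" and w: "w:cdom D" "w i:cdom c"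
 obtain d where d: "D=prod_chart r d" "!!i. i<r==>d i:atlas E" using D by (auto simp: atlas_prod_manifold)
 have wi: "w i:cdom (d i)" using w(1) i unfolding d(1) prod_chart_sel by blast
 have ev: "has_fderiv (cmodel D) (cmap (d i) o (%w. w i) o cinv D) (%v. apply_bcontfun v i) (cmap D w)"
  unfolding d(1) by (rule diff_map_proj[OF E i]) (use w(1) d in simp_all)
 have "has_fderiv (cmodel D) (cmap c o (%w. w i) o cinv D)
  (%v. fderiv (cmodel (d i)) (cmap c o cinv (d i)) (cmap (d i) (w i)) (apply_bcontfun v i)) (cmap D w)"
  by (rule chart_chain(1)[of "mtop (prod_manifold r E)" D "mtop E" "d i" "%w. w i" w, OF dm_chart[OF DP D] dm_chart[OF DE d(2)[OF i]] pc w(1) wi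
    ev diff_manifold_trans[OF DE d(2)[OF i] wi c w(2)]])
 then show "EX f'. has_fderiv (cmodel D) (cmap c o (%w. w i) o cinv D) f' (cmap D w)" by blast
qed

text \<open>The coordinates of a point of the fibre product in charts of the factors are \<open>C\<^sup>1\<close> functions of
  its coordinates in a chart of the fibre product, and their derivatives are jointly bounded below.\<close>

lemma fiber_coords0:
 fixes E :: "('e, 'm::banach) manifold" and X :: "('x, 'n::banach) manifold"
 assumes E: "banach_manifold E" and X: "banach_manifold X" and p: "submersion E X p" and r: "0<r"
 defines "Y \<equiv> fiber_product_manifold r E p"
 assumes C: "C:atlas Y" "u:cdom C" and dO: "ALL i<r. d i:atlas E" "u:cdom (prod_chart r d)"
 obtains S f' where "openin (top_of_set (cmodel C)) S" "cmap C u:S" "S<=cmap C ` cdom C"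
  "!!z. z:S==>cinv C z:cdom (prod_chart r d)"
  "C1_on (cmodel C) S (cmap (prod_chart r d) o cinv C) f'"
  "!!v. v:cmodel C==>f' (cmap C u) v:cmodel (prod_chart r d)"
  "EX K>0. ALL v:cmodel C. norm v<=K * norm (f' (cmap C u) v)"
proof -
 have d: "!!i. i<r==>d i:atlas E" "u:cdom (prod_chart r d)" using dO by blast+
 let ?D="prod_chart r d" and ?F="fiber_product r (mtop E) p" and ?PM="prod_manifold r E"
 have DY: "diff_manifold Y" unfolding Y_def by (rule diff_manifold_fiber_product[OF E X p r])
 note DP=diff_manifold_prod[OF E, of r]
 have "C:atlas (submanifold_of ?PM ?F)" using C(1) by (simp add: Y_def fiber_product_manifold_def)
 then obtain c W where c: "C=\<lparr>cdom=cdom c\<inter>?F, cmap=cmap c, cmodel=W\<rparr>" "c:max_atlas ?PM" "splits (cmodel c) W"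
  "cmap c ` (cdom c\<inter>?F)=cmap c ` cdom c\<inter>W" unfolding submanifold_of_def by auto
 have sel: "cdom C=cdom c\<inter>?F" "cmap C=cmap c" "cmodel C=W" using c(1) by simp_all
 note chC=dm_chart[OF DY C(1)]
 have DA: "?D:atlas ?PM" using d(1) by (auto simp: atlas_prod_manifold)
 note chD=dm_chart[OF DP DA]
 have chc: "is_chart (mtop ?PM) c" and s1: "smooth_transition c ?D" and s2: "smooth_transition ?D c"
  using c(2) DA by (auto simp: max_atlas_def)
 have uc: "u:cdom c" using C(2) sel by simp
 have WV: "W<=cmodel c" "subspace W" using c(3) by (auto simp: splits_def)
 define S0 where "S0=cmap c ` (cdom c\<inter>cdom ?D)"
 have So: "openin (top_of_set (cmodel c)) S0" unfolding S0_def by (rule openin_transition_domain[OF chc chartD(1)[OF chD]])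
 obtain f' where f': "C1_on (cmodel c) S0 (cmap ?D o cinv c) f'"
  using Ck_on_imp_C1[OF s1[unfolded smooth_transition_def, folded S0_def] _ chartD(2)[OF chc] So] by (metis enat_ord_code(3))
 define S where "S=S0\<inter>W"
 have zS: "cinv C z=cinv c z" "cinv C z:cdom ?D" "z:cmap C ` cdom C" if z: "z:S" for z
 proof -
  obtain m where m: "m:cdom c" "m:cdom ?D" "z=cmap c m" using z by (auto simp: S_def S0_def)
  have "z:cmap c ` (cdom c\<inter>?F)" using m z unfolding c(4) S_def by blast
  then obtain m' where m': "m':cdom c\<inter>?F" "z=cmap c m'" by blast
  have "m=m'" using m m' chartD(5)[OF chc] by (auto simp: inj_on_def)
  then have mC: "m:cdom C" using m' sel by simp
  have "cinv C z=m" using cinv_cmap[OF chC mC] m(3) sel(2) by simp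
  moreover have "cinv c z=m" using cinv_cmap[OF chc m(1)] m(3) by simp
  ultimately show "cinv C z=cinv c z" "cinv C z:cdom ?D" using m(2) by simp_all
  show "z:cmap C ` cdom C" using mC m(3) sel(2) by auto
 qed
 have SoW: "openin (top_of_set W) S"
 proof -
  obtain T where T: "open T" "S0=cmodel c\<inter>T" using So unfolding openin_open by blast
  then have "S=W\<inter>T" using WV(1) by (auto simp: S_def)
  then show ?thesis using T(1) by (auto simp: openin_open)
 qed
 have uS: "cmap C u:S" using uc d(2) cmap_in_cmodel[OF chC C(2)] sel by (auto simp: S_def S0_def)
 have C1: "C1_on W S (cmap ?D o cinv C) f'"
 proof (rule C1_on_cong[OF _ WV(2) SoW])
  show "C1_on W S (cmap ?D o cinv c) f'" by (rule C1_on_subset[OF f' WV(1)]) (simp add: S_def)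
  show "(cmap ?D o cinv c) z=(cmap ?D o cinv C) z" if "z:S" for z using zS(1)[OF that] by simp
 qed
 have fu: "has_fderiv (cmodel c) (cmap ?D o (%x. x) o cinv c) (f' (cmap C u)) (cmap c u)"
  using f' uS sel(2) unfolding C1_on_def S_def comp_def by auto
 \<comment> \<open>The derivative of the opposite chart change is a left inverse of the coordinate
   derivative; its norm bound is the constant \<open>K\<close> of the lower estimate.\<close>
 obtain h' where h': "has_fderiv (cmodel ?D) (cmap c o cinv ?D) h' (cmap ?D ((%x. x) u))"
  using smooth_transition_fderiv[OF chD chc s2 d(2) uc] by auto
 have idc: "continuous_map (mtop ?PM) (mtop ?PM) (%x. x)" by simp
 note chain=chart_chain[of "mtop ?PM" c "mtop ?PM" ?D "%x. x" u, OF chc chD idc uc d(2) fu h']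
 have rng: "f' (cmap C u) v:cmodel ?D" if "v:cmodel C" for v
  using chain(2) that WV(1) sel(3) by auto
 have inv: "h' (f' (cmap C u) v)=v" if "v:cmodel C" for v
 proof -
  have v: "v:cmodel c" using that WV(1) sel(3) by blast
  have "has_fderiv (cmodel c) (cmap c o cinv c) (%v. h' (f' (cmap C u) v)) (cmap c u)"
   using chain(1) by (simp add: comp_def)
  from fderiv_eq[OF this chartD(2)[OF chc] cmap_in_cmodel[OF chc uc] v] fderiv_self[OF chc uc v] show ?thesis by simp
 qed
 obtain K where K: "K>0" "!!v. v:cmodel ?D==>norm (h' v)<=K * norm v"
  by (fact blinear_on_bound[OF has_fderiv_linear[OF h']])
 show thesis
 proof (rule that[OF SoW[folded sel(3)] uS _ _ C1[folded sel(3)] rng])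
  show "S<=cmap C ` cdom C" using zS(3) by blast
  show "cinv C z:cdom ?D" if "z:S" for z by (rule zS(2)[OF that])
  have "norm v<=K * norm (f' (cmap C u) v)" if "v:cmodel C" for v
   using K(2)[OF rng[OF that]] inv[OF that] by simp
  then show "EX K>0. ALL v:cmodel C. norm v<=K * norm (f' (cmap C u) v)" using K(1) by blast
 qed
qed

lemma diff_map_fiber_inclusion:
 fixes E :: "('e, 'm::banach) manifold" and X :: "('x, 'n::banach) manifold"
 assumes E: "banach_manifold E" and X: "banach_manifold X" and p: "submersion E X p" and r: "0<r"
 shows "diff_map (fiber_product_manifold r E p) (prod_manifold r E) (%x. x)"
 unfolding diff_map_def
proof (intro conjI ballI impI)
 show "continuous_map (mtop (fiber_product_manifold r E p)) (mtop (prod_manifold r E)) (%x. x)"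
  unfolding mtop_fiber_product_manifold fiber_product_topology_def mtop_prod_manifold
  by (intro continuous_map_from_subtopology) simp
 fix C D u assume C: "C:atlas (fiber_product_manifold r E p)" "u:cdom C" and D: "D:atlas (prod_manifold r E)" "u:cdom D"
 obtain d where d: "D=prod_chart r d" "!!i. i<r==>d i:atlas E" using D by (auto simp: atlas_prod_manifold)
 have "ALL i<r. d i:atlas E" using d(2) by blast
 then show "EX f'. has_fderiv (cmodel C) (cmap D o (%x. x) o cinv C) f' (cmap C u)"
 proof (rule fiber_coords0[OF E X p r C _ D(2)[unfolded d(1)]])
  fix S f' assume "cmap C u:S" "C1_on (cmodel C) S (cmap (prod_chart r d) o cinv C) f'"
  then have "has_fderiv (cmodel C) (cmap D o (%x. x) o cinv C) (f' (cmap C u)) (cmap C u)"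
   unfolding d(1) C1_on_def comp_def by blast
  then show "EX f'. has_fderiv (cmodel C) (cmap D o (%x. x) o cinv C) f' (cmap C u)" by blast
 qed
qed

lemma fiber_coords:
 fixes E :: "('e, 'm::banach) manifold" and X :: "('x, 'n::banach) manifold"
 assumes E: "banach_manifold E" and X: "banach_manifold X" and p: "submersion E X p" and r: "0<r"
 defines "Y \<equiv> fiber_product_manifold r E p"
 assumes C: "C:atlas Y" "u:cdom C" and dO: "ALL i<r. d i:atlas E" "ALL i<r. u i:cdom (d i)"
 obtains S kap' where "openin (top_of_set (cmodel C)) S" "cmap C u:S" "S<=cmap C ` cdom C"
  "!!z i. z:S==>i<r==>cinv C z i:cdom (d i)"
  "!!i. i<r==>C1_on (cmodel C) S (%z. cmap (d i) (cinv C z i)) (kap' i)"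
  "!!i v. i<r==>v:cmodel C==>kap' i (cmap C u) v:cmodel (d i)"
  "EX K>0. ALL v:cmodel C. norm v<=K * (\<Sum>i<r. norm (kap' i (cmap C u) v))"
  "!!g v w. v:cmodel C==>w:cmodel C ==>
    fiber_product_metric r E p g u (tvec Y u C v) (tvec Y u C w) =
    (\<Sum>i<r. g (u i) (tvec E (u i) (d i) (kap' i (cmap C u) v)) (tvec E (u i) (d i) (kap' i (cmap C u) w)))"
proof -
 have d: "!!i. i<r==>d i:atlas E" "!!i. i<r==>u i:cdom (d i)" using dO by blast+
 let ?D="prod_chart r d" and ?F="fiber_product r (mtop E) p" and ?PM="prod_manifold r E"
 note DE=banach_imp_diff_manifold[OF E]
 have DY: "diff_manifold Y" unfolding Y_def by (rule diff_manifold_fiber_product[OF E X p r])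
 note DP=diff_manifold_prod[OF E, of r]
 note chC=dm_chart[OF DY C(1)]
 have "u:mpoints Y" using chartD(6)[OF chC] C(2) by blast
 then have "u:?F" unfolding Y_def mtop_fiber_product_manifold topspace_fiber_product .
 then have ext: "u:extensional {..<r}" by (auto simp: fiber_product_def PiE_iff)
 then have uD: "u:cdom ?D" unfolding prod_chart_sel using d(2) by (auto simp: PiE_iff)
 have DA: "?D:atlas ?PM" using d(1) by (auto simp: atlas_prod_manifold)
 obtain S f' where S: "openin (top_of_set (cmodel C)) S" "cmap C u:S" "S<=cmap C ` cdom C"
  "!!z. z:S==>cinv C z:cdom ?D" "C1_on (cmodel C) S (cmap ?D o cinv C) f'"
  "!!v. v:cmodel C==>f' (cmap C u) v:cmodel ?D" "EX K>0. ALL v:cmodel C. norm v<=K * norm (f' (cmap C u) v)"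
  by (fact fiber_coords0[OF E X p r C[unfolded Y_def] dO(1) uD])
 obtain K where K: "K>0" "!!v. v:cmodel C==>norm v<=K * norm (f' (cmap C u) v)" using S(7) by blast
 define kap' where "kap'=(%i z v. apply_bcontfun (f' z v) i)"
 have zc: "cinv C z i:cdom (d i)" if "z:S" "i<r" for z i
  using S(4)[OF that(1)] that(2) unfolding prod_chart_sel by blast
 show thesis
 proof (rule that[OF S(1-3) zc, of kap'])
  show "C1_on (cmodel C) S (%z. cmap (d i) (cinv C z i)) (kap' i)" if i: "i<r" for i
  proof (rule C1_on_cong[OF _ chartD(2)[OF chC] S(1)])
   show "C1_on (cmodel C) S (%z. apply_bcontfun ((cmap ?D o cinv C) z) i) (kap' i)"
    unfolding kap'_def by (rule C1_on_bounded_linear[OF S(5) bounded_linear_eval])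
   show "apply_bcontfun ((cmap ?D o cinv C) z) i=cmap (d i) (cinv C z i)" for z using i by (simp add: prod_chart_sel)
  qed
  show "kap' i (cmap C u) v:cmodel (d i)" if "i<r" "v:cmodel C" for i v
   using S(6)[OF that(2)] that(1) unfolding prod_chart_sel(3) vmodel_iff kap'_def by blast
  have "norm v<=K * (\<Sum>i<r. norm (kap' i (cmap C u) v))" if v: "v:cmodel C" for v
  proof -
   have "f' (cmap C u) v=fvec r (%i. kap' i (cmap C u) v)"
    using fvec_eval[OF S(6)[OF v, unfolded prod_chart_sel(3)]] by (simp add: kap'_def)
   moreover have "norm (fvec r (%i. kap' i (cmap C u) v))<=(\<Sum>i<r. norm (kap' i (cmap C u) v))"
    by (intro norm_fvec_le sum_nonneg member_le_sum) auto
   ultimately show ?thesis using K(2)[OF v] K(1) by (smt (verit) mult_left_mono)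
  qed
  then show "EX K>0. ALL v:cmodel C. norm v<=K * (\<Sum>i<r. norm (kap' i (cmap C u) v))" using K(1) by blast
  fix g v w assume vw: "v:cmodel C" "w:cmodel C"
  have md: "mdiff (submanifold_of ?PM ?F) ?PM (%x. x) u (tvec Y u C v)=tvec ?PM u ?D (f' (cmap C u) v)" if v: "v:cmodel C" for v
  proof -
   have "mdiff Y ?PM (%x. x) u (tvec Y u C v)=tvec ?PM u ?D (fderiv (cmodel C) (cmap ?D o (%x. x) o cinv C) (cmap C u) v)"
    using mdiff_tvec[OF DY DP diff_map_fiber_inclusion[OF E X p r, folded Y_def] C DA uD v] .
   also have "fderiv (cmodel C) (cmap ?D o (%x. x) o cinv C) (cmap C u) v=f' (cmap C u) v"
   proof (rule fderiv_eq[OF _ chartD(2)[OF chC] cmap_in_cmodel[OF chC C(2)] v])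
    show "has_fderiv (cmodel C) (cmap ?D o (%x. x) o cinv C) (f' (cmap C u)) (cmap C u)"
     using S(2,5) unfolding C1_on_def comp_def by blast
   qed
   finally show ?thesis unfolding Y_def fiber_product_manifold_def .
  qed
  have mp: "mdiff ?PM E (%w. w i) u (tvec ?PM u ?D z)=tvec E (u i) (d i) (apply_bcontfun z i)" if i: "i<r" and z: "z:cmodel ?D" for i z
  proof -
   note chD=dm_chart[OF DP DA]
   have "mdiff ?PM E (%w. w i) u (tvec ?PM u ?D z)=tvec E (u i) (d i) (fderiv (cmodel ?D) (cmap (d i) o (%w. w i) o cinv ?D) (cmap ?D u) z)"
    by (rule mdiff_tvec[OF DP DE diff_map_prod_proj[OF E i] DA uD d(1)[OF i] d(2)[OF i] z])
   also have "fderiv (cmodel ?D) (cmap (d i) o (%w. w i) o cinv ?D) (cmap ?D u) z=apply_bcontfun z i"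
    by (rule fderiv_eq[OF diff_map_proj[OF E i dO(1) uD] chartD(2)[OF chD] cmap_in_cmodel[OF chD uD] z])
   finally show ?thesis .
  qed
  show "fiber_product_metric r E p g u (tvec Y u C v) (tvec Y u C w) =
    (\<Sum>i<r. g (u i) (tvec E (u i) (d i) (kap' i (cmap C u) v)) (tvec E (u i) (d i) (kap' i (cmap C u) w)))"
   unfolding fiber_product_metric_def restrict_metric_def md[OF vw(1)] md[OF vw(2)] prod_metric_def kap'_def
   by (intro sum.cong refl) (simp add: mp S(6) vw)
 qed
qed

text \<open>The parallelogram identity with nonnegativity at \<open>v - w\<close> already gives a
  triangle inequality with the crude factor 2. The loss is absorbed in the constant of
  \<open>fiber_local_descent\<close>.\<close>

lemma tnorm_add_le:
 assumes g: "riemannian_metric E g" and E: "diff_manifold E" and c: "c:atlas E" "m:cdom c" and vw: "v:cmodel c" "w:cmodel c"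
 shows "tnorm g m (tvec E m c (v + w))<=2 * (tnorm g m (tvec E m c v) + tnorm g m (tvec E m c w))"
proof -
 note L=metric_chart_linear[OF g E c] and S=metric_chart_sym[OF g E c]
 note ch=dm_chart[OF E c(1)]
 obtain k where "k>0" "!!v. v:cmodel c==>k * (norm v)\<^sup>2<=g m (tvec E m c v) (tvec E m c v)" using metric_chart_coercive[OF g E c] by blast
 then have pos: "0<=g m (tvec E m c v) (tvec E m c v)" if "v:cmodel c" for v
  using that by (meson mult_nonneg_nonneg less_imp_le order_trans zero_le_power2)
 let ?B="%v w. g m (tvec E m c v) (tvec E m c w)"
 have mem: "v + w:cmodel c" "- 1 *\<^sub>R w + v:cmodel c" using chartD(2)[OF ch] vw by (simp_all add: subspace_add subspace_diff)
 have 1: "?B (v + w) (v + w)=?B v v + 2 * ?B v w + ?B w w"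
  using L[OF vw mem(1), of 1] L[OF vw vw(1), of 1] L[OF vw vw(2), of 1] S[OF mem(1) vw(1)] S[OF mem(1) vw(2)] S[OF vw] by simp
 have 2: "?B (- 1 *\<^sub>R w + v) (- 1 *\<^sub>R w + v)=?B v v - 2 * ?B v w + ?B w w"
  using L[OF vw(2,1) mem(2), of "-1"] L[OF vw(2,1,1), of "-1"] L[OF vw(2,1,2), of "-1"] S[OF mem(2) vw(1)] S[OF mem(2) vw(2)] S[OF vw] by simp
 have "?B (v + w) (v + w)<=2 * ?B v v + 2 * ?B w w" using 1 2 pos[OF mem(2)] by linarith
 also have "...<=(2 * (sqrt (?B v v) + sqrt (?B w w)))\<^sup>2"
  using pos[OF vw(1)] pos[OF vw(2)] by (simp add: power_mult_distrib power2_sum)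
 finally have "sqrt (?B (v + w) (v + w))<=sqrt ((2 * (sqrt (?B v v) + sqrt (?B w w)))\<^sup>2)" by (rule real_sqrt_le_mono)
 then show ?thesis using pos[OF vw(1)] pos[OF vw(2)] by (simp add: tnorm_def)
qed

lemma fiber_product_charts:
 assumes E: "banach_manifold E" and u: "u:fiber_product r (mtop E) p"
 obtains d where "!!i. i<r==>d i:atlas E" "!!i. i<r==>u i:cdom (d i)"
proof -
 have "EX c. c:atlas E&u i:cdom c" if i: "i<r" for i
 proof -
  have "u i:mpoints E" using u i by (auto simp: fiber_product_def PiE_iff)
  then show ?thesis using diff_manifold_cover[OF banach_imp_diff_manifold[OF E]] by metis
 qed
 then show thesis using that by metis
qed

lemma Ck_function_C1:
 assumes Y: "diff_manifold Y" and F: "Ck_function 1 Y F" and C: "C:atlas Y"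
 obtains F' where "C1_on (cmodel C) (cmap C ` cdom C) (F o cinv C) F'"
proof -
 note ch=dm_chart[OF Y C]
 have "Ck_on 1 (cmodel C) (cmap C ` cdom C) (F o cinv C)" using F C by (simp add: Ck_function_def)
 from Ck_on_imp_C1[OF this order_refl chartD(2,4)[OF ch]] show thesis using that by blast
qed

text \<open>The definite description in \<open>gradient\<close> is meaningful because the restricted
  metric, read in coordinates as a sum of the metrics of the factors, is bounded and coercive:
  existence is \<open>riesz_on\<close>, uniqueness is definiteness. By construction the squared
  length of the gradient is the derivative of \<open>F\<close> in its own direction.\<close>

lemma fiber_gradient:
 fixes E :: "('e, 'm::banach) manifold" and X :: "('x, 'n::banach) manifold"
 assumes E: "banach_manifold E" and X: "banach_manifold X" and p: "submersion E X p" and r: "0<r"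
  and g: "riemannian_metric E g"
 defines "Y \<equiv> fiber_product_manifold r E p" and "gb \<equiv> fiber_product_metric r E p g"
 assumes F: "Ck_function 1 Y F" and C: "C:atlas Y" "u:cdom C"
  and F': "has_fderiv (cmodel C) (F o cinv C) F' (cmap C u)"
 obtains x where "x:cmodel C" "gradient Y gb F u=tvec Y u C x" "gb u (tvec Y u C x) (tvec Y u C x)=F' x" "0<=F' x"
  "!!a v. v:cmodel C==>gb u (tvec Y u C (a *\<^sub>R v)) (tvec Y u C (a *\<^sub>R v))=a\<^sup>2 * gb u (tvec Y u C v) (tvec Y u C v)"
  "u:Crit Y F\<longleftrightarrow>F' x=0"
proof -
 note DE=banach_imp_diff_manifold[OF E]
 have DY: "diff_manifold Y" unfolding Y_def by (rule diff_manifold_fiber_product[OF E X p r])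
 note ch=dm_chart[OF DY C(1)]
 let ?V="cmodel C"
 note V=chartD(2,3)[OF ch]
 have "u:mpoints Y" using chartD(6)[OF ch] C(2) by blast
 then have uF: "u:fiber_product r (mtop E) p" unfolding Y_def mtop_fiber_product_manifold topspace_fiber_product .
 obtain d where d: "!!i. i<r==>d i:atlas E" "!!i. i<r==>u i:cdom (d i)" by (rule fiber_product_charts[OF E uF]) blast
 then have dO: "ALL i<r. d i:atlas E" "ALL i<r. u i:cdom (d i)" by blast+
 obtain S kap' where kap: "openin (top_of_set ?V) S" "cmap C u:S" "S<=cmap C ` cdom C"
  "!!z i. z:S==>i<r==>cinv C z i:cdom (d i)"
  "!!i. i<r==>C1_on ?V S (%z. cmap (d i) (cinv C z i)) (kap' i)"
  "!!i v. i<r==>v:?V==>kap' i (cmap C u) v:cmodel (d i)"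
  "EX K>0. ALL v:?V. norm v<=K * (\<Sum>i<r. norm (kap' i (cmap C u) v))"
  "!!g v w. v:?V==>w:?V ==>
    fiber_product_metric r E p g u (tvec Y u C v) (tvec Y u C w) =
    (\<Sum>i<r. g (u i) (tvec E (u i) (d i) (kap' i (cmap C u) v)) (tvec E (u i) (d i) (kap' i (cmap C u) w)))"
  by (fact fiber_coords[OF E X p r C[unfolded Y_def] dO, folded Y_def])
 define k where "k=(%i v. kap' i (cmap C u) v)"
 define b where "b=(%i v w. g (u i) (tvec E (u i) (d i) v) (tvec E (u i) (d i) w))"
 define B where "B=(%v w. gb u (tvec Y u C v) (tvec Y u C w))"
 have Bb: "B v w=(\<Sum>i<r. b i (k i v) (k i w))" if "v:?V" "w:?V" for v w
  using kap(8)[OF that, of g] by (simp add: B_def gb_def b_def k_def)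
 have km: "k i v:cmodel (d i)" if "i<r" "v:?V" for i v using kap(6)[OF that] by (simp add: k_def)
 have kl: "blinear_on ?V (k i)" if "i<r" for i
  using kap(5)[OF that] kap(2) has_fderiv_linear unfolding k_def C1_on_def by blast
 have comb: "a *\<^sub>R v + w:?V" if "v:?V" "w:?V" for a v w using V(1) that by (simp add: subspace_add subspace_scale)
 have kc: "k i (a *\<^sub>R v + w)=a *\<^sub>R k i v + k i w" if "i<r" "v:?V" "w:?V" for i a v w
  using blinear_on_add[OF kl[OF that(1)] subspace_scale[OF V(1) that(2)] that(3)] blinear_on_scale[OF kl[OF that(1)] that(2)] by simp
 note Mlin=metric_chart_linear[OF g DE d] and Msym=metric_chart_sym[OF g DE d]
 have Blin: "B (a *\<^sub>R v + w) z=a * B v z + B w z" if "v:?V" "w:?V" "z:?V" for a v w z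
 proof -
  have "B (a *\<^sub>R v + w) z=(\<Sum>i<r. a * b i (k i v) (k i z) + b i (k i w) (k i z))"
   unfolding Bb[OF comb[OF that(1,2)] that(3)]
   using that km by (intro sum.cong refl) (simp add: kc b_def Mlin)
  then show ?thesis unfolding Bb[OF that(1,3)] Bb[OF that(2,3)] by (simp add: sum.distrib sum_distrib_left)
 qed
 have Bsym: "B v w=B w v" if "v:?V" "w:?V" for v w
  unfolding Bb[OF that] Bb[OF that(2,1)] b_def using that km Msym by (intro sum.cong refl) auto
 have "EX c>0. ALL v:?V. ALL w:?V. \<bar>b i (k i v) (k i w)\<bar><=c * norm v * norm w" if i: "i<r" for i
 proof -
  obtain c where c: "c>0" "!!v w. v:cmodel (d i)==>w:cmodel (d i)==>\<bar>b i v w\<bar><=c * norm v * norm w"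
   using metric_chart_bound[OF g DE d[OF i]] unfolding b_def by blast
  obtain K where K: "K>0" "!!v. v:?V==>norm (k i v)<=K * norm v" by (fact blinear_on_bound[OF kl[OF i]])
  have "\<bar>b i (k i v) (k i w)\<bar><=c * K * K * norm v * norm w" if vw: "v:?V" "w:?V" for v w
  proof -
   have "\<bar>b i (k i v) (k i w)\<bar><=c * norm (k i v) * norm (k i w)" using c(2) km i vw by blast
   also have "...<=c * (K * norm v) * (K * norm w)" using c(1) K vw by (intro mult_mono) auto
   finally show ?thesis by (simp add: mult_ac)
  qed
  then show ?thesis using c(1) K(1) by (intro exI[of _ "c * K * K"]) auto
 qed
 then obtain cb where cb: "!!i v w. i<r==>v:?V==>w:?V==>\<bar>b i (k i v) (k i w)\<bar><=cb i * norm v * norm w" by metis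
 have Bbd: "\<bar>B v w\<bar><=(\<Sum>i<r. cb i) * norm v * norm w" if "v:?V" "w:?V" for v w
 proof -
  have "\<bar>B v w\<bar><=(\<Sum>i<r. \<bar>b i (k i v) (k i w)\<bar>)" unfolding Bb[OF that] by (rule sum_abs)
  also have "...<=(\<Sum>i<r. cb i * norm v * norm w)" using cb that by (intro sum_mono) auto
  finally show ?thesis by (simp add: sum_distrib_right)
 qed
 have "EX c>0. ALL v:cmodel (d i). c * (norm v)\<^sup>2<=b i v v" if "i<r" for i
  using metric_chart_coercive[OF g DE d[OF that]] unfolding b_def .
 then obtain kk where kk: "!!i. i<r==>kk i>0" "!!i v. i<r==>v:cmodel (d i)==>kk i * (norm v)\<^sup>2<=b i v v" by metis
 obtain K where K: "K>0" "!!v. v:?V==>norm v<=K * (\<Sum>i<r. norm (k i v))" using kap(7) unfolding k_def by blast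
 have bpos: "0<=b i (k i v) (k i v)" if "i<r" "v:?V" for i v
  using kk(2)[OF that(1) km[OF that]] kk(1)[OF that(1)] by (meson mult_nonneg_nonneg less_imp_le order_trans zero_le_power2)
 \<comment> \<open>Each coordinate speed is at most \<open>1 / sqrt (kk i)\<close> times the length
   in the restricted metric; summed up and combined with the lower bound \<open>K\<close> of the
   coordinates this controls \<open>norm v\<close>.\<close>
 define K2 where "K2=K * (\<Sum>i<r. 1 / sqrt (kk i))"
 have K2: "K2>0" unfolding K2_def using K kk(1) r by (intro mult_pos_pos sum_pos) auto
 have coer: "1 / K2\<^sup>2 * (norm v)\<^sup>2<=B v v" if v: "v:?V" for v
 proof -
  have B0: "0<=B v v" unfolding Bb[OF v v] using bpos v by (intro sum_nonneg) auto
  have "norm (k i v)<=1 / sqrt (kk i) * sqrt (B v v)" if i: "i<r" for i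
  proof -
   have "b i (k i v) (k i v)<=B v v"
    unfolding Bb[OF v v] by (rule member_le_sum[of i "{..<r}" "%i. b i (k i v) (k i v)"]) (use i bpos v in auto)
   then have "kk i * (norm (k i v))\<^sup>2<=B v v" using kk(2)[OF i km[OF i v]] by linarith
   from real_sqrt_le_mono[OF this] have "sqrt (kk i) * norm (k i v)<=sqrt (B v v)" by (simp add: real_sqrt_mult)
   then show ?thesis using kk(1)[OF i] by (simp add: field_simps)
  qed
  then have "(\<Sum>i<r. norm (k i v))<=(\<Sum>i<r. 1 / sqrt (kk i) * sqrt (B v v))" by (intro sum_mono) auto
  then have "K * (\<Sum>i<r. norm (k i v))<=K * ((\<Sum>i<r. 1 / sqrt (kk i)) * sqrt (B v v))"
   unfolding sum_distrib_right[symmetric] using K(1) by (intro mult_left_mono) auto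
  then have "K * (\<Sum>i<r. norm (k i v))<=K2 * sqrt (B v v)" unfolding K2_def by (simp only: mult.assoc)
  then have "norm v<=K2 * sqrt (B v v)" using K(2)[OF v] by linarith
  then have "(norm v)\<^sup>2<=(K2 * sqrt (B v v))\<^sup>2" by (intro power_mono) auto
  then show ?thesis using K2 B0 by (simp add: power_mult_distrib field_simps)
 qed
 have K2': "1 / K2\<^sup>2>0" using K2 by simp
 have "EX x:?V. ALL w:?V. B x w=F' w"
  by (rule riesz_on[OF V has_fderiv_linear[OF F'] Blin Bsym Bbd K2' coer]) assumption+
 then obtain x where x: "x:?V" "!!w. w:?V==>B x w=F' w" by blast
 have Fd: "EX F'. has_fderiv (cmodel c) (F o cinv c) F' (cmap c u)" if c: "c:atlas Y" "u:cdom c" for c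
 proof -
  obtain G where "C1_on (cmodel c) (cmap c ` cdom c) (F o cinv c) G" by (rule Ck_function_C1[OF DY F c(1)])
  then show ?thesis using c(2) unfolding C1_on_def by blast
 qed
 have rd: "rdiff F u (tvec Y u C v)=F' v" if v: "v:?V" for v
  using rdiff_tvec[OF DY C v Fd] fderiv_eq[OF F' V(1) cmap_in_cmodel[OF ch C(2)] v] by simp
 note ts=tangent_space_eq[OF DY C]
 have Bpos0: "v=0" if "v:?V" "B v v=0" for v
  using coer[OF that(1)] that(2) K2 by (simp add: divide_le_0_iff)
 have "gradient Y gb F u=tvec Y u C x"
  unfolding gradient_def
 proof (rule the_equality)
  show "tvec Y u C x:tangent_space Y u&(ALL eta:tangent_space Y u. gb u (tvec Y u C x) eta=rdiff F u eta)"
  proof (intro conjI ballI)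
   show "tvec Y u C x:tangent_space Y u" unfolding ts using x(1) by (rule imageI)
   fix eta assume "eta:tangent_space Y u"
   then obtain w where w: "w:?V" "eta=tvec Y u C w" unfolding ts by blast
   show "gb u (tvec Y u C x) eta=rdiff F u eta" unfolding w(2) rd[OF w(1)] using x(2)[OF w(1)] by (simp only: B_def)
  qed
  fix xi assume xi: "xi:tangent_space Y u&(ALL eta:tangent_space Y u. gb u xi eta=rdiff F u eta)"
  then obtain y where y: "y:?V" "xi=tvec Y u C y" unfolding ts by blast
  have yB: "B y w=F' w" if "w:?V" for w
  proof -
   have "tvec Y u C w:tangent_space Y u" unfolding ts using that by (rule imageI)
   then have "gb u xi (tvec Y u C w)=rdiff F u (tvec Y u C w)" using xi by blast
   then show ?thesis unfolding y(2) rd[OF that] B_def .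
  qed
  have m: "- 1 *\<^sub>R y + x:?V" using comb[OF y(1) x(1)] .
  have "B (- 1 *\<^sub>R y + x) (- 1 *\<^sub>R y + x)=0" using Blin[OF y(1) x(1) m, of "-1"] yB[OF m] x(2)[OF m] by simp
  then have "- 1 *\<^sub>R y + x=0" by (rule Bpos0[OF m])
  then show "xi=tvec Y u C x" using y(2) by simp
 qed
 moreover have "gb u (tvec Y u C x) (tvec Y u C x)=F' x" using x(2)[OF x(1)] by (simp add: B_def)
 moreover have "0<=F' x"
 proof -
  have "0<=1 / K2\<^sup>2 * (norm x)\<^sup>2" by simp
  also note coer[OF x(1)]
  also note x(2)[OF x(1)]
  finally show ?thesis .
 qed
 moreover have "gb u (tvec Y u C (a *\<^sub>R v)) (tvec Y u C (a *\<^sub>R v))=a\<^sup>2 * gb u (tvec Y u C v) (tvec Y u C v)" if v: "v:?V" for a v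
 proof -
  have 0: "0:?V" and av: "a *\<^sub>R v:?V" using V(1) v by (simp_all add: subspace_0 subspace_scale)
  have B0: "B 0 w=0" if "w:?V" for w using Blin[OF 0 0 that, of 1] by simp
  have 1: "B (a *\<^sub>R v) w=a * B v w" if "w:?V" for w using Blin[OF v 0 that, of a] B0[OF that] by simp
  have "B (a *\<^sub>R v) (a *\<^sub>R v)=a\<^sup>2 * B v v" using 1[OF av] Bsym[OF v av] 1[OF v] by (simp add: power2_eq_square)
  then show ?thesis by (simp add: B_def)
 qed
 moreover have Fv0: "F' v=0" if "F' x=0" "v:?V" for v
 proof -
  have "x=0" by (rule Bpos0[OF x(1)]) (use x(2)[OF x(1)] that(1) in simp)
  moreover have "B 0 v=0" using Blin[OF subspace_0[OF V(1)] subspace_0[OF V(1)] that(2), of 1] by simp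
  ultimately show ?thesis using x(2)[OF that(2)] by simp
 qed
 moreover have "u:Crit Y F\<longleftrightarrow>F' x=0"
 proof
  assume "u:Crit Y F"
  then have "rdiff F u (tvec Y u C x)=0" using x(1) unfolding Crit_def mem_Collect_eq ts by blast
  then show "F' x=0" unfolding rd[OF x(1)] .
 next
  assume "F' x=0"
  then have "rdiff F u (tvec Y u C v)=0" if "v:?V" for v unfolding rd[OF that] using Fv0 that by blast
  then show "u:Crit Y F" using \<open>u:mpoints Y\<close> unfolding Crit_def mem_Collect_eq ts by blast
 qed
 ultimately show thesis using that[OF x(1)] by blast
qed

text \<open>The move goes along a straight line in a chart in the negative gradient direction,
  scaled so that no coordinate travels more than \<open>t / real r\<close> in time \<open>t\<close>.
  To first order \<open>F\<close> then falls at rate at least \<open>s0 / (8 * real r)\<close>; half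
  of it is given up to the error of linearisation, which explains the factor 16.\<close>

theorem fiber_local_descent:
 fixes E :: "('e, 'm::banach) manifold" and X :: "('x, 'n::banach) manifold"
 assumes E: "banach_manifold E" and X: "banach_manifold X" and p: "submersion E X p" and r: "0<r"
  and g: "riemannian_metric E g"
 defines "Y \<equiv> fiber_product_manifold r E p" and "gb \<equiv> fiber_product_metric r E p g"
  and "D \<equiv> sum_dist r (mdist E g)"
 assumes MS: "Metric_space (mpoints Y) D" and top: "Metric_space.mtopology (mpoints Y) D=mtop Y"
  and F: "Ck_function 1 Y F" and u: "u:mpoints Y" and s0: "0<s0" "s0<=tnorm gb u (gradient Y gb F u)"
 shows "EX N dlt H. u:N&Metric_space.local_descent (mpoints Y) D F (s0 / (16 * real r)) N dlt H"
proof -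
 interpret M: Metric_space "mpoints Y" D by (rule MS)
 note DE=banach_imp_diff_manifold[OF E]
 have DY: "diff_manifold Y" unfolding Y_def by (rule diff_manifold_fiber_product[OF E X p r])
 obtain C where C: "C:atlas Y" "u:cdom C" using diff_manifold_cover[OF DY u] by metis
 note ch=dm_chart[OF DY C(1)]
 let ?V="cmodel C" and ?z0="cmap C u"
 note V=chartD(2,3)[OF ch]
 have z0V: "?z0:?V" by (rule cmap_in_cmodel[OF ch C(2)])
 have uF: "u:fiber_product r (mtop E) p" using u unfolding Y_def mtop_fiber_product_manifold topspace_fiber_product .
 obtain d where d: "!!i. i<r==>d i:atlas E" "!!i. i<r==>u i:cdom (d i)" by (rule fiber_product_charts[OF E uF]) blast
 then have dO: "ALL i<r. d i:atlas E" "ALL i<r. u i:cdom (d i)" by blast+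
 obtain S kap' where kap: "openin (top_of_set ?V) S" "?z0:S" "S<=cmap C ` cdom C"
  "!!z i. z:S==>i<r==>cinv C z i:cdom (d i)"
  "!!i. i<r==>C1_on ?V S (%z. cmap (d i) (cinv C z i)) (kap' i)"
  "!!i v. i<r==>v:?V==>kap' i ?z0 v:cmodel (d i)"
  "EX K>0. ALL v:?V. norm v<=K * (\<Sum>i<r. norm (kap' i ?z0 v))"
  "!!g v w. v:?V==>w:?V ==>
    fiber_product_metric r E p g u (tvec Y u C v) (tvec Y u C w) =
    (\<Sum>i<r. g (u i) (tvec E (u i) (d i) (kap' i ?z0 v)) (tvec E (u i) (d i) (kap' i ?z0 w)))"
  by (fact fiber_coords[OF E X p r C[unfolded Y_def] dO, folded Y_def])
 obtain F' where F': "C1_on ?V (cmap C ` cdom C) (F o cinv C) F'" by (rule Ck_function_C1[OF DY F C(1)])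
 have z0C: "?z0:cmap C ` cdom C" using C(2) by blast
 have hF: "has_fderiv ?V (F o cinv C) (F' ?z0) ?z0" using F' z0C unfolding C1_on_def by blast
 obtain x where x: "x:?V" "gradient Y gb F u=tvec Y u C x" "gb u (tvec Y u C x) (tvec Y u C x)=F' ?z0 x" "0<=F' ?z0 x"
  "!!a v. v:?V==>gb u (tvec Y u C (a *\<^sub>R v)) (tvec Y u C (a *\<^sub>R v))=a\<^sup>2 * gb u (tvec Y u C v) (tvec Y u C v)"
  "u:Crit Y F\<longleftrightarrow>F' ?z0 x=0"
  by (fact fiber_gradient[OF E X p r g F[unfolded Y_def] C[unfolded Y_def] hF, folded Y_def gb_def])
 define G where "G=sqrt (F' ?z0 x)"
 have G: "s0<=G" "0<G" "G * G=F' ?z0 x" 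
 proof -
  show "s0<=G" using s0(2) unfolding tnorm_def x(2,3) G_def .
  then show "0<G" using s0(1) by linarith
  show "G * G=F' ?z0 x" using x(4) by (simp add: G_def)
 qed
 \<comment> \<open>The factor 8 collects 2 from the distance estimate in charts, 2 from the crude
   triangle inequality, and 2 because linear part and error each contribute
   \<open>t / R\<close>.\<close>
 define R where "R=8 * real r"
 have R: "R>0" using r by (simp add: R_def)
 define v where "v=(- 1 / (R * G)) *\<^sub>R x"
 have v: "v:?V" unfolding v_def by (rule subspace_scale[OF V(1) x(1)])
 have Bv: "gb u (tvec Y u C v) (tvec Y u C v)=(1 / R)\<^sup>2"
  unfolding v_def x(5)[OF x(1)] x(3) G(3)[symmetric] using G(2) R by (simp add: power2_eq_square)
 have Lv: "F' ?z0 v = - (G / R)"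
  unfolding v_def blinear_on_scale[OF has_fderiv_linear[OF hF] x(1)] G(3)[symmetric] using G(2) R by simp
 have nv: "norm v + 1>0" by (simp add: add_nonneg_pos)
 let ?kap="%i z. cmap (d i) (cinv C z i)"
 have loc: "EX dlt>0. ALL z z'. z:?V-->dist z ?z0<dlt-->z':?V-->dist z' ?z0<dlt-->z:S&z':S &
   (ALL t>=0. z'=z + t *\<^sub>R v-->mdist E g (cinv C z' i) (cinv C z i)<=t / real r)" if i: "i<r" for i
 proof -
  note chd=dm_chart[OF DE d(1)[OF i]]
  have ui: "cinv C ?z0 i=u i" using cinv_cmap[OF ch C(2)] by simp
  obtain rho where rho: "rho>0" "!!v. v:cmodel (d i)==>dist v (cmap (d i) (u i))<rho==>v:cmap (d i) ` cdom (d i)"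
   "!!x y. x:cdom (d i)==>y:cdom (d i)==>dist (cmap (d i) x) (cmap (d i) (u i))<rho==>dist (cmap (d i) y) (cmap (d i) (u i))<rho ==>
    mdist E g x y<=2 * tnorm g (u i) (tvec E (u i) (d i) (cmap (d i) x - cmap (d i) y))" by (fact mdist_upper[OF E g d[OF i]])
  obtain b where b: "b>0" "!!v w. v:cmodel (d i)==>w:cmodel (d i)==>\<bar>g (u i) (tvec E (u i) (d i) v) (tvec E (u i) (d i) w)\<bar><=b * norm v * norm w"
   using metric_chart_bound[OF g DE d[OF i]] by blast
  \<comment> \<open>Chosen so that the linearisation error of coordinate \<open>i\<close>, measured
    by the metric with bound \<open>b\<close>, has length at most \<open>t / R\<close>, the same as
    the linear part.\<close>
  define eps where "eps=1 / (R * sqrt b * (norm v + 1))"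
  have eps: "eps>0" using R b nv by (simp add: eps_def)
  obtain dlt1 where dlt1: "dlt1>0" "!!y. y:?V==>dist y ?z0<dlt1==>y:S"
   "!!y z. y:?V==>dist y ?z0<dlt1==>z:?V==>dist z ?z0<dlt1==>norm (?kap i y - ?kap i z - kap' i ?z0 (y - z))<=eps * norm (y - z)"
   by (fact C1_on_strict[OF kap(5)[OF i] V(1) kap(1,2) eps])
  have "S<=?V" using kap(1) openin_imp_subset by blast
  from C1_on_continuous_on[OF kap(5)[OF i] V(1) this]
  obtain dlt2 where dlt2: "dlt2>0" "!!y. y:S==>dist y ?z0<dlt2==>dist (?kap i y) (?kap i ?z0)<rho"
   using kap(2) rho(1) unfolding continuous_on_iff by meson
  have hk: "blinear_on ?V (kap' i ?z0)" using kap(2) kap(5)[OF i] has_fderiv_linear unfolding C1_on_def by blast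
  show ?thesis
  proof (intro exI[of _ "min dlt1 dlt2"] conjI allI impI)
   show "min dlt1 dlt2>0" using dlt1 dlt2 by simp
   fix z z' assume z: "z:?V" "dist z ?z0<min dlt1 dlt2" "z':?V" "dist z' ?z0<min dlt1 dlt2"
   show zS: "z:S" "z':S" using dlt1(2) z by auto
   fix t :: real assume t: "0<=t" and z': "z'=z + t *\<^sub>R v"
   define w1 where "w1=t *\<^sub>R kap' i ?z0 v"
   define w2 where "w2=?kap i z' - ?kap i z - w1"
   have dz: "z' - z=t *\<^sub>R v" using z' by simp
   have w1: "w1:cmodel (d i)" using kap(6)[OF i v] chartD(2)[OF chd] by (simp add: w1_def subspace_scale)
   have kz: "?kap i y:cmodel (d i)" if "y:S" for y by (rule cmap_in_cmodel[OF chd kap(4)[OF that i]])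
   have w2: "w2:cmodel (d i)" unfolding w2_def using kz zS w1 chartD(2)[OF chd] by (simp add: subspace_diff)
   have "norm w2<=eps * norm (t *\<^sub>R v)"
    using dlt1(3)[of z' z] z blinear_on_scale[OF hk v, of t] unfolding dz w2_def w1_def by simp
   then have nw2: "norm w2<=eps * (t * norm v)" using t by simp
   have "tnorm g (u i) (tvec E (u i) (d i) w2)<=sqrt b * norm w2"
   proof -
    have "g (u i) (tvec E (u i) (d i) w2) (tvec E (u i) (d i) w2)<=b * (norm w2)\<^sup>2"
     using b(2)[OF w2 w2] by (simp add: power2_eq_square mult.assoc)
    from real_sqrt_le_mono[OF this] show ?thesis by (simp add: tnorm_def real_sqrt_mult)
   qed
   also have "...<=sqrt b * (eps * (t * norm v))" using nw2 b by (intro mult_left_mono) auto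
   also have "...=t * (norm v / (norm v + 1)) / R"
   proof -
    have "s * (1 / (R * s * n) * (t * m))=t * (m / n) / R" if "s~=0" for s n m :: real using that by simp
    then show ?thesis unfolding eps_def using b(1) by simp
   qed
   also have "...<=t / R" using t R nv by (intro divide_right_mono mult_left_le) (auto simp: divide_simps)
   finally have t2: "tnorm g (u i) (tvec E (u i) (d i) w2)<=t / R" .
   have t1: "tnorm g (u i) (tvec E (u i) (d i) w1)<=t / R"
   proof -
    have "g (u i) (tvec E (u i) (d i) (kap' i ?z0 v)) (tvec E (u i) (d i) (kap' i ?z0 v))<=gb u (tvec Y u C v) (tvec Y u C v)"
     unfolding gb_def kap(8)[OF v v]
    proof (rule member_le_sum[of i "{..<r}" "%i. g (u i) (tvec E (u i) (d i) (kap' i ?z0 v)) (tvec E (u i) (d i) (kap' i ?z0 v))"])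
     fix j assume j: "j:{..<r} - {i}"
     obtain c where "c>0" "!!v. v:cmodel (d j)==>c * (norm v)\<^sup>2<=g (u j) (tvec E (u j) (d j) v) (tvec E (u j) (d j) v)"
      using metric_chart_coercive[OF g DE d] j by blast
     then show "0<=g (u j) (tvec E (u j) (d j) (kap' j ?z0 v)) (tvec E (u j) (d j) (kap' j ?z0 v))"
      using kap(6)[OF _ v, of j] j by (meson DiffD1 lessThan_iff mult_nonneg_nonneg less_imp_le order_trans zero_le_power2)
    qed (use i in auto)
    from real_sqrt_le_mono[OF this] have "tnorm g (u i) (tvec E (u i) (d i) (kap' i ?z0 v))<=1 / R"
     unfolding Bv tnorm_def using R by simp
    then have "\<bar>t\<bar> * tnorm g (u i) (tvec E (u i) (d i) (kap' i ?z0 v))<=t * (1 / R)" 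
     unfolding abs_of_nonneg[OF t] by (rule mult_left_mono[OF _ t])
    then show ?thesis unfolding w1_def tnorm_scale[OF g DE d[OF i] kap(6)[OF i v]] by simp
   qed
   have sm: "?kap i z' - ?kap i z=w1 + w2" by (simp add: w2_def)
   have "mdist E g (cinv C z' i) (cinv C z i)<=2 * tnorm g (u i) (tvec E (u i) (d i) (w1 + w2))"
    using rho(3)[OF kap(4)[OF zS(2) i] kap(4)[OF zS(1) i]] dlt2(2) zS z unfolding sm ui by simp
   also have "...<=2 * (2 * (t / R + t / R))"
    using order_trans[OF tnorm_add_le[OF g DE d[OF i] w1 w2] mult_left_mono[OF add_mono[OF t1 t2], of 2]] by simp
   also have "...=t / real r" using r by (simp add: R_def)
   finally show "mdist E g (cinv C z' i) (cinv C z i)<=t / real r" .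
  qed
 qed
 then obtain dltf where dltf: "!!i. i<r==>dltf i>0"
  "!!i z z'. i<r==>z:?V==>dist z ?z0<dltf i==>z':?V==>dist z' ?z0<dltf i==>z:S&z':S &
   (ALL t>=0. z'=z + t *\<^sub>R v-->mdist E g (cinv C z' i) (cinv C z i)<=t / real r)" by metis
 \<comment> \<open>With this tolerance for \<open>F\<close> the error over time \<open>t\<close> is
   at most half of the guaranteed drop \<open>t * s0 / R\<close>.\<close>
 have "s0 / (2 * R * (norm v + 1))>0" using s0 R nv by simp
 from C1_on_strict[OF F' V(1) chartD(4)[OF ch] z0C this]
 obtain dlt3 where dlt3: "dlt3>0" "!!y. y:?V==>dist y ?z0<dlt3==>y:cmap C ` cdom C"
  "!!y z. y:?V==>dist y ?z0<dlt3==>z:?V==>dist z ?z0<dlt3 ==>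
   norm ((F o cinv C) y - (F o cinv C) z - F' ?z0 (y - z))<=s0 / (2 * R * (norm v + 1)) * norm (y - z)" by metis
 define dlt0 where "dlt0=Min (insert dlt3 (dltf ` {..<r}))"
 have dlt0: "dlt0>0" "dlt0<=dlt3" "!!i. i<r==>dlt0<=dltf i" using dltf(1) dlt3(1) by (auto simp: dlt0_def)
 \<comment> \<open>A start within \<open>dlt0 / 2\<close> of the centre followed by a chart
   displacement of at most \<open>dlt0 / 2\<close> stays in the ball where all estimates
   hold.\<close>
 define dlt where "dlt=dlt0 / (2 * (norm v + 1))"
 define N0 where "N0={z:?V. dist z ?z0<dlt0 / 2}"
 have N0C: "N0<=cmap C ` cdom C" using dlt3(2) dlt0 by (auto simp: N0_def)
 define N where "N=cinv C ` N0"
 define H where "H=(%(y, t). cinv C (cmap C y + t *\<^sub>R v))"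
 have near: "cmap C y:N0" "y:cdom C" "cinv C (cmap C y)=y" if "y:N" for y
 proof -
  obtain z where z: "z:N0" "y=cinv C z" using \<open>y:N\<close> by (auto simp: N_def)
  then have zc: "z:cmap C ` cdom C" using N0C by blast
  show "y:cdom C" using cinv_in[OF zc] z by simp
  show "cmap C y:N0" using cmap_cinv[OF zc] z by simp
  show "cinv C (cmap C y)=y" using cmap_cinv[OF zc] z by simp
 qed
 have step: "cmap C y + t *\<^sub>R v:?V" "dist (cmap C y + t *\<^sub>R v) ?z0<dlt0" "cmap C y:?V" "dist (cmap C y) ?z0<dlt0"
  if yt: "y:N" "t:{0..dlt}" for y t
 proof -
  have yV: "cmap C y:?V" "dist (cmap C y) ?z0<dlt0 / 2" using near(1)[OF yt(1)] by (auto simp: N0_def)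
  show "cmap C y + t *\<^sub>R v:?V" using V(1) v yV(1) by (simp add: subspace_add subspace_scale)
  have "t * norm v<=dlt * (norm v + 1)" using yt(2) by (intro mult_mono) auto
  also have "...=dlt0 / 2"
  proof -
   have h: "a / (2 * n) * n=a / 2" if "n~=0" for a n :: real using that by simp
   show ?thesis unfolding dlt_def by (rule h) (use nv in simp)
  qed
  finally have "dist (cmap C y + t *\<^sub>R v) (cmap C y)<=dlt0 / 2" using yt(2) by (simp add: dist_norm)
  then show "dist (cmap C y + t *\<^sub>R v) ?z0<dlt0" using yV(2) dist_triangle[of "cmap C y + t *\<^sub>R v" ?z0 "cmap C y"] by linarith
  show "cmap C y:?V" "dist (cmap C y) ?z0<dlt0" using yV dlt0(1) by auto
 qed
 have stepC: "cmap C y + t *\<^sub>R v:cmap C ` cdom C" if "y:N" "t:{0..dlt}" for y t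
  using dlt3(2) step(1,2)[OF that] dlt0(2) by auto
 have oN: "openin (mtop Y) N" unfolding N_def
 proof (rule openin_cinv_image[OF ch _ N0C])
  show "openin (top_of_set ?V) N0"
   using openin_open_Int[OF open_ball[of ?z0 "dlt0 / 2"], of ?V] by (simp add: N0_def Int_def dist_commute ball_def)
 qed
 have uN: "u:N" unfolding N_def using cinv_cmap[OF ch C(2)] z0V dlt0(1) by (intro image_eqI[of _ _ ?z0]) (auto simp: N0_def)
 have NC: "N<=cdom C" using near(2) by blast
 have cH: "continuous_map (prod_topology (subtopology (mtop Y) N) (top_of_set {0..dlt})) (mtop Y) H"
 proof -
  let ?P="prod_topology (subtopology (mtop Y) N) (top_of_set {0..dlt})"
  have "continuous_map (subtopology (mtop Y) N) euclidean (cmap C)"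
   using continuous_map_into_fulltopology[OF continuous_map_from_subtopology_mono[OF continuous_map_cmap[OF ch] NC]] .
  from continuous_map_compose[OF continuous_map_fst this]
  have c1: "continuous_map ?P euclidean (%q. cmap C (fst q))" by (simp add: comp_def)
  have "continuous_map ?P euclideanreal snd" by (rule continuous_map_into_fulltopology[OF continuous_map_snd])
  from continuous_map_compose[OF this, of euclidean "%t. t *\<^sub>R v"]
  have c2: "continuous_map ?P euclidean (%q. snd q *\<^sub>R v)" by (simp add: comp_def continuous_intros)
  have "continuous_map ?P (top_of_set (cmap C ` cdom C)) (%q. cmap C (fst q) + snd q *\<^sub>R v)"
   unfolding continuous_map_in_subtopology
  proof (intro conjI continuous_map_add c1 c2)
   show "(%q. cmap C (fst q) + snd q *\<^sub>R v):topspace ?P \<rightarrow> cmap C ` cdom C" using stepC by auto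
  qed
  from continuous_map_compose[OF this continuous_map_cinv[OF ch]] show ?thesis by (simp add: H_def comp_def case_prod_unfold)
 qed
 have "M.local_descent F (s0 / (16 * real r)) N dlt H"
  unfolding M.local_descent_def top
 proof (intro conjI oN cH ballI)
  show "dlt>0" using dlt0 nv by (simp add: dlt_def)
  fix y t assume yt: "y:N" "t:{0..dlt}"
  note s=step[OF yt]
  let ?a="cmap C y" and ?b="cmap C y + t *\<^sub>R v"
  have Hy: "H (y, t)=cinv C ?b" "y=cinv C ?a" using near(3)[OF yt(1)] by (simp_all add: H_def)
  have "D (H (y, t)) y=(\<Sum>i<r. mdist E g (cinv C ?b i) (cinv C ?a i))"
   unfolding D_def sum_dist_def Hy(1) using Hy(2) by simp
  also have "...<=(\<Sum>i<r. t / real r)"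
  proof (rule sum_mono)
   fix i assume "i:{..<r}"
   then have i: "i<r" by simp
   show "mdist E g (cinv C ?b i) (cinv C ?a i)<=t / real r"
    using dltf(2)[OF i s(3) _ s(1)] s(2,4) dlt0(3)[OF i] yt(2) by auto
  qed
  also have "...=t" using r by simp
  finally show "D (H (y, t)) y<=t" .
  have "norm ((F o cinv C) ?b - (F o cinv C) ?a - F' ?z0 (t *\<^sub>R v))<=s0 / (2 * R * (norm v + 1)) * norm (t *\<^sub>R v)"
   using dlt3(3)[OF s(1) _ s(3)] s(2,4) dlt0(2) by simp
  then have "\<bar>F (H (y, t)) - F y - t * F' ?z0 v\<bar><=s0 / (2 * R * (norm v + 1)) * (t * norm v)"
   using Hy blinear_on_scale[OF has_fderiv_linear[OF hF] v, of t] yt(2) by simp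
  also have "...=t * s0 / (2 * R) * (norm v / (norm v + 1))" using nv R by (simp add: field_simps)
  also have "...<=t * s0 / (2 * R)" using yt(2) s0 R nv by (intro mult_left_le) (auto simp: divide_simps)
  finally have "F (H (y, t))<=F y + t * F' ?z0 v + t * s0 / (2 * R)" by (simp add: abs_le_iff)
  moreover have "t * F' ?z0 v <= - (t * s0 / R)"
  proof -
   have "t * s0 / R<=t * G / R" using yt(2) G(1) R by (intro divide_right_mono mult_left_mono) auto
   then show ?thesis unfolding Lv by simp
  qed
  moreover have "t * s0 / (2 * R)=t * s0 / R / 2" by simp
  moreover have "s0 / (16 * real r) * t=t * s0 / R / 2" by (simp add: R_def)
  moreover have "h<=f - e" if "h<=f + a + b" "a <= - c" "b=c / 2" "e=c / 2" for h f a b c e :: real using that by linarith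
  ultimately show "F (H (y, t))<=F y - s0 / (16 * real r) * t" by blast
 qed
 then show ?thesis using uN by blast
qed

section \<open>Passing a level\<close>

lemma (in Metric_space) local_descent_mono:
 assumes "local_descent F sig N dlt H" "sig'<=sig" shows "local_descent F sig' N dlt H"
proof -
 have "F y - sig * t<=F y - sig' * t" if "t:{0..dlt}" for y t
  using mult_right_mono[OF assms(2), of t] that by simp
 then show ?thesis using assms(1) unfolding local_descent_def by (meson order_trans)
qed

lemma inverse_Suc_small: "e>0==>\<forall>\<^sub>F n in sequentially. 1 / real (Suc n)<e"
 using order_tendstoD(2)[OF LIMSEQ_Suc[OF lim_1_over_n], of e] by simp

text \<open>The Palais-Smale condition gives a uniform rate of descent near a level, away from its critical set;
  no continuity of the gradient norm is needed because the sets on which descent is possible are open.\<close>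

lemma (in Metric_space) uniform_descent:
 fixes F gn :: "'a=>real"
 assumes F: "continuous_map mtopology euclideanreal F"
  and kap: "kap>0" and gn: "!!u. u:M==>0<=gn u"
  and desc: "!!u s. u:M==>0<s==>s<=gn u==>EX N dlt H. u:N&local_descent F (kap * s) N dlt H"
  and PS: "!!s b. range s<=M==>(!!n. \<bar>F (s n)\<bar><=b)==>(%n. gn (s n)) \<longlonglongrightarrow> 0 ==>
   EX l k. strict_mono k&limitin mtopology (s o k) l sequentially"
  and U: "openin mtopology U" "!!u. u:M==>F u=c==>gn u=0==>u:U"
 obtains eps sig where "eps>0" "sig>0"
  "!!u. u:M==>\<bar>F u - c\<bar><=eps==>u \<notin> U==>EX N dlt H. u:N&local_descent F sig N dlt H"
proof (rule ccontr)
 assume "\<not> thesis"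
 \<comment> \<open>Failure for all constants is tested with \<open>eps = 1 / (n + 1)\<close> and a
   rate to which \<open>desc\<close> would apply as soon as \<open>gn\<close> is at least
   \<open>1 / (n + 1)\<close>. Hence \<open>gn\<close> tends to zero along the sequence of
   counterexamples.\<close>
 then have "EX u. u:M&\<bar>F u - c\<bar><=1 / real (Suc n)&u \<notin> U&\<not> (EX N dlt H. u:N&local_descent F (kap * (1 / real (Suc n))) N dlt H)" for n
  using that[of "1 / real (Suc n)" "kap * (1 / real (Suc n))"] kap by fastforce
 then obtain s where s: "!!n. s n:M" "!!n. \<bar>F (s n) - c\<bar><=1 / real (Suc n)" "!!n. s n \<notin> U"
  "!!n N dlt H. s n:N==>\<not> local_descent F (kap * (1 / real (Suc n))) N dlt H" by metis
 have g1: "gn (s n)<1 / real (Suc n)" for n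
 proof (rule ccontr)
  assume "\<not> gn (s n)<1 / real (Suc n)"
  then show False using desc[OF s(1), of "1 / real (Suc n)" n] s(4)[of n] by auto
 qed
 have to0: "(%n. 1 / real (Suc n)) \<longlonglongrightarrow> 0" using LIMSEQ_Suc[OF lim_1_over_n] .
 have gs: "(%n. gn (s n)) \<longlonglongrightarrow> 0"
  by (rule tendsto_sandwich[OF _ _ tendsto_const to0]) (use gn s(1) g1 in \<open>auto intro!: always_eventually less_imp_le\<close>)
 have "\<bar>F (s n)\<bar><=\<bar>c\<bar> + 1" for n
 proof -
  have "1 / real (Suc n)<=1" by simp
  then show ?thesis using s(2)[of n] by linarith
 qed
 then obtain l k where lk: "strict_mono k" "limitin mtopology (s o k) l sequentially"
  using PS[of s "\<bar>c\<bar> + 1"] s(1) gs by blast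
 have lM: "l:M" using limitin_topspace[OF lk(2)] by simp
 have kn: "filterlim k sequentially sequentially" using lk(1) by (rule filterlim_subseq)
 have "F l=c"
 proof -
  have "limitin euclideanreal (F o (s o k)) (F l) sequentially" by (rule continuous_map_limit[OF F lk(2)])
  then have 1: "(%n. F (s (k n))) \<longlonglongrightarrow> F l" by (simp add: comp_def)
  have "(%n. F (s n) - c) \<longlonglongrightarrow> 0" by (rule Lim_null_comparison[OF _ to0]) (use s(2) in simp)
  then have "(%n. F (s n)) \<longlonglongrightarrow> c" by (simp add: LIM_zero_iff)
  then have "(%n. F (s (k n))) \<longlonglongrightarrow> c" using filterlim_compose[OF _ kn] by blast
  then show ?thesis using 1 LIMSEQ_unique by blast
 qed
 moreover have "gn l=0"
 proof (rule ccontr)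
  assume "gn l~=0"
  then have pos: "gn l>0" using gn[OF lM] by simp
  \<comment> \<open>If \<open>gn l\<close> were positive, the open set \<open>N\<close> around the
    limit would contain late members of the sequence and allow descent there at a rate already
    excluded for them.\<close>
  then obtain N dlt H where N: "l:N" "local_descent F (kap * gn l) N dlt H" using desc[OF lM pos order_refl] by blast
  have "openin mtopology N" using N(2) by (simp add: local_descent_def)
  then have e1: "\<forall>\<^sub>F n in sequentially. s (k n):N" using lk(2) N(1) unfolding limitin_def by auto
  have e2: "\<forall>\<^sub>F n in sequentially. 1 / real (Suc (k n))<gn l"
   using inverse_Suc_small[OF pos] kn unfolding filterlim_iff by blast
  obtain n where n: "s (k n):N" "1 / real (Suc (k n))<gn l"
   using eventually_happens[OF eventually_conj[OF e1 e2]] by auto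
  have "local_descent F (kap * (1 / real (Suc (k n)))) N dlt H"
   by (rule local_descent_mono[OF N(2)]) (use n(2) kap in \<open>intro mult_left_mono; simp\<close>)
  then show False using s(4) n(1) by blast
 qed
 ultimately have "l:U" using U(2) lM by blast
 then have "\<forall>\<^sub>F n in sequentially. s (k n):U" using lk(2) U(1) unfolding limitin_def by auto
 then show False using s(3) by (simp add: eventually_False)
qed

text \<open>An open \<open>U\<close> around \<open>K\<close> has the same bound as \<open>K\<close>.
  Points of the sublevel set outside a \<open>2 * dlt\<close> neighbourhood of \<open>K\<close>
  descend so cheaply that they stay outside the \<open>dlt\<close> neighbourhood \<open>V\<close>,
  where the uniform rate holds; homotopy invariance compares them with the lower sublevel set, and
  the rest lies in \<open>U\<close>.\<close>

theorem TC_pass_level: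
 fixes F gn :: "(nat=>'e)=>real" and TE :: "'e topology" and p :: "'e=>'x" and r :: nat
 defines "T \<equiv> fiber_product_topology r TE p"
 assumes r: "2<=r" and p: "hurewicz_fibration TE TX p"
  and MS: "Metric_space M D" and top: "Metric_space.mtopology M D=T" and cmp: "Metric_space.mcomplete M D"
  and F: "continuous_map T euclideanreal F"
  and kap: "kap>0" and gn: "!!u. u:M==>0<=gn u"
  and desc: "!!u s. u:M==>0<s==>s<=gn u==>EX N dlt H. u:N&Metric_space.local_descent M D F (kap * s) N dlt H"
  and PS: "!!s b. range s<=M==>(!!n. \<bar>F (s n)\<bar><=b)==>(%n. gn (s n)) \<longlonglongrightarrow> 0 ==>
   EX l k. strict_mono k&limitin T (s o k) l sequentially"
  and K: "K={u:M. F u=c&gn u=0}" "compactin T K"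
 shows "EX eps>0. TC r TE p (sublevel M F (c + eps))<=TC r TE p (sublevel M F (c - eps)) + TC r TE p K"
proof (cases "TC r TE p K")
 case infinity
 then show ?thesis by (intro exI[of _ 1]) simp
next
 case (enat n)
 interpret Metric_space M D by (rule MS)
 have "TC r TE p K<=enat n" using enat by simp
 from TC_leE[OF r this] obtain Us where Us: "K<=(\<Union>i<n. Us i)" "!!i. i<n==>sectional r TE p (Us i)" by blast
 define U where "U=(\<Union>i<n. Us i)"
 have oU: "openin mtopology U" unfolding U_def top T_def using Us(2) by (intro openin_Union) (auto simp: sectional_def)
 have TCU: "TC r TE p U<=TC r TE p K" unfolding enat U_def by (rule TC_leI[OF r order_refl Us(2)])
 have cK: "compactin mtopology K" using K(2) top by simp
 have KM: "K<=M" using K(1) by blast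
 have "EX dlt>0. ALL y:K. ALL z:M. D y z<2 * dlt-->z:U"
 proof (rule ccontr)
  assume neg: "\<not> ?thesis"
  have "EX y z. y:K&z:M&D y z<2 * (1 / real (Suc n))&z \<notin> U" for n
  proof -
   have "1 / real (Suc n)>0" by simp
   then show ?thesis using neg by blast
  qed
  then obtain y z where yz: "!!n. y n:K" "!!n. z n:M" "!!n. D (y n) (z n)<2 * (1 / real (Suc n))" "!!n. z n \<notin> U" by metis
  have "range y<=K" using yz(1) by blast
  then obtain l k where lk: "l:K" "strict_mono k" "limitin mtopology (y o k) l sequentially"
   using cK[unfolded compactin_sequentially, THEN conjunct2, THEN spec, of y] by blast
  have "l:U" using lk(1) Us(1) unfolding U_def by (rule rev_subsetD)
  then obtain e where e: "e>0" "mball l e<=U" using oU unfolding openin_mtopology by blast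
  have e1: "\<forall>\<^sub>F n in sequentially. D (y (k n)) l<e / 2"
   using lk(3) e(1) unfolding limitin_metric by (auto elim!: allE[of _ "e / 2"] eventually_mono)
  have kn: "filterlim k sequentially sequentially" using lk(2) by (rule filterlim_subseq)
  have "e / 4>0" using e by simp
  then have e2: "\<forall>\<^sub>F n in sequentially. 1 / real (Suc (k n))<e / 4"
   using inverse_Suc_small kn unfolding filterlim_iff by blast
  obtain n where n: "D (y (k n)) l<e / 2" "1 / real (Suc (k n))<e / 4"
   using eventually_happens[OF eventually_conj[OF e1 e2]] by auto
  have lM: "l:M" "y (k n):M" using lk(1) yz(1) KM by auto
  have "D l (z (k n))<=D l (y (k n)) + D (y (k n)) (z (k n))" by (rule triangle[OF lM(1,2) yz(2)])
  then have "D l (z (k n))<e" using n yz(3)[of "k n"] commute[of l "y (k n)"] by linarith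
  then show False using e(2) yz(2,4)[of "k n"] lM(1) by auto
 qed
 then obtain dlt where dlt: "dlt>0" "!!y z. y:K==>z:M==>D y z<2 * dlt==>z:U" by blast
 define V where "V=(\<Union>y\<in>K. mball y dlt)"
 have oV: "openin mtopology V" unfolding V_def by (intro openin_Union) auto
 have KV: "u:V" if "u:M" "F u=c" "gn u=0" for u
  using that dlt(1) K(1) unfolding V_def by (intro UN_I[of u]) auto
 obtain eps0 sig where es: "eps0>0" "sig>0"
  "!!u. u:M==>\<bar>F u - c\<bar><=eps0==>u \<notin> V==>EX N dlt H. u:N&local_descent F sig N dlt H"
  by (rule uniform_descent[OF F[folded top] kap gn desc PS[folded top] oV KV]) (assumption+, blast)
 \<comment> \<open>A drop from \<open>c + eps\<close> to \<open>c - 2 * eps\<close> amounts to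
   \<open>3 * eps\<close>, which buys a distance below \<open>dlt\<close> since
   \<open>4 * eps <= sig * dlt\<close>; all levels met stay within \<open>eps0\<close> of
   \<open>c\<close>.\<close>
 define eps where "eps=min (eps0 / 2) (sig * dlt / 4)"
 have eps: "eps>0" "2 * eps<=eps0" "4 * eps<=sig * dlt" using es(1,2) dlt(1) by (auto simp: eps_def)
 define R where "R={u:M. \<bar>F u - c\<bar><=eps0&u \<notin> V}"
 define A where "A={u:sublevel M F (c + eps). ALL y:K. 2 * dlt<=D y u}"
 have AM: "A<=M" by (auto simp: A_def sublevel_def)
 have Rd: "EX N dlt H. x:N&local_descent F sig N dlt H" if "x:R" for x using that es(3) unfolding R_def by blast
 have a12: "c - 2 * eps<c - eps" using eps(1) by simp
 have reach: "z:R" if y: "y:A" and z: "z:M" "c - 2 * eps<=F z" "sig * D y z<=F y - F z" for y z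
 proof -
  have yM: "y:M" "F y<=c + eps" using y by (auto simp: A_def sublevel_def)
  have "0<=sig * D y z" using es(2) by simp
  then have Fz: "F z<=c + eps" using z(3) yM(2) by linarith
  have "sig * D y z<sig * dlt" using z(2,3) yM(2) eps by linarith
  then have dyz: "D y z<dlt" using es(2) by simp
  have "z \<notin> V"
  proof
   assume "z:V"
   then obtain k where k: "k:K" "D k z<dlt" by (auto simp: V_def)
   have "2 * dlt<=D k y" using y k(1) by (auto simp: A_def)
   also have "...<=D k z + D z y" using triangle[of k z y] k(1) KM z(1) yM(1) by blast
   finally show False using k(2) dyz commute[of z y] by linarith
  qed
  then show ?thesis using Fz z(1,2) eps by (auto simp: R_def abs_le_iff)
 qed
 obtain G b where Gb: "openin mtopology G" "A<=G" "continuous_map (prod_topology (subtopology mtopology G) UI) mtopology b"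
  "!!y. y:G==>b (y, 0)=y" "!!y. y:G==>F (b (y, 1))<c - eps"
  by (rule deformation[OF cmp F[folded top] es(2) Rd a12 AM reach]) (assumption+, blast)
 have bM: "b (y, 1):M" if "y:G" for y
 proof -
  have "(y, 1):topspace (prod_topology (subtopology mtopology G) UI)" using that openin_subset[OF Gb(1)] by auto
  then show ?thesis using continuous_map_funspace[OF Gb(3)] by auto
 qed
 have TCA: "TC r TE p A<=TC r TE p (sublevel M F (c - eps))"
 proof (rule TC_homotopy_le[OF r p Gb(1)[unfolded top T_def] Gb(3)[unfolded top T_def] Gb(4) Gb(2)])
  show "b (u, 1):sublevel M F (c - eps)" if "u:A" for u
   using Gb(2,5) bM that by (force simp: sublevel_def less_imp_le)
 qed
 have "sublevel M F (c + eps)<=A \<union> U"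
 proof
  fix u assume u: "u:sublevel M F (c + eps)"
  show "u:A \<union> U"
  proof (cases "ALL y:K. 2 * dlt<=D y u")
   case False
   then obtain y where "y:K" "D y u<2 * dlt" by force
   then show ?thesis using dlt(2) u by (auto simp: sublevel_def)
  qed (use u in \<open>simp add: A_def\<close>)
 qed
 then have "TC r TE p (sublevel M F (c + eps))<=TC r TE p (A \<union> U)" by (rule TC_mono[OF r])
 also have "...<=TC r TE p A + TC r TE p U" by (rule TC_Un_le[OF r])
 also have "...<=TC r TE p (sublevel M F (c - eps)) + TC r TE p K" by (rule add_mono[OF TCA TCU])
 finally show ?thesis using eps(1) by blast
qed

section \<open>Summation over the levels\<close>

lemma infsum_enat_SUP: "infsum w A=(SUP F\<in>{F. finite F&F<=A}. sum w F)" for w :: "real=>enat"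
 by (rule nonneg_infsum_complete) simp

text \<open>The infinite sum is the supremum of finite sums, and adjoining the new index
  \<open>c\<close> to each of them costs \<open>w c\<close>. When the total is finite,
  \<open>w c\<close> can be subtracted from the bound before the supremum is taken.\<close>

lemma infsum_enat_insert_le:
 fixes w :: "real=>enat"
 assumes "a<c" "c<=b"
 shows "infsum w {..a} + w c<=infsum w {..b}"
proof (cases "infsum w {..b}")
 case (enat m)
 have le: "sum w S + w c<=enat m" if "finite S" "S<={..a}" for S
 proof -
  have "c \<notin> S" using that assms by auto
  then have "sum w S + w c=sum w (insert c S)" using that(1) by (simp add: add.commute)
  also have "...<=infsum w {..b}" unfolding infsum_enat_SUP using that assms by (intro SUP_upper) auto
  finally show ?thesis using enat by simp
 qed
 have "w c<=enat m" using le[of "{}"] by simp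
 then obtain k where k: "w c=enat k" "k<=m" by (cases "w c") auto
 have "infsum w {..a}<=enat (m - k)"
  unfolding infsum_enat_SUP
 proof (rule SUP_least)
  fix S assume "S:{S. finite S&S<={..a}}"
  then show "sum w S<=enat (m - k)" using le[of S] k by (cases "sum w S") auto
 qed
 then have "infsum w {..a} + w c<=enat (m - k) + enat k" unfolding k(1) by (rule add_right_mono)
 then show ?thesis using k(2) enat by simp
qed simp

text \<open>No discreteness of the levels with positive weight is assumed, so one argues at the
  supremum \<open>s\<close> of the levels up to which the bound holds. One step across
  \<open>s\<close> carries the bound beyond it, so \<open>s\<close> cannot lie below
  \<open>l\<close>.\<close>

lemma sum_over_levels:
 fixes w tc :: "real=>enat"
 assumes mono: "!!a b. a<=b==>tc a<=tc b" and base: "tc a0=0"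
  and step: "!!c. EX eps>0. tc (c + eps)<=tc (c - eps) + w c"
 shows "tc l<=infsum w {..l}"
proof -
 define P where "P=(%a. tc a<=infsum w {..a})"
 define S where "S={a. a<=l&(ALL a'<=a. P a')}"
 have P0: "P a" if "a<=a0" for a using mono[OF that] base by (simp add: P_def)
 have ne: "min a0 l:S" unfolding S_def mem_Collect_eq using P0 by (intro conjI allI impI) simp_all
 have bdd: "bdd_above S" by (intro bdd_aboveI[of _ l]) (simp add: S_def)
 define s where "s=Sup S"
 have sl: "s<=l" unfolding s_def
 proof (rule cSup_least)
  show "S~={}" using ne by blast
  show "x<=l" if "x:S" for x using that by (simp add: S_def)
 qed
 obtain eps where eps: "eps>0" "tc (s + eps)<=tc (s - eps) + w s" using step by blast
 have below: "P a" if "a<s" for a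
 proof -
  have "EX x:S. a<x"
   by (rule iffD1[OF less_cSup_iff]) (use that ne bdd in \<open>auto simp only: s_def\<close>)
  then obtain x where "x:S" "a<x" by blast
  then show ?thesis unfolding S_def mem_Collect_eq by (meson less_imp_le)
 qed
 \<comment> \<open>The bound is known at \<open>s - eps\<close>, strictly below \<open>s\<close>, so
   the weight at \<open>s\<close> is not yet counted there and enters the larger sum once.\<close>
 have above: "P b" if b: "s<=b" "b<=s + eps" for b
 proof -
  have "tc b<=tc (s + eps)" by (rule mono[OF b(2)])
  also note eps(2)
  also have "tc (s - eps) + w s<=infsum w {..s - eps} + w s"
   using below[of "s - eps"] eps(1) unfolding P_def by (intro add_right_mono) simp
  also have "...<=infsum w {..b}" using eps(1) b(1) by (intro infsum_enat_insert_le) auto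
  finally show ?thesis by (simp add: P_def)
 qed
 have all: "P b" if "b<=s + eps" for b using below above that by (cases "b<s") auto
 then have "min l (s + eps):S" by (auto simp: S_def)
 then have "min l (s + eps)<=s" unfolding s_def using bdd by (intro cSup_upper)
 then have "l<=s + eps" using eps(1) by (auto simp: min_def split: if_splits)
 then show ?thesis using all unfolding P_def by blast
qed

section \<open>Continuity of the function and its critical points in charts\<close>

lemma Ck_function_continuous:
 assumes Y: "diff_manifold Y" and F: "Ck_function 1 Y F"
 shows "continuous_map (mtop Y) euclideanreal F"
proof (rule pasting_lemma[where I="atlas Y" and T=cdom and f="%_. F"])
 fix C assume C: "C:atlas Y"
 note ch=dm_chart[OF Y C]
 show "openin (mtop Y) (cdom C)" by (rule chartD(1)[OF ch])
 obtain F' where F': "C1_on (cmodel C) (cmap C ` cdom C) (F o cinv C) F'" by (rule Ck_function_C1[OF Y F C])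
 have "cmap C ` cdom C<=cmodel C" using cmap_in_cmodel[OF ch] by blast
 from C1_on_continuous_on[OF F' chartD(2)[OF ch] this]
 have "continuous_map (top_of_set (cmap C ` cdom C)) euclideanreal (F o cinv C)" by simp
 from continuous_map_compose[OF continuous_map_cmap[OF ch] this]
 show "continuous_map (subtopology (mtop Y) (cdom C)) euclideanreal F"
  by (rule continuous_map_eq) (use cinv_cmap[OF ch] in auto)
next
 fix x assume "x:mpoints Y"
 then obtain C where "C:atlas Y" "x:cdom C" by (rule diff_manifold_cover[OF Y])
 then show "EX C. C:atlas Y&x:cdom C&F x=F x" by blast
qed simp

lemma Crit_iff_chart:
 assumes Y: "diff_manifold Y" and F: "Ck_function 1 Y F" and C: "C:atlas Y" "u:cdom C"
  and F': "C1_on (cmodel C) (cmap C ` cdom C) (F o cinv C) F'"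
 shows "u:Crit Y F\<longleftrightarrow>(ALL v:cmodel C. F' (cmap C u) v=0)"
proof -
 note ch=dm_chart[OF Y C(1)]
 have hF: "has_fderiv (cmodel C) (F o cinv C) (F' (cmap C u)) (cmap C u)" using F' C(2) unfolding C1_on_def by blast
 have Fd: "EX F'. has_fderiv (cmodel c) (F o cinv c) F' (cmap c u)" if c: "c:atlas Y" "u:cdom c" for c
 proof -
  obtain G where "C1_on (cmodel c) (cmap c ` cdom c) (F o cinv c) G" by (rule Ck_function_C1[OF Y F c(1)])
  then show ?thesis using c(2) unfolding C1_on_def by blast
 qed
 have rd: "rdiff F u (tvec Y u C v)=F' (cmap C u) v" if v: "v:cmodel C" for v
  using rdiff_tvec[OF Y C v Fd] fderiv_eq[OF hF chartD(2)[OF ch] cmap_in_cmodel[OF ch C(2)] v] by simp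
 have "u:mpoints Y" using chartD(6)[OF ch] C(2) by blast
 then show ?thesis using rd unfolding Crit_def mem_Collect_eq tangent_space_eq[OF Y C] by auto
qed

text \<open>At a noncritical point some fixed chart vector \<open>v\<close> has nonzero derivative,
  and this persists nearby since \<open>F'\<close> applied to \<open>v\<close> is continuous.
  Continuity of the gradient norm is thereby avoided.\<close>

lemma closedin_Crit:
 assumes Y: "diff_manifold Y" and F: "Ck_function 1 Y F"
 shows "closedin (mtop Y) (Crit Y F)"
 unfolding closedin_def
proof (intro conjI)
 show "Crit Y F<=mpoints Y" by (auto simp: Crit_def)
 show "openin (mtop Y) (mpoints Y - Crit Y F)"
 proof (subst openin_subopen, intro ballI)
  fix u assume u: "u:mpoints Y - Crit Y F"
  then obtain C where C: "C:atlas Y" "u:cdom C" using diff_manifold_cover[OF Y] by blast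
  note ch=dm_chart[OF Y C(1)]
  obtain F' where F': "C1_on (cmodel C) (cmap C ` cdom C) (F o cinv C) F'" by (rule Ck_function_C1[OF Y F C(1)])
  obtain v where v: "v:cmodel C" "F' (cmap C u) v~=0" using u Crit_iff_chart[OF Y F C F'] by blast
  have "continuous_on (cmap C ` cdom C) (%z. F' z v)" by (rule C1_on_deriv_continuous[OF F' v(1)])
  then have c0: "continuous_map (top_of_set (cmap C ` cdom C)) euclideanreal (%z. F' z v)" by simp
  have c1: "continuous_map (subtopology (mtop Y) (cdom C)) euclideanreal (%y. F' (cmap C y) v)"
   using continuous_map_compose[OF continuous_map_cmap[OF ch] c0] by (simp add: comp_def)
  let ?N="{y:topspace (subtopology (mtop Y) (cdom C)). F' (cmap C y) v:- {0}}"
  have "openin (subtopology (mtop Y) (cdom C)) ?N" by (rule openin_continuous_map_preimage[OF c1]) auto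
  then have "openin (mtop Y) ?N" by (rule openin_trans_full[OF _ chartD(1)[OF ch]])
  moreover have "u:?N" using u C(2) v(2) by auto
  moreover have "?N<=mpoints Y - Crit Y F" using Crit_iff_chart[OF Y F C(1) _ F'] v(1) by auto
  ultimately show "EX T. openin (mtop Y) T&u:T&T<=mpoints Y - Crit Y F" by blast
 qed
qed

theorem theorem6p5:
  fixes r :: nat
    and E :: "('e, 'm::banach) manifold"
    and X :: "('x, 'n::banach) manifold"
    and p :: "'e \<Rightarrow> 'x"
    and g :: "('e, 'm) metric"
    and F :: "(nat \<Rightarrow> 'e) \<Rightarrow> real"
    and l :: real
  defines "Y \<equiv> fiber_product_manifold r E p"
    and "gbar \<equiv> fiber_product_metric r E p g"
  assumes "2 \<le> r"
    and "banach_manifold E" "paracompact_space (mtop E)"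
    and "banach_manifold X" "paracompact_space (mtop X)"
    and "smooth_map E X p"
    and "hurewicz_fibration (mtop E) (mtop X) p"
    and "submersion E X p"
    and "p ` mpoints E = mpoints X"
    and "\<forall>x\<in>mpoints X. path_connectedin (mtop E) {e \<in> mpoints E. p e = x}"
    and "riemannian_metric E g" "complete_metric E g"
    and "Ck_function 1 Y F"
    and "bdd_below (F ` mpoints Y)"
    and "palais_smale Y gbar F"
    and "vertically_proportional Y X (fiber_proj p) gbar (gradient Y gbar F)"
  shows "TC r (mtop E) p (sublevel (mpoints Y) F l)
      \<le> (\<Sum>\<^sub>\<infinity>\<mu>\<in>{..l}. SUP C\<in>crit_components Y F \<mu>. TC r (mtop E) p C)"
proof -
 note r=\<open>2<=r\<close> and E=\<open>banach_manifold E\<close> and X=\<open>banach_manifold X\<close> and g=\<open>riemannian_metric E g\<close>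
  and sub=\<open>submersion E X p\<close> and hur=\<open>hurewicz_fibration (mtop E) (mtop X) p\<close> and F=\<open>Ck_function 1 Y F\<close>
  and par=\<open>paracompact_space (mtop E)\<close> and cg=\<open>complete_metric E g\<close> and PS=\<open>palais_smale Y gbar F\<close>
 have r0: "0<r" using r by simp
 let ?T="fiber_product_topology r (mtop E) p"
 define D where "D=sum_dist r (mdist E g)"
 define gn where "gn=(%u. tnorm gbar u (gradient Y gbar F u))"
 define M where "M=mpoints Y"
 have mY: "mtop Y=?T" unfolding Y_def by (rule mtop_fiber_product_manifold)
 have MF: "M=fiber_product r (mtop E) p" unfolding M_def mY topspace_fiber_product ..
 have DY: "diff_manifold Y" unfolding Y_def by (rule diff_manifold_fiber_product[OF E X sub r0])
 have HX: "Hausdorff_space (mtop X)" using X by (simp add: banach_manifold_def)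
 have cp: "continuous_map (mtop E) (mtop X) p" using hur by (simp add: hurewicz_fibration_def)
 note met=fiber_product_metric_space[OF E par g cg HX cp, of r, folded D_def MF]
 interpret Metric_space M D by (rule met(1))
 have top: "mtopology=?T" by (rule met(2))
 have Fc: "continuous_map ?T euclideanreal F" using Ck_function_continuous[OF DY F] mY by simp
 have crit: "0<=gn u&(u:Crit Y F\<longleftrightarrow>gn u=0)" if u: "u:M" for u
 proof -
  obtain C where C: "C:atlas Y" "u:cdom C" using diff_manifold_cover[OF DY] u unfolding M_def by blast
  obtain F' where "C1_on (cmodel C) (cmap C ` cdom C) (F o cinv C) F'" by (rule Ck_function_C1[OF DY F C(1)])
  then have hF: "has_fderiv (cmodel C) (F o cinv C) (F' (cmap C u)) (cmap C u)" using C(2) unfolding C1_on_def by blast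
  show ?thesis
  proof (rule fiber_gradient[OF E X sub r0 g F[unfolded Y_def] C[unfolded Y_def] hF, folded Y_def gbar_def])
   fix x assume x: "gradient Y gbar F u=tvec Y u C x" "gbar u (tvec Y u C x) (tvec Y u C x)=F' (cmap C u) x"
    "0<=F' (cmap C u) x" "u:Crit Y F\<longleftrightarrow>F' (cmap C u) x=0"
   then show ?thesis by (simp add: gn_def tnorm_def)
  qed
 qed
 have desc: "EX N dlt H. u:N&local_descent F (1 / (16 * real r) * s) N dlt H" if "u:M" "0<s" "s<=gn u" for u s
  using fiber_local_descent[OF E X sub r0 g, folded Y_def gbar_def D_def, OF _ _ F _ that(2), folded M_def] met(1,2) mY that
  by (simp add: gn_def M_def)
 have PS': "EX l k. strict_mono k&limitin ?T (s o k) l sequentially"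
  if "range s<=M" "!!n. \<bar>F (s n)\<bar><=b" "(%n. gn (s n)) \<longlonglongrightarrow> 0" for s b
  using PS that unfolding palais_smale_def mY[symmetric] M_def gn_def by blast
 define K where "K=(%c. level M F c\<inter>Crit Y F)"
 have Keq: "K c={u:M. F u=c&gn u=0}" for c using crit by (auto simp: K_def level_def)
 \<comment> \<open>On this set \<open>gn\<close> is zero and \<open>F\<close> is constant, so the
   Palais-Smale condition applies to every sequence in it; closedness puts the limit back into the
   set, and sequential compactness suffices in a metric space.\<close>
 have Kc: "compactin ?T (K c)" for c
  unfolding top[symmetric] compactin_sequentially
 proof (intro conjI allI impI)
  show "K c<=M" by (auto simp: Keq)
  fix s :: "nat=>nat=>'e" assume s: "range s<=K c"
  then have sK: "s n:M" "F (s n)=c" "gn (s n)=0" for n unfolding Keq by blast+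
  obtain z k where lk: "strict_mono k" "limitin mtopology (s o k) z sequentially"
  proof -
   have "range s<=M" using sK(1) by blast
   moreover have "(%n. gn (s n)) \<longlonglongrightarrow> 0" unfolding sK(3) by simp
   ultimately show ?thesis using PS'[of s "\<bar>c\<bar>"] sK(2) that unfolding top by auto
  qed
  have "closedin mtopology {u:topspace mtopology. F u:{c}}"
   by (rule closedin_continuous_map_preimage[OF Fc[folded top]]) simp
  then have "closedin mtopology ({u:topspace mtopology. F u:{c}}\<inter>Crit Y F)"
   using closedin_Crit[OF DY F] unfolding mY top[symmetric] by (rule closedin_Int)
  moreover have "{u:topspace mtopology. F u:{c}}\<inter>Crit Y F=K c" by (auto simp: K_def level_def)
  ultimately have cl: "closedin mtopology (K c)" by simp
  have "z:K c"
   by (rule limitin_closedin[OF lk(2) cl]) (use s in \<open>auto intro!: always_eventually\<close>)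
  then show "EX l k. l:K c&strict_mono k&limitin mtopology (s o k) l sequentially" using lk by blast
 qed
 have HT: "Hausdorff_space ?T" using Hausdorff_space_mtopology top by simp
 let ?w="%mu. SUP C\<in>crit_components Y F mu. TC r (mtop E) p C"
 let ?tc="%a. TC r (mtop E) p (sublevel M F a)"
 obtain b where b: "!!u. u:M==>b<=F u" using \<open>bdd_below (F ` mpoints Y)\<close> unfolding bdd_below_def M_def by blast
 have "?tc l<=infsum ?w {..l}"
 proof (rule sum_over_levels)
  show "?tc a<=?tc b" if "a<=b" for a b by (rule TC_mono[OF r]) (use that in \<open>auto simp: sublevel_def\<close>)
  \<comment> \<open>Below the lower bound of \<open>F\<close> the sublevel set is empty and its
    complexity is 0, which starts the summation.\<close>
  have empty: "sublevel M F (b - 1)={}" using b by (force simp: sublevel_def)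
  have "TC r (mtop E) p {}<=enat 0" by (rule TC_leI[OF r, where U="%_. {}"]) auto
  then show "?tc (b - 1)=0" unfolding empty by (simp add: zero_enat_def[symmetric])
  fix c
  have "TC r (mtop E) p (K c)<=?w c"
   using TC_compact_le_components[OF r HT Kc[of c]] unfolding crit_components_def K_def M_def mY .
  moreover have "EX eps>0. ?tc (c + eps)<=?tc (c - eps) + TC r (mtop E) p (K c)"
   by (rule TC_pass_level[OF r hur met(1) met(2) met(3) Fc _ _ desc PS' Keq Kc]) (use crit r0 in auto)
  ultimately show "EX eps>0. ?tc (c + eps)<=?tc (c - eps) + ?w c" by (meson add_left_mono order_trans)
 qed
 then show ?thesis by (simp add: M_def)
qed

end
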